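(* Assume: (i) there are constants $\alpha,\beta\ge 0$ and continuous functions $a,b:\mathbb R_+\to\mathbb R_+$ such that, as $\varepsilon\to0$, $\alpha^\varepsilon\to\alpha$, $\beta^\varepsilon\to\beta$, $a^\varepsilon\to a$ and $b^\varepsilon\to b$ uniformly on every compact subset of $\mathbb R_+$, and there are constants $K_a,K_b>0$ with $a^\varepsilon(x)\le K_a(1+x)$ and $b^\varepsilon(x)\le K_b(1+x)$ for all $x\in\mathbb R_+$ and all $\varepsilon$; (ii) $\mu^\varepsilon_{\rm in}$ converges in law (in $(\mathcal X,w)$) to a deterministic measure $\mu_{\rm in}\in\mathcal X$, and there is a weakly compact set $\mathcal K\subset\mathcal X$ such that $\mathbb P(\mu^\varepsilon_{\rm in}\in\mathcal K)=1$ for all $\varepsilon$; (iii) $u^\varepsilon_{\rm in}$ converges in law to a deterministic $u_{\rm in}\in\mathbb R_+$. Let $\mu$ be a limit in law of the rescaled Stochastic Becker–Döring processes $\mu^\varepsilon$ in $\mathcal D(\mathbb R_+,w\text{-}\mathcal X)$ along a subsequence $\varepsilon\to0$ (such a limit exists). Then $\mu$ is a vague solution of the Lifshitz–Slyozov equation: almost surely, for all $\varphi\in\mathcal C^1_c((0,\infty))$ and all $t\ge0$, $$\langle\mu_t,\varphi\rangle=\langle\mu_{\rm in},\varphi\rangle+\int_0^t\int_0^\infty\varphi'(x)\,(a(x)u(s)-b(x))\,\mu_s(dx)\,ds,$$ where $u(t)+\langle\mu_t,\mathrm{Id}\rangle=m$ with $m:=u_{\rm in}+\langle\mu_{\rm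 in},\mathrm{Id}\rangle$.
   Context: Notation. $\mathbb R_+=[0,\infty)$, $\mathbb N=\{0,1,2,\dots\}$, $\mathrm{Id}(x)=x$. $\mathcal C^1_c((0,\infty))$: $C^1$ functions compactly supported in $(0,\infty)$. $\mathcal M_b(\mathbb R_+)$: finite nonnegative Radon measures on $\mathbb R_+$; $\langle\nu,\varphi\rangle=\int\varphi\,d\nu$. $\mathcal X=\{\nu\in\mathcal M_b(\mathbb R_+):\langle\nu,\mathrm{Id}\rangle<\infty\}$ with the weak topology $w$: the coarsest topology making $\nu\mapsto\langle\nu,\varphi\rangle$ and $\nu\mapsto\langle\nu,\mathrm{Id}\,\varphi\rangle$ continuous for all bounded continuous $\varphi$; $w\text{-}\mathcal X=(\mathcal X,w)$. $\mathcal D(\mathbb R_+,w\text{-}\mathcal X)$: càdlàg $(\mathcal X,w)$-valued functions with the Skorohod topology. Process. $\varepsilon$ ranges over a sequence of positive numbers tending to $0$. For each $\varepsilon$ there are constants $\alpha^\varepsilon,\beta^\varepsilon\ge0$ (nucleation, de-nucleation rates) and nonnegative measurable functions $a^\varepsilon,b^\varepsilon$ on $\mathbb R_+$ (aggregation, fragmentation rates). Let $\mathcal M^\varepsilon_\delta$ be the set of measures $\sum_{i=1}^n\varepsilon\delta_{\varepsilon x_i}$, $n\ge0$, $x_i\in\mathbb N$, $x_i\ge2$. The initial data are random: $\mu^\varepsilon_{\rm in}\in\mathcal M_\delta^\varepsilon$ and $u^\varepsilon_{\rm in}\in\varepsilon^2\mathbb N$; set $m^\varepsilon=u^\varepsilon_{\rm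 in}+\langle\mu^\varepsilon_{\rm in},\mathrm{Id}\rangle$. The rescaled (measure-valued) Stochastic Becker–Döring (SBD) process $\mu^\varepsilon=(\mu^\varepsilon_t)_{t\ge0}$ is the càdlàg process started at $\mu^\varepsilon_{\rm in}$ with values in $\mathcal M^\varepsilon_\delta$ which, conditionally on the initial data, is the (finite state space) continuous-time Markov chain with generator, writing $c=m^\varepsilon-\langle\nu,\mathrm{Id}\rangle$, $$\mathcal L^\varepsilon\psi(\nu)=\tfrac{\psi(\nu+\varepsilon\delta_{2\varepsilon})-\psi(\nu)}{\varepsilon}\alpha^\varepsilon c(c-\varepsilon^2)+\tfrac{\psi(\nu-\varepsilon\delta_{2\varepsilon})-\psi(\nu)}{\varepsilon}\beta^\varepsilon\nu(\{2\varepsilon\})$$ $$+\int_{[2\varepsilon,\infty)}\tfrac{\psi(\nu+\varepsilon\delta_{x+\varepsilon}-\varepsilon\delta_x)-\psi(\nu)}{\varepsilon^2}a^\varepsilon(x)c\,\nu(dx)+\int_{[3\varepsilon,\infty)}\tfrac{\psi(\nu-\varepsilon\delta_x+\varepsilon\delta_{x-\varepsilon})-\psi(\nu)}{\varepsilon^2}b^\varepsilon(x)\,\nu(dx).$$ *)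

theory Defs
  imports "HOL-Probability.Probability"
begin

section \<open>The space of measures and its weak topology\<close>

abbreviation borel_nonneg :: "real measure" where
  "borel_nonneg \<equiv> restrict_space borel {0..}"

text \<open>Finite Borel measures on the half line are automatically Radon. Note that two elements of
  this set are equal as soon as they agree on the Borel subsets of the half line.\<close>

definition moment_measures :: "real measure set" where
  "moment_measures =
     {\<nu>. sets \<nu> = sets borel_nonneg \<and> finite_measure \<nu> \<and> integrable \<nu> (\<lambda>x. x)}"

definition bounded_continuous :: "(real \<Rightarrow> real) set" where
  "bounded_continuous = {\<phi>. continuous_on {0..} \<phi> \<and> bounded (\<phi> ` {0..})}"

definition weak_topology :: "real measure topology" where
  "weak_topology = topology_generated_by
     ({{\<nu> \<in> moment_measures. (\<integral>x. \<phi> x \<partial>\<nu>) \<in> U} |\<phi> U. \<phi> \<in> bounded_continuous \<and> open U} \<union>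
      {{\<nu> \<in> moment_measures. (\<integral>x. x * \<phi> x \<partial>\<nu>) \<in> U} |\<phi> U. \<phi> \<in> bounded_continuous \<and> open U})"

lemma topspace_weak_topology [simp]: "topspace weak_topology = moment_measures"
proof -
  have "(\<lambda>x. 0) \<in> bounded_continuous"
    by (auto simp: bounded_continuous_def bounded_iff)
  moreover have "moment_measures = {\<nu> \<in> moment_measures. (\<integral>x. (\<lambda>x. 0) x \<partial>\<nu>) \<in> (UNIV :: real set)}"
    by simp
  ultimately have "moment_measures \<in> {{\<nu> \<in> moment_measures. (\<integral>x. \<phi> x \<partial>\<nu>) \<in> U} |\<phi> U.
      \<phi> \<in> bounded_continuous \<and> open U}"
    using open_UNIV by blast
  then show ?thesis
    unfolding weak_topology_def topology_generated_by_topspace by blast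
qed

section \<open>Cadlag paths and the Skorohod topology\<close>

text \<open>Paths are indexed by nonnegative times; they take the value \<open>undefined\<close> at negative reals.\<close>

definition cadlag :: "'s topology \<Rightarrow> (real \<Rightarrow> 's) set" where
  "cadlag E = {x \<in> {0..} \<rightarrow>\<^sub>E topspace E.
     (\<forall>t\<ge>0. limitin E x (x t) (at_right t)) \<and> (\<forall>t>0. \<exists>l. limitin E x l (at_left t))}"

definition time_changes :: "(real \<Rightarrow> real) set" where
  "time_changes = {\<tau>. strict_mono_on {0..} \<tau> \<and> \<tau> ` {0..} = {0..}}"

text \<open>Basic neighbourhoods of a path for the Skorohod (J1) topology, written without reference to a
  metric on the state space: closeness of two states is measured by finitely many
  continuous real functions, as in Jakubowski's definition for completely regular spaces. If
  \<open>d\<close> metrizes \<open>E\<close>, then, since the image of \<open>[0, T]\<close> under a cadlag path is relatively compact,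
  these neighbourhoods generate the same filter as those with \<open>d (y t) (x (\<tau> t)) < \<delta>\<close>
  for all \<open>t\<close> in \<open>[0, T]\<close>. So \<open>x\<^sub>n\<close> converges to \<open>x\<close> iff for every \<open>T\<close> there are time changes
  \<open>\<tau>\<^sub>n\<close> with \<open>sup\<^bsub>t\<le>T\<^esub> |\<tau>\<^sub>n t - t|\<close> and \<open>sup\<^bsub>t\<le>T\<^esub> d (x\<^sub>n t) (x (\<tau>\<^sub>n t))\<close> tending to 0 (Ethier and Kurtz,
  Markov Processes, Proposition 3.5.3).\<close>

definition skorohod_nbhd ::
  "'s topology \<Rightarrow> ('s \<Rightarrow> real) set \<Rightarrow> real \<Rightarrow> real \<Rightarrow> (real \<Rightarrow> 's) \<Rightarrow> (real \<Rightarrow> 's) set" where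
  "skorohod_nbhd E F T \<delta> x = {y \<in> cadlag E. \<exists>\<tau>\<in>time_changes. \<forall>t\<in>{0..T}.
     \<bar>\<tau> t - t\<bar> < \<delta> \<and> (\<forall>f\<in>F. \<bar>f (y t) - f (x (\<tau> t))\<bar> < \<delta>)}"

definition skorohod_open :: "'s topology \<Rightarrow> (real \<Rightarrow> 's) set \<Rightarrow> bool" where
  "skorohod_open E U \<longleftrightarrow> U \<subseteq> cadlag E \<and>
     (\<forall>x\<in>U. \<exists>F T \<delta>. finite F \<and> (\<forall>f\<in>F. continuous_map E euclideanreal f) \<and> T > 0 \<and> \<delta> > 0 \<and>
        skorohod_nbhd E F T \<delta> x \<subseteq> U)"

definition skorohod_topology :: "'s topology \<Rightarrow> (real \<Rightarrow> 's) topology" where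
  "skorohod_topology E = topology (skorohod_open E)"

lemma skorohod_nbhd_mono:
  assumes "F \<subseteq> F'" "T \<le> T'" "\<delta>' \<le> \<delta>"
  shows "skorohod_nbhd E F' T' \<delta>' x \<subseteq> skorohod_nbhd E F T \<delta> x"
proof
  fix y assume "y \<in> skorohod_nbhd E F' T' \<delta>' x"
  then obtain \<tau> where y: "y \<in> cadlag E" "\<tau> \<in> time_changes" and
    \<tau>: "\<And>t. t \<in> {0..T'} \<Longrightarrow> \<bar>\<tau> t - t\<bar> < \<delta>' \<and> (\<forall>f\<in>F'. \<bar>f (y t) - f (x (\<tau> t))\<bar> < \<delta>')"
    by (auto simp: skorohod_nbhd_def)
  have "\<bar>\<tau> t - t\<bar> < \<delta> \<and> (\<forall>f\<in>F. \<bar>f (y t) - f (x (\<tau> t))\<bar> < \<delta>)" if "t \<in> {0..T}" for t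
    using \<tau>[of t] that assms by fastforce
  with y show "y \<in> skorohod_nbhd E F T \<delta> x"
    unfolding skorohod_nbhd_def by blast
qed

lemma istopology_skorohod_open: "istopology (skorohod_open E)"
  unfolding istopology_def
proof (intro conjI allI impI)
  fix U V assume U: "skorohod_open E U" and V: "skorohod_open E V"
  show "skorohod_open E (U \<inter> V)"
    unfolding skorohod_open_def
  proof (intro conjI ballI)
    show "U \<inter> V \<subseteq> cadlag E"
      using U by (auto simp: skorohod_open_def)
    fix x assume x: "x \<in> U \<inter> V"
    obtain F T \<delta> where 1: "finite F" "\<forall>f\<in>F. continuous_map E euclideanreal f" "T > 0" "\<delta> > 0"
        "skorohod_nbhd E F T \<delta> x \<subseteq> U"
      using U x unfolding skorohod_open_def by blast
    obtain F' T' \<delta>' where 2: "finite F'" "\<forall>f\<in>F'. continuous_map E euclideanreal f" "T' > 0" "\<delta>' > 0"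
        "skorohod_nbhd E F' T' \<delta>' x \<subseteq> V"
      using V x unfolding skorohod_open_def by blast
    let ?N = "skorohod_nbhd E (F \<union> F') (max T T') (min \<delta> \<delta>') x"
    have "?N \<subseteq> skorohod_nbhd E F T \<delta> x" "?N \<subseteq> skorohod_nbhd E F' T' \<delta>' x"
      by (rule skorohod_nbhd_mono; simp)+
    with 1 2 have "?N \<subseteq> U \<inter> V"
      by blast
    with 1 2 show "\<exists>F T \<delta>. finite F \<and> (\<forall>f\<in>F. continuous_map E euclideanreal f) \<and> T > 0 \<and> \<delta> > 0 \<and>
        skorohod_nbhd E F T \<delta> x \<subseteq> U \<inter> V"
      by (intro exI[of _ "F \<union> F'"] exI[of _ "max T T'"] exI[of _ "min \<delta> \<delta>'"]) auto
  qed
next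
  fix \<K> assume *: "\<forall>K\<in>\<K>. skorohod_open E K"
  show "skorohod_open E (\<Union>\<K>)"
    unfolding skorohod_open_def
  proof (intro conjI ballI)
    show "\<Union>\<K> \<subseteq> cadlag E"
      using * by (auto simp: skorohod_open_def)
    fix x assume "x \<in> \<Union>\<K>"
    then obtain K where K: "K \<in> \<K>" "x \<in> K" by blast
    with * have "skorohod_open E K" by blast
    then obtain F T \<delta> where N: "finite F" "\<forall>f\<in>F. continuous_map E euclideanreal f" "T > 0" "\<delta> > 0"
        "skorohod_nbhd E F T \<delta> x \<subseteq> K"
      using K unfolding skorohod_open_def by blast
    then have "skorohod_nbhd E F T \<delta> x \<subseteq> \<Union>\<K>"
      using K by blast
    with N show "\<exists>F T \<delta>. finite F \<and> (\<forall>f\<in>F. continuous_map E euclideanreal f) \<and> T > 0 \<and> \<delta> > 0 \<and>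
        skorohod_nbhd E F T \<delta> x \<subseteq> \<Union>\<K>"
      by blast
  qed
qed

lemma openin_skorohod_topology: "openin (skorohod_topology E) U \<longleftrightarrow> skorohod_open E U"
  by (simp add: skorohod_topology_def topology_inverse'[OF istopology_skorohod_open])

lemma topspace_skorohod_topology [simp]: "topspace (skorohod_topology E) = cadlag E"
proof -
  have "skorohod_open E (cadlag E)"
    unfolding skorohod_open_def skorohod_nbhd_def
    by (auto intro!: exI[of _ "{}"] exI[of _ "1 :: real"])
  moreover have "U \<subseteq> cadlag E" if "skorohod_open E U" for U
    using that by (simp add: skorohod_open_def)
  ultimately show ?thesis
    unfolding topspace_def openin_skorohod_topology by blast
qed

section \<open>Convergence in law\<close>

definition borel_of :: "'s topology \<Rightarrow> 's measure" where
  "borel_of T = sigma (topspace T) {U. openin T U}"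

definition converges_weakly :: "'s topology \<Rightarrow> (nat \<Rightarrow> 's measure) \<Rightarrow> 's measure \<Rightarrow> bool" where
  "converges_weakly T P Q \<longleftrightarrow>
     (\<forall>f. continuous_map T euclideanreal f \<and> bounded (f ` topspace T) \<longrightarrow>
        (\<lambda>n. \<integral>x. f x \<partial>P n) \<longlonglongrightarrow> (\<integral>x. f x \<partial>Q))"

definition subsequential_limit_in_law ::
  "'s topology \<Rightarrow> (nat \<Rightarrow> 'a measure) \<Rightarrow> (nat \<Rightarrow> 'a \<Rightarrow> 's) \<Rightarrow> 'b measure \<Rightarrow> ('b \<Rightarrow> 's) \<Rightarrow> bool" where
  "subsequential_limit_in_law T M X N Y \<longleftrightarrow>
     prob_space N \<and> Y \<in> N \<rightarrow>\<^sub>M borel_of T \<and>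
     (\<exists>r. strict_mono r \<and>
        converges_weakly T (\<lambda>k. distr (M (r k)) (borel_of T) (X (r k))) (distr N (borel_of T) Y))"

section \<open>The rescaled stochastic Becker--Doering process\<close>

definition sbd_states :: "real \<Rightarrow> real measure set" where
  "sbd_states \<epsilon> = {\<nu>. sets \<nu> = sets borel_nonneg \<and>
     (\<exists>n (x :: nat \<Rightarrow> nat). (\<forall>i<n. x i \<ge> 2) \<and>
        (\<forall>A\<in>sets borel_nonneg. emeasure \<nu> A = (\<Sum>i<n. ennreal \<epsilon> * indicator A (\<epsilon> * real (x i)))))}"

definition point_mass :: "real \<Rightarrow> real \<Rightarrow> real measure" where
  "point_mass \<epsilon> x = scale_measure (ennreal \<epsilon>) (return borel_nonneg x)"

definition plus_measure :: "'s measure \<Rightarrow> 's measure \<Rightarrow> 's measure" where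
  "plus_measure \<mu> \<nu> = measure_of (space \<mu>) (sets \<mu>) (\<lambda>A. emeasure \<mu> A + emeasure \<nu> A)"

text \<open>The integral of a function against a purely atomic measure with finitely many atoms. It
  evaluates the integrand at the atoms only: in the generator below the integrand is a function of
  \<open>\<nu> - \<epsilon>\<delta>\<^sub>x\<close>, which is a measure only if \<open>x\<close> is an atom of \<open>\<nu>\<close>.
  The lemma shows that this is the Lebesgue integral for measurable integrands.\<close>

definition atomic_integral :: "real measure \<Rightarrow> real set \<Rightarrow> (real \<Rightarrow> real) \<Rightarrow> real" where
  "atomic_integral \<nu> A f = (\<Sum>x | x \<in> A \<and> measure \<nu> {x} \<noteq> 0. f x * measure \<nu> {x})"

lemma atomic_integral_eq_set_integral:
  assumes \<nu>: "\<nu> \<in> sbd_states \<epsilon>" and f: "f \<in> borel_measurable borel_nonneg"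
    and A: "A \<in> sets borel_nonneg"
  shows "(\<integral>x\<in>A. f x \<partial>\<nu>) = atomic_integral \<nu> A f"
proof -
  obtain n and x :: "nat \<Rightarrow> nat" where sets: "sets \<nu> = sets borel_nonneg"
    and em: "\<And>B. B \<in> sets borel_nonneg \<Longrightarrow>
      emeasure \<nu> B = (\<Sum>i<n. ennreal \<epsilon> * indicator B (\<epsilon> * real (x i)))"
    using \<nu> unfolding sbd_states_def by blast
  define S where "S = {y \<in> (\<lambda>i. \<epsilon> * real (x i)) ` {..<n}. y \<ge> 0}"
  have sp: "space \<nu> = {0..}"
    using sets_eq_imp_space_eq[OF sets] by (simp add: space_restrict_space)
  have sets_iff: "B \<in> sets \<nu> \<longleftrightarrow> B \<in> sets borel \<and> B \<subseteq> {0..}" for B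
    by (auto simp: sets sets_restrict_space_iff)
  have fin: "finite S"
    by (simp add: S_def)
  have S: "S \<in> sets \<nu>"
    unfolding sets_iff using borel_closed[OF finite_imp_closed[OF fin]] by (auto simp: S_def)
  have "emeasure \<nu> (space \<nu> - S) = 0"
  proof (subst em)
    show "space \<nu> - S \<in> sets borel_nonneg"
      using S unfolding sets[symmetric] by blast
    show "(\<Sum>i<n. ennreal \<epsilon> * indicator (space \<nu> - S) (\<epsilon> * real (x i))) = 0"
      by (intro sum.neutral) (auto simp: S_def sp indicator_def)
  qed
  then have AE: "AE y in \<nu>. y \<in> S"
    using S by (intro AE_I[of _ _ "space \<nu> - S"]) auto
  have sing: "{y} \<in> sets \<nu>" "emeasure \<nu> {y} < \<infinity>" if "y \<in> S" for y
  proof -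
    show "{y} \<in> sets \<nu>"
      using that by (auto simp: sets_iff S_def)
    then show "emeasure \<nu> {y} < \<infinity>"
      by (subst em) (auto simp: sets ennreal_mult_less_top of_nat_less_top indicator_def)
  qed
  have outside: "measure \<nu> {y} = 0" if "y \<notin> S" for y
  proof (cases "y \<ge> 0")
    case True
    then have "emeasure \<nu> {y} = 0"
      using that by (subst em) (auto simp: S_def sets_restrict_space_iff indicator_def)
    then show ?thesis
      by (simp add: measure_def)
  next
    case False
    then show ?thesis
      by (intro measure_notin_sets) (auto simp: sets_iff)
  qed
  have meas [measurable]: "f \<in> borel_measurable \<nu>" "A \<in> sets \<nu>"
    using f A by (simp_all add: sets measurable_cong_sets[OF sets refl])
  have "(\<integral>x\<in>A. f x \<partial>\<nu>) = (\<integral>z. (\<Sum>y\<in>S. indicator {y} z *\<^sub>R (indicator A y * f y)) \<partial>\<nu>)"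
    unfolding set_lebesgue_integral_def
  proof (rule integral_cong_AE)
    show "(\<lambda>z. \<Sum>y\<in>S. indicator {y} z *\<^sub>R (indicator A y * f y)) \<in> borel_measurable \<nu>"
      using sing by (intro borel_measurable_sum borel_measurable_scaleR borel_measurable_indicator) auto
    show "AE z in \<nu>. indicator A z *\<^sub>R f z =
        (\<Sum>y\<in>S. indicator {y} z *\<^sub>R (indicator A y * f y))"
      using AE
    proof eventually_elim
      case (elim z)
      have "(\<Sum>y\<in>S. indicator {y} z *\<^sub>R (indicator A y * f y)) =
          (\<Sum>y\<in>S. if y = z then indicator A y * f y else 0)"
        by (intro sum.cong) (auto simp: indicator_def)
      with elim fin show ?case
        by simp
    qed
  qed measurable
  also have "\<dots> = (\<Sum>y\<in>S. measure \<nu> {y} *\<^sub>R (indicator A y * f y))"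
    using sing by (subst Bochner_Integration.integral_sum) (auto simp: sp S_def)
  also have "\<dots> = (\<Sum>y | y \<in> A \<and> measure \<nu> {y} \<noteq> 0. f y * measure \<nu> {y})"
    using fin outside by (intro sum.mono_neutral_cong_right) (auto simp: indicator_def)
  finally show ?thesis
    by (simp add: atomic_integral_def)
qed

definition sbd_generator ::
  "real \<Rightarrow> real \<Rightarrow> real \<Rightarrow> (real \<Rightarrow> real) \<Rightarrow> (real \<Rightarrow> real) \<Rightarrow> real \<Rightarrow>
   (real measure \<Rightarrow> real) \<Rightarrow> real measure \<Rightarrow> real" where
  "sbd_generator \<epsilon> \<alpha> \<beta> a b m \<psi> \<nu> =
     (let c = m - (\<integral>x. x \<partial>\<nu>) in
        (\<psi> (plus_measure \<nu> (point_mass \<epsilon> (2 * \<epsilon>))) - \<psi> \<nu>) / \<epsilon> * (\<alpha> * c * (c - \<epsilon>\<^sup>2))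
      + (\<psi> (diff_measure \<nu> (point_mass \<epsilon> (2 * \<epsilon>))) - \<psi> \<nu>) / \<epsilon> * (\<beta> * measure \<nu> {2 * \<epsilon>})
      + atomic_integral \<nu> {2 * \<epsilon>..} (\<lambda>x.
          (\<psi> (diff_measure (plus_measure \<nu> (point_mass \<epsilon> (x + \<epsilon>))) (point_mass \<epsilon> x)) - \<psi> \<nu>) / \<epsilon>\<^sup>2
            * (a x * c))
      + atomic_integral \<nu> {3 * \<epsilon>..} (\<lambda>x.
          (\<psi> (plus_measure (diff_measure \<nu> (point_mass \<epsilon> x)) (point_mass \<epsilon> (x - \<epsilon>))) - \<psi> \<nu>) / \<epsilon>\<^sup>2
            * b x))"

text \<open>The semigroup \<open>exp (t L)\<close>. For fixed total mass \<open>m\<close> the chain lives in the finite set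
  of states \<open>\<nu>\<close> with first moment at most \<open>m\<close>; this set is preserved by the transitions with
  nonzero rate, so the series converges there.\<close>

definition generated_semigroup ::
  "(('s \<Rightarrow> real) \<Rightarrow> 's \<Rightarrow> real) \<Rightarrow> real \<Rightarrow> ('s \<Rightarrow> real) \<Rightarrow> 's \<Rightarrow> real" where
  "generated_semigroup L t \<psi> \<nu> = (\<Sum>k. t ^ k / fact k * (L ^^ k) \<psi> \<nu>)"

text \<open>The last clause is the Markov property with the transition semigroup of the generator,
  conditionally on the initial data being \<open>(\<nu>\<^sub>0, u\<^sub>0)\<close>. The initial data take countably many values,
  so conditioning is elementary; the identity is multiplied by the
  probability of the conditioning event, so that null events need no separate treatment.\<close>

definition sbd_process ::
  "'a measure \<Rightarrow> real \<Rightarrow> real \<Rightarrow> real \<Rightarrow> (real \<Rightarrow> real) \<Rightarrow> (real \<Rightarrow> real) \<Rightarrow>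
   ('a \<Rightarrow> real measure) \<Rightarrow> ('a \<Rightarrow> real) \<Rightarrow> ('a \<Rightarrow> real \<Rightarrow> real measure) \<Rightarrow> bool" where
  "sbd_process M \<epsilon> \<alpha> \<beta> a b \<mu>in uin \<mu> \<longleftrightarrow>
     prob_space M \<and>
     \<mu>in \<in> M \<rightarrow>\<^sub>M borel_of weak_topology \<and> (\<forall>\<omega>\<in>space M. \<mu>in \<omega> \<in> sbd_states \<epsilon>) \<and>
     uin \<in> borel_measurable M \<and> (\<forall>\<omega>\<in>space M. \<exists>k :: nat. uin \<omega> = \<epsilon>\<^sup>2 * real k) \<and>
     \<mu> \<in> M \<rightarrow>\<^sub>M borel_of (skorohod_topology weak_topology) \<and>
     (\<forall>\<omega>\<in>space M. \<mu> \<omega> 0 = \<mu>in \<omega> \<and> (\<forall>t\<ge>0. \<mu> \<omega> t \<in> sbd_states \<epsilon>)) \<and>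
     (\<forall>\<nu>\<^sub>0 u\<^sub>0 n (s :: nat \<Rightarrow> real) (y :: nat \<Rightarrow> real measure) t z.
        0 \<le> s 0 \<and> (\<forall>i<n. s i \<le> s (Suc i)) \<and> 0 \<le> t \<longrightarrow>
        \<P>(\<omega> in M. \<mu>in \<omega> = \<nu>\<^sub>0 \<and> uin \<omega> = u\<^sub>0 \<and> (\<forall>i\<le>n. \<mu> \<omega> (s i) = y i) \<and> \<mu> \<omega> (s n + t) = z) =
        \<P>(\<omega> in M. \<mu>in \<omega> = \<nu>\<^sub>0 \<and> uin \<omega> = u\<^sub>0 \<and> (\<forall>i\<le>n. \<mu> \<omega> (s i) = y i)) *
          generated_semigroup (sbd_generator \<epsilon> \<alpha> \<beta> a b (u\<^sub>0 + (\<integral>x. x \<partial>\<nu>\<^sub>0))) t (indicator {z}) (y n))"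

section \<open>The Lifshitz--Slyozov equation\<close>

text \<open>Test functions on the open half line are extended by zero.\<close>

definition C1_compact_support :: "(real \<Rightarrow> real) set" where
  "C1_compact_support =
     {\<phi>. \<phi> C1_differentiable_on {0<..} \<and> (\<exists>K. compact K \<and> K \<subseteq> {0<..} \<and> (\<forall>x. x \<notin> K \<longrightarrow> \<phi> x = 0))}"

definition vague_LS_solution ::
  "(real \<Rightarrow> real) \<Rightarrow> (real \<Rightarrow> real) \<Rightarrow> real measure \<Rightarrow> real \<Rightarrow> (real \<Rightarrow> real measure) \<Rightarrow> bool" where
  "vague_LS_solution a b \<mu>in m \<mu> \<longleftrightarrow>
     (let u = (\<lambda>t. m - (\<integral>x. x \<partial>\<mu> t)) in
        \<forall>\<phi>\<in>C1_compact_support. \<forall>t\<ge>0.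
          set_integrable lborel {0..t} (\<lambda>s. \<integral>x. deriv \<phi> x * (a x * u s - b x) \<partial>\<mu> s) \<and>
          (\<integral>x. \<phi> x \<partial>\<mu> t) = (\<integral>x. \<phi> x \<partial>\<mu>in) +
            (\<integral>s\<in>{0..t}. (\<integral>x. deriv \<phi> x * (a x * u s - b x) \<partial>\<mu> s) \<partial>lborel))"

end

theory Submission
  imports Defs
begin

text \<open>
 Exponential martingale inequalities for the finite chains bound, up to events of vanishing
 probability, the number of clusters, the tails of the first moment (through the weight
 \<open>x min 1 (x / R)\<close>) and the oscillation of countably many integrals along the paths. Since each
 jump changes these functionals by \<open>O(eps)\<close> at rate \<open>O(1/eps\<^sup>2)\<close>, the errors are exponentially small
 in \<open>1/eps\<close>. Paths obeying such bounds form sets that are compact in the limit, and a limit law is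
 built directly from nested cells of the countably many evaluations, transported to a Cantor set of
 the real line.

 For the identification, the equation is integrated once more in time: this makes it a functional
 of the path that is continuous for the Skorohod topology, and the same exponential inequality shows
 that it tends to 0 in probability along the processes. So it vanishes almost surely at the limit for
 a countable family of test functions with derivative \<open>x\<^sup>k\<close> times a cutoff, hence for all of them by the
 Weierstrass theorem; differentiating from the right in time gives the equation.
\<close>



text \<open>The process is given through its finite-dimensional laws, so every estimate is first
  made on a time grid: along the grid an exponential functional is almost a supermartingale, the
  error vanishes with the mesh for fixed eps, and right continuity carries the bound to the whole
  path. Events that involve a supremum over uncountably many times are only covered by measurable
  sets of small probability. Conditioning on the initial data is elementary, since below a mass
  bound there are finitely many of them.

  Nothing metric about the path space enters: countably many evaluations separate points and control
  convergence on the sets of regular paths. The first moment is part of the topology, so mass must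
  not escape to infinity; conservation of mass alone does not prevent that, and a Gronwall argument
  for a logarithm propagates the tails of the compact set of initial measures. Test functions live
  away from 0, so for small eps they do not see nucleation, and error terms proportional to
  \<open>x\<close> are summed by the first moment.\<close>

section \<open>Measures with finite first moment and their weak topology\<close>

lemma abs_integral_le:
 fixes f g :: "'a => real"
 assumes "integrable M f" "integrable M g" "\<And>x. x \<in> space M ==> \<bar>f x\<bar> <= g x"
 shows "\<bar>LINT x|M. f x\<bar> <= (LINT x|M. g x)"
proof -
 have "\<bar>LINT x|M. f x\<bar> <= (LINT x|M. \<bar>f x\<bar>)"
  by (rule integral_abs_bound)
 also have "\<dots> <= (LINT x|M. g x)"
  using assms by (intro integral_mono) auto
 finally show ?thesis .
qed

lemma moment_measuresD:
 assumes "\<nu> \<in> moment_measures"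
 shows sets_moment_measure: "sets \<nu> = sets borel_nonneg"
  and space_moment_measure: "space \<nu> = {0..}"
  and finite_moment_measure: "finite_measure \<nu>"
  and integrable_id_moment_measure: "integrable \<nu> (\<lambda>x. x)"
proof -
 show s: "sets \<nu> = sets borel_nonneg" and "finite_measure \<nu>" and "integrable \<nu> (\<lambda>x. x)"
  using assms by (auto simp: moment_measures_def)
 show "space \<nu> = {0..}"
  using sets_eq_imp_space_eq[OF s] by (simp add: space_restrict_space)
qed

lemma borel_measurable_continuous_moment_measure:
 fixes f :: "real => real"
 assumes "\<nu> \<in> moment_measures" "continuous_on {0..} f"
 shows "f \<in> borel_measurable \<nu>"
 using borel_measurable_continuous_on_restrict[OF assms(2)]
 by (simp add: measurable_cong_sets[OF sets_moment_measure[OF assms(1)] refl])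

lemma integrable_linear_growth:
 fixes f :: "real => real"
 assumes \<nu>: "\<nu> \<in> moment_measures" and f: "continuous_on {0..} f"
  and le: "\<And>x. x >= 0 ==> \<bar>f x\<bar> <= C * (1 + x)"
 shows "integrable \<nu> f"
proof (rule Bochner_Integration.integrable_bound)
 interpret finite_measure \<nu> using finite_moment_measure[OF \<nu>] .
 show "integrable \<nu> (\<lambda>x. C * (1 + x))"
  using integrable_id_moment_measure[OF \<nu>] by simp
 show "f \<in> borel_measurable \<nu>"
  by (rule borel_measurable_continuous_moment_measure[OF \<nu> f])
 show "AE x in \<nu>. norm (f x) <= norm (C * (1 + x))"
  using space_moment_measure[OF \<nu>] le by (intro AE_I2) force
qed

lemma bounded_continuousI:
 assumes "continuous_on {0..} f" "\<And>x. x >= 0 ==> \<bar>f x\<bar> <= C"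
 shows "f \<in> bounded_continuous"
 using assms unfolding bounded_continuous_def bounded_iff by auto

lemma bounded_continuousE:
 assumes "f \<in> bounded_continuous"
 obtains C where "C >= 0" "continuous_on {0..} f" "\<And>x. x >= 0 ==> \<bar>f x\<bar> <= C"
proof -
 from assms obtain C where C: "\<And>x. x >= 0 ==> \<bar>f x\<bar> <= C"
  unfolding bounded_continuous_def bounded_iff by auto
 moreover have "C >= 0"
  using C[of 0] by linarith
 ultimately show ?thesis
  using assms that[of C] by (auto simp: bounded_continuous_def)
qed

lemma integrable_bounded_continuous:
 assumes \<nu>: "\<nu> \<in> moment_measures" and f: "f \<in> bounded_continuous"
 shows "integrable \<nu> f" "integrable \<nu> (\<lambda>x. x * f x)"
proof -
 obtain C where C: "C >= 0" "continuous_on {0..} f" "\<And>x. x >= 0 ==> \<bar>f x\<bar> <= C"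
  using bounded_continuousE[OF f] by blast
 have "\<bar>f x\<bar> <= C * (1 + x)" if "x >= 0" for x
  using C(3)[OF that] mult_nonneg_nonneg[OF C(1) that] by (simp add: algebra_simps)
 then show "integrable \<nu> f"
  using C(2) by (rule integrable_linear_growth[OF \<nu>, rotated])
 have "\<bar>x * f x\<bar> <= C * (1 + x)" if "x >= 0" for x
  using mult_left_mono[OF C(3)[OF that] that] C(1) that by (simp add: algebra_simps abs_mult)
 then show "integrable \<nu> (\<lambda>x. x * f x)"
  using C(2) by (intro integrable_linear_growth[OF \<nu>]) (auto intro: continuous_intros)
qed

lemma continuous_map_weak_integral:
 assumes "f \<in> bounded_continuous"
 shows "continuous_map weak_topology euclideanreal (\<lambda>\<nu>. LINT x|\<nu>. f x)"
  and "continuous_map weak_topology euclideanreal (\<lambda>\<nu>. LINT x|\<nu>. x * f x)"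
proof -
 have "openin weak_topology {\<nu> \<in> moment_measures. (LINT x|\<nu>. f x) \<in> U}"
  "openin weak_topology {\<nu> \<in> moment_measures. (LINT x|\<nu>. x * f x) \<in> U}" if "open U" for U
  unfolding weak_topology_def using that assms by (auto intro!: topology_generated_by_Basis)
 then show "continuous_map weak_topology euclideanreal (\<lambda>\<nu>. LINT x|\<nu>. f x)"
  "continuous_map weak_topology euclideanreal (\<lambda>\<nu>. LINT x|\<nu>. x * f x)"
  unfolding continuous_map by auto
qed

lemma continuous_map_weak_moment:
 "continuous_map weak_topology euclideanreal (\<lambda>\<nu>. LINT x|\<nu>. x)"
proof -
 have "(\<lambda>x. 1) \<in> bounded_continuous"
  by (rule bounded_continuousI[of _ 1]) auto
 from continuous_map_weak_integral(2)[OF this] show ?thesis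
  by simp
qed

text \<open>Eventual membership passes to finite intersections and, through a single member, to
  unions, so only the subbasis has to be tested.\<close>

lemma limitin_topology_generated_by:
 assumes l: "l \<in> \<Union>S" and ev: "\<And>U. U \<in> S ==> l \<in> U ==> eventually (\<lambda>x. f x \<in> U) F"
 shows "limitin (topology_generated_by S) f l F"
 unfolding limitin_def
proof (intro conjI allI impI)
 show "l \<in> topspace (topology_generated_by S)"
  using l by simp
 fix U assume "openin (topology_generated_by S) U \<and> l \<in> U"
 then have "generate_topology_on S U" "l \<in> U"
  by (auto simp: openin_topology_generated_by_iff)
 then show "eventually (\<lambda>x. f x \<in> U) F"
 proof (induction rule: generate_topology_on.induct)
  case (Int a b)
  then show ?case by (auto intro: eventually_conj)
 next
  case (UN K)
  then obtain k where "k \<in> K" "l \<in> k" by blast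
  with UN have "eventually (\<lambda>x. f x \<in> k) F" by blast
  then show ?case by eventually_elim (use \<open>k \<in> K\<close> in blast)
 qed (use ev in auto)
qed

lemma limitin_weak_topologyI:
 assumes l: "\<nu> \<in> moment_measures" and X: "eventually (\<lambda>k. X k \<in> moment_measures) F"
  and "\<And>f. f \<in> bounded_continuous ==> ((\<lambda>k. LINT x|X k. f x) \<longlongrightarrow> (LINT x|\<nu>. f x)) F"
  and "\<And>f. f \<in> bounded_continuous ==> ((\<lambda>k. LINT x|X k. x * f x) \<longlongrightarrow> (LINT x|\<nu>. x * f x)) F"
 shows "limitin weak_topology X \<nu> F"
 unfolding weak_topology_def
proof (rule limitin_topology_generated_by, goal_cases)
 case 1
 then show ?case
  using l topspace_weak_topology by (simp add: weak_topology_def)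
next
 case (2 U)
 from 2(1) show ?case
 proof
  assume "U \<in> {{\<nu> \<in> moment_measures. (LINT x|\<nu>. \<phi> x) \<in> U} |\<phi> U. \<phi> \<in> bounded_continuous \<and> open U}"
  then obtain f V where "U = {\<nu> \<in> moment_measures. (LINT x|\<nu>. f x) \<in> V}"
   "f \<in> bounded_continuous" "open V" by blast
  then show ?thesis
   using topological_tendstoD[OF assms(3), of f V] 2 X by (auto elim: eventually_elim2)
 next
  assume "U \<in> {{\<nu> \<in> moment_measures. (LINT x|\<nu>. x * \<phi> x) \<in> U} |\<phi> U. \<phi> \<in> bounded_continuous \<and> open U}"
  then obtain f V where "U = {\<nu> \<in> moment_measures. (LINT x|\<nu>. x * f x) \<in> V}"
   "f \<in> bounded_continuous" "open V" by blast
  then show ?thesis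
   using topological_tendstoD[OF assms(4), of f V] 2 X by (auto elim: eventually_elim2)
 qed
qed

lemma tendsto_continuous_functional:
 fixes f :: "'s => real"
 assumes "continuous_map T euclideanreal f" "limitin T X l F"
 shows "((\<lambda>k. f (X k)) \<longlongrightarrow> f l) F"
 using continuous_map_limit[OF assms] by (simp add: o_def)

section \<open>Ramps and tail weights\<close>

text \<open>A countable family of Lipschitz approximations of the indicators of rays: the index is a
  rational foot and an integer slope. On the half line the index \<open>(-1, 1)\<close> gives the
  constant 1 and so represents the total mass.\<close>

definition ramp :: "rat \<times> nat => real => real" where
 "ramp i x = min 1 (max 0 (real (snd i) * (x - of_rat (fst i))))"

text \<open>It is \<open>x\<close> times a bounded continuous function, so its integral is weakly
  continuous, and from \<open>R\<close> on it equals \<open>x\<close>. Being quadratic below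
  \<open>R\<close>, it hardly notices the creation of clusters of size
  \<open>2 * eps\<close>.\<close>

definition tail_weight :: "real => real => real" where
 "tail_weight R x = x * min 1 (x / R)"

lemma ramp_bounds: "0 <= ramp i x" "ramp i x <= 1" "\<bar>ramp i x\<bar> <= 1"
 by (auto simp: ramp_def)

lemma ramp_lipschitz: "\<bar>ramp i x - ramp i y\<bar> <= real (snd i) * \<bar>x - y\<bar>"
proof -
 have "\<bar>ramp i x - ramp i y\<bar> <= \<bar>real (snd i) * (x - of_rat (fst i)) - real (snd i) * (y - of_rat (fst i))\<bar>"
  unfolding ramp_def by linarith
 also have "\<dots> = real (snd i) * \<bar>x - y\<bar>"
  by (simp add: right_diff_distrib[symmetric] abs_mult)
 finally show ?thesis .
qed

lemma continuous_on_ramp [continuous_intros]: "continuous_on S (ramp i)"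
 unfolding ramp_def[abs_def] by (intro continuous_intros)

lemma ramp_bounded_continuous: "ramp i \<in> bounded_continuous"
 by (rule bounded_continuousI[of _ 1]) (auto intro: continuous_intros ramp_bounds)

lemma ramp_one: "x >= 0 ==> ramp (-1, 1) x = 1"
 by (simp add: ramp_def of_rat_minus)

lemma ramp_tendsto_indicator: "(\<lambda>k. ramp (q, k) x) \<longlonglongrightarrow> indicator {of_rat q<..} x"
proof (cases "x > of_rat q")
 case True
 obtain K :: nat where K: "1 / (x - of_rat q) < real K"
  using reals_Archimedean2 by blast
 have "ramp (q, k) x = 1" if "k >= K" for k
 proof -
  have "1 < real K * (x - of_rat q)"
   using K True by (simp add: field_simps)
  also have "\<dots> <= real k * (x - of_rat q)"
   using that True by (intro mult_right_mono) auto
  finally show ?thesis by (simp add: ramp_def)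
 qed
 then have "eventually (\<lambda>k. ramp (q, k) x = 1) sequentially"
  by (auto simp: eventually_sequentially)
 with True show ?thesis
  by (simp add: tendsto_eventually)
next
 case False
 then have "real k * (x - of_rat q) <= 0" for k
  by (simp add: mult_nonneg_nonpos)
 then have "ramp (q, k) x = 0" for k
  by (simp add: ramp_def)
 with False show ?thesis by simp
qed

lemma moment_measure_measure_Ioi:
 assumes \<nu>: "\<nu> \<in> moment_measures"
 shows "(\<lambda>k. LINT x|\<nu>. ramp (q, k) x) \<longlonglongrightarrow> measure \<nu> ({of_rat q<..} \<inter> {0..})"
proof -
 interpret finite_measure \<nu> using finite_moment_measure[OF \<nu>] .
 have m: "{of_rat q<..} \<inter> {0..} \<in> sets \<nu>"
  by (auto simp: sets_moment_measure[OF \<nu>] sets_restrict_space_iff)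
 have "(\<lambda>k. LINT x|\<nu>. ramp (q, k) x) \<longlonglongrightarrow> (LINT x|\<nu>. indicator ({of_rat q<..} \<inter> {0..}) x)"
 proof (rule integral_dominated_convergence[where w="\<lambda>_. 1"])
  show "AE x in \<nu>. (\<lambda>k. ramp (q, k) x) \<longlonglongrightarrow> indicator ({of_rat q<..} \<inter> {0..}) x"
   using ramp_tendsto_indicator[of q]
   by (intro AE_I2) (auto simp: space_moment_measure[OF \<nu>] indicator_inter_arith)
 qed (use m in \<open>auto intro: borel_measurable_continuous_moment_measure[OF \<nu>] continuous_intros ramp_bounds\<close>)
 then show ?thesis using m by simp
qed

text \<open>For a fixed foot the ramps tend to the indicator of the open ray as the slope grows, so
  their integrals determine the masses of all rational rays. These rays are stable under
  intersection and generate the Borel sets of the half line.\<close>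

lemma moment_measures_eqI:
 assumes \<nu>: "\<nu> \<in> moment_measures" and \<nu>': "\<nu>' \<in> moment_measures"
  and eq: "\<And>i. (LINT x|\<nu>. ramp i x) = (LINT x|\<nu>'. ramp i x)"
 shows "\<nu> = \<nu>'"
proof -
 interpret A: finite_measure \<nu> using finite_moment_measure[OF \<nu>] .
 interpret B: finite_measure \<nu>' using finite_moment_measure[OF \<nu>'] .
 have tail: "emeasure \<nu> ({of_rat q<..} \<inter> {0..}) = emeasure \<nu>' ({of_rat q<..} \<inter> {0..})" for q
  using LIMSEQ_unique[OF moment_measure_measure_Ioi[OF \<nu>, of q]] moment_measure_measure_Ioi[OF \<nu>', of q]
  by (simp add: eq A.emeasure_eq_measure B.emeasure_eq_measure)
 let ?E = "{{of_rat q<..} \<inter> {0..} | q. True} :: real set set"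
 show ?thesis
 proof (rule measure_eqI_generator_eq[where \<Omega>="{0..}" and E="?E" and A="\<lambda>_. {0..}"])
  show "Int_stable ?E"
  proof (rule Int_stableI, safe)
   fix q q' :: rat
   have "{of_rat q<..} \<inter> {0..} \<inter> ({of_rat q'<..} \<inter> {0..}) = {of_rat (max q q')<..} \<inter> {0::real..}"
    by (auto simp: max_def of_rat_less_eq) (metis of_rat_less_eq linorder_le_cases order.strict_trans1 order_le_less_trans not_le)+
   then show "\<exists>qa. {of_rat q<..} \<inter> {0..} \<inter> ({of_rat q'<..} \<inter> {0..}) = {of_rat qa<..} \<inter> {0::real..} \<and> True"
    by blast
  qed
  have gen: "sets borel_nonneg = sigma_sets {0..} ?E"
  proof -
   have b: "(borel :: real measure) = sigma UNIV ((\<lambda>q. {of_rat q<..}) ` (UNIV :: rat set))"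
   proof (rule borel_eq_sigmaI1[OF borel_Ioi])
    fix X :: "real set" assume "X \<in> range greaterThan"
    then obtain a where X: "X = {a<..}" by blast
    have "X = (\<Union>q\<in>{q. a < of_rat q}. {of_rat q<..})"
     using of_rat_dense unfolding X by (auto intro: less_trans)
    also have "\<dots> \<in> sets (sigma UNIV ((\<lambda>q. {of_rat q<..}) ` (UNIV :: rat set)))"
     by (intro sets.countable_UN') auto
    finally show "X \<in> sets (sigma UNIV ((\<lambda>q. {of_rat q<..}) ` (UNIV :: rat set)))" .
   qed auto
   let ?F = "(\<lambda>q. {of_rat q<..}) ` (UNIV :: rat set) :: real set set"
   have "{0..} \<in> sets (borel :: real measure)"
    by simp
   then have "{0..} \<in> sigma_sets UNIV ?F"
    by (subst (asm) b) simp
   then have "sets borel_nonneg = sigma_sets {0..} ((\<inter>) {0..} ` ?F)"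
    by (subst b, subst sets_restrict_space) (simp add: sigma_sets_Int)
   also have "(\<inter>) {0..} ` ?F = ?E"
    by blast
   finally show ?thesis .
  qed
  show "sets \<nu> = sigma_sets {0..} ?E" "sets \<nu>' = sigma_sets {0..} ?E"
   using gen sets_moment_measure \<nu> \<nu>' by auto
  \<comment> \<open>The whole half line is itself one of the rays, so the constant sequence exhausts
    the space.\<close>
  have "{0..} = {of_rat (-1)<..} \<inter> {0::real..}"
   by (auto simp: of_rat_minus)
  then show "range (\<lambda>_. {0..}) \<subseteq> ?E" by blast
 qed (use tail A.emeasure_finite in auto)
qed

lemma tail_weight_nonneg: "R > 0 ==> x >= 0 ==> 0 <= tail_weight R x"
 by (auto simp: tail_weight_def)

lemma tail_weight_le: "R > 0 ==> x >= 0 ==> tail_weight R x <= x"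
 unfolding tail_weight_def by (rule mult_left_le) auto

lemma tail_weight_antimono: "0 < R ==> R <= R' ==> x >= 0 ==> tail_weight R' x <= tail_weight R x"
 unfolding tail_weight_def by (intro mult_left_mono min.mono) (auto intro: divide_left_mono)

lemma cutoff_bounded_continuous: "R > 0 ==> (\<lambda>x. min 1 (x / R)) \<in> bounded_continuous"
 by (rule bounded_continuousI[of _ 1]) (auto intro!: continuous_intros)

lemma integrable_tail_weight: "\<nu> \<in> moment_measures ==> R > 0 ==> integrable \<nu> (tail_weight R)"
 using integrable_bounded_continuous(2)[OF _ cutoff_bounded_continuous] by (simp add: tail_weight_def[abs_def])

lemma continuous_map_weak_tail_weight:
 "R > 0 ==> continuous_map weak_topology euclideanreal (\<lambda>\<nu>. LINT x|\<nu>. tail_weight R x)"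
 using continuous_map_weak_integral(2)[OF cutoff_bounded_continuous[of R]] by (simp add: tail_weight_def)

lemma tail_weight_integral_antimono:
 "\<nu> \<in> moment_measures ==> 0 < R ==> R <= R' ==> (LINT x|\<nu>. tail_weight R' x) <= (LINT x|\<nu>. tail_weight R x)"
 by (intro integral_mono integrable_tail_weight) (auto simp: space_moment_measure tail_weight_antimono)

lemma tail_weight_integral_tendsto_0:
 assumes \<nu>: "\<nu> \<in> moment_measures"
 shows "(\<lambda>k. LINT x|\<nu>. tail_weight (real (Suc k)) x) \<longlonglongrightarrow> 0"
proof -
 have "(\<lambda>k. LINT x|\<nu>. tail_weight (real (Suc k)) x) \<longlonglongrightarrow> (LINT x|\<nu>. 0)"
 proof (rule integral_dominated_convergence[where w="\<lambda>x. x"])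
  show "AE x in \<nu>. (\<lambda>k. tail_weight (real (Suc k)) x) \<longlonglongrightarrow> 0"
  proof (intro AE_I2)
   fix x assume "x \<in> space \<nu>"
   have "(\<lambda>k. x / real (Suc k)) \<longlonglongrightarrow> 0"
    by (intro LIMSEQ_Suc lim_const_over_n)
   then have "(\<lambda>k. x * min 1 (x / real (Suc k))) \<longlonglongrightarrow> x * min 1 0"
    by (intro tendsto_intros)
   then show "(\<lambda>k. tail_weight (real (Suc k)) x) \<longlonglongrightarrow> 0"
    by (simp add: tail_weight_def)
  qed
  show "AE x in \<nu>. norm (tail_weight (real (Suc k)) x) <= x" for k
   using tail_weight_nonneg tail_weight_le
   by (intro AE_I2) (auto simp: space_moment_measure[OF \<nu>])
  show "integrable \<nu> (\<lambda>x. x)"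
   by (rule integrable_id_moment_measure[OF \<nu>])
  show "tail_weight (real (Suc k)) \<in> borel_measurable \<nu>" for k
   by (rule borel_measurable_integrable[OF integrable_tail_weight[OF \<nu>]]) simp
 qed simp
 then show ?thesis by simp
qed

section \<open>Relative compactness in the weak topology\<close>

lemma sets_plus_measure [simp]: "sets (plus_measure \<mu> \<nu>) = sets \<mu>"
 and space_plus_measure [simp]: "space (plus_measure \<mu> \<nu>) = space \<mu>"
 by (simp_all add: plus_measure_def)

lemma emeasure_plus_measure:
 assumes eq: "sets \<mu> = sets \<nu>" and A: "A \<in> sets \<mu>"
 shows "emeasure (plus_measure \<mu> \<nu>) A = emeasure \<mu> A + emeasure \<nu> A"
 unfolding plus_measure_def
proof (rule emeasure_measure_of_sigma)
 show "sigma_algebra (space \<mu>) (sets \<mu>)" ..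
 show "positive (sets \<mu>) (\<lambda>A. emeasure \<mu> A + emeasure \<nu> A)"
  by (simp add: positive_def)
 show "countably_additive (sets \<mu>) (\<lambda>A. emeasure \<mu> A + emeasure \<nu> A)"
  using eq by (intro countably_additiveI) (simp add: suminf_add[symmetric] suminf_emeasure)
qed (rule A)

lemma measure_moment_measure_Ici:
 assumes \<nu>: "\<nu> \<in> moment_measures" and R: "R > 0"
 shows "measure \<nu> {R..} <= (LINT x|\<nu>. x) / R"
proof -
 have "measure \<nu> {x\<in>space \<nu>. R <= x} <= (LINT x|\<nu>. x) / R"
  using integrable_id_moment_measure[OF \<nu>] R
  by (intro integral_Markov_inequality_measure[where A="{}"]) (auto intro!: AE_I2 simp: space_moment_measure[OF \<nu>])
 also have "{x\<in>space \<nu>. R <= x} = {R..}"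
  using R by (auto simp: space_moment_measure[OF \<nu>])
 finally show ?thesis .
qed

text \<open>The measures are scaled to have mass at most 1 and completed to probabilities on the
  line by an atom at -1, which stays separated from the half line. Helly selection then gives a
  limit, whose part on the half line is scaled back. The uniform tails upgrade convergence of
  integrals of bounded functions to integrals of \<open>x * f x\<close>.\<close>

lemma moment_measure_compactness:
 fixes X :: "nat => real measure"
 assumes X: "\<And>k. X k \<in> moment_measures"
  and mass: "\<And>k. measure (X k) {0..} <= A" and moment: "\<And>k. (LINT x|X k. x) <= B"
  and tails: "\<And>e. e > 0 ==> \<exists>R>0. eventually (\<lambda>k. (LINT x|X k. tail_weight R x) <= e) sequentially"
 shows "\<exists>r \<nu>. strict_mono r \<and> limitin weak_topology (X \<circ> r) \<nu> sequentially"
proof -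
 \<comment> \<open>The maximum with 1 makes division by \<open>A'\<close> possible and also
   decreasing, which the tightness estimate uses.\<close>
 define A' where "A' = max A 1"
 have A': "A' > 0" "A' >= 1" "\<And>k. measure (X k) {0..} <= A'"
  using mass by (auto simp: A'_def intro: order_trans max.cobounded1)
 define c where "c k = 1 - measure (X k) {0..} / A'" for k
 have c: "0 <= c k" for k
  using A' by (simp add: c_def)
 \<comment> \<open>The missing mass \<open>c k\<close> sits at -1, outside the half line, so that no
   part of the original measure is altered.\<close>
 define P where "P k = plus_measure (distr (density (X k) (\<lambda>_. ennreal (1 / A'))) borel (\<lambda>x. x))
  (density (return borel (-1)) (\<lambda>_. ennreal (c k)))" for k
 have sets_P [simp]: "sets (P k) = sets borel" for k
  by (simp add: P_def)
 have space_P [simp]: "space (P k) = UNIV" for k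
  using sets_eq_imp_space_eq[OF sets_P] by simp
 have em: "emeasure (P k) S = ennreal (1 / A') * emeasure (X k) (S \<inter> {0..}) + ennreal (c k) * indicator S (-1)"
  if "S \<in> sets borel" for S k
 proof -
  have m: "(\<lambda>x. x) \<in> borel_measurable (X k)"
   by (intro borel_measurable_continuous_moment_measure[OF X] continuous_intros)
  have "S \<inter> {0..} \<in> sets (X k)"
   using that by (auto simp: sets_moment_measure[OF X] sets_restrict_space_iff)
  then show ?thesis
   unfolding P_def using that m
   by (subst emeasure_plus_measure) (auto simp: emeasure_distr emeasure_density_const space_moment_measure[OF X])
 qed
 interpret X: finite_measure "X k" for k using finite_moment_measure[OF X] .
 interpret P: prob_space "P k" for k
 proof
  show "emeasure (P k) (space (P k)) = 1"
   using A' c[of k] by (simp add: em X.emeasure_eq_measure ennreal_mult[symmetric] ennreal_plus[symmetric] del: ennreal_plus)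
    (simp add: c_def)
 qed
 interpret P: real_distribution "P k" for k
  by unfold_locales simp
 have mP: "measure (P k) S = measure (X k) (S \<inter> {0..}) / A' + c k * indicator S (-1)" if "S \<in> sets borel" for S k
  using em[OF that, of k] A' c[of k]
  by (simp add: P.emeasure_eq_measure X.emeasure_eq_measure ennreal_mult[symmetric] ennreal_plus[symmetric] ennreal_indicator[symmetric]
    zero_le_mult_iff add_nonneg_nonneg del: ennreal_plus)
 have restr: "restrict_space (P k) {0..} = density (X k) (\<lambda>_. ennreal (1 / A'))" for k
 proof (rule measure_eqI)
  show s: "sets (restrict_space (P k) {0..}) = sets (density (X k) (\<lambda>_. ennreal (1 / A')))"
   by (simp add: sets_moment_measure[OF X]) (rule sets_restrict_space_cong, simp)
  fix S assume S: "S \<in> sets (restrict_space (P k) {0..})"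
  then have S': "S \<in> sets borel" "S \<subseteq> {0..}"
   by (auto simp: sets_restrict_space_iff)
  then have "S \<inter> {0..} = S" "-1 \<notin> S" by auto
  with S S' s show "emeasure (restrict_space (P k) {0..}) S = emeasure (density (X k) (\<lambda>_. ennreal (1 / A'))) S"
   by (simp add: emeasure_restrict_space em emeasure_density_const)
 qed
 have int_P: "(LINT x|P k. f x) = (LINT x|X k. f x) / A'" if f: "continuous_on UNIV f" and f1: "f (-1) = 0" for f :: "real => real" and k
 proof -
  have mf: "f \<in> borel_measurable (P k)"
   using borel_measurable_continuous_onI[OF f] by (simp cong: measurable_cong_sets)
  have "measure (P k) ({-1} \<union> {0..}) = 1"
   using A' by (subst mP) (auto simp: c_def Int_Un_distrib2)
  then have "AE x in P k. x \<in> {-1} \<union> {0..}"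
   by (simp add: P.prob_eq_1)
  then have "(LINT x|P k. f x) = (LINT x|P k. indicator {0..} x *\<^sub>R f x)"
   using mf by (intro integral_cong_AE) (auto simp: f1 elim!: eventually_mono split: split_indicator)
  also have "\<dots> = (\<integral>x. f x \<partial>restrict_space (P k) {0..})"
   by (subst integral_restrict_space) auto
  also have "\<dots> = (LINT x|X k. (1 / A') * f x)"
   unfolding restr using A' f
   by (subst integral_density) (auto intro!: borel_measurable_continuous_moment_measure[OF X] intro: continuous_on_subset)
  finally show ?thesis by simp
 qed
 have "tight P"
  unfolding tight_def
 proof (intro conjI allI impI)
  show "real_distribution (P k)" for k by unfold_locales
  fix e :: real assume e: "e > 0"
  \<comment> \<open>Chosen so that Markov's inequality for the first moment leaves less than
    \<open>e\<close> beyond \<open>R\<close>.\<close>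
  define R where "R = (\<bar>B\<bar> + 1) / e"
  have R: "R > 0" using e by (simp add: R_def)
  have "measure (P k) {-2<..R} > 1 - e" for k
  proof -
   have "measure (P k) {R<..} = measure (X k) {R<..} / A'"
    using R by (subst mP) (auto simp: Int_absorb2 Int_absorb1 intro!: arg_cong[where f="measure (X k)"])
   also have "\<dots> <= measure (X k) {R..} / A'"
    using A' R by (intro divide_right_mono X.finite_measure_mono) (auto simp: sets_moment_measure[OF X] sets_restrict_space_iff)
   also have "\<dots> <= measure (X k) {R..}"
    using A' mult_left_mono[of 1 A' "measure (X k) {R..}"] by (simp add: divide_le_eq)
   also have "\<dots> <= B / R"
    using R moment[of k] by (intro order_trans[OF measure_moment_measure_Ici[OF X R]] divide_right_mono) auto
   also have "\<dots> < e"
    using e R by (simp add: R_def divide_simps mult_less_cancel_left_pos)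
   finally have 1: "measure (P k) {R<..} < e" .
   have "{..-2} \<inter> {0::real..} = {}" by auto
   then have "measure (P k) {..-2} = 0"
    by (simp add: mP)
   moreover have "space (P k) - {-2<..R} = {..-2} \<union> {R<..}" by auto
   ultimately have "measure (P k) (space (P k) - {-2<..R}) < e"
    using 1 measure_Un_le[of "{..-2}" "P k" "{R<..}"] by simp
   then show ?thesis
    by (subst (asm) P.prob_compl) auto
  qed
  then show "\<exists>a b. a < b \<and> (\<forall>n. 1 - e < measure (P n) {a<..b})"
   using R by (intro exI[of _ "-2"] exI[of _ R]) auto
 qed
 from tight_imp_convergent_subsubsequence[OF this, of id] obtain r Q where
  r: "strict_mono r" and Q: "real_distribution Q" and conv: "weak_conv_m (P \<circ> r) Q"
  by (auto simp: strict_mono_def)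
 interpret Q: real_distribution Q by (rule Q)
 define \<nu> where "\<nu> = density (restrict_space Q {0..}) (\<lambda>_. ennreal A')"
 have PQ: "(\<lambda>k. LINT x|P (r k). f x) \<longlonglongrightarrow> (LINT x|Q. f x)"
  if "continuous_on UNIV f" "\<And>x. \<bar>f x\<bar> <= C" for f :: "real => real" and C
  using weak_conv_imp_integral_bdd_continuous_conv[of "P \<circ> r" Q f C] conv Q that
  by (auto simp: continuous_on_eq_continuous_at o_def P.real_distribution_axioms)
 have sets_\<nu>: "sets \<nu> = sets borel_nonneg"
  unfolding \<nu>_def by (simp, rule sets_restrict_space_cong, simp)
 have space_\<nu>: "space \<nu> = {0..}"
  using sets_eq_imp_space_eq[OF sets_\<nu>] by (simp add: space_restrict_space)
 have meas_\<nu>: "f \<in> borel_measurable (restrict_space Q {0..})" "f \<in> borel_measurable \<nu>"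
  if "continuous_on {0..} f" for f :: "real => real"
 proof -
  have "f \<in> borel_measurable borel_nonneg"
   using that by (rule borel_measurable_continuous_on_restrict)
  then show "f \<in> borel_measurable \<nu>"
   by (simp add: measurable_cong_sets[OF sets_\<nu> refl])
  then show "f \<in> borel_measurable (restrict_space Q {0..})"
   by (simp add: \<nu>_def)
 qed
 \<comment> \<open>A tent supported in \<open>[-1, 0]\<close> has integral 0 under every
   \<open>P k\<close>, hence under \<open>Q\<close>: the limit does not charge the gap, and the atom
   cannot leak into the half line.\<close>
 have gap: "AE x in Q. \<not> (-1 < x \<and> x < 0)"
 proof -
  let ?g = "\<lambda>x::real. max 0 (min (x + 1) (- x))"
  have g: "continuous_on UNIV ?g" by (intro continuous_intros)
  have b: "\<bar>?g x\<bar> <= 1" for x by (auto simp: max_def min_def)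
  have "(LINT x|P k. ?g x) = 0" for k
   using g by (subst int_P) (auto intro!: integral_eq_zero_AE AE_I2 simp: space_moment_measure[OF X])
  with PQ[OF g b] have "(LINT x|Q. ?g x) = 0"
   by (simp add: LIMSEQ_const_iff)
  moreover have "integrable Q ?g"
   using b g by (intro Q.integrable_const_bound[where B=1]) (auto intro!: borel_measurable_continuous_onI)
  ultimately have "AE x in Q. ?g x = 0"
   by (subst (asm) integral_nonneg_eq_0_iff_AE) auto
  then show ?thesis by eventually_elim (auto simp: max_def min_def split: if_splits)
 qed
 have conv1: "(\<lambda>k. LINT x|X (r k). f x) \<longlonglongrightarrow> (LINT x|\<nu>. f x)" if f: "f \<in> bounded_continuous" for f
 proof -
  obtain C where C: "C >= 0" "continuous_on {0..} f" "\<And>x. x >= 0 ==> \<bar>f x\<bar> <= C"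
   using bounded_continuousE[OF f] by blast
  \<comment> \<open>Extends \<open>f\<close> continuously to the line so that it vanishes from -1
    downwards; the artificial atom then contributes nothing.\<close>
  define g where "g x = f (max 0 x) * max 0 (min 1 (1 + x))" for x
  have g: "continuous_on UNIV g"
   unfolding g_def by (intro continuous_intros continuous_on_compose2[OF C(2)]) auto
  have gb: "\<bar>g x\<bar> <= C" for x
   unfolding g_def abs_mult
   using C(3)[of "max 0 x"] C(1) mult_mono[of "\<bar>f (max 0 x)\<bar>" C "\<bar>max 0 (min 1 (1 + x))\<bar>" 1] by auto
  have gf: "g x = f x" if "x >= 0" for x using that by (simp add: g_def)
  have 0: "g x = 0" if "x <= -1" for x using that by (simp add: g_def)
  have "(\<lambda>k. A' * (LINT x|P (r k). g x)) \<longlonglongrightarrow> A' * (LINT x|Q. g x)"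
   using PQ[OF g gb] by (intro tendsto_intros)
  moreover have "A' * (LINT x|P k. g x) = (LINT x|X k. f x)" for k
  proof -
   have "(LINT x|X k. g x) = (LINT x|X k. f x)"
    by (intro Bochner_Integration.integral_cong) (auto simp: space_moment_measure[OF X] gf)
   then show ?thesis using A' int_P[OF g] 0 by simp
  qed
  moreover have "A' * (LINT x|Q. g x) = (LINT x|\<nu>. f x)"
  proof -
   have mg: "g \<in> borel_measurable Q"
    using borel_measurable_continuous_onI[OF g] by (simp cong: measurable_cong_sets)
   have "(LINT x|Q. g x) = (LINT x|Q. indicator {0..} x *\<^sub>R g x)"
    using gap mg
    by (intro integral_cong_AE) (auto elim!: eventually_mono simp: not_less 0 split: split_indicator)
   also have "\<dots> = (\<integral>x. g x \<partial>restrict_space Q {0..})"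
    by (subst integral_restrict_space) auto
   also have "\<dots> = (\<integral>x. f x \<partial>restrict_space Q {0..})"
    by (intro Bochner_Integration.integral_cong) (auto simp: space_restrict_space gf)
   finally show ?thesis
    unfolding \<nu>_def using A' C(2) meas_\<nu>
    by (subst integral_density) auto
  qed
  ultimately show ?thesis by simp
 qed
 have fin: "finite_measure \<nu>"
 proof
  have "emeasure \<nu> (space \<nu>) = ennreal A' * emeasure Q {0..}"
   unfolding space_\<nu> by (simp add: \<nu>_def emeasure_density_const emeasure_restrict_space sets_restrict_space_iff)
  then show "emeasure \<nu> (space \<nu>) \<noteq> \<infinity>"
   by (simp add: ennreal_mult_eq_top_iff Q.emeasure_eq_measure)
 qed
 interpret \<nu>: finite_measure \<nu> by (rule fin)
 \<comment> \<open>The truncations \<open>min x m\<close> are bounded and continuous, so the moment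
   bound passes to the limit for each of them, and then to their supremum by monotone
   convergence.\<close>
 have "integrable \<nu> (\<lambda>x. x)"
 proof (rule integrableI_bounded)
  show "(\<lambda>x. x) \<in> borel_measurable \<nu>"
   by (intro meas_\<nu> continuous_intros)
  have le: "(LINT x|\<nu>. min x (real m)) <= B" for m
  proof (rule LIMSEQ_le_const2)
   show "(\<lambda>k. LINT x|X (r k). min x (real m)) \<longlonglongrightarrow> (LINT x|\<nu>. min x (real m))"
    by (intro conv1 bounded_continuousI[of _ "real m"] continuous_intros) auto
   have "(LINT x|X k. min x (real m)) <= B" for k
   proof -
    have "integrable (X k) (\<lambda>x. min x (real m))"
     by (intro integrable_bounded_continuous X bounded_continuousI[of _ "real m"] continuous_intros) auto
    then have "(LINT x|X k. min x (real m)) <= (LINT x|X k. x)"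
     using integrable_id_moment_measure[OF X] by (intro integral_mono) auto
    then show ?thesis using moment[of k] by simp
   qed
   then show "\<exists>N. \<forall>n\<ge>N. (LINT x|X (r n). min x (real m)) <= B" by blast
  qed
  have "(\<integral>\<^sup>+ x. ennreal (norm x) \<partial>\<nu>) = (\<integral>\<^sup>+ x. (SUP m. ennreal (min x (real m))) \<partial>\<nu>)"
  proof (rule nn_integral_cong)
   fix x assume "x \<in> space \<nu>"
   then have x: "x >= 0" by (simp add: space_\<nu>)
   obtain m :: nat where "x <= real m" using real_arch_simple by blast
   then have "ennreal x <= (SUP m. ennreal (min x (real m)))"
    by (intro SUP_upper2[of m]) (auto simp: min_def)
   moreover have "(SUP m. ennreal (min x (real m))) <= ennreal x"
    by (intro SUP_least ennreal_leI) auto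
   ultimately show "ennreal (norm x) = (SUP m. ennreal (min x (real m)))"
    using x by simp
  qed
  also have "\<dots> = (SUP m. \<integral>\<^sup>+ x. ennreal (min x (real m)) \<partial>\<nu>)"
   by (intro nn_integral_monotone_convergence_SUP measurable_compose[OF meas_\<nu>(2) measurable_ennreal] continuous_intros)
    (auto simp: incseq_def le_fun_def intro!: ennreal_leI)
  also have "\<dots> <= ennreal B"
  proof (intro SUP_least)
   fix m :: nat
   have "integrable \<nu> (\<lambda>x. min x (real m))"
    by (intro \<nu>.integrable_const_bound[where B="real m"] meas_\<nu> continuous_intros AE_I2) (auto simp: space_\<nu>)
   then have "(\<integral>\<^sup>+ x. ennreal (min x (real m)) \<partial>\<nu>) = ennreal (LINT x|\<nu>. min x (real m))"
    by (intro nn_integral_eq_integral AE_I2) (auto simp: space_\<nu>)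
   then show "(\<integral>\<^sup>+ x. ennreal (min x (real m)) \<partial>\<nu>) <= ennreal B"
    using le[of m] by (simp add: ennreal_leI)
  qed
  finally show "(\<integral>\<^sup>+ x. ennreal (norm x) \<partial>\<nu>) < \<infinity>"
   by (simp add: le_less_trans)
 qed
 then have \<nu>: "\<nu> \<in> moment_measures"
  using sets_\<nu> fin by (simp add: moment_measures_def)
 have conv2: "(\<lambda>k. LINT x|X (r k). x * f x) \<longlonglongrightarrow> (LINT x|\<nu>. x * f x)" if f: "f \<in> bounded_continuous" for f
 proof (rule LIMSEQ_I)
  fix e :: real assume e: "e > 0"
  obtain C where C: "C >= 0" "continuous_on {0..} f" "\<And>x. x >= 0 ==> \<bar>f x\<bar> <= C"
   using bounded_continuousE[OF f] by blast
  \<comment> \<open>The tail of \<open>x * f x\<close> costs at most \<open>C * d\<close> for the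
    sequence and again for the limit, together less than \<open>e / 2\<close>; the truncated part is
    bounded and continuous and takes the other half.\<close>
  define d where "d = e / (4 * (C + 1))"
  have d: "d > 0" using e C by (simp add: d_def)
  obtain R1 where R1: "R1 > 0" "eventually (\<lambda>k. (LINT x|X k. tail_weight R1 x) <= d) sequentially"
   using tails[OF d] by blast
  obtain m where m: "(LINT x|\<nu>. tail_weight (real (Suc m)) x) < d"
   using order_tendstoD(2)[OF tail_weight_integral_tendsto_0[OF \<nu>] d] by (auto simp: eventually_sequentially)
  define R where "R = max R1 (real (Suc m))"
  have R: "R > 0" "R >= R1" "R >= real (Suc m)" using R1 by (auto simp: R_def)
  have split: "\<bar>(LINT x|\<rho>. x * f x) - (LINT x|\<rho>. x * (f x * (1 - min 1 (x / R))))\<bar> <= C * d"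
   if \<rho>: "\<rho> \<in> moment_measures" and t: "(LINT x|\<rho>. tail_weight R x) <= d" for \<rho>
  proof -
   have g: "(\<lambda>x. f x * (1 - min 1 (x / R))) \<in> bounded_continuous"
   proof (rule bounded_continuousI[of _ C])
    fix x :: real assume x: "x >= 0"
    then have "\<bar>1 - min 1 (x / R)\<bar> <= 1" using R by (auto simp: min_def)
    then show "\<bar>f x * (1 - min 1 (x / R))\<bar> <= C"
     using C(3)[OF x] C(1) mult_mono[of "\<bar>f x\<bar>" C "\<bar>1 - min 1 (x / R)\<bar>" 1] by (simp add: abs_mult)
   qed (use R in \<open>auto intro!: continuous_intros C\<close>)
   have "(LINT x|\<rho>. x * f x) - (LINT x|\<rho>. x * (f x * (1 - min 1 (x / R)))) =
     (LINT x|\<rho>. x * f x - x * (f x * (1 - min 1 (x / R))))"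
    using integrable_bounded_continuous(2)[OF \<rho>] f g by simp
   also have "\<dots> = (LINT x|\<rho>. f x * tail_weight R x)"
    by (intro Bochner_Integration.integral_cong) (auto simp: tail_weight_def algebra_simps)
   also have "\<bar>\<dots>\<bar> <= (LINT x|\<rho>. C * tail_weight R x)"
   proof (rule abs_integral_le)
    show i: "integrable \<rho> (\<lambda>x. C * tail_weight R x)"
     using integrable_tail_weight[OF \<rho> R(1)] by simp
    show le: "\<bar>f x * tail_weight R x\<bar> <= C * tail_weight R x" if "x \<in> space \<rho>" for x
     using that C tail_weight_nonneg[OF R(1), of x] by (auto simp: space_moment_measure[OF \<rho>] abs_mult intro!: mult_right_mono)
    show "integrable \<rho> (\<lambda>x. f x * tail_weight R x)"
    proof (rule Bochner_Integration.integrable_bound[OF i])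
     show "AE x in \<rho>. norm (f x * tail_weight R x) <= norm (C * tail_weight R x)"
      using le by (intro AE_I2) force
     show "(\<lambda>x. f x * tail_weight R x) \<in> borel_measurable \<rho>"
      unfolding tail_weight_def using R by (intro borel_measurable_continuous_moment_measure[OF \<rho>] continuous_intros C) auto
    qed
   qed
   also have "\<dots> <= C * d"
    using t C by (simp add: mult_left_mono)
   finally show ?thesis .
  qed
  have g: "(\<lambda>x. x * (f x * (1 - min 1 (x / R)))) \<in> bounded_continuous"
  proof (rule bounded_continuousI[of _ "R * C"])
   fix x :: real assume x: "x >= 0"
   have "x * (1 - min 1 (x / R)) <= R * 1"
   proof (cases "x <= R")
    case True
    then show ?thesis using x R by (intro mult_mono) (auto simp: min_def)
   qed (use R in \<open>auto simp: min_def\<close>)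
   moreover have "0 <= x * (1 - min 1 (x / R))" using x by auto
   ultimately have "\<bar>x * (1 - min 1 (x / R))\<bar> * \<bar>f x\<bar> <= R * C"
    using C(1) C(3)[OF x] R by (intro mult_mono) auto
   then show "\<bar>x * (f x * (1 - min 1 (x / R)))\<bar> <= R * C"
    by (simp add: abs_mult mult.commute mult.left_commute)
  qed (use R in \<open>auto intro!: continuous_intros C\<close>)
  have cd: "2 * (C * d) < e / 2"
  proof -
   have "4 * (C * d) < 4 * ((C + 1) * d)" using d by (simp add: algebra_simps)
   also have "\<dots> = e" using C(1) by (simp add: d_def field_simps)
   finally show ?thesis by simp
  qed
  have "eventually (\<lambda>k. \<bar>(LINT x|X (r k). x * (f x * (1 - min 1 (x / R)))) - (LINT x|\<nu>. x * (f x * (1 - min 1 (x / R))))\<bar> < e / 2) sequentially"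
   using tendstoD[OF conv1[OF g], of "e / 2"] e by (simp add: dist_real_def)
  moreover have "eventually (\<lambda>k. (LINT x|X (r k). tail_weight R1 x) <= d) sequentially"
   using eventually_compose_filterlim[OF R1(2) filterlim_subseq[OF r]] .
  ultimately have "eventually (\<lambda>k. norm ((LINT x|X (r k). x * f x) - (LINT x|\<nu>. x * f x)) < e) sequentially"
  proof eventually_elim
   case (elim k)
   have "(LINT x|X (r k). tail_weight R x) <= d"
    using tail_weight_integral_antimono[OF X R1(1) R(2), of "r k"] elim(2) by linarith
   from split[OF X this] have 1: "\<bar>(LINT x|X (r k). x * f x) - (LINT x|X (r k). x * (f x * (1 - min 1 (x / R))))\<bar> <= C * d" .
   have "(LINT x|\<nu>. tail_weight R x) <= d"
    using tail_weight_integral_antimono[OF \<nu> _ R(3)] m by simp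
   from split[OF \<nu> this] 1 elim cd show ?case
    unfolding real_norm_def by linarith
  qed
  then show "\<exists>no. \<forall>n\<ge>no. norm ((LINT x|X (r n). x * f x) - (LINT x|\<nu>. x * f x)) < e"
   by (simp add: eventually_sequentially)
 qed
 have "limitin weak_topology (X \<circ> r) \<nu> sequentially"
  using X \<nu> conv1 conv2 by (intro limitin_weak_topologyI) (auto simp: o_def)
 with r show ?thesis by blast
qed

text \<open>Along any subsequence that stays outside a neighbourhood of \<nu>, compactness gives a
  further limit; its ramp integrals are those of \<nu>, so it is \<nu>, a contradiction.\<close>

lemma moment_measures_ramp_convergence:
 fixes X :: "nat => real measure"
 assumes X: "\<And>k. X k \<in> moment_measures"
  and mass: "\<And>k. measure (X k) {0..} <= A" and moment: "\<And>k. (LINT x|X k. x) <= B"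
  and tails: "\<And>e. e > 0 ==> \<exists>R>0. eventually (\<lambda>k. (LINT x|X k. tail_weight R x) <= e) sequentially"
  and \<nu>: "\<nu> \<in> moment_measures"
  and ramps: "\<And>i. (\<lambda>k. LINT x|X k. ramp i x) \<longlonglongrightarrow> (LINT x|\<nu>. ramp i x)"
 shows "limitin weak_topology X \<nu> sequentially"
 unfolding limitin_def
proof (intro conjI allI impI)
 show "\<nu> \<in> topspace weak_topology" using \<nu> by simp
 fix U assume U: "openin weak_topology U \<and> \<nu> \<in> U"
 show "\<forall>\<^sub>F x in sequentially. X x \<in> U"
 proof (rule ccontr)
  assume "\<not> ?thesis"
  then obtain s :: "nat => nat" where s: "strict_mono s" "\<And>n. X (s n) \<notin> U"
   using not_eventually_sequentiallyD[of "\<lambda>x. X x \<in> U"] by auto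
  have "\<exists>r \<nu>'. strict_mono r \<and> limitin weak_topology ((X \<circ> s) \<circ> r) \<nu>' sequentially"
  proof (rule moment_measure_compactness)
   show "\<exists>R>0. eventually (\<lambda>k. (LINT x|(X \<circ> s) k. tail_weight R x) <= e) sequentially" if e: "e > 0" for e
   proof -
    obtain R where R: "R > 0" "eventually (\<lambda>k. (LINT x|X k. tail_weight R x) <= e) sequentially"
     using tails[OF e] by blast
    with eventually_compose_filterlim[OF R(2) filterlim_subseq[OF s(1)]] show ?thesis
     by (auto simp: o_def)
   qed
  qed (use X mass moment in auto)
  then obtain r \<nu>' where r: "strict_mono r" and lim: "limitin weak_topology ((X \<circ> s) \<circ> r) \<nu>' sequentially"
   by blast
  then have \<nu>': "\<nu>' \<in> moment_measures"
   using limitin_topspace by fastforce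
  have "\<nu>' = \<nu>"
  proof (rule moment_measures_eqI[OF \<nu>' \<nu>])
   fix i
   have "(\<lambda>k. LINT x|X (s (r k)). ramp i x) \<longlonglongrightarrow> (LINT x|\<nu>'. ramp i x)"
    using tendsto_continuous_functional[OF continuous_map_weak_integral(1)[OF ramp_bounded_continuous] lim] by simp
   moreover have "(\<lambda>k. LINT x|X (s (r k)). ramp i x) \<longlonglongrightarrow> (LINT x|\<nu>. ramp i x)"
    using LIMSEQ_subseq_LIMSEQ[OF ramps strict_mono_o[OF s(1) r]] by (simp add: o_def)
   ultimately show "(LINT x|\<nu>'. ramp i x) = (LINT x|\<nu>. ramp i x)"
    by (rule LIMSEQ_unique)
  qed
  with lim U have "eventually (\<lambda>k. X (s (r k)) \<in> U) sequentially"
   by (auto simp: limitin_def)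
  with s(2) show False by simp
 qed
qed

lemma moment_measures_ramp_convergent:
 fixes X :: "nat => real measure"
 assumes X: "\<And>k. X k \<in> moment_measures"
  and mass: "\<And>k. measure (X k) {0..} <= A" and moment: "\<And>k. (LINT x|X k. x) <= B"
  and tails: "\<And>e. e > 0 ==> \<exists>R>0. eventually (\<lambda>k. (LINT x|X k. tail_weight R x) <= e) sequentially"
  and ramps: "\<And>i. convergent (\<lambda>k. LINT x|X k. ramp i x)"
 shows "\<exists>\<nu>. limitin weak_topology X \<nu> sequentially"
proof -
 obtain r \<nu> where r: "strict_mono r" and lim: "limitin weak_topology (X \<circ> r) \<nu> sequentially"
  using moment_measure_compactness[OF X mass moment tails] by blast
 then have \<nu>: "\<nu> \<in> moment_measures"
  using limitin_topspace by fastforce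
 have "(\<lambda>k. LINT x|X k. ramp i x) \<longlonglongrightarrow> (LINT x|\<nu>. ramp i x)" for i
 proof -
  obtain l where l: "(\<lambda>k. LINT x|X k. ramp i x) \<longlonglongrightarrow> l"
   using ramps[of i] by (auto simp: convergent_def)
  have "(\<lambda>k. LINT x|X (r k). ramp i x) \<longlonglongrightarrow> (LINT x|\<nu>. ramp i x)"
   using tendsto_continuous_functional[OF continuous_map_weak_integral(1)[OF ramp_bounded_continuous] lim] by simp
  with LIMSEQ_subseq_LIMSEQ[OF l r] have "l = (LINT x|\<nu>. ramp i x)"
   using LIMSEQ_unique by (auto simp: o_def)
  with l show ?thesis by simp
 qed
 from moment_measures_ramp_convergence[OF X mass moment tails \<nu> this] show ?thesis by blast
qed


section \<open>Real cadlag functions and time integrals along paths\<close>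

definition rcll :: "(real => real) => bool" where
 "rcll h \<longleftrightarrow> (\<forall>t\<ge>0. (h \<longlongrightarrow> h t) (at_right t)) \<and> (\<forall>t>0. \<exists>l. (h \<longlongrightarrow> l) (at_left t))"

lemma rcll_right: "rcll h ==> t >= 0 ==> (h \<longlongrightarrow> h t) (at_right t)"
 by (auto simp: rcll_def)

lemma rcll_cadlag:
 assumes "x \<in> cadlag E" "continuous_map E euclideanreal g"
 shows "rcll (\<lambda>t. g (x t))"
 unfolding rcll_def
proof (intro conjI allI impI)
 fix t :: real assume "t >= 0"
 then have "limitin E x (x t) (at_right t)" using assms(1) by (auto simp: cadlag_def)
 then show "((\<lambda>t. g (x t)) \<longlongrightarrow> g (x t)) (at_right t)"
  by (rule tendsto_continuous_functional[OF assms(2)])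
next
 fix t :: real assume "t > 0"
 then obtain l where "limitin E x l (at_left t)" using assms(1) by (auto simp: cadlag_def)
 then show "\<exists>l. ((\<lambda>t. g (x t)) \<longlongrightarrow> l) (at_left t)"
  using tendsto_continuous_functional[OF assms(2)] by blast
qed

lemma cadlag_topspace: "x \<in> cadlag E ==> t >= 0 ==> x t \<in> topspace E"
 by (auto simp: cadlag_def)

lemma rcll_punctured:
 assumes h: "rcll h" and t: "t >= 0" and e: "e > 0"
 obtains d l where "d > 0" "\<And>s. t < s ==> s < t + d ==> \<bar>h s - h t\<bar> < e"
  "\<And>s. 0 <= s ==> t - d < s ==> s < t ==> \<bar>h s - l\<bar> < e"
proof -
 obtain b where b: "b > t" "\<And>s. t < s ==> s < b ==> \<bar>h s - h t\<bar> < e"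
  using tendstoD[OF rcll_right[OF h t] e] unfolding eventually_at_right_field dist_real_def by auto
 obtain a l where a: "a < t" "\<And>s. 0 <= s ==> a < s ==> s < t ==> \<bar>h s - l\<bar> < e"
 \<comment> \<open>At time 0 no nonnegative time lies to the left, so any value serves as
   \<open>l\<close>.\<close>
 proof (cases "t = 0")
  case True
  then show ?thesis using that[of "-1"] by auto
 next
  case False
  with t have "t > 0" by simp
  then obtain l where "(h \<longlongrightarrow> l) (at_left t)" using h by (auto simp: rcll_def)
  from tendstoD[OF this e] show ?thesis
   using that unfolding eventually_at_left_field dist_real_def by auto
 qed
 show ?thesis
  by (rule that[of "min (b - t) (t - a)" l]) (use a b in auto)
qed

lemma rcll_bounded:
 assumes h: "rcll h"
 obtains C where "C >= 0" "\<And>t. 0 <= t ==> t <= T ==> \<bar>h t\<bar> <= C"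
proof -
 have "\<exists>d C. d > 0 \<and> (\<forall>s\<in>{0..}. s \<in> ball t d \<longrightarrow> \<bar>h s\<bar> <= C)" if "t \<in> {0..T}" for t
 proof -
  from that have "t >= 0" by simp
  then obtain d l where d: "d > 0" "\<And>s. t < s ==> s < t + d ==> \<bar>h s - h t\<bar> < 1"
   "\<And>s. 0 <= s ==> t - d < s ==> s < t ==> \<bar>h s - l\<bar> < 1"
   using rcll_punctured[OF h, of t 1] by auto
  have "\<bar>h s\<bar> <= \<bar>h t\<bar> + \<bar>l\<bar> + 1" if "s \<in> {0..}" "s \<in> ball t d" for s
  proof -
   have "s = t \<or> (t < s \<and> s < t + d) \<or> (t - d < s \<and> s < t)"
    using that by (auto simp: dist_real_def)
   then consider "s = t" | "t < s" "s < t + d" | "t - d < s" "s < t"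
    by blast
   then show ?thesis
   proof cases
    case 2 then show ?thesis using d(2)[of s] by linarith
   next
    case 3 then show ?thesis using d(3)[of s] that by auto
   qed auto
  qed
  with d(1) show ?thesis by blast
 qed
 then obtain d C where dC: "\<And>t. t \<in> {0..T} ==> d t > 0"
  "\<And>t s. t \<in> {0..T} ==> s \<in> {0..} ==> s \<in> ball t (d t) ==> \<bar>h s\<bar> <= C t"
  by metis
 have "compact {0..T}" by simp
 then obtain D where D: "D \<subseteq> {0..T}" "finite D" "{0..T} \<subseteq> (\<Union>t\<in>D. ball t (d t))"
 proof (rule compactE_image[where C="{0..T}" and f="\<lambda>t. ball t (d t)"])
  show "{0..T} \<subseteq> (\<Union>t\<in>{0..T}. ball t (d t))"
   using dC(1) centre_in_ball by blast
 qed simp_all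
 have "\<bar>h t\<bar> <= (\<Sum>s\<in>D. \<bar>C s\<bar>)" if "0 <= t" "t <= T" for t
 proof -
  have "t \<in> {0..T}" using that by simp
  then obtain s where s: "s \<in> D" "t \<in> ball s (d s)" using D(3) by blast
  with D(1) dC(2)[of s t] that have "\<bar>h t\<bar> <= \<bar>C s\<bar>" by force
  also have "\<dots> <= (\<Sum>s\<in>D. \<bar>C s\<bar>)"
   using s D(2) by (intro member_le_sum) auto
  finally show ?thesis .
 qed
 then show ?thesis by (rule that[rotated]) (auto intro: sum_nonneg)
qed

text \<open>\<open>D k\<close> collects the positive times where the oscillation does not fall below
  \<open>1 / (k + 1)\<close>. One-sided limits keep such times from accumulating anywhere, so each
  compact interval contains finitely many.\<close>

lemma rcll_countable_discontinuities:
 assumes h: "rcll h"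
 shows "countable {t. t > 0 \<and> \<not> isCont h t}"
proof -
 define D where "D k = {s. s > 0 \<and> \<not> (\<exists>d>0. \<forall>r. \<bar>r - s\<bar> < d \<longrightarrow> \<bar>h r - h s\<bar> < 1 / real (Suc k))}" for k
 have "finite ({0..real T} \<inter> D k)" for T k
 proof (rule finite_not_islimpt_in_compact)
  fix t :: real assume t: "t \<in> {0..real T}"
  \<comment> \<open>Half the threshold, since two values near the same one-sided limit are compared
    with each other.\<close>
  define e where "e = 1 / (2 * real (Suc k))"
  have e: "e > 0" "2 * e = 1 / real (Suc k)" by (auto simp: e_def field_simps)
  obtain d l where d: "d > 0" "\<And>s. t < s ==> s < t + d ==> \<bar>h s - h t\<bar> < e"
   "\<And>s. 0 <= s ==> t - d < s ==> s < t ==> \<bar>h s - l\<bar> < e"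
   using rcll_punctured[OF h, of t e] t e by auto
  have "s \<notin> D k" if s: "s \<noteq> t" "\<bar>s - t\<bar> < d" for s
  proof
   assume "s \<in> D k"
   then have s0: "s > 0" and no: "\<And>d. d > 0 ==> \<exists>r. \<bar>r - s\<bar> < d \<and> \<not> \<bar>h r - h s\<bar> < 1 / real (Suc k)"
    by (auto simp: D_def)
   show False
   proof (cases "t < s")
    case True
    with s no[of "min (s - t) (t + d - s)"] obtain r where
     r: "\<bar>r - s\<bar> < min (s - t) (t + d - s)" "\<not> \<bar>h r - h s\<bar> < 1 / real (Suc k)" by auto
    have "\<bar>h r - h t\<bar> < e" "\<bar>h s - h t\<bar> < e" using r(1) s True by (auto intro!: d(2))
    then show False using r(2) e(2) by linarith
   next
    case False
    \<comment> \<open>The radius does not exceed \<open>s\<close>, so \<open>r\<close> stays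
      positive, where the bound from the left is available.\<close>
    with s no[of "min s (min (t - s) (s - t + d))"] s0 obtain r where
     r: "\<bar>r - s\<bar> < min s (min (t - s) (s - t + d))" "\<not> \<bar>h r - h s\<bar> < 1 / real (Suc k)" by auto
    have "\<bar>h r - l\<bar> < e" "\<bar>h s - l\<bar> < e" using r(1) s False s0 by (auto intro!: d(3))
    then show False using r(2) e(2) by linarith
   qed
  qed
  then show "\<not> t islimpt D k"
   unfolding islimpt_approachable dist_real_def using d(1) by metis
 qed simp
 then have "countable ({0..real T} \<inter> D k)" for T k
  using countable_finite by blast
 then have "countable (\<Union>k. \<Union>T. {0..real T} \<inter> D k)"
  by (intro countable_UN) simp_all
 moreover have "{t. t > 0 \<and> \<not> isCont h t} \<subseteq> (\<Union>k. \<Union>T. {0..real T} \<inter> D k)"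
 proof safe
  fix t assume t: "t > 0" "\<not> isCont h t"
  then obtain e where e: "e > 0" "\<And>d. d > 0 ==> \<exists>r. \<bar>r - t\<bar> < d \<and> \<not> \<bar>h r - h t\<bar> < e"
   unfolding continuous_at_eps_delta dist_real_def by auto
  obtain k where k: "1 / real (Suc k) < e" using e(1) nat_approx_posE by blast
  have "t \<in> D k"
   using t e(2) k unfolding D_def by (auto, meson less_trans)
  moreover obtain T :: nat where "t <= real T" using real_arch_simple by blast
  ultimately show "t \<in> (\<Union>k. \<Union>T. {0..real T} \<inter> D k)" using t by auto
 qed
 ultimately show ?thesis by (rule countable_subset[rotated])
qed

lemma rcll_borel_measurable:
 assumes h: "rcll h"
 shows "(\<lambda>t. indicator {0..T} t * h t) \<in> borel_measurable borel"
proof (rule borel_measurable_continuous_countable_exceptions)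
 let ?X = "{t. t > 0 \<and> \<not> isCont h t} \<union> {0, T}"
 show "countable ?X" using rcll_countable_discontinuities[OF h] by simp
 show "continuous_on (- ?X) (\<lambda>t. indicator {0..T} t * h t)"
 proof (intro continuous_at_imp_continuous_on ballI)
  fix t assume t: "t \<in> - ?X"
  consider "t < 0" | "t > T" | "0 < t" "t < T" using t by fastforce
  then show "isCont (\<lambda>t. indicator {0..T} t * h t) t"
  proof cases
   case 1
   then have "eventually (\<lambda>s. indicator {0..T} s * h s = 0) (nhds t)"
    using order_tendstoD(2)[of "\<lambda>s. s" t "nhds t" 0] by (auto elim!: eventually_mono simp: filterlim_ident)
   then show ?thesis by (subst isCont_cong[where g="\<lambda>_. 0"]) auto
  next
   case 2
   then have "eventually (\<lambda>s. indicator {0..T} s * h s = 0) (nhds t)"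
    using order_tendstoD(1)[of "\<lambda>s. s" t "nhds t" T] by (auto elim!: eventually_mono simp: filterlim_ident)
   then show ?thesis by (subst isCont_cong[where g="\<lambda>_. 0"]) auto
  next
   case 3
   have "eventually (\<lambda>s. s \<in> {0<..<T}) (nhds t)"
    using 3 by (intro eventually_nhds_in_open) auto
   then have "eventually (\<lambda>s. indicator {0..T} s * h s = h s) (nhds t)"
    by eventually_elim auto
   then show ?thesis using t 3 by (subst isCont_cong[where g=h]) auto
  qed
 qed
qed

lemma rcll_integrable:
 assumes h: "rcll h" and w: "continuous_on UNIV w"
 shows "integrable lborel (\<lambda>s. indicator {0..T} s * (w s * h s))"
proof -
 obtain C where C: "C >= 0" "\<And>t. 0 <= t ==> t <= T ==> \<bar>h t\<bar> <= C"
  using rcll_bounded[OF h] by blast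
 obtain W where W: "\<And>t. t \<in> {0..T} ==> \<bar>w t\<bar> <= W"
  using compact_imp_bounded[OF compact_continuous_image[OF continuous_on_subset[OF w] compact_Icc]]
  unfolding bounded_iff by fastforce
 have "(\<lambda>s. w s * (indicator {0..T} s * h s)) \<in> borel_measurable borel"
  by (rule borel_measurable_times[OF borel_measurable_continuous_onI[OF w] rcll_borel_measurable[OF h]])
 then have m: "(\<lambda>s. indicator {0..T} s * (w s * h s)) \<in> borel_measurable borel"
  by (simp add: mult.left_commute)
 have "integrable lborel (\<lambda>s. indicator {0..T} s * (W * C))"
  by (cases "T >= 0") auto
 then show ?thesis
 proof (rule Bochner_Integration.integrable_bound)
  show "(\<lambda>s. indicator {0..T} s * (w s * h s)) \<in> borel_measurable lborel" using m by simp
  show "AE s in lborel. norm (indicator {0..T} s * (w s * h s)) <= norm (indicator {0..T} s * (W * C))"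
  proof (intro AE_I2)
   fix s show "norm (indicator {0..T} s * (w s * h s)) <= norm (indicator {0..T} s * (W * C))"
   proof (cases "s \<in> {0..T}")
    case True
    then have "\<bar>w s\<bar> * \<bar>h s\<bar> <= W * C"
     using W[OF True] C by (intro mult_mono) (auto intro: order_trans[OF abs_ge_zero W])
    then have "\<bar>w s\<bar> * \<bar>h s\<bar> <= \<bar>W * C\<bar>" by linarith
    with True show ?thesis by (simp add: abs_mult)
   qed simp
  qed
 qed
qed

definition path_integral :: "real => (real => real) => ('s => real) => (real => 's) => real" where
 "path_integral T w g x = (LINT s|lborel. indicator {0..T} s * (w s * g (x s)))"

lemma continuous_map_skorohodI:
 assumes "\<And>x e. x \<in> cadlag E ==> e > 0 ==> \<exists>F T d. finite F \<and> (\<forall>f\<in>F. continuous_map E euclideanreal f) \<and>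
  T > 0 \<and> d > 0 \<and> (\<forall>y\<in>skorohod_nbhd E F T d x. \<bar>\<Phi> y - \<Phi> x\<bar> < e)"
 shows "continuous_map (skorohod_topology E) euclideanreal \<Phi>"
 unfolding continuous_map
proof (intro conjI allI impI)
 fix U :: "real set" assume "openin euclideanreal U"
 then have U: "open U" by simp
 show "openin (skorohod_topology E) {x \<in> topspace (skorohod_topology E). \<Phi> x \<in> U}"
  unfolding openin_skorohod_topology skorohod_open_def
 proof (intro conjI ballI)
  fix x assume "x \<in> {x \<in> topspace (skorohod_topology E). \<Phi> x \<in> U}"
  then have x: "x \<in> cadlag E" "\<Phi> x \<in> U" by auto
  then obtain e where e: "e > 0" "\<And>r. \<bar>r - \<Phi> x\<bar> < e ==> r \<in> U"
   using U unfolding open_dist dist_real_def by blast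
  obtain F T d where "finite F" "\<forall>f\<in>F. continuous_map E euclideanreal f" "T > 0" "d > 0"
   "\<forall>y\<in>skorohod_nbhd E F T d x. \<bar>\<Phi> y - \<Phi> x\<bar> < e"
   using assms[OF x(1) e(1)] by blast
  then show "\<exists>F T \<delta>. finite F \<and> (\<forall>f\<in>F. continuous_map E euclideanreal f) \<and> 0 < T \<and> 0 < \<delta> \<and>
    skorohod_nbhd E F T \<delta> x \<subseteq> {x \<in> topspace (skorohod_topology E). \<Phi> x \<in> U}"
   using e(2) by (intro exI[of _ F] exI[of _ T] exI[of _ d]) (auto simp: skorohod_nbhd_def)
 qed auto
qed auto

text \<open>The single functional \<open>g\<close> suffices for the neighbourhoods. Along a sequence
  in shrinking neighbourhoods the time changes tend to the identity, so the integrands converge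
  wherever the path is continuous under \<open>g\<close>, that is outside a countable and hence null
  set; dominated convergence concludes.\<close>

lemma continuous_map_path_integral:
 assumes g: "continuous_map E euclideanreal g" and w: "continuous_on UNIV w"
 shows "continuous_map (skorohod_topology E) euclideanreal (path_integral T w g)"
proof (rule continuous_map_skorohodI)
 fix x and e :: real assume x: "x \<in> cadlag E" and e: "e > 0"
 define T' where "T' = max T 1"
 show "\<exists>F U d. finite F \<and> (\<forall>f\<in>F. continuous_map E euclideanreal f) \<and> U > 0 \<and> d > 0 \<and>
   (\<forall>y\<in>skorohod_nbhd E F U d x. \<bar>path_integral T w g y - path_integral T w g x\<bar> < e)" (is "\<exists>F U d. ?P F U d")
 proof (rule ccontr)
  assume neg: "\<not> ?thesis"
  have "\<exists>y\<in>skorohod_nbhd E {g} T' (1 / real (Suc k)) x. \<not> \<bar>path_integral T w g y - path_integral T w g x\<bar> < e" for k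
  proof (rule ccontr)
   assume "\<not> ?thesis"
   then have "?P {g} T' (1 / real (Suc k))" using g by (auto simp: T'_def)
   with neg show False by blast
  qed
  then obtain y where y: "\<And>k. y k \<in> skorohod_nbhd E {g} T' (1 / real (Suc k)) x"
   "\<And>k. \<not> \<bar>path_integral T w g (y k) - path_integral T w g x\<bar> < e"
   by metis
  then have yc: "\<And>k. y k \<in> cadlag E" by (auto simp: skorohod_nbhd_def)
  have "\<exists>\<tau>\<in>time_changes. \<forall>t\<in>{0..T'}. \<bar>\<tau> t - t\<bar> < 1 / real (Suc k) \<and> \<bar>g (y k t) - g (x (\<tau> t))\<bar> < 1 / real (Suc k)" for k
   using y(1)[of k] by (auto simp: skorohod_nbhd_def)
  then obtain \<tau> where \<tau>: "\<And>k. \<tau> k \<in> time_changes"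
   "\<And>k t. t \<in> {0..T'} ==> \<bar>\<tau> k t - t\<bar> < 1 / real (Suc k) \<and> \<bar>g (y k t) - g (x (\<tau> k t))\<bar> < 1 / real (Suc k)"
   by metis
  have \<tau>0: "\<tau> k t >= 0" if "t >= 0" for k t
   using \<tau>(1)[of k] that by (auto simp: time_changes_def)
  note rx = rcll_cadlag[OF x g] and ry = rcll_cadlag[OF yc g]
  \<comment> \<open>The bound is taken up to \<open>T' + 1\<close> because the time changes may move
    a time beyond \<open>T'\<close>, by at most 1.\<close>
  obtain C where C: "C >= 0" "\<And>t. 0 <= t ==> t <= T' + 1 ==> \<bar>g (x t)\<bar> <= C"
   using rcll_bounded[OF rx] by blast
  obtain W where W: "\<And>t. t \<in> {0..T} ==> \<bar>w t\<bar> <= W"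
   using compact_imp_bounded[OF compact_continuous_image[OF continuous_on_subset[OF w] compact_Icc]]
   unfolding bounded_iff by fastforce
  have inv: "(\<lambda>k. 1 / real (Suc k)) \<longlonglongrightarrow> 0"
   by (intro LIMSEQ_Suc lim_const_over_n)
  have "(\<lambda>k. path_integral T w g (y k)) \<longlonglongrightarrow> path_integral T w g x"
   unfolding path_integral_def
  proof (rule integral_dominated_convergence[where w="\<lambda>s. indicator {0..T} s * (W * (C + 1))"])
   show "integrable lborel (\<lambda>s. indicator {0..T} s * (W * (C + 1)))"
    by (cases "T >= 0") auto
   show "(\<lambda>s. indicator {0..T} s * (w s * g (x s))) \<in> borel_measurable lborel"
    by (rule borel_measurable_integrable[OF rcll_integrable[OF rx w]])
   show "(\<lambda>s. indicator {0..T} s * (w s * g (y k s))) \<in> borel_measurable lborel" for k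
    by (rule borel_measurable_integrable[OF rcll_integrable[OF ry w]])
   show "AE s in lborel. norm (indicator {0..T} s * (w s * g (y k s))) <= indicator {0..T} s * (W * (C + 1))" for k
   proof (intro AE_I2)
    fix s show "norm (indicator {0..T} s * (w s * g (y k s))) <= indicator {0..T} s * (W * (C + 1))"
    proof (cases "s \<in> {0..T}")
     case True
     then have s: "s \<in> {0..T'}" by (auto simp: T'_def)
     have one: "1 / real (Suc k) <= 1" by simp
     have "\<bar>\<tau> k s - s\<bar> < 1 / real (Suc k)" using \<tau>(2)[OF s] by blast
     then have "\<tau> k s <= T' + 1" using s one unfolding atLeastAtMost_iff by linarith
     then have "\<bar>g (x (\<tau> k s))\<bar> <= C" using C(2)[of "\<tau> k s"] \<tau>0[of s k] s by auto
     then have "\<bar>g (y k s)\<bar> <= C + 1" using \<tau>(2)[OF s, of k] one by linarith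
     then have "\<bar>w s\<bar> * \<bar>g (y k s)\<bar> <= W * (C + 1)"
      using W[OF True] by (intro mult_mono) (auto intro: order_trans[OF abs_ge_zero W])
     with True show ?thesis by (simp add: abs_mult)
    qed simp
   qed
   have "AE s in lborel. s \<notin> {t. t > 0 \<and> \<not> isCont (\<lambda>t. g (x t)) t} \<union> {0}"
    using rcll_countable_discontinuities[OF rx]
    by (intro AE_not_in countable_imp_null_set_lborel) simp
   then show "AE s in lborel. (\<lambda>k. indicator {0..T} s * (w s * g (y k s))) \<longlonglongrightarrow> indicator {0..T} s * (w s * g (x s))"
   proof eventually_elim
    case (elim s)
    show ?case
    proof (cases "s \<in> {0..T}")
     case True
     then have s: "s \<in> {0..T'}" "s > 0" using elim by (auto simp: T'_def)
     have "(\<lambda>k. \<tau> k s) \<longlonglongrightarrow> s"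
      using \<tau>(2)[OF s(1)] by (intro LIM_zero_cancel[OF Lim_null_comparison[OF _ inv]] always_eventually)
       (simp only: real_norm_def less_imp_le simp_thms)
     with elim s have 1: "(\<lambda>k. g (x (\<tau> k s))) \<longlonglongrightarrow> g (x s)"
      by (intro isCont_tendsto_compose[of s "\<lambda>t. g (x t)"]) auto
     have "(\<lambda>k. g (y k s) - g (x (\<tau> k s))) \<longlonglongrightarrow> 0"
      using \<tau>(2)[OF s(1)] by (intro Lim_null_comparison[OF _ inv] always_eventually)
       (simp only: real_norm_def less_imp_le simp_thms)
     from tendsto_add[OF this 1] have "(\<lambda>k. g (y k s)) \<longlonglongrightarrow> g (x s)" by simp
     then show ?thesis by (intro tendsto_mult tendsto_const)
    qed simp
   qed
  qed
  from tendstoD[OF this e] y(2) show False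
   by (auto simp: dist_real_def eventually_sequentially)
 qed
qed

lemma space_borel_of [simp]: "space (borel_of T) = topspace T"
 unfolding borel_of_def by (rule space_measure_of) (auto dest: openin_subset)

lemma sets_borel_of: "sets (borel_of T) = sigma_sets (topspace T) {U. openin T U}"
 unfolding borel_of_def by (rule sets_measure_of) (auto dest: openin_subset)

lemma openin_sets_borel_of: "openin T U ==> U \<in> sets (borel_of T)"
 by (auto simp: sets_borel_of)

lemma borel_measurable_continuous_map:
 assumes "continuous_map T euclideanreal f"
 shows "f \<in> borel_measurable (borel_of T)"
proof (rule borel_measurableI)
 fix S :: "real set" assume "open S"
 then have "openin T {x \<in> topspace T. f x \<in> S}"
  using assms by (auto simp: continuous_map)
 moreover have "f -` S \<inter> space (borel_of T) = {x \<in> topspace T. f x \<in> S}" by auto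
 ultimately show "f -` S \<inter> space (borel_of T) \<in> sets (borel_of T)"
  by (simp add: openin_sets_borel_of)
qed

text \<open>Evaluation at a fixed time is not continuous on the Skorohod space; it is recovered from the
 continuous averages of the path over the interval after that time.\<close>

lemma rcll_right_average:
 assumes h: "rcll h" and t: "t >= 0"
 shows "(\<lambda>k. real (Suc k) * ((LINT s|lborel. indicator {0..t + 1 / real (Suc k)} s * (1 * h s))
   - (LINT s|lborel. indicator {0..t} s * (1 * h s)))) \<longlonglongrightarrow> h t"
proof (rule LIMSEQ_I)
 fix e :: real assume e: "e > 0"
 then obtain d l where d: "d > 0" "\<And>s. t < s ==> s < t + d ==> \<bar>h s - h t\<bar> < e / 2"
  using rcll_punctured[OF h t, of "e / 2"] by (metis half_gt_zero)
 obtain N where N: "1 / real (Suc N) < d" using d(1) nat_approx_posE by blast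
 have "norm (real (Suc k) * ((LINT s|lborel. indicator {0..t + 1 / real (Suc k)} s * (1 * h s))
   - (LINT s|lborel. indicator {0..t} s * (1 * h s))) - h t) < e" if k: "k >= N" for k
 proof -
  define r where "r = 1 / real (Suc k)"
  have "r <= 1 / real (Suc N)"
   unfolding r_def using k by (intro divide_left_mono) auto
  with N have r: "r > 0" "r < d" by (auto simp: r_def)
  have i: "integrable lborel (\<lambda>s. indicator {0..T} s * (1 * h s))" for T
   by (intro rcll_integrable[OF h] continuous_intros)
  have 1: "(LINT s|lborel. indicator {0..t + r} s * (1 * h s)) - (LINT s|lborel. indicator {0..t} s * (1 * h s))
   = (LINT s|lborel. indicator {t<..t + r} s * h s)"
   unfolding Bochner_Integration.integral_diff[OF i i, symmetric] using t r
   by (intro Bochner_Integration.integral_cong) (auto split: split_indicator)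
  have eq: "(\<lambda>s. indicator {t<..t + r} s * h s) = (\<lambda>s. indicator {0..t + r} s * (1 * h s) - indicator {0..t} s * (1 * h s))"
   using t r by (auto simp: fun_eq_iff split: split_indicator)
  have j: "integrable lborel (\<lambda>s. indicator {t<..t + r} s * h s)"
   unfolding eq by (intro Bochner_Integration.integrable_diff i)
  have jc: "integrable lborel (\<lambda>s. indicator {t<..t + r} s * (c :: real))" for c
   by (intro integrable_mult_left integrable_real_indicator) (use r in auto)
  have ic: "(LINT s|lborel. indicator {t<..t + r} s * (c :: real)) = r * c" for c
   using r by simp
  have "(LINT s|lborel. indicator {t<..t + r} s * h s) - r * h t = (LINT s|lborel. indicator {t<..t + r} s * h s - indicator {t<..t + r} s * h t)"
   by (subst Bochner_Integration.integral_diff[OF j jc]) (simp only: ic)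
  also have "\<bar>\<dots>\<bar> <= (LINT s|lborel. indicator {t<..t + r} s * (e / 2))"
  proof (rule abs_integral_le)
   show "\<bar>indicator {t<..t + r} s * h s - indicator {t<..t + r} s * h t\<bar> <= indicator {t<..t + r} s * (e / 2)" for s
    using d(2)[of s] r by (auto split: split_indicator)
  qed (intro Bochner_Integration.integrable_diff j jc)+
  also have "\<dots> = r * (e / 2)" by (rule ic)
  finally have "\<bar>(LINT s|lborel. indicator {t<..t + r} s * h s) - r * h t\<bar> <= r * (e / 2)" .
  then have "\<bar>(LINT s|lborel. indicator {t<..t + r} s * h s) - r * h t\<bar> / r <= e / 2"
   using r by (simp add: divide_le_eq mult.commute)
  moreover have "\<bar>(LINT s|lborel. indicator {t<..t + r} s * h s) - r * h t\<bar> / r = \<bar>((LINT s|lborel. indicator {t<..t + r} s * h s) - r * h t) / r\<bar>"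
   using r by simp
  moreover have "((LINT s|lborel. indicator {t<..t + r} s * h s) - r * h t) / r = real (Suc k) * (LINT s|lborel. indicator {t<..t + r} s * h s) - h t"
   unfolding diff_divide_distrib using r(1) by (simp, simp add: r_def)
  ultimately show ?thesis
   using 1 e by (simp add: r_def)
 qed
 then show "\<exists>no. \<forall>k\<ge>no. norm (real (Suc k) * ((LINT s|lborel. indicator {0..t + 1 / real (Suc k)} s * (1 * h s))
   - (LINT s|lborel. indicator {0..t} s * (1 * h s))) - h t) < e"
  by blast
qed

lemma borel_measurable_evaluation:
 assumes g: "continuous_map E euclideanreal g" and t: "t >= 0"
 shows "(\<lambda>x. g (x t)) \<in> borel_measurable (borel_of (skorohod_topology E))"
proof (rule borel_measurable_LIMSEQ_real)
 fix x assume "x \<in> space (borel_of (skorohod_topology E))"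
 then have "x \<in> cadlag E" by simp
 from rcll_right_average[OF rcll_cadlag[OF this g] t]
 show "(\<lambda>k. real (Suc k) * (path_integral (t + 1 / real (Suc k)) (\<lambda>_. 1) g x - path_integral t (\<lambda>_. 1) g x)) \<longlonglongrightarrow> g (x t)"
  by (simp add: path_integral_def)
next
 show "(\<lambda>x. real (Suc k) * (path_integral (t + 1 / real (Suc k)) (\<lambda>_. 1) g x - path_integral t (\<lambda>_. 1) g x))
   \<in> borel_measurable (borel_of (skorohod_topology E))" for k
  by (intro borel_measurable_times borel_measurable_diff borel_measurable_const
    borel_measurable_continuous_map[OF continuous_map_path_integral[OF g]] continuous_intros)
qed


section \<open>Coding by the Cantor set and existence of limits in law\<close>

text \<open>The left end of the Cantor interval whose ternary digits are 2 at the positions in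
  \<open>b\<close> and 0 elsewhere.\<close>

definition cantor_point :: "nat set => real" where
 "cantor_point b = (\<Sum>i\<in>b. 2 / 3 ^ Suc i)"

definition cantor_interval :: "nat => nat set => real set" where
 "cantor_interval k b = {cantor_point b .. cantor_point b + 1 / 3 ^ k}"

text \<open>A bump equal to 1 on the interval that reaches 0 at distance \<open>1 / 3 ^ k\<close>
  from it. Distinct intervals of level \<open>k\<close> are at least that far apart, so the bump
  vanishes on all others.\<close>

definition cantor_hat :: "nat => nat set => real => real" where
 "cantor_hat k b c =
  max 0 (1 - 3 ^ k * max 0 (max (cantor_point b - c) (c - (cantor_point b + 1 / 3 ^ k))))"

text \<open>Every function of the first \<open>k\<close> bits becomes in this way a continuous
  function on the line, to which weak convergence of the laws of the codes applies.\<close>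

definition cantor_step :: "nat => (nat set => real) => real => real" where
 "cantor_step k s c = (\<Sum>b\<in>Pow {..<k}. s b * cantor_hat k b c)"

lemma cantor_point_split:
 assumes "b \<subseteq> {..<Suc k}"
 shows "cantor_point b = cantor_point (b \<inter> {..<k}) + (if k \<in> b then 2 / 3 ^ Suc k else 0)"
proof -
 have fin: "finite (b \<inter> {..<k})" by simp
 show ?thesis
 proof (cases "k \<in> b")
  case True
  then have "b = insert k (b \<inter> {..<k})" using assms by (auto simp: less_Suc_eq)
  then have "cantor_point b = cantor_point (insert k (b \<inter> {..<k}))" by simp
  also have "\<dots> = 2 / 3 ^ Suc k + cantor_point (b \<inter> {..<k})"
   unfolding cantor_point_def by (subst sum.insert) (use fin in auto)
  finally show ?thesis using True by simp
 next
  case False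
  then have "b \<inter> {..<k} = b" using assms by (auto simp: less_Suc_eq)
  with False show ?thesis by simp
 qed
qed

text \<open>If all earlier digits agree, the last digit alone contributes the gap. Otherwise the gap
  between the prefixes is three times the required one, and the last digits reduce it by at most one
  third.\<close>

lemma cantor_point_separated:
 assumes "b \<subseteq> {..<k}" "b' \<subseteq> {..<k}" "b \<noteq> b'"
 shows "2 / 3 ^ k <= \<bar>cantor_point b - cantor_point b'\<bar>"
 using assms
proof (induction k arbitrary: b b')
 case (Suc k)
 note s = cantor_point_split[OF Suc.prems(1)] cantor_point_split[OF Suc.prems(2)]
 have p: "2 / 3 ^ k = 3 * (2 / 3 ^ Suc k :: real)" "0 <= (2 / 3 ^ Suc k :: real)" by simp_all
 show ?case
 proof (cases "b \<inter> {..<k} = b' \<inter> {..<k}")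
  case True
  obtain x where x: "x \<in> b \<longleftrightarrow> x \<notin> b'" using Suc.prems(3) by blast
  then have "x < Suc k" using Suc.prems(1,2) by blast
  moreover have "\<not> x < k" using True x by blast
  ultimately have "x = k" by simp
  with x have "k \<in> b \<longleftrightarrow> k \<notin> b'" by simp
  with True s show ?thesis by (auto simp del: power_Suc)
 next
  case False
  then have "2 / 3 ^ k <= \<bar>cantor_point (b \<inter> {..<k}) - cantor_point (b' \<inter> {..<k})\<bar>"
   by (intro Suc.IH) auto
  with s p show ?thesis by (auto simp del: power_Suc split: if_splits)
 qed
qed simp

lemma cantor_hat_continuous: "continuous_on UNIV (cantor_hat k b)"
 unfolding cantor_hat_def by (intro continuous_intros)

lemma cantor_hat_bounds: "0 <= cantor_hat k b c" "cantor_hat k b c <= 1"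
 by (auto simp: cantor_hat_def)

lemma cantor_hat_eq_1: "cantor_hat k b c = 1 \<longleftrightarrow> c \<in> cantor_interval k b"
proof -
 have "cantor_hat k b c = 1 \<longleftrightarrow> max 0 (max (cantor_point b - c) (c - (cantor_point b + 1 / 3 ^ k))) = 0"
  unfolding cantor_hat_def by (auto simp: max_def)
 also have "\<dots> \<longleftrightarrow> c \<in> cantor_interval k b"
  by (auto simp: cantor_interval_def max_def)
 finally show ?thesis .
qed

lemma cantor_hat_eq_0:
 assumes "b \<subseteq> {..<k}" "b' \<subseteq> {..<k}" "b \<noteq> b'" and c: "c \<in> cantor_interval k b"
 shows "cantor_hat k b' c = 0"
proof -
 have p: "2 / 3 ^ k = 1 / 3 ^ k + (1 / 3 ^ k :: real)" by simp
 have "1 / 3 ^ k <= max 0 (max (cantor_point b' - c) (c - (cantor_point b' + 1 / 3 ^ k)))"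
  using cantor_point_separated[OF assms(1-3)] c p unfolding cantor_interval_def atLeastAtMost_iff by linarith
 then have "1 <= 3 ^ k * max 0 (max (cantor_point b' - c) (c - (cantor_point b' + 1 / 3 ^ k)))"
  by (simp add: divide_le_eq mult.commute)
 then show ?thesis by (simp add: cantor_hat_def)
qed

lemma cantor_step_eq:
 assumes "b \<subseteq> {..<k}" "c \<in> cantor_interval k b"
 shows "cantor_step k s c = s b"
proof -
 have "cantor_step k s c = (\<Sum>b'\<in>Pow {..<k}. if b' = b then s b else 0)"
  unfolding cantor_step_def using cantor_hat_eq_0[OF assms(1) _ _ assms(2)] assms cantor_hat_eq_1
  by (intro sum.cong) auto
 also have "\<dots> = s b" using assms(1) by simp
 finally show ?thesis .
qed

lemma cantor_step_continuous: "continuous_on UNIV (cantor_step k s)"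
 unfolding cantor_step_def by (intro continuous_intros continuous_on_sum cantor_hat_continuous)

lemma cantor_step_bounded: "\<bar>cantor_step k s c\<bar> <= (\<Sum>b\<in>Pow {..<k}. \<bar>s b\<bar>)"
proof -
 have "\<bar>cantor_step k s c\<bar> <= (\<Sum>b\<in>Pow {..<k}. \<bar>s b * cantor_hat k b c\<bar>)"
  unfolding cantor_step_def by (rule sum_abs)
 also have "\<dots> <= (\<Sum>b\<in>Pow {..<k}. \<bar>s b\<bar>)"
  using cantor_hat_bounds by (intro sum_mono) (auto simp: abs_mult intro!: mult_left_le)
 finally show ?thesis .
qed

lemma cantor_interval_unique:
 assumes "b \<subseteq> {..<k}" "b' \<subseteq> {..<k}" "c \<in> cantor_interval k b" "c \<in> cantor_interval k b'"
 shows "b = b'"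
 using cantor_hat_eq_0[of b k b' c] cantor_hat_eq_1[of k b' c] assms by auto

lemma cantor_interval_restrict:
 assumes "b \<subseteq> {..<Suc k}" "c \<in> cantor_interval (Suc k) b"
 shows "c \<in> cantor_interval k (b \<inter> {..<k})"
proof -
 have "1 / 3 ^ k = 3 * (1 / 3 ^ Suc k :: real)" "2 / 3 ^ Suc k = 2 * (1 / 3 ^ Suc k :: real)" "0 <= (1 / 3 ^ Suc k :: real)"
  by simp_all
 then show ?thesis
  using cantor_point_split[OF assms(1)] assms(2)
  unfolding cantor_interval_def atLeastAtMost_iff by (simp del: power_Suc split: if_splits)
qed

text \<open>The digits from \<open>k\<close> on contribute at most the geometric sum
  \<open>1 / 3 ^ k\<close>, the length of the interval.\<close>

lemma cantor_code:
 fixes B :: "nat => bool"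
 shows "(\<Sum>i. (if B i then 2 / 3 ^ Suc i else 0)) \<in> cantor_interval k {i. i < k \<and> B i}"
proof -
 let ?f = "\<lambda>i. (if B i then 2 / 3 ^ Suc i else 0) :: real"
 have g: "(\<lambda>i. 2 / 3 ^ Suc (i + k)) sums (1 / 3 ^ k :: real)"
 proof -
  have "(\<lambda>i. (2 / 3 ^ Suc k) * (1 / 3) ^ i) sums ((2 / 3 ^ Suc k) * (1 / (1 - 1 / 3)) :: real)"
   by (intro sums_mult geometric_sums) simp
  then show ?thesis by (simp add: power_add power_divide mult.commute mult.left_commute)
 qed
 have g0: "summable (\<lambda>i. 2 / 3 ^ Suc i :: real)"
  using g summable_iff_shift[of "\<lambda>i. 2 / 3 ^ Suc i :: real" k] by (auto simp: sums_iff)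
 have f: "summable ?f"
  by (rule summable_comparison_test'[OF g0, of 0]) auto
 have "(\<Sum>i. ?f i) = (\<Sum>i. ?f (i + k)) + (\<Sum>i<k. ?f i)"
  by (rule suminf_split_initial_segment[OF f])
 moreover have "(\<Sum>i<k. ?f i) = cantor_point {i. i < k \<and> B i}"
  unfolding cantor_point_def by (intro sum.mono_neutral_cong_right) auto
 moreover have f': "summable (\<lambda>i. ?f (i + k))" using f summable_iff_shift[of ?f k] by simp
 then have "0 <= (\<Sum>i. ?f (i + k))" by (rule suminf_nonneg) auto
 moreover have "(\<Sum>i. ?f (i + k)) <= (\<Sum>i. 2 / 3 ^ Suc (i + k))"
  using f' g by (intro suminf_le) (auto simp: sums_iff)
 moreover have "(\<Sum>i. 2 / 3 ^ Suc (i + k)) = (1 / 3 ^ k :: real)" using g by (simp add: sums_iff)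
 ultimately show ?thesis unfolding cantor_interval_def atLeastAtMost_iff by linarith
qed

text \<open>The limit is the supremum of the rationals that the sequence eventually exceeds;
  boundedness makes this set nonempty and bounded. A rational slightly above the supremum is not
  eventually exceeded, hence is an eventual upper bound.\<close>

lemma convergent_rational_comparison:
 fixes a :: "nat => real"
 assumes bdd: "eventually (\<lambda>k. \<bar>a k\<bar> <= C) sequentially"
  and cut: "\<And>r :: rat. eventually (\<lambda>k. a k <= of_rat r) sequentially \<or> eventually (\<lambda>k. a k > of_rat r) sequentially"
 shows "convergent a"
proof -
 define S where "S = {x :: real. \<exists>r. x = of_rat r \<and> eventually (\<lambda>k. a k > of_rat r) sequentially}"
 have up: "x <= C" if x: "x \<in> S" for x
 proof -
  have "eventually (\<lambda>k. a k > x) sequentially" using x by (auto simp: S_def)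
  with bdd have "eventually (\<lambda>k. x <= C) sequentially" by eventually_elim auto
  then show ?thesis by simp
 qed
 obtain r where r: "real_of_rat r < - C" using of_rat_dense[of "- C - 1" "- C"] by auto
 have "eventually (\<lambda>k. a k > of_rat r) sequentially" using bdd by eventually_elim (use r in auto)
 then have ne: "of_rat r \<in> S" by (auto simp: S_def)
 have bd: "bdd_above S" using up by (auto simp: bdd_above_def)
 have "a \<longlonglongrightarrow> Sup S"
 proof (rule LIMSEQ_I)
  fix e :: real assume e: "e > 0"
  have "Sup S - e < Sup S" using e by simp
  then obtain x where x: "x \<in> S" "Sup S - e < x" using less_cSup_iff[OF _ bd] ne by blast
  obtain r2 where r2: "Sup S < real_of_rat r2" "real_of_rat r2 < Sup S + e"
   using of_rat_dense[of "Sup S" "Sup S + e"] e by auto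
  have "real_of_rat r2 \<notin> S" using cSup_upper[OF _ bd] r2(1) by force
  then have "\<not> eventually (\<lambda>k. a k > of_rat r2) sequentially" by (auto simp: S_def)
  with cut have "eventually (\<lambda>k. a k <= of_rat r2) sequentially" by blast
  moreover have "eventually (\<lambda>k. a k > x) sequentially" using x by (auto simp: S_def)
  ultimately have "eventually (\<lambda>k. norm (a k - Sup S) < e) sequentially"
   by eventually_elim (use x r2 in \<open>simp add: abs_less_iff\<close>)
  then show "\<exists>no. \<forall>n\<ge>no. norm (a n - Sup S) < e" by (simp add: eventually_sequentially)
 qed
 then show ?thesis by (auto simp: convergent_def)
qed

text \<open>A rational strictly between the limits would eventually be compared differently with the
  two sequences.\<close>

lemma LIMSEQ_rational_comparison_le:
 fixes a a' :: "nat => real"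
 assumes "a \<longlonglongrightarrow> L" "a' \<longlonglongrightarrow> L'"
  and same: "\<And>r :: rat. eventually (\<lambda>k. a k <= of_rat r \<longleftrightarrow> a' k <= of_rat r) sequentially"
 shows "L <= L'"
proof (rule ccontr)
 assume "\<not> ?thesis"
 then obtain r where r: "L' < real_of_rat r" "real_of_rat r < L" using of_rat_dense[of L' L] by auto
 have "eventually (\<lambda>k. False) sequentially"
  using order_tendstoD(1)[OF assms(1) r(2)] order_tendstoD(2)[OF assms(2) r(1)] same[of r]
  by eventually_elim auto
 then show False by simp
qed

lemma LIMSEQ_rational_comparison_eq:
 fixes a a' :: "nat => real"
 assumes "a \<longlonglongrightarrow> L" "a' \<longlonglongrightarrow> L'"
  and same: "\<And>r :: rat. eventually (\<lambda>k. a k <= of_rat r \<longleftrightarrow> a' k <= of_rat r) sequentially"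
 shows "L = L'"
proof (rule antisym)
 show "L <= L'" by (rule LIMSEQ_rational_comparison_le[OF assms])
 show "L' <= L" using same by (intro LIMSEQ_rational_comparison_le[OF assms(2,1)]) (simp add: eq_commute)
qed

text \<open>The values of the functionals \<open>q j\<close> are coded, via the truth values of \<open>q j x <= r\<close> for rational \<open>r\<close>,
 by a point of the Cantor set. Helly's theorem yields a limit of the laws of the codes, and the limit
 point \<open>Y c\<close> is read off a code \<open>c\<close> by compactness.\<close>

theorem subsequential_limit_in_law_exists:
 fixes T :: "'s topology" and q :: "nat => 's => real" and G :: "nat => 's set"
  and M :: "nat => 'a measure" and X :: "nat => 'a => 's"
 assumes prob: "\<And>n. prob_space (M n)"
  and X: "\<And>n. X n \<in> M n \<rightarrow>\<^sub>M borel_of T"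
  and q: "\<And>j. q j \<in> borel_measurable (borel_of T)"
  and bdd: "\<And>j. \<exists>C k. \<forall>x\<in>G k. \<bar>q j x\<bar> <= C"
  and decG: "\<And>k. G (Suc k) \<subseteq> G k" and subG: "G 0 \<subseteq> topspace T"
  and conv: "\<And>x. (\<And>k. x k \<in> G k) ==> (\<And>j. convergent (\<lambda>k. q j (x k))) ==>
   \<exists>y\<in>(\<Inter>k. G k). limitin T x y sequentially \<and> (\<forall>j. (\<lambda>k. q j (x k)) \<longlonglongrightarrow> q j y)"
  and sep: "\<And>x y. x \<in> (\<Inter>k. G k) ==> y \<in> (\<Inter>k. G k) ==> (\<And>j. q j x = q j y) ==> x = y"
  and mass: "\<And>k. \<exists>Z. (\<forall>n. Z n \<in> sets (M n) \<and> {\<omega>\<in>space (M n). X n \<omega> \<notin> G k} \<subseteq> Z n) \<and>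
   (\<lambda>n. measure (M n) (Z n)) \<longlonglongrightarrow> 0"
 shows "\<exists>(N :: 's measure) Y. subsequential_limit_in_law T M X N Y"
proof -
 interpret M: prob_space "M n" for n by (rule prob)
 have antiG: "G l \<subseteq> G k" if "k <= l" for k l
  using decG that by (rule lift_Suc_antimono_le)
 define bit where "bit i x \<longleftrightarrow> q (fst (from_nat i :: nat \<times> rat)) x <= of_rat (snd (from_nat i :: nat \<times> rat))" for i x
 define bits where "bits k x = {i. i < k \<and> bit i x}" for k x
 define code where "code x = (\<Sum>i. (if bit i x then 2 / 3 ^ Suc i else 0) :: real)" for x
 have bits_sub: "bits k x \<subseteq> {..<k}" for k x by (auto simp: bits_def)
 have code_in: "code x \<in> cantor_interval k (bits k x)" for k x
  unfolding code_def bits_def by (rule cantor_code)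
 have step_code: "cantor_step k s (code x) = s (bits k x)" for k s x
  by (rule cantor_step_eq[OF bits_sub code_in])
 have code01: "code x \<in> {0..1}" for x
  using code_in[of x 0] by (simp add: bits_def cantor_interval_def cantor_point_def)
 have code_meas: "code \<in> borel_measurable (borel_of T)"
  unfolding code_def bit_def using q by measurable
 have codeX: "(\<lambda>\<omega>. code (X n \<omega>)) \<in> borel_measurable (M n)" for n
  by (rule measurable_compose[OF X code_meas])
 define \<mu> where "\<mu> n = distr (M n) borel (\<lambda>\<omega>. code (X n \<omega>))" for n
 have rd: "real_distribution (\<mu> n)" for n
  unfolding \<mu>_def by (intro M.real_distribution_distr codeX)
 have "tight \<mu>"
  unfolding tight_def
 proof (intro conjI allI impI rd)
  fix e :: real assume e: "e > 0"
  have "measure (\<mu> n) {-1<..2} = 1" for n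
  proof -
   have "(\<lambda>\<omega>. code (X n \<omega>)) -` {-1<..2} \<inter> space (M n) = space (M n)"
   proof -
    have "-1 < code x \<and> code x <= 2" for x using code01[of x] by simp
    then show ?thesis by auto
   qed
   then show ?thesis
    unfolding \<mu>_def using codeX by (subst measure_distr) (auto simp: M.prob_space)
  qed
  then show "\<exists>a b. a < b \<and> (\<forall>n. 1 - e < measure (\<mu> n) {a<..b})"
   using e by (intro exI[of _ "-1"] exI[of _ 2]) auto
 qed
 from tight_imp_convergent_subsubsequence[OF this, of id] obtain r \<rho> where
  r: "strict_mono r" and \<rho>: "real_distribution \<rho>" and wc: "weak_conv_m (\<mu> \<circ> r) \<rho>"
  by (auto simp: strict_mono_def)
 interpret \<rho>: real_distribution \<rho> by (rule \<rho>)
 have int_conv: "(\<lambda>n. LINT \<omega>|M (r n). g (code (X (r n) \<omega>))) \<longlonglongrightarrow> (LINT c|\<rho>. g c)"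
  if g: "continuous_on UNIV g" "\<And>x. \<bar>g x\<bar> <= C" for g :: "real => real" and C
 proof -
  have "(\<lambda>n. LINT x|\<mu> (r n). g x) \<longlonglongrightarrow> (LINT c|\<rho>. g c)"
   using weak_conv_imp_integral_bdd_continuous_conv[of "\<mu> \<circ> r" \<rho> g C] wc rd \<rho> g
   by (auto simp: continuous_on_eq_continuous_at o_def)
  moreover have "(LINT x|\<mu> n. g x) = (LINT \<omega>|M n. g (code (X n \<omega>)))" for n
   unfolding \<mu>_def using codeX g by (intro integral_distr) (auto intro: borel_measurable_continuous_onI)
  ultimately show ?thesis by simp
 qed
 have step_conv: "(\<lambda>n. LINT \<omega>|M (r n). s (bits k (X (r n) \<omega>))) \<longlonglongrightarrow> (LINT c|\<rho>. cantor_step k s c)" for k s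
  using int_conv[OF cantor_step_continuous cantor_step_bounded, of k s] by (simp add: step_code)
 have meas_cont: "g \<in> borel_measurable \<rho>" if "continuous_on UNIV g" for g :: "real => real"
  using borel_measurable_continuous_onI[OF that] by simp
 have meas_step: "cantor_step k s \<in> borel_measurable \<rho>" for k s
  by (rule meas_cont[OF cantor_step_continuous])
 have step_integrable: "integrable \<rho> (cantor_step k s)" for k s
  using cantor_step_bounded by (intro \<rho>.integrable_const_bound[OF AE_I2 meas_step]) auto
 have bits_meas: "(\<lambda>\<omega>. s (bits k (X n \<omega>)) :: real) \<in> borel_measurable (M n)" for s k n
 proof -
  have "(\<lambda>\<omega>. cantor_step k s (code (X n \<omega>))) \<in> borel_measurable (M n)"
   using codeX borel_measurable_continuous_onI[OF cantor_step_continuous] by (rule measurable_compose)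
  then show ?thesis by (simp add: step_code)
 qed
 have in_C: "AE c in \<rho>. \<exists>b\<in>Pow {..<k}. c \<in> cantor_interval k b" for k
 proof -
  \<comment> \<open>At every code one factor is 0, so the integrals of \<open>g\<close> vanish along
    the sequence and in the limit; thus \<rho> is carried by the intervals of level
    \<open>k\<close>.\<close>
  define g where "g c = (\<Prod>b\<in>Pow {..<k}. 1 - cantor_hat k b c)" for c
  have g: "continuous_on UNIV g"
   unfolding g_def by (intro continuous_intros cantor_hat_continuous)
  have gb: "0 <= g c" "g c <= 1" for c
   unfolding g_def using cantor_hat_bounds by (auto intro!: prod_nonneg prod_le_1)
  have "g (code x) = 0" for x
   unfolding g_def using bits_sub code_in by (intro prod_zero bexI[of _ "bits k x"]) (auto simp: cantor_hat_eq_1)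
  then have "(LINT c|\<rho>. g c) = 0"
   using int_conv[OF g, of 1] gb by (simp add: LIMSEQ_const_iff)
  moreover have "integrable \<rho> g"
   using gb by (intro \<rho>.integrable_const_bound[of _ 1] meas_cont[OF g]) auto
  ultimately have "AE c in \<rho>. g c = 0"
   using gb by (subst (asm) integral_nonneg_eq_0_iff_AE) auto
  then show ?thesis
  proof eventually_elim
   case (elim c)
   then obtain b where "b \<in> Pow {..<k}" "1 - cantor_hat k b c = 0"
    unfolding g_def by (auto simp: prod_zero_iff)
   then show ?case using cantor_hat_eq_1[of k b c] by auto
  qed
 qed
 define cell where "cell k b = {x \<in> G k. bits k x = b}" for k b
 have nonempty: "AE c in \<rho>. \<forall>b\<in>Pow {..<k}. c \<in> cantor_interval k b \<longrightarrow> cell k b \<noteq> {}" for k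
 proof -
  \<comment> \<open>The indicator of the empty cells. A variable in \<open>G k\<close> lies in its
    own cell, so only values outside \<open>G k\<close> contribute, and their probability tends to
    0.\<close>
  define s where "s b = (if cell k b = {} then 1 else 0 :: real)" for b
  obtain Z where Z: "\<And>n. Z n \<in> sets (M n)" "\<And>n. {\<omega>\<in>space (M n). X n \<omega> \<notin> G k} \<subseteq> Z n"
   "(\<lambda>n. measure (M n) (Z n)) \<longlonglongrightarrow> 0"
   using mass[of k] by blast
  have "(LINT \<omega>|M n. s (bits k (X n \<omega>))) <= measure (M n) (Z n)" for n
  proof -
   have "(LINT \<omega>|M n. s (bits k (X n \<omega>))) <= (LINT \<omega>|M n. indicator (Z n) \<omega>)"
   proof (rule integral_mono)
    show "integrable (M n) (\<lambda>\<omega>. s (bits k (X n \<omega>)))"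
     by (intro M.integrable_const_bound[of _ 1] bits_meas AE_I2) (simp add: s_def)
    show "integrable (M n) (\<lambda>\<omega>. indicator (Z n) \<omega> :: real)" using Z(1) by (simp add: M.emeasure_eq_measure)
    fix \<omega> assume \<omega>: "\<omega> \<in> space (M n)"
    show "s (bits k (X n \<omega>)) <= indicator (Z n) \<omega>"
    proof (cases "X n \<omega> \<in> G k")
     case True
     then have "X n \<omega> \<in> cell k (bits k (X n \<omega>))" by (simp add: cell_def)
     then show ?thesis by (auto simp: s_def)
    next
     case False
     then have "\<omega> \<in> Z n" using Z(2) \<omega> by blast
     then show ?thesis by (simp add: s_def)
    qed
   qed
   then show ?thesis using Z(1) by simp
  qed
  then have "(LINT c|\<rho>. cantor_step k s c) <= 0"
   using LIMSEQ_subseq_LIMSEQ[OF Z(3) r] by (intro LIMSEQ_le[OF step_conv]) (auto simp: o_def)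
  moreover have s0: "0 <= cantor_step k s c" for c
   unfolding cantor_step_def using cantor_hat_bounds by (intro sum_nonneg mult_nonneg_nonneg) (auto simp: s_def)
  then have "0 <= (LINT c|\<rho>. cantor_step k s c)" by (intro integral_nonneg_AE) simp
  ultimately have "(LINT c|\<rho>. cantor_step k s c) = 0" by simp
  then have "AE c in \<rho>. cantor_step k s c = 0"
   using s0 step_integrable by (subst (asm) integral_nonneg_eq_0_iff_AE) auto
  then show ?thesis
  proof eventually_elim
   case (elim c)
   show ?case
   proof safe
    fix b assume b: "b \<subseteq> {..<k}" "c \<in> cantor_interval k b" "cell k b = {}"
    then have "cantor_step k s c = 1" using cantor_step_eq[OF b(1,2), of s] by (simp add: s_def)
    with elim show False by simp
   qed
  qed
 qed
 \<comment> \<open>For each \<open>k\<close> some point of \<open>G k\<close> realises the first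
   \<open>k\<close> bits. No single point need have the whole code, which is why limit points are
   obtained from selections below.\<close>
 define \<Gamma> where "\<Gamma> = {c. \<forall>k. \<exists>b\<in>Pow {..<k}. c \<in> cantor_interval k b \<and> cell k b \<noteq> {}}"
 have AE_\<Gamma>: "AE c in \<rho>. c \<in> \<Gamma>"
 proof -
  have "AE c in \<rho>. \<forall>k. (\<exists>b\<in>Pow {..<k}. c \<in> cantor_interval k b) \<and>
    (\<forall>b\<in>Pow {..<k}. c \<in> cantor_interval k b \<longrightarrow> cell k b \<noteq> {})"
   using in_C nonempty by (simp add: AE_all_countable)
  then show ?thesis by eventually_elim (unfold \<Gamma>_def, blast)
 qed
 have \<Gamma>_sets [measurable]: "\<Gamma> \<in> sets borel"
 proof -
  have "\<Gamma> = (\<Inter>k. \<Union>b\<in>{b\<in>Pow {..<k}. cell k b \<noteq> {}}. cantor_interval k b)"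
   unfolding \<Gamma>_def by blast
  also have "\<dots> \<in> sets borel"
   by (intro sets.countable_INT'' sets.finite_UN) (auto simp: cantor_interval_def)
  finally show ?thesis .
 qed
 define pat where "pat k c = (THE b. b \<subseteq> {..<k} \<and> c \<in> cantor_interval k b)" for k c
 have pat: "pat k c \<subseteq> {..<k}" "c \<in> cantor_interval k (pat k c)" "cell k (pat k c) \<noteq> {}" if "c \<in> \<Gamma>" for k c
 proof -
  from that have "\<exists>b\<in>Pow {..<k}. c \<in> cantor_interval k b \<and> cell k b \<noteq> {}"
   unfolding \<Gamma>_def mem_Collect_eq by (rule spec)
  then obtain b where b: "b \<subseteq> {..<k}" "c \<in> cantor_interval k b" "cell k b \<noteq> {}"
   by (elim bexE conjE PowD[elim_format])
  then have "pat k c = b"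
   unfolding pat_def using cantor_interval_unique by (intro the_equality) blast+
  with b show "pat k c \<subseteq> {..<k}" "c \<in> cantor_interval k (pat k c)" "cell k (pat k c) \<noteq> {}" by auto
 qed
 have pat_Suc: "pat (Suc k) c \<inter> {..<k} = pat k c" if "c \<in> \<Gamma>" for k c
  using cantor_interval_restrict[OF pat(1,2)[OF that], of k] pat(1,2)[OF that, of k]
  by (intro cantor_interval_unique) auto
 have pat_mono: "pat (k + m) c \<inter> {..<k} = pat k c" if c: "c \<in> \<Gamma>" for k m c
 proof (induction m)
  case 0
  then show ?case using pat(1)[OF c, of k] by auto
 next
  case (Suc m)
  have "pat (k + Suc m) c \<inter> {..<k} = (pat (Suc (k + m)) c \<inter> {..<k + m}) \<inter> {..<k}" by auto
  also have "\<dots> = pat k c" using Suc pat_Suc[OF c] by simp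
  finally show ?case .
 qed
 have pat_mem: "i \<in> pat k c \<longleftrightarrow> i \<in> pat (Suc i) c" if c: "c \<in> \<Gamma>" "i < k" for i k c
  using pat_mono[OF c(1), of "Suc i" "k - Suc i"] c(2) by auto
 \<comment> \<open>One point in each of the nested cells along a code. Its comparisons with each
   rational are eventually constant, so all functionals converge along it.\<close>
 define selection where "selection c x \<longleftrightarrow> (\<forall>k. x k \<in> cell k (pat k c))" for c and x :: "nat => 's"
 have sel_bit: "bit i (x k) \<longleftrightarrow> i \<in> pat (Suc i) c" if "c \<in> \<Gamma>" "selection c x" "i < k" for c x i k
 proof -
  have "bits k (x k) = pat k c" using that(2) by (auto simp: selection_def cell_def)
  then have "bit i (x k) \<longleftrightarrow> i \<in> pat k c" using that(3) by (auto simp: bits_def)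
  then show ?thesis using pat_mem[OF that(1,3)] by simp
 qed
 have sel_cmp: "(q j (x k) <= of_rat p \<longleftrightarrow> to_nat (j, p) \<in> pat (Suc (to_nat (j, p))) c)"
  if "c \<in> \<Gamma>" "selection c x" "k > to_nat (j, p)" for c x j p k
  using sel_bit[OF that] by (simp add: bit_def)
 have sel_conv: "convergent (\<lambda>k. q j (x k))" if c: "c \<in> \<Gamma>" and x: "selection c x" for c x j
 proof -
  obtain C k where C: "\<forall>x\<in>G k. \<bar>q j x\<bar> <= C" using bdd by blast
  show ?thesis
  proof (rule convergent_rational_comparison)
   show "eventually (\<lambda>k. \<bar>q j (x k)\<bar> <= C) sequentially"
    unfolding eventually_sequentially
   proof (intro exI[of _ k] allI impI)
    fix l assume "k <= l"
    moreover have "x l \<in> G l" using x by (simp add: selection_def cell_def)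
    ultimately have "x l \<in> G k" using antiG by blast
    then show "\<bar>q j (x l)\<bar> <= C" using C by blast
   qed
   fix p :: rat
   show "eventually (\<lambda>k. q j (x k) <= of_rat p) sequentially \<or> eventually (\<lambda>k. of_rat p < q j (x k)) sequentially"
   proof (cases "to_nat (j, p) \<in> pat (Suc (to_nat (j, p))) c")
    case True
    then have "eventually (\<lambda>k. q j (x k) <= of_rat p) sequentially"
     by (intro eventually_mono[OF eventually_gt_at_top[of "to_nat (j, p)"]]) (use sel_cmp[OF c x] in blast)
    then show ?thesis ..
   next
    case False
    then have "eventually (\<lambda>k. \<not> q j (x k) <= of_rat p) sequentially"
     by (intro eventually_mono[OF eventually_gt_at_top[of "to_nat (j, p)"]]) (use sel_cmp[OF c x] in blast)
    then show ?thesis by (simp add: not_le)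
   qed
  qed
 qed
 have sel_G: "x k \<in> G k" if "selection c x" for c x k
  using that by (auto simp: selection_def cell_def)
 define rep where "rep k b = (SOME x. x \<in> cell k b)" for k b
 have sel_rep: "selection c (\<lambda>k. rep k (pat k c))" if "c \<in> \<Gamma>" for c
  unfolding selection_def rep_def by (simp add: some_in_eq pat(3)[OF that])
 have "\<exists>c. c \<in> \<Gamma>"
  using AE_\<Gamma> \<rho>.prob_space \<rho>.AE_False by (metis (mono_tags, lifting) eventually_mono)
 have lim_ex: "\<exists>y\<in>(\<Inter>k. G k). (\<forall>x. selection c x \<longrightarrow> limitin T x y sequentially \<and> (\<forall>j. (\<lambda>k. q j (x k)) \<longlonglongrightarrow> q j y))"
  if c: "c \<in> \<Gamma>" for c
 proof -
  let ?x = "\<lambda>k. rep k (pat k c)"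
  obtain y where y: "y \<in> (\<Inter>k. G k)" "\<And>j. (\<lambda>k. q j (?x k)) \<longlonglongrightarrow> q j y"
   using conv[OF sel_G[OF sel_rep[OF c]] sel_conv[OF c sel_rep[OF c]]] by blast
  \<comment> \<open>Two selections along the same code eventually agree in every rational
    comparison; their functionals have the same limits, and \<open>sep\<close> identifies the limit
    points.\<close>
  have "limitin T x y sequentially \<and> (\<forall>j. (\<lambda>k. q j (x k)) \<longlonglongrightarrow> q j y)" if x: "selection c x" for x
  proof -
   obtain z where z: "z \<in> (\<Inter>k. G k)" "limitin T x z sequentially" "\<And>j. (\<lambda>k. q j (x k)) \<longlonglongrightarrow> q j z"
    using conv[OF sel_G[OF x] sel_conv[OF c x]] by blast
   have "y = z"
   proof (rule sep[OF y(1) z(1)])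
    fix j
    show "q j y = q j z"
    proof (rule LIMSEQ_rational_comparison_eq[OF y(2) z(3)])
     fix p :: rat
     show "eventually (\<lambda>k. (q j (?x k) <= of_rat p) = (q j (x k) <= of_rat p)) sequentially"
      using eventually_gt_at_top[of "to_nat (j, p)"]
      by eventually_elim (simp add: sel_cmp[OF c x] sel_cmp[OF c sel_rep[OF c]])
    qed
   qed
   with z show ?thesis by simp
  qed
  with y(1) show ?thesis by blast
 qed
 obtain Y1 where Y1: "\<And>c. c \<in> \<Gamma> ==> Y1 c \<in> (\<Inter>k. G k)"
  "\<And>c x. c \<in> \<Gamma> ==> selection c x ==> limitin T x (Y1 c) sequentially"
  "\<And>c x j. c \<in> \<Gamma> ==> selection c x ==> (\<lambda>k. q j (x k)) \<longlonglongrightarrow> q j (Y1 c)"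
  using lim_ex by metis
 obtain c0 where c0: "c0 \<in> \<Gamma>" using \<open>\<exists>c. c \<in> \<Gamma>\<close> by blast
 \<comment> \<open>Outside \<Gamma>, a null set for \<rho>, a fixed admissible value is used, so
   that \<open>Y\<close> takes values in all \<open>G k\<close> without exception.\<close>
 define Y where "Y c = (if c \<in> \<Gamma> then Y1 c else Y1 c0)" for c
 have Y_G: "Y c \<in> (\<Inter>k. G k)" for c using Y1(1) c0 by (auto simp: Y_def)
 have Y_top: "Y c \<in> topspace T" for c using Y_G[of c] subG by blast
 have qY [measurable]: "(\<lambda>c. q j (Y c)) \<in> borel_measurable \<rho>" for j
 proof (rule borel_measurable_LIMSEQ_real)
  fix c
  show "(\<lambda>k. if c \<in> \<Gamma> then cantor_step k (\<lambda>b. q j (rep k b)) c else q j (Y1 c0)) \<longlonglongrightarrow> q j (Y c)"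
  proof (cases "c \<in> \<Gamma>")
   case True
   then have "cantor_step k (\<lambda>b. q j (rep k b)) c = q j (rep k (pat k c))" for k
    using cantor_step_eq[OF pat(1,2)] by simp
   with True Y1(3)[OF True sel_rep[OF True]] show ?thesis by (simp add: Y_def)
  qed (simp add: Y_def)
 next
  show "(\<lambda>c. if c \<in> \<Gamma> then cantor_step k (\<lambda>b. q j (rep k b)) c else q j (Y1 c0)) \<in> borel_measurable \<rho>" for k
   by (intro measurable_If_set meas_step) auto
 qed
 have Y_meas: "Y \<in> \<rho> \<rightarrow>\<^sub>M borel_of T"
  unfolding borel_of_def
 proof (rule measurable_sigma_sets[OF sets_measure_of])
  show "{U. openin T U} \<subseteq> Pow (topspace T)" by (auto dest: openin_subset)
  then show "{U. openin T U} \<subseteq> Pow (topspace T)" .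
  show "Y \<in> space \<rho> \<rightarrow> topspace T" using Y_top by auto
  fix U assume "U \<in> {U. openin T U}"
  then have U: "openin T U" by simp
  \<comment> \<open>On the intersection of the \<open>G k\<close>, convergence of all functionals
    forces convergence in \<open>T\<close>. Hence finitely many functionals already isolate a
    neighbourhood inside \<open>U\<close>.\<close>
  have box: "\<exists>K. \<forall>x\<in>(\<Inter>k. G k). (\<forall>j<K. \<bar>q j x - q j y\<bar> < 1 / real (Suc K)) \<longrightarrow> x \<in> U"
   if y: "y \<in> (\<Inter>k. G k)" "y \<in> U" for y
  proof (rule ccontr)
   assume "\<not> ?thesis"
   then have "\<forall>K. \<exists>x\<in>(\<Inter>k. G k). (\<forall>j<K. \<bar>q j x - q j y\<bar> < 1 / real (Suc K)) \<and> x \<notin> U" by blast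
   then obtain x where x: "\<And>K. x K \<in> (\<Inter>k. G k)" "\<And>K j. j < K ==> \<bar>q j (x K) - q j y\<bar> < 1 / real (Suc K)" "\<And>K. x K \<notin> U"
    by metis
   have lim: "(\<lambda>k. q j (x k)) \<longlonglongrightarrow> q j y" for j
   proof (rule LIM_zero_cancel, rule Lim_null_comparison)
    show "eventually (\<lambda>k. norm (q j (x k) - q j y) <= 1 / real (Suc k)) sequentially"
     using eventually_gt_at_top[of j] by eventually_elim (use x(2) in \<open>auto intro: less_imp_le\<close>)
    show "(\<lambda>k. 1 / real (Suc k)) \<longlonglongrightarrow> 0" by (intro LIMSEQ_Suc lim_const_over_n)
   qed
   have "\<exists>z\<in>(\<Inter>k. G k). limitin T x z sequentially \<and> (\<forall>j. (\<lambda>k. q j (x k)) \<longlonglongrightarrow> q j z)"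
    using x(1) lim by (intro conv) (auto simp: convergent_def)
   then obtain z where z: "z \<in> (\<Inter>k. G k)" "limitin T x z sequentially" "\<And>j. (\<lambda>k. q j (x k)) \<longlonglongrightarrow> q j z" by blast
   have "z = y" using LIMSEQ_unique[OF z(3) lim] by (intro sep z y)
   with z(2) U y(2) have "eventually (\<lambda>k. x k \<in> U) sequentially" by (auto simp: limitin_def)
   with x(3) show False by simp
  qed
  then obtain K where K: "\<And>y x. y \<in> (\<Inter>k. G k) ==> y \<in> U ==> x \<in> (\<Inter>k. G k) ==>
    (\<forall>j<K y. \<bar>q j x - q j y\<bar> < 1 / real (Suc (K y))) ==> x \<in> U"
   by metis
  \<comment> \<open>The union of boxes may be uncountable. It is therefore formed in the space of
    real sequences, where it is open and thus Borel, and pulled back by the measurable sequence of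
    functionals.\<close>
  define V where "V = (\<Union>y\<in>(\<Inter>k. G k) \<inter> U. {z :: nat => real. \<forall>j\<in>{..<K y}. \<bar>z j - q j y\<bar> < 1 / real (Suc (K y))})"
  have "open V"
   unfolding V_def
  proof (intro open_UN ballI)
   fix y
   have "{z :: nat => real. \<forall>j\<in>{..<K y}. \<bar>z j - q j y\<bar> < 1 / real (Suc (K y))} =
     (\<Inter>j\<in>{..<K y}. {z. \<bar>z j - q j y\<bar> < 1 / real (Suc (K y))})" by auto
   also have "open \<dots>"
    by (intro open_INT ballI open_Collect_less continuous_intros continuous_on_product_coordinates) auto
   finally show "open {z :: nat => real. \<forall>j\<in>{..<K y}. \<bar>z j - q j y\<bar> < 1 / real (Suc (K y))}" .
  qed
  have Q: "(\<lambda>c j. q j (Y c)) \<in> borel_measurable \<rho>"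
   by (rule measurable_coordinatewise_then_product) (rule qY)
  have "Y -` U \<inter> space \<rho> = (\<lambda>c j. q j (Y c)) -` V \<inter> space \<rho>"
  proof -
   have "Y c \<in> U \<longleftrightarrow> (\<lambda>j. q j (Y c)) \<in> V" for c
   proof
    assume "Y c \<in> U"
    then show "(\<lambda>j. q j (Y c)) \<in> V"
     unfolding V_def using Y_G[of c] by (intro UN_I[of "Y c"]) auto
   next
    assume "(\<lambda>j. q j (Y c)) \<in> V"
    then show "Y c \<in> U"
     unfolding V_def using K[OF _ _ Y_G[of c]] by blast
   qed
   then show ?thesis by auto
  qed
  also have "\<dots> \<in> sets \<rho>" using Q \<open>open V\<close> by (intro measurable_sets) auto
  finally show "Y -` U \<inter> space \<rho> \<in> sets \<rho>" .
 qed
 have upper: "eventually (\<lambda>n. (LINT \<omega>|M (r n). f (X (r n) \<omega>)) < (LINT c|\<rho>. f (Y c)) + e) sequentially"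
  if f: "continuous_map T euclideanreal f" and F: "\<And>x. x \<in> topspace T ==> \<bar>f x\<bar> <= F" and e: "e > 0" for f F e
 proof -
  have F0: "0 <= F" using F[OF Y_top[of 0]] by linarith
  \<comment> \<open>A near maximiser on each cell turns \<open>f\<close> into a step function of the
    code that bounds it from above on \<open>G k\<close>. Along a code these points form a
    selection, so the step functions tend to \<open>f (Y c)\<close>. The lower bound comes from
    \<open>- f\<close>.\<close>
  have "\<exists>u\<in>cell k b. \<forall>x\<in>cell k b. f x <= f u + 1 / real (Suc k)" if ne: "cell k b \<noteq> {}" for k b
  proof (rule ccontr)
   assume no: "\<not> ?thesis"
   have cT: "cell k b \<subseteq> topspace T" using antiG[of 0 k] subG by (auto simp: cell_def)
   then have bd: "bdd_above (f ` cell k b)" using F by (intro bdd_aboveI2[of _ _ F]) (meson abs_le_D1 subsetD)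
   have "(SUP x\<in>cell k b. f x) - 1 / real (Suc k) < (SUP x\<in>cell k b. f x)" by simp
   then obtain u where u: "u \<in> cell k b" "(SUP x\<in>cell k b. f x) - 1 / real (Suc k) < f u"
    using less_cSUP_iff[OF ne bd] by blast
   have "f x <= f u + 1 / real (Suc k)" if "x \<in> cell k b" for x
    using cSUP_upper[OF that bd] u(2) by linarith
   with u(1) no show False by blast
  qed
  then obtain u where u: "\<And>k b. cell k b \<noteq> {} ==> u k b \<in> cell k b"
   "\<And>k b x. x \<in> cell k b ==> f x <= f (u k b) + 1 / real (Suc k)"
   by (metis emptyE)
  define s where "s k b = (if cell k b = {} then 0 else f (u k b))" for k b
  have s_le: "\<bar>s k b\<bar> <= F" for k b
  proof (cases "cell k b = {}")
   case False
   then have "u k b \<in> topspace T" using u(1)[OF False] antiG[of 0 k] subG by (auto simp: cell_def)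
   then show ?thesis using F F0 by (simp add: s_def)
  qed (simp add: s_def F0)
  have s_lim: "(\<lambda>k. LINT c|\<rho>. cantor_step k (s k) c) \<longlonglongrightarrow> (LINT c|\<rho>. f (Y c))"
  proof (rule integral_dominated_convergence[where w="\<lambda>_. F"])
   show "(\<lambda>c. f (Y c)) \<in> borel_measurable \<rho>"
    by (rule measurable_compose[OF Y_meas borel_measurable_continuous_map[OF f]])
   have eq: "cantor_step k (s k) c = f (u k (pat k c))" if "c \<in> \<Gamma>" for k c
    using cantor_step_eq[OF pat(1,2)[OF that]] pat(3)[OF that] by (simp add: s_def)
   show "AE c in \<rho>. (\<lambda>k. cantor_step k (s k) c) \<longlonglongrightarrow> f (Y c)"
    using AE_\<Gamma>
   proof eventually_elim
    case (elim c)
    then have "selection c (\<lambda>k. u k (pat k c))" using u(1) pat(3) by (auto simp: selection_def)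
    from Y1(2)[OF elim this] have "(\<lambda>k. f (u k (pat k c))) \<longlonglongrightarrow> f (Y c)"
     using tendsto_continuous_functional[OF f] elim by (simp add: Y_def)
    then show ?case using eq[OF elim] by simp
   qed
   show "AE c in \<rho>. norm (cantor_step k (s k) c) <= F" for k
    using AE_\<Gamma>
   proof eventually_elim
    case (elim c)
    show ?case using cantor_step_eq[where s="s k" and k=k, OF pat(1,2)[OF elim]] s_le by simp
   qed
  qed (auto intro: meas_step)
  have inv: "(\<lambda>k. 1 / real (Suc k)) \<longlonglongrightarrow> 0" by (intro LIMSEQ_Suc lim_const_over_n)
  obtain k where k: "(LINT c|\<rho>. cantor_step k (s k) c) < (LINT c|\<rho>. f (Y c)) + e / 4" "1 / real (Suc k) < e / 4"
  proof -
   have "eventually (\<lambda>k. (LINT c|\<rho>. cantor_step k (s k) c) < (LINT c|\<rho>. f (Y c)) + e / 4) sequentially"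
    using e by (intro order_tendstoD(2)[OF s_lim]) simp
   moreover have "eventually (\<lambda>k. 1 / real (Suc k) < e / 4) sequentially"
    using e by (intro order_tendstoD(2)[OF inv]) simp
   ultimately have "eventually (\<lambda>k. (LINT c|\<rho>. cantor_step k (s k) c) < (LINT c|\<rho>. f (Y c)) + e / 4 \<and> 1 / real (Suc k) < e / 4) sequentially"
    by eventually_elim auto
   then show ?thesis using that by (auto simp: eventually_sequentially)
  qed
  obtain Z where Z: "\<And>n. Z n \<in> sets (M n)" "\<And>n. {\<omega>\<in>space (M n). X n \<omega> \<notin> G k} \<subseteq> Z n"
   "(\<lambda>n. measure (M n) (Z n)) \<longlonglongrightarrow> 0"
   using mass[of k] by blast
  \<comment> \<open>Outside \<open>G k\<close> both \<open>f\<close> and the step function lie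
    within \<open>F\<close> of 0, whence the factor \<open>2 * F\<close>.\<close>
  have bound: "(LINT \<omega>|M n. f (X n \<omega>)) <= (LINT \<omega>|M n. s k (bits k (X n \<omega>))) + 1 / real (Suc k) + 2 * F * measure (M n) (Z n)" for n
  proof -
   have XT: "X n \<omega> \<in> topspace T" if "\<omega> \<in> space (M n)" for \<omega>
    using measurable_space[OF X that] by simp
   have i1: "integrable (M n) (\<lambda>\<omega>. s k (bits k (X n \<omega>)))"
    using s_le by (intro M.integrable_const_bound[of _ F] bits_meas AE_I2) simp
   have i2: "integrable (M n) (\<lambda>\<omega>. indicator (Z n) \<omega> :: real)" using Z(1) by (simp add: M.emeasure_eq_measure)
   have "(LINT \<omega>|M n. f (X n \<omega>)) <= (LINT \<omega>|M n. s k (bits k (X n \<omega>)) + 1 / real (Suc k) + 2 * F * indicator (Z n) \<omega>)"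
   proof (rule integral_mono)
    show "integrable (M n) (\<lambda>\<omega>. f (X n \<omega>))"
     using F XT by (intro M.integrable_const_bound[of _ F] AE_I2 measurable_compose[OF X borel_measurable_continuous_map[OF f]]) auto
    show "integrable (M n) (\<lambda>\<omega>. s k (bits k (X n \<omega>)) + 1 / real (Suc k) + 2 * F * indicator (Z n) \<omega>)"
     using i1 i2 by (intro Bochner_Integration.integrable_add integrable_mult_right) auto
    fix \<omega> assume \<omega>: "\<omega> \<in> space (M n)"
    show "f (X n \<omega>) <= s k (bits k (X n \<omega>)) + 1 / real (Suc k) + 2 * F * indicator (Z n) \<omega>"
    proof (cases "X n \<omega> \<in> G k")
     case True
     then have x: "X n \<omega> \<in> cell k (bits k (X n \<omega>))" by (simp add: cell_def)
     then have "s k (bits k (X n \<omega>)) = f (u k (bits k (X n \<omega>)))" by (auto simp: s_def)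
     moreover have "0 <= 2 * F * indicator (Z n) \<omega>" using F0 by simp
     ultimately show ?thesis using u(2)[OF x] by linarith
    next
     case False
     then have "\<omega> \<in> Z n" using Z(2) \<omega> by blast
     then have "2 * F * indicator (Z n) \<omega> = 2 * F" by simp
     moreover have "0 <= 1 / real (Suc k)" by simp
     ultimately show ?thesis using F[OF XT[OF \<omega>]] s_le[of k "bits k (X n \<omega>)"] by linarith
    qed
   qed
   also have "\<dots> = (LINT \<omega>|M n. s k (bits k (X n \<omega>))) + 1 / real (Suc k) + 2 * F * measure (M n) (Z n)"
    using i1 i2 Z(1) by (simp add: M.prob_space)
   finally show ?thesis .
  qed
  have "(\<lambda>n. (LINT \<omega>|M (r n). s k (bits k (X (r n) \<omega>))) + 1 / real (Suc k) + 2 * F * measure (M (r n)) (Z (r n)))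
    \<longlonglongrightarrow> (LINT c|\<rho>. cantor_step k (s k) c) + 1 / real (Suc k) + 2 * F * 0"
   using LIMSEQ_subseq_LIMSEQ[OF Z(3) r] by (intro tendsto_intros step_conv) (simp add: o_def)
  moreover have "(LINT c|\<rho>. cantor_step k (s k) c) + 1 / real (Suc k) + 2 * F * 0 < (LINT c|\<rho>. f (Y c)) + e"
   using k e by simp
  ultimately have "eventually (\<lambda>n. (LINT \<omega>|M (r n). s k (bits k (X (r n) \<omega>))) + 1 / real (Suc k) + 2 * F * measure (M (r n)) (Z (r n))
    < (LINT c|\<rho>. f (Y c)) + e) sequentially"
   by (rule order_tendstoD(2))
  then show ?thesis
   by eventually_elim (use bound in \<open>auto intro: le_less_trans\<close>)
 qed
 \<comment> \<open>The law is moved to the state space itself, with the identity as random variable,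
   as the type in the claim requires.\<close>
 define N where "N = distr \<rho> (borel_of T) Y"
 have setsN: "sets N = sets (borel_of T)" by (simp add: N_def)
 have distrN: "distr N (borel_of T) (\<lambda>x. x) = N" by (rule distr_id2) (simp add: setsN)
 have "converges_weakly T (\<lambda>k. distr (M (r k)) (borel_of T) (X (r k))) (distr N (borel_of T) (\<lambda>x. x))"
  unfolding converges_weakly_def distrN
 proof (intro allI impI)
  fix f assume "continuous_map T euclideanreal f \<and> bounded (f ` topspace T)"
  then obtain F where f: "continuous_map T euclideanreal f" and F: "\<And>x. x \<in> topspace T ==> \<bar>f x\<bar> <= F"
   unfolding bounded_iff by auto
  have fm: "f \<in> borel_measurable (borel_of T)" by (rule borel_measurable_continuous_map[OF f])
  have "(\<lambda>n. LINT \<omega>|M (r n). f (X (r n) \<omega>)) \<longlonglongrightarrow> (LINT c|\<rho>. f (Y c))"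
  proof (rule LIMSEQ_I)
   fix e :: real assume e: "e > 0"
   have "continuous_map T euclideanreal (\<lambda>x. - f x)" using continuous_map_minus[OF f] .
   from upper[OF this _ e, of F] F have
    "eventually (\<lambda>n. (LINT \<omega>|M (r n). - f (X (r n) \<omega>)) < (LINT c|\<rho>. - f (Y c)) + e) sequentially" by simp
   moreover have "eventually (\<lambda>n. (LINT \<omega>|M (r n). f (X (r n) \<omega>)) < (LINT c|\<rho>. f (Y c)) + e) sequentially"
    using upper[OF f _ e, of F] F by simp
   ultimately have "eventually (\<lambda>n. norm ((LINT \<omega>|M (r n). f (X (r n) \<omega>)) - (LINT c|\<rho>. f (Y c))) < e) sequentially"
    by eventually_elim (simp add: abs_less_iff)
   then show "\<exists>no. \<forall>n\<ge>no. norm ((LINT \<omega>|M (r n). f (X (r n) \<omega>)) - (LINT c|\<rho>. f (Y c))) < e"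
    by (simp add: eventually_sequentially)
  qed
  then show "(\<lambda>n. LINT x|distr (M (r n)) (borel_of T) (X (r n)). f x) \<longlonglongrightarrow> (LINT x|N. f x)"
   unfolding N_def by (simp add: integral_distr[OF X fm] integral_distr[OF Y_meas fm])
 qed
 moreover have "prob_space N" unfolding N_def by (rule \<rho>.prob_space_distr[OF Y_meas])
 moreover have "(\<lambda>x. x) \<in> N \<rightarrow>\<^sub>M borel_of T" by (rule measurable_ident_sets[OF setsN])
 ultimately show ?thesis
  unfolding subsequential_limit_in_law_def using r by blast
qed


section \<open>Regular paths and their compactness\<close>

text \<open>The bounds are only eventual because the path with index \<open>k\<close> obeys the
  bounds for horizon \<open>T\<close> only from \<open>k >= T\<close> on.\<close>

definition uniformly_tight :: "(nat => real measure) => bool" where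
 "uniformly_tight X \<longleftrightarrow> (\<exists>A B. eventually (\<lambda>k. X k \<in> moment_measures \<and> measure (X k) {0..} <= A \<and> (LINT x|X k. x) <= B) sequentially) \<and>
  (\<forall>e>0. \<exists>R>0. eventually (\<lambda>k. (LINT x|X k. tail_weight R x) <= e) sequentially)"

lemma uniformly_tight_offset:
 assumes "uniformly_tight X"
 obtains N A B where "\<And>k. X (k + N) \<in> moment_measures" "\<And>k. measure (X (k + N)) {0..} <= A"
  "\<And>k. (\<integral>x. x \<partial>X (k + N)) <= B"
  "\<And>e. e > 0 ==> \<exists>R>0. eventually (\<lambda>k. (\<integral>x. tail_weight R x \<partial>X (k + N)) <= e) sequentially"
proof -
 obtain A B N where N: "\<And>k. k >= N ==> X k \<in> moment_measures \<and> measure (X k) {0..} <= A \<and> (LINT x|X k. x) <= B"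
  using assms unfolding uniformly_tight_def eventually_sequentially by blast
 have "\<exists>R>0. eventually (\<lambda>k. (\<integral>x. tail_weight R x \<partial>X (k + N)) <= e) sequentially" if e: "e > 0" for e
 proof -
  obtain R where R: "R > 0" "eventually (\<lambda>k. (LINT x|X k. tail_weight R x) <= e) sequentially"
   using assms e unfolding uniformly_tight_def by blast
  have "eventually (\<lambda>k. (\<integral>x. tail_weight R x \<partial>X (k + N)) <= e) sequentially"
   using R(2) by (rule sequentially_offset)
  with R(1) show ?thesis by blast
 qed
 then show ?thesis using N by (intro that[of N A B]) auto
qed

lemma uniformly_tight_ramp_convergence:
 assumes X: "uniformly_tight X" and \<nu>: "\<nu> \<in> moment_measures"
  and ramps: "\<And>i. (\<lambda>k. LINT x|X k. ramp i x) \<longlonglongrightarrow> (LINT x|\<nu>. ramp i x)"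
 shows "limitin weak_topology X \<nu> sequentially"
proof -
 obtain N A B where N: "\<And>k. X (k + N) \<in> moment_measures" "\<And>k. measure (X (k + N)) {0..} <= A"
  "\<And>k. (\<integral>x. x \<partial>X (k + N)) <= B"
  "\<And>e. e > 0 ==> \<exists>R>0. eventually (\<lambda>k. (\<integral>x. tail_weight R x \<partial>X (k + N)) <= e) sequentially"
  using uniformly_tight_offset[OF X] by blast
 have "limitin weak_topology (\<lambda>k. X (k + N)) \<nu> sequentially"
  using moment_measures_ramp_convergence[where X="\<lambda>k. X (k + N)", OF N \<nu>] ramps LIMSEQ_ignore_initial_segment[OF ramps] by blast
 then show ?thesis by (rule limitin_sequentially_offset_rev)
qed

lemma uniformly_tight_ramp_convergent:
 assumes X: "uniformly_tight X"
  and ramps: "\<And>i. convergent (\<lambda>k. LINT x|X k. ramp i x)"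
 shows "\<exists>\<nu>. limitin weak_topology X \<nu> sequentially"
proof -
 obtain N A B where N: "\<And>k. X (k + N) \<in> moment_measures" "\<And>k. measure (X (k + N)) {0..} <= A"
  "\<And>k. (\<integral>x. x \<partial>X (k + N)) <= B"
  "\<And>e. e > 0 ==> \<exists>R>0. eventually (\<lambda>k. (\<integral>x. tail_weight R x \<partial>X (k + N)) <= e) sequentially"
  using uniformly_tight_offset[OF X] by blast
 have "convergent (\<lambda>k. \<integral>x. ramp i x \<partial>X (k + N))" for i
  using ramps[of i] LIMSEQ_ignore_initial_segment unfolding convergent_def by blast
 then have "\<exists>\<nu>. limitin weak_topology (\<lambda>k. X (k + N)) \<nu> sequentially"
  using N(4) by (intro moment_measures_ramp_convergent[where A=A and B=B, OF N(1) N(2) N(3)])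
 then obtain \<nu> where "limitin weak_topology (\<lambda>k. X (k + N)) \<nu> sequentially" by blast
 from limitin_sequentially_offset_rev[OF this] show ?thesis by blast
qed

lemma measure_Ici_eq_ramp: "\<nu> \<in> moment_measures ==> measure \<nu> {0..} = (LINT x|\<nu>. ramp (-1, 1) x)"
proof -
 assume \<nu>: "\<nu> \<in> moment_measures"
 have "(LINT x|\<nu>. ramp (-1, 1) x) = (LINT x|\<nu>. 1)"
  by (intro Bochner_Integration.integral_cong) (auto simp: space_moment_measure[OF \<nu>] ramp_one simp del: One_nat_def)
 then show ?thesis by (simp add: space_moment_measure[OF \<nu>])
qed

lemma ramp_integral_bounds:
 assumes \<nu>: "\<nu> \<in> moment_measures"
 shows "\<bar>LINT x|\<nu>. ramp i x\<bar> <= measure \<nu> {0..}"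
proof -
 interpret finite_measure \<nu> using finite_moment_measure[OF \<nu>] .
 have "\<bar>LINT x|\<nu>. ramp i x\<bar> <= (LINT x|\<nu>. 1)"
  using ramp_bounds by (intro abs_integral_le integrable_bounded_continuous(1)[OF \<nu> ramp_bounded_continuous]) auto
 then show ?thesis by (simp add: space_moment_measure[OF \<nu>])
qed

text \<open>The set of index \<open>k\<close> imposes only the conditions with indices up to
  \<open>k\<close>, so its complement is covered by finitely many bad events. The term
  \<open>1 / (k + 1)\<close> leaves room for the jumps of the processes; it disappears in the
  intersection over \<open>k\<close>, where ramp integrals are locally Lipschitz in time.\<close>

definition regular_paths ::
 "(nat => real) => real => (nat => nat => real) => (nat => rat \<times> nat => real) => nat => (real => real measure) set" where
 "regular_paths A B \<tau> C k = {x \<in> cadlag weak_topology. \<forall>T\<le>k. \<forall>t\<in>{0..real T}.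
  measure (x t) {0..} <= A T \<and> (LINT z|x t. z) <= B \<and>
  (\<forall>R\<le>k. (LINT z|x t. tail_weight (real (Suc R)) z) <= \<tau> T R) \<and>
  (\<forall>i. to_nat i <= k \<longrightarrow> (\<forall>s\<in>{0..real T}. \<bar>(LINT z|x s. ramp i z) - (LINT z|x t. ramp i z)\<bar>
    <= C T i * (\<bar>s - t\<bar> + 1 / real (Suc k))))}"

text \<open>A countable family of evaluations, one for each rational time and ramp. The absolute
  value lets every rational denote an admissible time.\<close>

definition rational_evaluation :: "nat => (real => real measure) => real" where
 "rational_evaluation j x = (let (s :: rat, i) = from_nat j in \<integral>z. ramp i z \<partial>x \<bar>of_rat s\<bar>)"

lemma rational_evaluation_to_nat:
 "rational_evaluation (to_nat (s :: rat, i :: rat \<times> nat)) x = (LINT z|x \<bar>of_rat s\<bar>. ramp i z)"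
 by (simp add: rational_evaluation_def)

lemma rational_evaluation_measurable:
 "rational_evaluation j \<in> borel_measurable (borel_of (skorohod_topology weak_topology))"
proof -
 obtain s :: rat and i :: "rat \<times> nat" where j: "from_nat j = (s, i)"
  by (cases "from_nat j :: rat \<times> (rat \<times> nat)") auto
 show ?thesis
  unfolding rational_evaluation_def j
  using borel_measurable_evaluation[OF continuous_map_weak_integral(1)[OF ramp_bounded_continuous], of "\<bar>of_rat s\<bar>" i] by simp
qed

lemma regular_paths_decreasing:
 assumes C: "\<And>T i. C T i >= 0"
 shows "regular_paths A B \<tau> C (Suc k) \<subseteq> regular_paths A B \<tau> C k"
proof
 fix x assume x: "x \<in> regular_paths A B \<tau> C (Suc k)"
 have le: "C T i * (\<bar>s - t\<bar> + 1 / real (Suc (Suc k))) <= C T i * (\<bar>s - t\<bar> + 1 / real (Suc k))" for T i s t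
  using C by (intro mult_left_mono add_left_mono divide_left_mono) auto
 show "x \<in> regular_paths A B \<tau> C k"
  unfolding regular_paths_def mem_Collect_eq
 proof (intro conjI allI impI ballI)
  fix T t s and i :: "rat \<times> nat" assume "T <= k" "t \<in> {0..real T}" "to_nat i <= k" "s \<in> {0..real T}"
  with x have "\<bar>(LINT z|x s. ramp i z) - (LINT z|x t. ramp i z)\<bar> <= C T i * (\<bar>s - t\<bar> + 1 / real (Suc (Suc k)))"
   unfolding regular_paths_def mem_Collect_eq by (meson le_SucI)
  then show "\<bar>(LINT z|x s. ramp i z) - (LINT z|x t. ramp i z)\<bar> <= C T i * (\<bar>s - t\<bar> + 1 / real (Suc k))"
   using le order_trans by blast
 qed (use x in \<open>auto simp: regular_paths_def\<close>)
qed

lemma regular_paths_bounded: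
 "\<exists>K k. \<forall>x\<in>regular_paths A B \<tau> C k. \<bar>rational_evaluation j x\<bar> <= K"
proof -
 obtain s :: rat and i :: "rat \<times> nat" where j: "from_nat j = (s, i)"
  by (cases "from_nat j :: rat \<times> (rat \<times> nat)") auto
 obtain T :: nat where T: "\<bar>real_of_rat s\<bar> <= real T" using real_arch_simple by blast
 have "\<bar>rational_evaluation j x\<bar> <= A T" if x: "x \<in> regular_paths A B \<tau> C T" for x
 proof -
  have "x \<bar>of_rat s\<bar> \<in> moment_measures"
   using x cadlag_topspace[of x weak_topology "\<bar>of_rat s\<bar>"] by (simp add: regular_paths_def)
  then have "\<bar>LINT z|x \<bar>of_rat s\<bar>. ramp i z\<bar> <= measure (x \<bar>of_rat s\<bar>) {0..}"
   by (rule ramp_integral_bounds)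
  also have "\<dots> <= A T" using x T unfolding regular_paths_def by auto
  finally show ?thesis by (simp add: rational_evaluation_def j)
 qed
 then show ?thesis by blast
qed

text \<open>Right continuity recovers the ramp integrals at any time from later rational times, and
  these integrals determine the measure. At negative times both paths are
  \<open>undefined\<close>.\<close>

lemma cadlag_weak_eqI:
 assumes x: "x \<in> cadlag weak_topology" and y: "y \<in> cadlag weak_topology"
  and eq: "\<And>j. rational_evaluation j x = rational_evaluation j y"
 shows "x = y"
proof
 fix t
 show "x t = y t"
 proof (cases "t >= 0")
  case True
  have "(LINT z|x t. ramp i z) = (LINT z|y t. ramp i z)" for i
  proof -
   note cm = continuous_map_weak_integral(1)[OF ramp_bounded_continuous, of i]
   have "\<exists>s. t < real_of_rat s \<and> real_of_rat s < t + 1 / real (Suc n)" for n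
    by (rule of_rat_dense) simp
   then obtain s where s: "\<And>n. t < real_of_rat (s n)" "\<And>n. real_of_rat (s n) < t + 1 / real (Suc n)" by metis
   have "(\<lambda>n. 1 / real (Suc n)) \<longlonglongrightarrow> 0" by (intro LIMSEQ_Suc lim_const_over_n)
   from tendsto_add[OF tendsto_const[of t] this] have "(\<lambda>n. t + 1 / real (Suc n)) \<longlonglongrightarrow> t" by simp
   from tendsto_sandwich[OF _ _ tendsto_const this, of "\<lambda>n. real_of_rat (s n)"] s
   have "(\<lambda>n. real_of_rat (s n)) \<longlonglongrightarrow> t" by (auto intro: less_imp_le always_eventually)
   then have lim: "filterlim (\<lambda>n. real_of_rat (s n)) (at_right t) sequentially"
    using s(1) by (auto simp: filterlim_at intro: always_eventually)
   have "(\<lambda>n. LINT z|x (of_rat (s n)). ramp i z) \<longlonglongrightarrow> (LINT z|x t. ramp i z)"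
    "(\<lambda>n. LINT z|y (of_rat (s n)). ramp i z) \<longlonglongrightarrow> (LINT z|y t. ramp i z)"
    using filterlim_compose[OF rcll_right[OF rcll_cadlag[OF x cm] True] lim]
     filterlim_compose[OF rcll_right[OF rcll_cadlag[OF y cm] True] lim] by auto
   moreover have "(LINT z|x (of_rat (s n)). ramp i z) = (LINT z|y (of_rat (s n)). ramp i z)" for n
   proof -
    have "\<bar>real_of_rat (s n)\<bar> = of_rat (s n)" using s(1)[of n] True by linarith
    then show ?thesis using eq[of "to_nat (s n, i)"] unfolding rational_evaluation_to_nat by (simp only:)
   qed
   ultimately show ?thesis using LIMSEQ_unique by auto
  qed
  then show ?thesis
   using cadlag_topspace[OF x True] cadlag_topspace[OF y True] by (intro moment_measures_eqI) auto
 next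
  case False
  then show ?thesis using x y by (auto simp: cadlag_def PiE_def extensional_def)
 qed
qed

lemma limitin_at_rightI:
 fixes y :: "real => 's"
 assumes l: "l \<in> topspace E"
  and seq: "\<And>u. (\<And>n. t < u n) ==> (\<And>n. u n < b) ==> u \<longlonglongrightarrow> t ==> limitin E (\<lambda>n. y (u n)) l sequentially" and "t < b"
 shows "limitin E y l (at_right t)"
 unfolding limitin_def
proof (intro conjI l allI impI)
 fix U assume U: "openin E U \<and> l \<in> U"
 show "eventually (\<lambda>s. y s \<in> U) (at_right t)"
  using \<open>t < b\<close>
 proof (rule sequentially_imp_eventually_at_right)
  fix u assume "\<And>n. t < u n" "\<And>n. u n < b" "u \<longlonglongrightarrow> t"
  from seq[OF this] U show "eventually (\<lambda>n. y (u n) \<in> U) sequentially" by (auto simp: limitin_def)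
 qed
qed

lemma limitin_at_leftI:
 fixes y :: "real => 's"
 assumes l: "l \<in> topspace E"
  and seq: "\<And>u. (\<And>n. u n < t) ==> (\<And>n. b < u n) ==> u \<longlonglongrightarrow> t ==> limitin E (\<lambda>n. y (u n)) l sequentially" and "b < t"
 shows "limitin E y l (at_left t)"
 unfolding limitin_def
proof (intro conjI l allI impI)
 fix U assume U: "openin E U \<and> l \<in> U"
 show "eventually (\<lambda>s. y s \<in> U) (at_left t)"
  using \<open>b < t\<close>
 proof (rule sequentially_imp_eventually_at_left)
  fix u assume "\<And>n. b < u n" "\<And>n. u n < t" "u \<longlonglongrightarrow> t"
  from seq[OF this(2,1,3)] U
  show "eventually (\<lambda>n. y (u n) \<in> U) sequentially" by (auto simp: limitin_def)
 qed
qed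

text \<open>With the identity as time change, and only finitely many functionals in each
  neighbourhood, locally uniform convergence of each continuous functional is enough.\<close>

lemma limitin_skorohod_uniform:
 assumes x: "\<And>k. x k \<in> cadlag E" and y: "y \<in> cadlag E"
  and unif: "\<And>f T d. continuous_map E euclideanreal f ==> d > 0 ==>
   eventually (\<lambda>k. \<forall>t\<in>{0..T}. \<bar>f (x k t) - f (y t)\<bar> < d) sequentially"
 shows "limitin (skorohod_topology E) x y sequentially"
 unfolding limitin_def
proof (intro conjI allI impI)
 show "y \<in> topspace (skorohod_topology E)" using y by simp
 fix U assume "openin (skorohod_topology E) U \<and> y \<in> U"
 then obtain F T d where F: "finite F" "\<forall>f\<in>F. continuous_map E euclideanreal f" "T > 0" "d > 0"
  "skorohod_nbhd E F T d y \<subseteq> U"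
  unfolding openin_skorohod_topology skorohod_open_def by blast
 have id: "(\<lambda>t. t) \<in> time_changes" by (auto simp: time_changes_def strict_mono_on_def)
 have "eventually (\<lambda>k. \<forall>f\<in>F. \<forall>t\<in>{0..T}. \<bar>f (x k t) - f (y t)\<bar> < d) sequentially"
  using F unif by (intro eventually_ball_finite) auto
 then show "eventually (\<lambda>k. x k \<in> U) sequentially"
 proof eventually_elim
  case (elim k)
  then have "x k \<in> skorohod_nbhd E F T d y"
   unfolding skorohod_nbhd_def using x id F(4) by (auto intro!: bexI[OF _ id])
  then show ?case using F(5) by blast
 qed
qed

text \<open>An Arzela-Ascoli argument: convergence at rational times spreads to all times through
  the approximate Lipschitz bound, tightness turns convergent ramp integrals into weak limits, and
  the limit path inherits all bounds by weak continuity.\<close>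

lemma regular_paths_compactness:
 assumes C: "\<And>T i. C T i >= 0" and \<tau>: "\<And>T. (\<lambda>R. \<tau> T R) \<longlonglongrightarrow> 0"
  and x: "\<And>k. x k \<in> regular_paths A B \<tau> C k"
  and cvg: "\<And>j. convergent (\<lambda>k. rational_evaluation j (x k))"
 shows "\<exists>y\<in>(\<Inter>k. regular_paths A B \<tau> C k). limitin (skorohod_topology weak_topology) x y sequentially \<and>
  (\<forall>j. (\<lambda>k. rational_evaluation j (x k)) \<longlonglongrightarrow> rational_evaluation j y)"
proof -
 have xc: "x k \<in> cadlag weak_topology" for k using x[of k] by (simp add: regular_paths_def)
 have xm: "x k t \<in> moment_measures" if "t >= 0" for k t using cadlag_topspace[OF xc that] by simp
 have xb: "measure (x k t) {0..} <= A T" "(LINT z|x k t. z) <= B"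
  "R <= k ==> (LINT z|x k t. tail_weight (real (Suc R)) z) <= \<tau> T R"
  if "T <= k" "0 <= t" "t <= real T" for k T t R
  using x[of k] that unfolding regular_paths_def by auto
 have xmod: "\<bar>(LINT z|x k s. ramp i z) - (LINT z|x k t. ramp i z)\<bar> <= C T i * (\<bar>s - t\<bar> + 1 / real (Suc k))"
  if "T <= k" "to_nat i <= k" "0 <= t" "t <= real T" "0 <= s" "s <= real T" for k T i s t
 proof -
  show ?thesis
   using x[of k] that unfolding regular_paths_def mem_Collect_eq by (meson atLeastAtMost_iff)
 qed
 have inv: "(\<lambda>k. 1 / real (Suc k)) \<longlonglongrightarrow> 0" by (intro LIMSEQ_Suc lim_const_over_n)
 have tight: "uniformly_tight (\<lambda>k. x (r k) (u k))"
  if r: "filterlim r sequentially sequentially" and u: "\<And>k. 0 <= u k" "\<And>k. u k <= real T" for r u T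
  unfolding uniformly_tight_def
 proof (intro conjI allI impI)
  have "eventually (\<lambda>k. T <= r k) sequentially"
   using r by (simp add: filterlim_at_top)
  then have "eventually (\<lambda>k. x (r k) (u k) \<in> moment_measures \<and> measure (x (r k) (u k)) {0..} <= A T \<and> (LINT z|x (r k) (u k). z) <= B) sequentially"
   by eventually_elim (use xm xb u in auto)
  then show "\<exists>A B. eventually (\<lambda>k. x (r k) (u k) \<in> moment_measures \<and> measure (x (r k) (u k)) {0..} <= A \<and> (LINT z|x (r k) (u k). z) <= B) sequentially"
   by blast
  fix e :: real assume "e > 0"
  then obtain R where R: "\<tau> T R < e"
   using order_tendstoD(2)[OF \<tau>[of T]] by (auto simp: eventually_sequentially)
  have "eventually (\<lambda>k. max T R <= r k) sequentially"
   using r by (simp only: filterlim_at_top)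
  then have "eventually (\<lambda>k. (LINT z|x (r k) (u k). tail_weight (real (Suc R)) z) <= e) sequentially"
  proof eventually_elim
   case (elim k)
   then show ?case using xb(3)[of T "r k" "u k" R] u R by simp
  qed
  then show "\<exists>R>0. eventually (\<lambda>k. (LINT z|x (r k) (u k). tail_weight R z) <= e) sequentially"
   by (intro exI[of _ "real (Suc R)"]) simp
 qed
 have ex: "\<exists>\<nu>. limitin weak_topology (\<lambda>k. x k t) \<nu> sequentially" if t: "t >= 0" for t
 proof -
  obtain T :: nat where T: "t + 1 <= real T" using real_arch_simple by blast
  show ?thesis
  proof (rule uniformly_tight_ramp_convergent)
   show "uniformly_tight (\<lambda>k. x k t)"
    using tight[of "\<lambda>k. k" "\<lambda>_. t" T] t T by (simp add: filterlim_ident)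
   fix i
   have "Cauchy (\<lambda>k. LINT z|x k t. ramp i z)"
   proof (rule metric_CauchyI)
    fix e :: real assume e: "e > 0"
    \<comment> \<open>The summand 1 avoids a division by 0 when the Lipschitz constant
      vanishes.\<close>
    define c where "c = C T i + 1"
    have c: "c > 0" "C T i <= c" using C[of T i] by (auto simp: c_def)
    \<comment> \<open>A rational time close after \<open>t\<close>. Passing from \<open>t\<close> to
      it costs \<open>e / 4\<close> at each of two indices, and the Cauchy property at the rational
      time costs another \<open>e / 4\<close>.\<close>
    obtain s where s: "t < real_of_rat s" "real_of_rat s < t + min 1 (e / (8 * c))"
     using of_rat_dense[of t "t + min 1 (e / (8 * c))"] e c by auto
    obtain N1 where N1: "1 / real (Suc N1) < e / (8 * c)"
     using nat_approx_posE[of "e / (8 * c)"] e c by auto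
    have "Cauchy (\<lambda>k. LINT z|x k (of_rat s). ramp i z)"
    proof -
     have "\<bar>real_of_rat s\<bar> = of_rat s" using s t by linarith
     then show ?thesis
      using cvg[of "to_nat (s, i)"] unfolding rational_evaluation_to_nat Cauchy_convergent_iff by (simp only:)
    qed
    then obtain N2 where N2: "\<And>m n. m >= N2 ==> n >= N2 ==> \<bar>(LINT z|x m (of_rat s). ramp i z) - (LINT z|x n (of_rat s). ramp i z)\<bar> < e / 4"
     using metric_CauchyD[of "\<lambda>k. \<integral>z. ramp i z \<partial>x k (of_rat s)" "e / 4"] e unfolding dist_real_def by auto
    define N where "N = max (max N1 N2) (max T (to_nat i))"
    have near: "\<bar>(LINT z|x k (of_rat s). ramp i z) - (LINT z|x k t. ramp i z)\<bar> <= e / 4" if "k >= N" for k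
    proof -
     have k: "T <= k" "to_nat i <= k" "N1 <= k" using that by (auto simp: N_def)
     have "1 / real (Suc k) <= 1 / real (Suc N1)" using k by (intro divide_left_mono) auto
     then have "\<bar>of_rat s - t\<bar> + 1 / real (Suc k) <= e / (4 * c)" using s N1 by simp
     then have "C T i * (\<bar>of_rat s - t\<bar> + 1 / real (Suc k)) <= c * (e / (4 * c))"
      using c by (intro mult_mono) auto
     also have "\<dots> = e / 4" using c by simp
     finally have le: "C T i * (\<bar>of_rat s - t\<bar> + 1 / real (Suc k)) <= e / 4" .
     have "t <= real T" "0 <= real_of_rat s" "real_of_rat s <= real T" using s t T by linarith+
     from order_trans[OF xmod[OF k(1,2) t this] le] show ?thesis .
    qed
    have "dist (LINT z|x m t. ramp i z) (LINT z|x n t. ramp i z) < e" if "m >= N" "n >= N" for m n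
     using near[OF that(1)] near[OF that(2)] N2[of m n] that unfolding dist_real_def N_def by linarith
    then show "\<exists>M. \<forall>m\<ge>M. \<forall>n\<ge>M. dist (LINT z|x m t. ramp i z) (LINT z|x n t. ramp i z) < e" by blast
   qed
   then show "convergent (\<lambda>k. LINT z|x k t. ramp i z)" by (simp add: Cauchy_convergent_iff)
  qed
 qed
 then obtain y0 where y0: "\<And>t. t >= 0 ==> limitin weak_topology (\<lambda>k. x k t) (y0 t) sequentially" by metis
 define y where "y t = (if t >= 0 then y0 t else undefined)" for t
 have ylim: "limitin weak_topology (\<lambda>k. x k t) (y t) sequentially" if "t >= 0" for t
  using y0[OF that] that by (simp add: y_def)
 have ym: "y t \<in> moment_measures" if "t >= 0" for t
  using limitin_topspace[OF ylim[OF that]] by simp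
 have yconv: "(\<lambda>k. f (x k t)) \<longlonglongrightarrow> f (y t)" if "continuous_map weak_topology euclideanreal f" "t >= 0" for f t
  using tendsto_continuous_functional[OF that(1) ylim[OF that(2)]] .
 note cramp = continuous_map_weak_integral(1)[OF ramp_bounded_continuous]
 have yb: "measure (y t) {0..} <= A T" "(LINT z|y t. z) <= B" "(LINT z|y t. tail_weight (real (Suc R)) z) <= \<tau> T R"
  if t: "0 <= t" "t <= real T" for t T R
 proof -
  have "(LINT z|y t. ramp (-1, 1) z) <= A T"
   using xb(1)[OF _ t] xm[OF t(1)] by (intro LIMSEQ_le_const2[OF yconv[OF cramp t(1)]] exI[of _ T]) (simp add: measure_Ici_eq_ramp)
  then show "measure (y t) {0..} <= A T" by (simp add: measure_Ici_eq_ramp[OF ym[OF t(1)]])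
  show "(LINT z|y t. z) <= B"
   using xb(2)[OF _ t] by (intro LIMSEQ_le_const2[OF yconv[OF continuous_map_weak_moment t(1)]] exI[of _ T]) simp
  show "(LINT z|y t. tail_weight (real (Suc R)) z) <= \<tau> T R"
   using xb(3)[OF _ t] by (intro LIMSEQ_le_const2[OF yconv[OF continuous_map_weak_tail_weight t(1)]] exI[of _ "max T R"]) auto
 qed
 have ymod: "\<bar>(LINT z|y s. ramp i z) - (LINT z|y t. ramp i z)\<bar> <= C T i * \<bar>s - t\<bar>"
  if st: "0 <= s" "s <= real T" "0 <= t" "t <= real T" for s t T i
 proof (rule LIMSEQ_le)
  show "(\<lambda>k. \<bar>(LINT z|x k s. ramp i z) - (LINT z|x k t. ramp i z)\<bar>) \<longlonglongrightarrow> \<bar>(LINT z|y s. ramp i z) - (LINT z|y t. ramp i z)\<bar>"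
   using st by (intro tendsto_intros yconv[OF cramp])
  have "(\<lambda>k. C T i * (\<bar>s - t\<bar> + 1 / real (Suc k))) \<longlonglongrightarrow> C T i * (\<bar>s - t\<bar> + 0)"
   by (intro tendsto_intros inv)
  then show "(\<lambda>k. C T i * (\<bar>s - t\<bar> + 1 / real (Suc k))) \<longlonglongrightarrow> C T i * \<bar>s - t\<bar>" by simp
  show "\<exists>N. \<forall>k\<ge>N. \<bar>(LINT z|x k s. ramp i z) - (LINT z|x k t. ramp i z)\<bar> <= C T i * (\<bar>s - t\<bar> + 1 / real (Suc k))"
   using xmod st by (intro exI[of _ "max T (to_nat i)"]) auto
 qed
 \<comment> \<open>Convergence along moving times, needed because the worst time for uniform
   convergence varies with \<open>k\<close>.\<close>
 have joint: "limitin weak_topology (\<lambda>k. x (r k) (u k)) (y t) sequentially"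
  if r: "filterlim r sequentially sequentially" and u: "\<And>k. 0 <= u k" "\<And>k. u k <= real T" "u \<longlonglongrightarrow> t" for r u T t
 proof (rule uniformly_tight_ramp_convergence)
  have t: "0 <= t" "t <= real T"
   using LIMSEQ_le_const[OF u(3)] LIMSEQ_le_const2[OF u(3)] u(1,2) by auto
  show "uniformly_tight (\<lambda>k. x (r k) (u k))" by (rule tight[OF r u(1,2)])
  show "y t \<in> moment_measures" by (rule ym[OF t(1)])
  fix i
  have 1: "(\<lambda>k. LINT z|x (r k) t. ramp i z) \<longlonglongrightarrow> (LINT z|y t. ramp i z)"
   using filterlim_compose[OF yconv[OF cramp t(1)] r] .
  have "(\<lambda>k. C T i * (\<bar>u k - t\<bar> + 1 / real (Suc (r k)))) \<longlonglongrightarrow> C T i * (\<bar>t - t\<bar> + 0)"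
   by (intro tendsto_intros u(3) filterlim_compose[OF inv r])
  then have 2: "(\<lambda>k. C T i * (\<bar>u k - t\<bar> + 1 / real (Suc (r k)))) \<longlonglongrightarrow> 0" by simp
  have "eventually (\<lambda>k. max T (to_nat i) <= r k) sequentially"
   using r by (simp only: filterlim_at_top)
  then have "eventually (\<lambda>k. norm ((LINT z|x (r k) (u k). ramp i z) - (LINT z|x (r k) t. ramp i z))
    <= C T i * (\<bar>u k - t\<bar> + 1 / real (Suc (r k)))) sequentially"
   by eventually_elim (use xmod t u in auto)
  from Lim_null_comparison[OF this 2] 1
  show "(\<lambda>k. LINT z|x (r k) (u k). ramp i z) \<longlonglongrightarrow> (LINT z|y t. ramp i z)"
   by (rule Lim_transform[rotated])
 qed
 have yseq: "limitin weak_topology (\<lambda>k. y (u k)) (y t) sequentially"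
  if u: "\<And>k. 0 <= u k" "\<And>k. u k <= real T" "u \<longlonglongrightarrow> t" for u T t
 proof (rule uniformly_tight_ramp_convergence)
  have t: "0 <= t" "t <= real T"
   using LIMSEQ_le_const[OF u(3)] LIMSEQ_le_const2[OF u(3)] u(1,2) by auto
  show "y t \<in> moment_measures" by (rule ym[OF t(1)])
  show "uniformly_tight (\<lambda>k. y (u k))"
   unfolding uniformly_tight_def
  proof (intro conjI allI impI)
   have "eventually (\<lambda>k. y (u k) \<in> moment_measures \<and> measure (y (u k)) {0..} <= A T \<and> (LINT z|y (u k). z) <= B) sequentially"
    by (intro always_eventually allI conjI ym yb(1)[of _ T] yb(2)[of _ T] u)
   then show "\<exists>A B. eventually (\<lambda>k. y (u k) \<in> moment_measures \<and> measure (y (u k)) {0..} <= A \<and> (LINT z|y (u k). z) <= B) sequentially"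
    by blast
   fix e :: real assume "e > 0"
   then obtain R where R: "\<tau> T R < e"
    using order_tendstoD(2)[OF \<tau>[of T]] by (auto simp: eventually_sequentially)
   have "(LINT z|y (u k). tail_weight (real (Suc R)) z) <= e" for k
    using yb(3)[OF u(1,2), where R=R] R by (meson less_imp_le order_trans)
   then show "\<exists>R>0. eventually (\<lambda>k. (LINT z|y (u k). tail_weight R z) <= e) sequentially"
    by (intro exI[of _ "real (Suc R)"]) simp
  qed
  fix i
  have "(\<lambda>k. C T i * \<bar>u k - t\<bar>) \<longlonglongrightarrow> C T i * \<bar>t - t\<bar>"
   by (intro tendsto_intros u(3))
  then have 2: "(\<lambda>k. C T i * \<bar>u k - t\<bar>) \<longlonglongrightarrow> 0" by simp
  have "(\<lambda>k. (LINT z|y (u k). ramp i z) - (LINT z|y t. ramp i z)) \<longlonglongrightarrow> 0"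
   by (rule Lim_null_comparison[OF _ 2]) (use ymod u t in \<open>auto intro: always_eventually\<close>)
  then show "(\<lambda>k. LINT z|y (u k). ramp i z) \<longlonglongrightarrow> (LINT z|y t. ramp i z)" by (rule LIM_zero_cancel)
 qed
 have yc: "y \<in> cadlag weak_topology"
  unfolding cadlag_def mem_Collect_eq
 proof (intro conjI allI impI)
  show "y \<in> {0..} \<rightarrow>\<^sub>E topspace weak_topology"
   using ym by (auto simp: PiE_def extensional_def y_def)
  fix t :: real
  obtain T :: nat where T: "t + 1 <= real T" using real_arch_simple by blast
  show "limitin weak_topology y (y t) (at_right t)" if t: "t >= 0"
  proof (rule limitin_at_rightI[where b="t + 1"])
   fix u assume u: "\<And>n. t < u n" "\<And>n. u n < t + 1" "u \<longlonglongrightarrow> t"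
   show "limitin weak_topology (\<lambda>n. y (u n)) (y t) sequentially"
   proof (rule yseq[of u T])
    show "0 <= u k" "u k <= real T" for k using u(1)[of k] u(2)[of k] t T by linarith+
   qed (rule u(3))
  qed (use ym t in auto)
  show "\<exists>l. limitin weak_topology y l (at_left t)" if t: "t > 0"
  \<comment> \<open>The limit path is continuous, so its left limit is again
    \<open>y t\<close>.\<close>
  proof (intro exI limitin_at_leftI[where b=0])
   fix u assume u: "\<And>n. u n < t" "\<And>n. 0 < u n" "u \<longlonglongrightarrow> t"
   have "u k <= real T" for k using u(1)[of k] T by linarith
   then show "limitin weak_topology (\<lambda>n. y (u n)) (y t) sequentially"
    using u by (intro yseq[of u T]) (auto intro: less_imp_le)
  qed (use ym t in auto)
 qed
 have yG: "y \<in> regular_paths A B \<tau> C k" for k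
  unfolding regular_paths_def mem_Collect_eq
 proof (intro conjI yc allI impI ballI)
  fix T t s and i :: "rat \<times> nat" assume "t \<in> {0..real T}" "s \<in> {0..real T}"
  then have "\<bar>(LINT z|y s. ramp i z) - (LINT z|y t. ramp i z)\<bar> <= C T i * \<bar>s - t\<bar>"
   using ymod by auto
  also have "\<dots> <= C T i * (\<bar>s - t\<bar> + 1 / real (Suc k))"
   using C by (intro mult_left_mono) auto
  finally show "\<bar>(LINT z|y s. ramp i z) - (LINT z|y t. ramp i z)\<bar> <= C T i * (\<bar>s - t\<bar> + 1 / real (Suc k))" .
 qed (use yb in auto)
 have "limitin (skorohod_topology weak_topology) x y sequentially"
 proof (rule limitin_skorohod_uniform[OF xc yc])
  fix f T and d :: real assume f: "continuous_map weak_topology euclideanreal f" and d: "d > 0"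
  obtain T' :: nat where T': "T <= real T'" using real_arch_simple by blast
  show "eventually (\<lambda>k. \<forall>t\<in>{0..T}. \<bar>f (x k t) - f (y t)\<bar> < d) sequentially"
  \<comment> \<open>If uniformity failed, the exceptional times would accumulate at some point of
    the compact interval, where \<open>joint\<close> and \<open>yseq\<close> give the same limit for
    both terms.\<close>
  proof (rule ccontr)
   assume "\<not> ?thesis"
   then obtain r :: "nat => nat" where r: "strict_mono r" "\<And>n. \<not> (\<forall>t\<in>{0..T}. \<bar>f (x (r n) t) - f (y t)\<bar> < d)"
    using not_eventually_sequentiallyD[of "\<lambda>k. \<forall>t\<in>{0..T}. \<bar>f (x k t) - f (y t)\<bar> < d"] by auto
   then have "\<forall>n. \<exists>t\<in>{0..T}. \<not> \<bar>f (x (r n) t) - f (y t)\<bar> < d" by blast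
   then obtain u where u: "\<And>n. u n \<in> {0..T}" "\<And>n. \<not> \<bar>f (x (r n) (u n)) - f (y (u n))\<bar> < d" by metis
   have "seq_compact {0..T}" using compact_Icc[of 0 T] by (simp add: compact_eq_seq_compact_metric)
   then obtain t l where l: "t \<in> {0..T}" "strict_mono (l :: nat => nat)" "(u \<circ> l) \<longlonglongrightarrow> t"
    using u(1) unfolding seq_compact_def by blast
   have ul: "0 <= u (l k)" "u (l k) <= real T'" for k using u(1)[of "l k"] T' by auto
   have ult: "(\<lambda>k. u (l k)) \<longlonglongrightarrow> t" using l(3) by (simp add: o_def)
   have "filterlim (\<lambda>k. r (l k)) sequentially sequentially"
    using filterlim_subseq[OF strict_mono_o[OF r(1) l(2)]] by (simp add: o_def)
   from tendsto_continuous_functional[OF f joint[OF this ul ult]]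
   have 1: "(\<lambda>k. f (x (r (l k)) (u (l k)))) \<longlonglongrightarrow> f (y t)" .
   have 2: "(\<lambda>k. f (y (u (l k)))) \<longlonglongrightarrow> f (y t)"
    using tendsto_continuous_functional[OF f yseq[OF ul ult]] .
   from tendsto_diff[OF 1 2] have "(\<lambda>k. f (x (r (l k)) (u (l k))) - f (y (u (l k)))) \<longlonglongrightarrow> 0" by simp
   from tendstoD[OF this d] u(2) show False
    by (auto simp: eventually_sequentially)
  qed
 qed
 moreover have "(\<lambda>k. rational_evaluation j (x k)) \<longlonglongrightarrow> rational_evaluation j y" for j
 proof -
  obtain s :: rat and i :: "rat \<times> nat" where j: "from_nat j = (s, i)"
  by (cases "from_nat j :: rat \<times> (rat \<times> nat)") auto
  show ?thesis unfolding rational_evaluation_def j using yconv[OF cramp, of "\<bar>of_rat s\<bar>" i] by simp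
 qed
 ultimately show ?thesis using yG by blast
qed


section \<open>States as multisets of cluster sizes, and the four transitions\<close>

text \<open>With multisets in place of indexed families, the transitions become insertion and
  removal of elements, without any choice of an enumeration.\<close>

definition cluster_sizes :: "real => nat multiset => real measure => bool" where
 "cluster_sizes eps N \<nu> \<longleftrightarrow> sets \<nu> = sets borel_nonneg \<and>
  (\<forall>A\<in>sets borel_nonneg. emeasure \<nu> A = (\<Sum>x\<in>#N. ennreal eps * indicator A (eps * real x)))"

lemma sbd_states_iff_cluster_sizes:
 "\<nu> \<in> sbd_states eps \<longleftrightarrow> (\<exists>N. (\<forall>x\<in>#N. x >= 2) \<and> cluster_sizes eps N \<nu>)"
proof
 assume "\<nu> \<in> sbd_states eps"
 then obtain n and x :: "nat => nat" where s: "sets \<nu> = sets borel_nonneg" and x: "\<forall>i<n. x i >= 2"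
  and em: "\<forall>A\<in>sets borel_nonneg. emeasure \<nu> A = (\<Sum>i<n. ennreal eps * indicator A (eps * real (x i)))"
  unfolding sbd_states_def by blast
 let ?N = "image_mset x (mset_set {..<n})"
 have "cluster_sizes eps ?N \<nu>"
  unfolding cluster_sizes_def using s em by (simp add: image_mset.compositionality o_def sum_unfold_sum_mset)
 moreover have "\<forall>y\<in>#?N. y >= 2" using x by auto
 ultimately show "\<exists>N. (\<forall>x\<in>#N. x >= 2) \<and> cluster_sizes eps N \<nu>" by blast
next
 assume "\<exists>N. (\<forall>x\<in>#N. x >= 2) \<and> cluster_sizes eps N \<nu>"
 then obtain N where N: "\<forall>x\<in>#N. x >= 2" "cluster_sizes eps N \<nu>" by blast
 obtain xs where xs: "mset xs = N" using ex_mset by blast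
 have "emeasure \<nu> A = (\<Sum>i<length xs. ennreal eps * indicator A (eps * real (xs ! i)))" if "A \<in> sets borel_nonneg" for A
 proof -
  have "emeasure \<nu> A = sum_mset (mset (map (\<lambda>x. ennreal eps * indicator A (eps * real x)) xs))"
   using N(2) that unfolding cluster_sizes_def xs[symmetric] by simp
  also have "\<dots> = (\<Sum>i<length xs. ennreal eps * indicator A (eps * real (xs ! i)))"
   by (subst sum_mset_sum_list) (simp add: sum_list_sum_nth lessThan_atLeast0)
  finally show ?thesis .
 qed
 moreover have "\<forall>i<length xs. xs ! i >= 2" using N(1) xs by (metis nth_mem_mset)
 ultimately show "\<nu> \<in> sbd_states eps"
  using N(2) unfolding sbd_states_def cluster_sizes_def by blast
qed

lemma cluster_sizes_sets: "cluster_sizes eps N \<nu> ==> sets \<nu> = sets borel_nonneg"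
 and cluster_sizes_space: "cluster_sizes eps N \<nu> ==> space \<nu> = {0..}"
proof -
 show 1: "cluster_sizes eps N \<nu> ==> sets \<nu> = sets borel_nonneg" by (simp add: cluster_sizes_def)
 show "cluster_sizes eps N \<nu> ==> space \<nu> = {0..}"
  using sets_eq_imp_space_eq[OF 1] by (simp add: space_restrict_space)
qed

lemma cluster_sizes_unique: "cluster_sizes eps N \<nu> ==> cluster_sizes eps N \<nu>' ==> \<nu> = \<nu>'"
 by (rule measure_eqI) (auto simp: cluster_sizes_def)

lemma borel_nonneg_sets_iff: "A \<in> sets borel_nonneg \<longleftrightarrow> A \<in> sets borel \<and> A \<subseteq> {0..}"
 by (auto simp: sets_restrict_space_iff)

lemma cluster_sizes_emeasure:
 assumes N: "cluster_sizes eps N \<nu>" and e: "eps > 0" and A: "A \<in> sets borel_nonneg"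
 shows "emeasure \<nu> A = ennreal (\<Sum>x\<in>#N. eps * indicator A (eps * real x))"
proof -
 have "(\<Sum>x\<in>#N. ennreal eps * indicator A (eps * real x)) = ennreal (\<Sum>x\<in>#N. eps * indicator A (eps * real x))"
 proof (induction N)
  case (add y N)
  have "0 <= (\<Sum>x\<in>#N. eps * indicator A (eps * real x))"
   by (induction N) (use e in auto)
  with add e show ?case by (auto simp: ennreal_plus indicator_def)
 qed simp
 then show ?thesis using N A by (simp add: cluster_sizes_def)
qed

lemma sum_mset_indicator_count:
 "eps > 0 ==> (\<Sum>x\<in>#N. eps * indicator {eps * real k} (eps * real x)) = eps * real (count N k)"
 by (induction N) (auto simp: algebra_simps)

lemma cluster_sizes_finite:
 assumes N: "cluster_sizes eps N \<nu>" and e: "eps > 0"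
 shows "finite_measure \<nu>"
proof
 have "{0..} \<in> sets borel_nonneg" by (simp add: borel_nonneg_sets_iff)
 then show "emeasure \<nu> (space \<nu>) \<noteq> \<infinity>"
  using cluster_sizes_emeasure[OF N e] by (simp add: cluster_sizes_space[OF N])
qed

lemma cluster_sizes_measure_singleton:
 assumes N: "cluster_sizes eps N \<nu>" and e: "eps > 0"
 shows "measure \<nu> {eps * real k} = eps * real (count N k)"
  and "x \<notin> (\<lambda>k. eps * real k) ` set_mset N ==> measure \<nu> {x} = 0"
proof -
 have "{eps * real k} \<in> sets borel_nonneg" using e by (simp add: borel_nonneg_sets_iff)
 then show "measure \<nu> {eps * real k} = eps * real (count N k)"
  using e by (simp add: measure_def cluster_sizes_emeasure[OF N e] sum_mset_indicator_count)
 assume x: "x \<notin> (\<lambda>k. eps * real k) ` set_mset N"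
 show "measure \<nu> {x} = 0"
 proof (cases "x >= 0")
  case True
  have "(\<Sum>k\<in>#N. eps * indicator {x} (eps * real k)) = (\<Sum>k\<in>#N. 0)"
   using x by (intro arg_cong[where f=sum_mset] image_mset_cong) (auto simp: indicator_def)
  then have "emeasure \<nu> {x} = 0"
   using True by (subst cluster_sizes_emeasure[OF N e]) (auto simp: borel_nonneg_sets_iff)
  then show ?thesis by (simp add: measure_def)
 next
  case False
  then show ?thesis by (intro measure_notin_sets) (auto simp: cluster_sizes_sets[OF N] borel_nonneg_sets_iff)
 qed
qed

lemma cluster_sizes_atoms:
 assumes N: "cluster_sizes eps N \<nu>" and e: "eps > 0"
 shows "{x. measure \<nu> {x} \<noteq> 0} = (\<lambda>k. eps * real k) ` set_mset N"
proof (intro equalityI subsetI)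
 fix x assume "x \<in> {x. measure \<nu> {x} \<noteq> 0}"
 then show "x \<in> (\<lambda>k. eps * real k) ` set_mset N"
  using cluster_sizes_measure_singleton(2)[OF N e] by blast
next
 fix x assume "x \<in> (\<lambda>k. eps * real k) ` set_mset N"
 then obtain k where "x = eps * real k" "k \<in># N" by blast
 then show "x \<in> {x. measure \<nu> {x} \<noteq> 0}"
  using cluster_sizes_measure_singleton(1)[OF N e, of k] e by simp
qed

lemma sum_mset_eq_sum_count:
 "(\<Sum>x\<in>#N. f x) = (\<Sum>x\<in>set_mset N. f x * real (count N x))"
proof (induction N)
 case (add y N)
 show ?case
 proof (cases "y \<in># N")
  case True
  have "(\<Sum>x\<in>set_mset (add_mset y N). f x * real (count (add_mset y N) x))
    = (\<Sum>x\<in>set_mset N. f x * real (count N x) + (if x = y then f x else 0))"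
   using True by (intro sum.cong) (auto simp: insert_absorb algebra_simps)
  also have "\<dots> = (\<Sum>x\<in>set_mset N. f x * real (count N x)) + f y"
   using True by (simp add: sum.distrib)
  finally show ?thesis using add by simp
 next
  case False
  then have "(\<Sum>x\<in>set_mset N. f x * real (count (add_mset y N) x)) = (\<Sum>x\<in>set_mset N. f x * real (count N x))"
   by (intro sum.cong) auto
  with False add show ?thesis by (simp add: not_in_iff)
 qed
qed simp

lemma atomic_integral_cluster_sizes:
 assumes N: "cluster_sizes eps N \<nu>" and e: "eps > 0"
 shows "atomic_integral \<nu> A f = (\<Sum>k | k \<in> set_mset N \<and> eps * real k \<in> A. f (eps * real k) * (eps * real (count N k)))"
proof -
 have "{x. x \<in> A \<and> measure \<nu> {x} \<noteq> 0} = (\<lambda>k. eps * real k) ` {k. k \<in> set_mset N \<and> eps * real k \<in> A}"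
  using cluster_sizes_atoms[OF N e] by auto
 moreover have "inj_on (\<lambda>k. eps * real k) X" for X using e by (auto simp: inj_on_def)
 ultimately show ?thesis
  unfolding atomic_integral_def by (simp add: sum.reindex cluster_sizes_measure_singleton(1)[OF N e])
qed

lemma cluster_sizes_integral:
 assumes N: "cluster_sizes eps N \<nu>" "\<forall>x\<in>#N. x >= 2" and e: "eps > 0" and f: "f \<in> borel_measurable borel_nonneg"
 shows "(LINT x|\<nu>. f x) = eps * (\<Sum>k\<in>#N. f (eps * real k))"
proof -
 have \<nu>: "\<nu> \<in> sbd_states eps" using N sbd_states_iff_cluster_sizes by blast
 have "{0..} \<in> sets borel_nonneg" by (simp add: borel_nonneg_sets_iff)
 from atomic_integral_eq_set_integral[OF \<nu> f this]
 have "(\<integral>x\<in>{0..}. f x \<partial>\<nu>) = atomic_integral \<nu> {0..} f" .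
 moreover have "(\<integral>x\<in>{0..}. f x \<partial>\<nu>) = (LINT x|\<nu>. f x)"
  unfolding set_lebesgue_integral_def
  by (intro Bochner_Integration.integral_cong) (auto simp: cluster_sizes_space[OF N(1)])
 moreover have "{k. k \<in> set_mset N \<and> eps * real k \<in> {0..}} = set_mset N" using e by auto
 ultimately show ?thesis
  using e by (simp add: atomic_integral_cluster_sizes[OF N(1) e] sum_mset_eq_sum_count sum_distrib_left algebra_simps)
qed

lemma cluster_sizes_moment_measure:
 assumes N: "cluster_sizes eps N \<nu>" and e: "eps > 0"
 shows "\<nu> \<in> moment_measures"
proof -
 interpret finite_measure \<nu> by (rule cluster_sizes_finite[OF N e])
 define K where "K = eps * real (Max (insert 0 (set_mset N)))"
 have "{K<..} \<inter> {0..} \<in> sets borel_nonneg" by (simp add: borel_nonneg_sets_iff)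
 have K: "eps * real k <= K" if "k \<in># N" for k
  unfolding K_def using e that by (intro mult_left_mono) auto
 have "(\<Sum>k\<in>#N. eps * indicator ({K<..} \<inter> {0..}) (eps * real k)) = (\<Sum>k\<in>#N. 0)"
  using K by (intro arg_cong[where f=sum_mset] image_mset_cong) (auto simp: indicator_def not_less)
 then have "emeasure \<nu> ({K<..} \<inter> {0..}) = 0"
  by (subst cluster_sizes_emeasure[OF N e]) (auto simp: borel_nonneg_sets_iff)
 then have "AE x in \<nu>. x \<notin> {K<..} \<inter> {0..}"
  by (intro AE_not_in null_setsI) (auto simp: cluster_sizes_sets[OF N] borel_nonneg_sets_iff)
 then have "AE x in \<nu>. norm x <= K"
  by (rule AE_mp) (auto intro!: AE_I2 simp: cluster_sizes_space[OF N])
 moreover have "(\<lambda>x. x) \<in> borel_measurable \<nu>"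
  unfolding measurable_cong_sets[OF cluster_sizes_sets[OF N] refl] by (intro measurable_restrict_space1) simp
 ultimately have "integrable \<nu> (\<lambda>x. x)" by (rule integrable_const_bound)
 then show ?thesis
  using cluster_sizes_sets[OF N] finite_measure_axioms by (simp add: moment_measures_def)
qed

lemma sbd_states_moment_measures: "eps > 0 ==> \<nu> \<in> sbd_states eps ==> \<nu> \<in> moment_measures"
 using sbd_states_iff_cluster_sizes cluster_sizes_moment_measure by blast

lemma emeasure_point_mass:
 "A \<in> sets borel_nonneg ==> emeasure (point_mass eps x) A = ennreal eps * indicator A x"
 by (simp add: point_mass_def)

lemma sets_point_mass [simp]: "sets (point_mass eps x) = sets borel_nonneg"
 by (simp add: point_mass_def)

lemma cluster_sizes_plus:
 assumes N: "cluster_sizes eps N \<nu>"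
 shows "cluster_sizes eps (add_mset k N) (plus_measure \<nu> (point_mass eps (eps * real k)))"
 using N unfolding cluster_sizes_def
 by (simp add: emeasure_plus_measure emeasure_point_mass add.commute)

text \<open>Membership of \<open>k\<close> guarantees that the subtracted point mass lies below
  \<nu>, which a difference of measures requires.\<close>

lemma cluster_sizes_diff:
 assumes N: "cluster_sizes eps N \<nu>" and e: "eps > 0" and k: "k \<in># N"
 shows "cluster_sizes eps (N - {#k#}) (diff_measure \<nu> (point_mass eps (eps * real k)))"
 unfolding cluster_sizes_def
proof (intro conjI ballI)
 show "sets (diff_measure \<nu> (point_mass eps (eps * real k))) = sets borel_nonneg"
  using cluster_sizes_sets[OF N] by simp
 obtain N' where N': "N = add_mset k N'" using k by (metis mset_add)
 have split: "emeasure \<nu> A = ennreal eps * indicator A (eps * real k) + (\<Sum>x\<in>#N'. ennreal eps * indicator A (eps * real x))"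
  if "A \<in> sets borel_nonneg" for A using N that unfolding N' cluster_sizes_def by simp
 fix A assume A: "A \<in> sets borel_nonneg"
 have fin: "finite_measure (point_mass eps (eps * real k))"
  using e by (intro finite_measureI) (auto simp: emeasure_point_mass space_restrict_space borel_nonneg_sets_iff
    sets_eq_imp_space_eq[OF sets_point_mass] ennreal_mult_eq_top_iff indicator_def)
 have "emeasure (diff_measure \<nu> (point_mass eps (eps * real k))) A = emeasure \<nu> A - emeasure (point_mass eps (eps * real k)) A"
  using A cluster_sizes_sets[OF N]
  by (intro emeasure_diff_measure cluster_sizes_finite[OF N e] fin) (auto simp: emeasure_point_mass split)
 also have "\<dots> = (\<Sum>x\<in>#N'. ennreal eps * indicator A (eps * real x))"
  using A by (simp add: emeasure_point_mass split ennreal_mult_eq_top_iff indicator_def)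
 finally show "emeasure (diff_measure \<nu> (point_mass eps (eps * real k))) A = (\<Sum>x\<in>#N - {#k#}. ennreal eps * indicator A (eps * real x))"
  by (simp add: N')
qed

definition nucleate :: "real => real measure => real measure" where
 "nucleate eps \<nu> = plus_measure \<nu> (point_mass eps (2 * eps))"
definition denucleate :: "real => real measure => real measure" where
 "denucleate eps \<nu> = diff_measure \<nu> (point_mass eps (2 * eps))"
definition grow :: "real => real measure => real => real measure" where
 "grow eps \<nu> x = diff_measure (plus_measure \<nu> (point_mass eps (x + eps))) (point_mass eps x)"
definition shrink :: "real => real measure => real => real measure" where
 "shrink eps \<nu> x = plus_measure (diff_measure \<nu> (point_mass eps x)) (point_mass eps (x - eps))"

definition atoms :: "real measure => real set" where
 "atoms \<nu> = {x. measure \<nu> {x} \<noteq> 0}"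

lemma sbd_states_atoms:
 assumes e: "eps > 0" and \<nu>: "\<nu> \<in> sbd_states eps"
 shows "finite (atoms \<nu>)" and "x \<in> atoms \<nu> ==> x >= 2 * eps"
  and "x \<in> atoms \<nu> ==> \<exists>k. x = eps * real k"
  and "f \<in> borel_measurable borel_nonneg ==> (LINT x|\<nu>. f x) = (\<Sum>x\<in>atoms \<nu>. f x * measure \<nu> {x})"
proof -
 obtain N where N: "\<forall>x\<in>#N. x >= 2" "cluster_sizes eps N \<nu>"
  using \<nu> sbd_states_iff_cluster_sizes by blast
 have a: "atoms \<nu> = (\<lambda>k. eps * real k) ` set_mset N"
  unfolding atoms_def by (rule cluster_sizes_atoms[OF N(2) e])
 show "finite (atoms \<nu>)" by (simp add: a)
 show "x \<in> atoms \<nu> ==> \<exists>k. x = eps * real k" by (auto simp: a)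
 show "x \<in> atoms \<nu> ==> x >= 2 * eps"
 proof -
  assume "x \<in> atoms \<nu>"
  then obtain k where "x = eps * real k" "k >= 2" using N(1) by (auto simp: a)
  then show ?thesis using e by simp
 qed
 assume f: "f \<in> borel_measurable borel_nonneg"
 have "inj_on (\<lambda>k. eps * real k) X" for X using e by (auto simp: inj_on_def)
 then show "(LINT x|\<nu>. f x) = (\<Sum>x\<in>atoms \<nu>. f x * measure \<nu> {x})"
  by (simp add: a cluster_sizes_integral[OF N(2,1) e f] sum.reindex cluster_sizes_measure_singleton(1)[OF N(2) e]
    sum_mset_eq_sum_count sum_distrib_left algebra_simps)
qed

text \<open>Each summand becomes an increment of \<open>\<psi>\<close> times a jump rate, with the
  powers of eps moved into the rate. The lower end \<open>2 * eps\<close> of the growth integral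
  disappears because all atoms lie beyond it.\<close>

lemma sbd_generator_eq:
 assumes e: "eps > 0" and \<nu>: "\<nu> \<in> sbd_states eps"
 shows "sbd_generator eps \<alpha> \<beta> a b m \<psi> \<nu> =
  (\<psi> (nucleate eps \<nu>) - \<psi> \<nu>) * (\<alpha> * (m - (LINT x|\<nu>. x)) * (m - (LINT x|\<nu>. x) - eps\<^sup>2) / eps) +
  (\<psi> (denucleate eps \<nu>) - \<psi> \<nu>) * (\<beta> * measure \<nu> {2 * eps} / eps) +
  (\<Sum>x\<in>atoms \<nu>. (\<psi> (grow eps \<nu> x) - \<psi> \<nu>) * (a x * (m - (LINT x|\<nu>. x)) * measure \<nu> {x} / eps\<^sup>2)) +
  (\<Sum>x\<in>atoms \<nu> \<inter> {3 * eps..}. (\<psi> (shrink eps \<nu> x) - \<psi> \<nu>) * (b x * measure \<nu> {x} / eps\<^sup>2))"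
proof -
 have 1: "{x. x \<in> {2 * eps..} \<and> measure \<nu> {x} \<noteq> 0} = atoms \<nu>"
  using sbd_states_atoms(2)[OF e \<nu>] by (auto simp: atoms_def)
 have 2: "{x. x \<in> {3 * eps..} \<and> measure \<nu> {x} \<noteq> 0} = atoms \<nu> \<inter> {3 * eps..}"
  by (auto simp: atoms_def)
 have t1: "p / eps * (\<alpha> * c * d) = p * (\<alpha> * c * d / eps)" "p / eps * (\<beta> * c) = p * (\<beta> * c / eps)" for p c d by simp_all
 have t3: "p / eps\<^sup>2 * (q * c) * r = p * (q * c * r / eps\<^sup>2)" "p / eps\<^sup>2 * q * r = p * (q * r / eps\<^sup>2)" for p q c r by simp_all
 show ?thesis
  unfolding sbd_generator_def Let_def atomic_integral_def 1 2 nucleate_def denucleate_def grow_def shrink_def t1 t3 ..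
qed

text \<open>Obtained from the multiset representation. These increments of linear functionals are
  all that later estimates need to know about the jumps: order eps for the creation or removal of a
  cluster, order \<open>eps\<^sup>2\<close> for a Lipschitz function when a cluster grows or
  shrinks.\<close>

lemma sbd_transitions:
 assumes e: "eps > 0" and \<nu>: "\<nu> \<in> sbd_states eps"
 shows "nucleate eps \<nu> \<in> sbd_states eps"
  and "measure \<nu> {2 * eps} \<noteq> 0 ==> denucleate eps \<nu> \<in> sbd_states eps"
  and "x \<in> atoms \<nu> ==> grow eps \<nu> x \<in> sbd_states eps"
  and "x \<in> atoms \<nu> ==> x >= 3 * eps ==> shrink eps \<nu> x \<in> sbd_states eps"
  and "f \<in> borel_measurable borel_nonneg ==> (LINT z|nucleate eps \<nu>. f z) = (LINT z|\<nu>. f z) + eps * f (2 * eps)"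
  and "f \<in> borel_measurable borel_nonneg ==> measure \<nu> {2 * eps} \<noteq> 0 ==>
   (LINT z|denucleate eps \<nu>. f z) = (LINT z|\<nu>. f z) - eps * f (2 * eps)"
  and "f \<in> borel_measurable borel_nonneg ==> x \<in> atoms \<nu> ==>
   (LINT z|grow eps \<nu> x. f z) = (LINT z|\<nu>. f z) + eps * (f (x + eps) - f x)"
  and "f \<in> borel_measurable borel_nonneg ==> x \<in> atoms \<nu> ==> x >= 3 * eps ==>
   (LINT z|shrink eps \<nu> x. f z) = (LINT z|\<nu>. f z) + eps * (f (x - eps) - f x)"
proof -
 obtain N where N2: "\<forall>x\<in>#N. x >= 2" and N: "cluster_sizes eps N \<nu>"
  using \<nu> sbd_states_iff_cluster_sizes by blast
 note int = cluster_sizes_integral[OF _ _ e]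
 have nu: "cluster_sizes eps (add_mset 2 N) (nucleate eps \<nu>)"
  using cluster_sizes_plus[OF N, of 2] by (simp add: nucleate_def mult.commute)
 have nu2: "\<forall>x\<in>#add_mset 2 N. x >= 2" using N2 by auto
 show "nucleate eps \<nu> \<in> sbd_states eps" using nu nu2 sbd_states_iff_cluster_sizes by blast
 show "(LINT z|nucleate eps \<nu>. f z) = (LINT z|\<nu>. f z) + eps * f (2 * eps)" if "f \<in> borel_measurable borel_nonneg"
  using int[OF nu nu2 that] int[OF N N2 that] by (simp add: algebra_simps)
 have two: "2 \<in># N" if "measure \<nu> {2 * eps} \<noteq> 0"
  using that cluster_sizes_measure_singleton(1)[OF N e, of 2] by (auto simp: mult.commute not_in_iff)
 have de: "cluster_sizes eps (N - {#2#}) (denucleate eps \<nu>)" if "2 \<in># N"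
  using cluster_sizes_diff[OF N e that] by (simp add: denucleate_def mult.commute)
 have de2: "\<forall>x\<in>#N - {#2#}. x >= 2" using N2 by (auto dest: in_diffD)
 show "denucleate eps \<nu> \<in> sbd_states eps" if "measure \<nu> {2 * eps} \<noteq> 0"
  using de[OF two[OF that]] de2 sbd_states_iff_cluster_sizes by blast
 show "(LINT z|denucleate eps \<nu>. f z) = (LINT z|\<nu>. f z) - eps * f (2 * eps)"
  if f: "f \<in> borel_measurable borel_nonneg" and m: "measure \<nu> {2 * eps} \<noteq> 0"
 proof -
  obtain N' where "N = add_mset 2 N'" using two[OF m] by (metis mset_add)
  then show ?thesis
   using int[OF de[OF two[OF m]] de2 f] int[OF N N2 f] by (simp add: algebra_simps)
 qed
 have at: "\<exists>k. x = eps * real k \<and> k \<in># N" if "x \<in> atoms \<nu>" for x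
  using that cluster_sizes_atoms[OF N e] by (auto simp: atoms_def)
 have gr: "cluster_sizes eps (add_mset (Suc k) N - {#k#}) (grow eps \<nu> (eps * real k))" if "k \<in># N" for k
 proof -
  have "cluster_sizes eps (add_mset (Suc k) N) (plus_measure \<nu> (point_mass eps (eps * real k + eps)))"
   using cluster_sizes_plus[OF N, of "Suc k"] by (simp add: algebra_simps)
  from cluster_sizes_diff[OF this e, of k] that show ?thesis by (simp add: grow_def)
 qed
 have gr2: "\<forall>x\<in>#add_mset (Suc k) N - {#k#}. x >= 2" if "k \<in># N" for k
  using N2 that by (auto dest!: in_diffD)
 show "grow eps \<nu> x \<in> sbd_states eps" if "x \<in> atoms \<nu>"
  using at[OF that] gr gr2 sbd_states_iff_cluster_sizes by blast
 show "(LINT z|grow eps \<nu> x. f z) = (LINT z|\<nu>. f z) + eps * (f (x + eps) - f x)"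
  if f: "f \<in> borel_measurable borel_nonneg" and x: "x \<in> atoms \<nu>"
 proof -
  obtain k where k: "x = eps * real k" "k \<in># N" using at[OF x] by blast
  then obtain N' where N': "N = add_mset k N'" by (metis mset_add)
  have "add_mset (Suc k) N - {#k#} = add_mset (Suc k) N'" by (simp add: N')
  then show ?thesis
   using int[OF gr[OF k(2)] gr2[OF k(2)] f] int[OF N N2 f] by (simp add: N' k(1) algebra_simps)
 qed
 have sh: "cluster_sizes eps (add_mset (k - 1) (N - {#k#})) (shrink eps \<nu> (eps * real k))" if "k \<in># N" for k
 proof -
  have "k >= 1" using N2 that by force
  then have "eps * real (k - 1) = eps * real k - eps" by (simp add: of_nat_diff algebra_simps)
  with cluster_sizes_plus[OF cluster_sizes_diff[OF N e that], of "k - 1"] show ?thesis by (simp add: shrink_def)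
 qed
 have sh2: "\<forall>x\<in>#add_mset (k - 1) (N - {#k#}). x >= 2" if "k >= 3" for k
  using N2 that by (auto dest!: in_diffD)
 have k3: "k >= 3" if "eps * real k >= 3 * eps" for k using that e by (simp add: mult.commute)
 show "shrink eps \<nu> x \<in> sbd_states eps" if "x \<in> atoms \<nu>" "x >= 3 * eps"
  using at[OF that(1)] that(2) sh sh2 k3 sbd_states_iff_cluster_sizes by blast
 show "(LINT z|shrink eps \<nu> x. f z) = (LINT z|\<nu>. f z) + eps * (f (x - eps) - f x)"
  if f: "f \<in> borel_measurable borel_nonneg" and x: "x \<in> atoms \<nu>" "x >= 3 * eps"
 proof -
  obtain k where k: "x = eps * real k" "k \<in># N" using at[OF x(1)] by blast
  then obtain N' where N': "N = add_mset k N'" by (metis mset_add)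
  have "k >= 3" using k3 x(2) k(1) by simp
  then obtain j where j: "k = Suc j" by (cases k) auto
  have x1: "x - eps = eps * real j" by (simp add: k(1) j algebra_simps)
  show ?thesis
   using int[OF sh[OF k(2)] sh2[OF \<open>k >= 3\<close>] f] int[OF N N2 f] unfolding x1 k(1) by (simp add: N' j algebra_simps)
 qed
qed

lemma sbd_states_moment:
 assumes e: "eps > 0" and \<nu>: "\<nu> \<in> sbd_states eps"
 shows "\<exists>k :: nat. (LINT x|\<nu>. x) = eps\<^sup>2 * real k"
proof -
 obtain N where N: "\<forall>x\<in>#N. x >= 2" "cluster_sizes eps N \<nu>"
  using \<nu> sbd_states_iff_cluster_sizes by blast
 have "(\<lambda>x. x) \<in> borel_measurable borel_nonneg" by (intro measurable_restrict_space1) simp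
 from cluster_sizes_integral[OF N(2,1) e this]
 have "(LINT x|\<nu>. x) = eps * (\<Sum>k\<in>#N. eps * real k)" .
 also have "(\<Sum>k\<in>#N. eps * real k) = eps * real (\<Sum>k\<in>#N. k)" by (induction N) (auto simp: algebra_simps)
 finally show ?thesis by (metis power2_eq_square mult.assoc)
qed

lemma finite_sbd_states_bounded:
 assumes e: "eps > 0"
 shows "finite {\<nu> \<in> sbd_states eps. (LINT x|\<nu>. x) <= m}"
proof -
 \<comment> \<open>The moment is \<open>eps\<^sup>2\<close> times the sum of the sizes and each size
   is positive, so \<open>K\<close> bounds both the number of clusters and every single
   size.\<close>
 define K where "K = nat \<lceil>m / eps\<^sup>2\<rceil>"
 let ?L = "{xs :: nat list. set xs \<subseteq> {..K} \<and> length xs <= K}"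
 let ?g = "\<lambda>xs. THE \<nu>. cluster_sizes eps (mset xs) \<nu>"
 have "finite (?g ` ?L)" by (intro finite_imageI finite_lists_length_le) simp
 moreover have "{\<nu> \<in> sbd_states eps. (LINT x|\<nu>. x) <= m} \<subseteq> ?g ` ?L"
 proof safe
  fix \<nu> assume \<nu>: "\<nu> \<in> sbd_states eps" and m: "(LINT x|\<nu>. x) <= m"
  then obtain N where N: "\<forall>x\<in>#N. x >= 2" "cluster_sizes eps N \<nu>"
   using sbd_states_iff_cluster_sizes by blast
  obtain xs where xs: "mset xs = N" using ex_mset by blast
  have "(\<lambda>x. x) \<in> borel_measurable borel_nonneg" by (intro measurable_restrict_space1) simp
  from cluster_sizes_integral[OF N(2,1) e this]
  have "(LINT x|\<nu>. x) = eps * (\<Sum>k\<in>#N. eps * real k)" .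
  also have "(\<Sum>k\<in>#N. eps * real k) = eps * real (\<Sum>k\<in>#N. k)" by (induction N) (auto simp: algebra_simps)
  finally have "eps\<^sup>2 * real (sum_list xs) <= m"
   using m by (simp add: power2_eq_square xs[symmetric] sum_mset_sum_list)
  then have "real (sum_list xs) <= m / eps\<^sup>2" using e by (simp add: field_simps)
  then have K: "sum_list xs <= K" unfolding K_def by linarith
  have "length xs <= sum_list xs"
   using N(1) unfolding xs[symmetric] by (induction xs) auto
  moreover have "x <= sum_list xs" if "x \<in> set xs" for x using that by (intro member_le_sum_list) auto
  ultimately have "xs \<in> ?L" using K by fastforce
  moreover have "?g xs = \<nu>"
   using N(2) cluster_sizes_unique unfolding xs[symmetric] by blast
  ultimately show "\<nu> \<in> ?g ` ?L" by blast
 qed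
 ultimately show ?thesis by (rule finite_subset[rotated])
qed

text \<open>The free mass is required to be a whole number of monomers. This keeps the nucleation
  rate nonnegative and stops nucleation when fewer than two monomers are left.\<close>

definition sbd_class :: "real => real => real measure set" where
 "sbd_class eps m = {\<nu> \<in> sbd_states eps. \<exists>j :: nat. m - (LINT x|\<nu>. x) = eps\<^sup>2 * real j}"

lemma finite_sbd_class: "eps > 0 ==> finite (sbd_class eps m)"
proof (rule finite_subset[OF _ finite_sbd_states_bounded])
 assume "eps > 0"
 show "sbd_class eps m \<subseteq> {\<nu> \<in> sbd_states eps. (LINT x|\<nu>. x) <= m}"
 proof safe
  fix \<nu> assume "\<nu> \<in> sbd_class eps m"
  then obtain j :: nat where "m - (LINT x|\<nu>. x) = eps\<^sup>2 * real j" by (auto simp: sbd_class_def)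
  moreover have "0 <= eps\<^sup>2 * real j" by simp
  ultimately show "(LINT x|\<nu>. x) <= m" by linarith
 qed (auto simp: sbd_class_def)
qed

text \<open>Write the free mass as \<open>j\<close> monomers. Nucleation consumes two and has rate 0
  for \<open>j <= 1\<close>, growth consumes one and has rate 0 for \<open>j = 0\<close>, and the
  reverse transitions release monomers. Hence no transition of positive rate leaves the
  class.\<close>

lemma sbd_class_transitions:
 assumes e: "eps > 0" and \<nu>: "\<nu> \<in> sbd_class eps m"
 defines "c \<equiv> m - (LINT x|\<nu>. x)"
 shows "0 <= c" and "0 <= c * (c - eps\<^sup>2)"
  and "c * (c - eps\<^sup>2) \<noteq> 0 ==> nucleate eps \<nu> \<in> sbd_class eps m"
  and "measure \<nu> {2 * eps} \<noteq> 0 ==> denucleate eps \<nu> \<in> sbd_class eps m"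
  and "x \<in> atoms \<nu> ==> c \<noteq> 0 ==> grow eps \<nu> x \<in> sbd_class eps m"
  and "x \<in> atoms \<nu> ==> x >= 3 * eps ==> shrink eps \<nu> x \<in> sbd_class eps m"
proof -
 have s: "\<nu> \<in> sbd_states eps" using \<nu> by (simp add: sbd_class_def)
 obtain j :: nat where j: "c = eps\<^sup>2 * real j" using \<nu> by (auto simp: sbd_class_def c_def)
 have id: "(\<lambda>x. x) \<in> borel_measurable borel_nonneg" by (intro measurable_restrict_space1) simp
 show "0 <= c" by (simp add: j)
 have cc: "c * (c - eps\<^sup>2) = eps\<^sup>2 * eps\<^sup>2 * (real j * (real j - 1))" by (simp add: j algebra_simps)
 have "0 <= real j * (real j - 1)" by (cases j) auto
 then show "0 <= c * (c - eps\<^sup>2)" unfolding cc by simp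
 note T = sbd_transitions[OF e s]
 show "nucleate eps \<nu> \<in> sbd_class eps m" if "c * (c - eps\<^sup>2) \<noteq> 0"
 proof -
  have "j \<noteq> 0" "j \<noteq> 1" using that cc by auto
  then obtain i where "j = Suc (Suc i)" by (metis not0_implies_Suc One_nat_def)
  then have "m - (LINT x|nucleate eps \<nu>. x) = eps\<^sup>2 * real i"
   using T(5)[OF id] j by (simp add: c_def algebra_simps power2_eq_square)
  with T(1) show ?thesis by (auto simp: sbd_class_def)
 qed
 show "denucleate eps \<nu> \<in> sbd_class eps m" if "measure \<nu> {2 * eps} \<noteq> 0"
 proof -
  have "m - (LINT x|denucleate eps \<nu>. x) = eps\<^sup>2 * real (j + 2)"
   using T(6)[OF id that] j by (simp add: c_def algebra_simps power2_eq_square)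
  with T(2)[OF that] show ?thesis unfolding sbd_class_def by blast
 qed
 show "grow eps \<nu> x \<in> sbd_class eps m" if "x \<in> atoms \<nu>" "c \<noteq> 0"
 proof -
  have "j \<noteq> 0" using that j by auto
  then obtain i where "j = Suc i" by (metis not0_implies_Suc)
  then have "m - (LINT x|grow eps \<nu> x. x) = eps\<^sup>2 * real i"
   using T(7)[OF id that(1)] j by (simp add: c_def algebra_simps power2_eq_square)
  with T(3)[OF that(1)] show ?thesis unfolding sbd_class_def by blast
 qed
 show "shrink eps \<nu> x \<in> sbd_class eps m" if "x \<in> atoms \<nu>" "x >= 3 * eps"
 proof -
  have "m - (LINT x|shrink eps \<nu> x. x) = eps\<^sup>2 * real (Suc j)"
   using T(8)[OF id that] j by (simp add: c_def algebra_simps power2_eq_square)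
  with T(4)[OF that] show ?thesis unfolding sbd_class_def by blast
 qed
qed

lemma sum_indicator_diff:
 fixes \<psi> :: "'s => real"
 assumes "finite S" "y \<in> S" "r \<noteq> 0 ==> w \<in> S"
 shows "(\<psi> w - \<psi> y) * r = (\<Sum>z\<in>S. \<psi> z * ((indicator {z} w - indicator {z} y) * r))"
proof (cases "r = 0")
 case False
 then have "w \<in> S" using assms by blast
 have "(\<Sum>z\<in>S. \<psi> z * indicator {z} v) = \<psi> v" if "v \<in> S" for v
 proof -
  have "(\<Sum>z\<in>S. \<psi> z * indicator {z} v) = (\<Sum>z\<in>S. if z = v then \<psi> v else 0)"
   by (intro sum.cong) (auto simp: indicator_def)
  with that assms(1) show ?thesis by simp
 qed
 note sel = this
 have "(\<Sum>z\<in>S. \<psi> z * ((indicator {z} w - indicator {z} y) * r)) =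
   (\<Sum>z\<in>S. \<psi> z * indicator {z} w * r - \<psi> z * indicator {z} y * r)"
  by (intro sum.cong) (auto simp: algebra_simps)
 also have "\<dots> = (\<Sum>z\<in>S. \<psi> z * indicator {z} w) * r - (\<Sum>z\<in>S. \<psi> z * indicator {z} y) * r"
  by (simp add: sum_subtractf sum_distrib_right)
 finally show ?thesis using sel[OF \<open>w \<in> S\<close>] sel[OF assms(2)] by (simp add: algebra_simps)
qed simp

text \<open>Increments towards states outside the class carry the rate 0, so on the class the
  generator acts as a finite matrix.\<close>

lemma sbd_generator_matrix:
 assumes e: "eps > 0" and \<nu>: "\<nu> \<in> sbd_class eps m"
 shows "sbd_generator eps \<alpha> \<beta> a b m \<psi> \<nu> =
  (\<Sum>z\<in>sbd_class eps m. \<psi> z * sbd_generator eps \<alpha> \<beta> a b m (indicator {z}) \<nu>)"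
proof -
 have s: "\<nu> \<in> sbd_states eps" using \<nu> by (simp add: sbd_class_def)
 let ?S = "sbd_class eps m"
 let ?c = "m - (LINT x|\<nu>. x)"
 note T = sbd_class_transitions[OF e \<nu>]
 note D = sum_indicator_diff[OF finite_sbd_class[OF e] \<nu>]
 have 1: "(\<psi> (nucleate eps \<nu>) - \<psi> \<nu>) * (\<alpha> * ?c * (?c - eps\<^sup>2) / eps) =
  (\<Sum>z\<in>?S. \<psi> z * ((indicator {z} (nucleate eps \<nu>) - indicator {z} \<nu>) * (\<alpha> * ?c * (?c - eps\<^sup>2) / eps)))"
  by (rule D) (use T(3) in auto)
 have 2: "(\<psi> (denucleate eps \<nu>) - \<psi> \<nu>) * (\<beta> * measure \<nu> {2 * eps} / eps) =
  (\<Sum>z\<in>?S. \<psi> z * ((indicator {z} (denucleate eps \<nu>) - indicator {z} \<nu>) * (\<beta> * measure \<nu> {2 * eps} / eps)))"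
  by (rule D) (use T(4) in auto)
 have 3: "(\<Sum>x\<in>atoms \<nu>. (\<psi> (grow eps \<nu> x) - \<psi> \<nu>) * (a x * ?c * measure \<nu> {x} / eps\<^sup>2)) =
  (\<Sum>z\<in>?S. \<psi> z * (\<Sum>x\<in>atoms \<nu>. (indicator {z} (grow eps \<nu> x) - indicator {z} \<nu>) * (a x * ?c * measure \<nu> {x} / eps\<^sup>2)))"
  unfolding sum_distrib_left by (subst sum.swap, intro sum.cong refl D) (use T(5) in auto)
 have 4: "(\<Sum>x\<in>atoms \<nu> \<inter> {3 * eps..}. (\<psi> (shrink eps \<nu> x) - \<psi> \<nu>) * (b x * measure \<nu> {x} / eps\<^sup>2)) =
  (\<Sum>z\<in>?S. \<psi> z * (\<Sum>x\<in>atoms \<nu> \<inter> {3 * eps..}. (indicator {z} (shrink eps \<nu> x) - indicator {z} \<nu>) * (b x * measure \<nu> {x} / eps\<^sup>2)))"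
  unfolding sum_distrib_left by (subst sum.swap, intro sum.cong refl D) (use T(6) in auto)
 show ?thesis
  unfolding sbd_generator_eq[OF e s] 1 2 3 4 by (simp only: distrib_left sum.distrib)
qed


section \<open>Semigroups on finite sets and the exponential inequality for chains\<close>

text \<open>\<open>L\<close> acts on functions of all states, but at points of \<open>S\<close> it
  sees only the values on \<open>S\<close>, through the matrix \<open>Q\<close>. This is what makes
  the exponential series converge there.\<close>

locale finite_generator =
 fixes S :: "'s set" and L :: "('s => real) => 's => real" and Q :: "'s => 's => real"
 assumes finite_S: "finite S"
  and L_eq: "\<And>\<psi> y. y \<in> S ==> L \<psi> y = (\<Sum>z\<in>S. \<psi> z * Q y z)"
begin

text \<open>A crude bound for the operator norm. It enters only errors of second order in the mesh,
  which vanish before eps changes.\<close>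

definition rate_bound :: real where "rate_bound = (\<Sum>y\<in>S. \<Sum>z\<in>S. \<bar>Q y z\<bar>)"

lemma rate_bound_nonneg: "0 <= rate_bound"
 unfolding rate_bound_def by (intro sum_nonneg) auto

lemma L_bound:
 assumes y: "y \<in> S" and \<psi>: "\<And>z. z \<in> S ==> \<bar>\<psi> z\<bar> <= C"
 shows "\<bar>L \<psi> y\<bar> <= rate_bound * C"
proof -
 have C: "0 <= C" using \<psi>[OF y] by linarith
 have "\<bar>L \<psi> y\<bar> <= (\<Sum>z\<in>S. \<bar>\<psi> z * Q y z\<bar>)" unfolding L_eq[OF y] by (rule sum_abs)
 also have "\<dots> <= (\<Sum>z\<in>S. C * \<bar>Q y z\<bar>)"
  using \<psi> by (intro sum_mono) (auto simp: abs_mult intro: mult_right_mono)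
 also have "\<dots> = C * (\<Sum>z\<in>S. \<bar>Q y z\<bar>)" by (simp add: sum_distrib_left)
 also have "\<dots> <= C * rate_bound"
  unfolding rate_bound_def using C y finite_S
  by (intro mult_left_mono member_le_sum[of y S "\<lambda>y. \<Sum>z\<in>S. \<bar>Q y z\<bar>"]) (auto intro: sum_nonneg)
 finally show ?thesis by (simp add: mult.commute)
qed

lemma L_power_bound:
 assumes y: "y \<in> S" and \<psi>: "\<And>z. z \<in> S ==> \<bar>\<psi> z\<bar> <= C"
 shows "\<bar>(L ^^ k) \<psi> y\<bar> <= rate_bound ^ k * C"
 using y
proof (induction k arbitrary: y)
 case 0
 then show ?case using \<psi> by simp
next
 case (Suc k)
 have "\<bar>L ((L ^^ k) \<psi>) y\<bar> <= rate_bound * (rate_bound ^ k * C)"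
  by (rule L_bound[OF Suc.prems Suc.IH])
 then show ?case by (simp add: mult.assoc)
qed

lemma L_power_cong:
 assumes "y \<in> S" "\<And>z. z \<in> S ==> \<psi> z = \<phi> z"
 shows "(L ^^ k) \<psi> y = (L ^^ k) \<phi> y"
 using assms(1) by (induction k arbitrary: y) (auto simp: L_eq assms(2))

lemma L_power_sum:
 assumes "y \<in> S"
 shows "(L ^^ k) (\<lambda>\<nu>. \<Sum>i\<in>A. c i * f i \<nu>) y = (\<Sum>i\<in>A. c i * (L ^^ k) (f i) y)"
 using assms
proof (induction k arbitrary: y)
 case (Suc k)
 have "L ((L ^^ k) (\<lambda>\<nu>. \<Sum>i\<in>A. c i * f i \<nu>)) y = (\<Sum>z\<in>S. (\<Sum>i\<in>A. c i * (L ^^ k) (f i) z) * Q y z)"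
  unfolding L_eq[OF Suc.prems] by (intro sum.cong refl) (simp add: Suc.IH)
 also have "\<dots> = (\<Sum>i\<in>A. c i * (\<Sum>z\<in>S. (L ^^ k) (f i) z * Q y z))"
  unfolding sum_distrib_right sum_distrib_left by (subst sum.swap) (simp add: mult.assoc)
 finally show ?case by (simp add: L_eq[OF Suc.prems])
qed simp

lemma semigroup_summable:
 assumes y: "y \<in> S"
 shows "summable (\<lambda>k. t ^ k / fact k * (L ^^ k) \<psi> y)"
proof -
 define C where "C = (\<Sum>z\<in>S. \<bar>\<psi> z\<bar>)"
 have C: "\<bar>\<psi> z\<bar> <= C" if "z \<in> S" for z
  unfolding C_def using that finite_S by (intro member_le_sum) auto
 have "summable (\<lambda>k. (\<bar>t\<bar> * rate_bound) ^ k /\<^sub>R fact k)" by (rule summable_exp_generic)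
 then have "summable (\<lambda>k. (\<bar>t\<bar> * rate_bound) ^ k / fact k * C)"
  by (intro summable_mult2) (simp add: divide_inverse mult.commute)
 then show ?thesis
 proof (rule summable_comparison_test'[where N=0])
  fix k
  have "norm (t ^ k / fact k * (L ^^ k) \<psi> y) = \<bar>t\<bar> ^ k / fact k * \<bar>(L ^^ k) \<psi> y\<bar>"
   by (simp add: abs_mult power_abs)
  also have "\<dots> <= \<bar>t\<bar> ^ k / fact k * (rate_bound ^ k * C)"
   by (intro mult_left_mono L_power_bound[OF y C]) auto
  finally show "norm (t ^ k / fact k * (L ^^ k) \<psi> y) <= (\<bar>t\<bar> * rate_bound) ^ k / fact k * C"
   by (simp add: power_mult_distrib)
 qed
qed

text \<open>Turns sums over transition probabilities into one application of the semigroup; powers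
  of \<open>L\<close> are linear on \<open>S\<close>, and the finite sum commutes with the
  series.\<close>

lemma semigroup_expand:
 assumes y: "y \<in> S"
 shows "(\<Sum>z\<in>S. \<psi> z * generated_semigroup L t (indicator {z}) y) = generated_semigroup L t \<psi> y"
proof -
 have rep: "\<psi> v = (\<Sum>z\<in>S. \<psi> z * indicator {z} v)" if "v \<in> S" for v
 proof -
  have "(\<Sum>z\<in>S. \<psi> z * indicator {z} v) = (\<Sum>z\<in>S. if z = v then \<psi> v else 0)"
   by (intro sum.cong) (auto simp: indicator_def)
  with that finite_S show ?thesis by simp
 qed
 have pow: "(L ^^ k) \<psi> y = (\<Sum>z\<in>S. \<psi> z * (L ^^ k) (indicator {z}) y)" for k
  using L_power_cong[where k=k, OF y rep] L_power_sum[where k=k and c=\<psi> and f="\<lambda>z. indicator {z}" and A=S, OF y] by simp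
 have "generated_semigroup L t \<psi> y = (\<Sum>k. \<Sum>z\<in>S. \<psi> z * (t ^ k / fact k * (L ^^ k) (indicator {z}) y))"
  unfolding generated_semigroup_def pow by (intro suminf_cong) (simp add: sum_distrib_left mult.left_commute)
 also have "\<dots> = (\<Sum>z\<in>S. \<Sum>k. \<psi> z * (t ^ k / fact k * (L ^^ k) (indicator {z}) y))"
  by (intro suminf_sum summable_mult semigroup_summable y)
 also have "\<dots> = (\<Sum>z\<in>S. \<psi> z * generated_semigroup L t (indicator {z}) y)"
  unfolding generated_semigroup_def by (intro sum.cong refl suminf_mult semigroup_summable y)
 finally show ?thesis ..
qed

text \<open>All terms of the series from the second on contain \<open>t\<close> to a power at least
  2, and for \<open>t <= 1\<close> they are dominated by \<open>t\<^sup>2\<close> times the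
  exponential series of the norm bound.\<close>

lemma semigroup_taylor:
 assumes y: "y \<in> S" and \<psi>: "\<And>z. z \<in> S ==> \<bar>\<psi> z\<bar> <= C" and t: "0 <= t" "t <= 1"
 shows "generated_semigroup L t \<psi> y <= \<psi> y + t * L \<psi> y + t\<^sup>2 * (C * exp rate_bound)"
proof -
 have C: "0 <= C" using \<psi>[OF y] by linarith
 let ?f = "\<lambda>k. t ^ k / fact k * (L ^^ k) \<psi> y"
 have sum_f: "summable ?f" by (rule semigroup_summable[OF y])
 have "generated_semigroup L t \<psi> y = (\<Sum>k. ?f (k + 2)) + (\<Sum>k<2. ?f k)"
  unfolding generated_semigroup_def by (rule suminf_split_initial_segment[OF sum_f])
 moreover have "(\<Sum>k<2. ?f k) = \<psi> y + t * L \<psi> y" by (simp add: numeral_2_eq_2)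
 moreover have "(\<Sum>k. ?f (k + 2)) <= t\<^sup>2 * (C * exp rate_bound)"
 proof -
  let ?g = "\<lambda>k. rate_bound ^ k / fact k"
  have g: "?g sums exp rate_bound"
   using exp_converges[of rate_bound] by (simp add: divide_inverse mult.commute)
  have "(\<Sum>k. ?g (k + 2)) <= exp rate_bound"
   using suminf_split_initial_segment[OF sums_summable[OF g], of 2] sums_unique[OF g] rate_bound_nonneg
   by (simp add: numeral_2_eq_2)
  moreover have "(\<Sum>k. ?f (k + 2)) <= (\<Sum>k. t\<^sup>2 * C * ?g (k + 2))"
  proof (rule suminf_le)
   show "summable (\<lambda>k. ?f (k + 2))" using sum_f by (subst summable_iff_shift)
   have "summable (\<lambda>k. ?g (k + 2))" using sums_summable[OF g] by (subst summable_iff_shift)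
   then show "summable (\<lambda>k. t\<^sup>2 * C * ?g (k + 2))" by (rule summable_mult)
   fix k
   have "?f (k + 2) <= t ^ (k + 2) / fact (k + 2) * (rate_bound ^ (k + 2) * C)"
    using t abs_le_D1[OF L_power_bound[where k="k + 2" and \<psi>=\<psi> and C=C, OF y \<psi>]] by (intro mult_left_mono) auto
   also have "t ^ (k + 2) <= t\<^sup>2" using t power_decreasing[of 2 "k + 2" t] by simp
   then have "t ^ (k + 2) / fact (k + 2) * (rate_bound ^ (k + 2) * C) <= t\<^sup>2 / fact (k + 2) * (rate_bound ^ (k + 2) * C)"
    using C rate_bound_nonneg by (intro mult_right_mono divide_right_mono) auto
   finally show "?f (k + 2) <= t\<^sup>2 * C * ?g (k + 2)" by (simp add: mult_ac)
  qed
  moreover have "(\<Sum>k. t\<^sup>2 * C * ?g (k + 2)) = t\<^sup>2 * C * (\<Sum>k. ?g (k + 2))"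
   using sums_summable[OF g] by (intro suminf_mult) (subst summable_iff_shift)
  ultimately show ?thesis using C mult_left_mono[of "\<Sum>k. ?g (k + 2)" "exp rate_bound" "t\<^sup>2 * C"] by (simp add: mult.assoc)
 qed
 ultimately show ?thesis by linarith
qed

lemma semigroup_one:
 assumes y: "y \<in> S" and 0: "\<And>z. z \<in> S ==> L (\<lambda>_. 1) z = 0"
 shows "generated_semigroup L t (\<lambda>_. 1) y = 1"
proof -
 have "(L ^^ Suc k) (\<lambda>_. 1) z = 0" if "z \<in> S" for k z
  using that by (induction k arbitrary: z) (auto simp: 0 L_eq)
 then have pow: "(L ^^ k) (\<lambda>_. 1) y = (if k = 0 then 1 else 0)" for k
  using y by (cases k) auto
 show ?thesis unfolding generated_semigroup_def pow by (subst suminf_finite[of "{0}"]) auto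
qed

end

lemma sum_PiE_Suc:
 assumes "finite S"
 shows "(\<Sum>f\<in>{..Suc n} \<rightarrow>\<^sub>E S. g f) = (\<Sum>f\<in>{..n} \<rightarrow>\<^sub>E S. \<Sum>z\<in>S. g (f(Suc n := z)))"
proof -
 have ins: "{..Suc n} = insert (Suc n) {..n}" by auto
 have "(\<Sum>f\<in>{..Suc n} \<rightarrow>\<^sub>E S. g f) = (\<Sum>(z, f)\<in>S \<times> ({..n} \<rightarrow>\<^sub>E S). g (f(Suc n := z)))"
  unfolding ins PiE_insert_eq
  by (subst sum.reindex) (auto intro!: inj_combinator simp: case_prod_beta o_def)
 also have "\<dots> = (\<Sum>z\<in>S. \<Sum>f\<in>{..n} \<rightarrow>\<^sub>E S. g (f(Suc n := z)))"
  by (rule sum.cartesian_product[symmetric])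
 also have "\<dots> = (\<Sum>f\<in>{..n} \<rightarrow>\<^sub>E S. \<Sum>z\<in>S. g (f(Suc n := z)))" by (rule sum.swap)
 finally show ?thesis .
qed

text \<open>\<open>I\<close> is the event that fixes the initial data. The Markov identities are
  weighted with its probability, so no conditional law has to be formed.\<close>

locale finite_markov_chain = prob_space M + finite_generator S L Q
 for M :: "'a measure" and S :: "'s set" and L :: "('s => real) => 's => real" and Q +
 fixes X :: "'a => real => 's" and I :: "'a => bool" and y\<^sub>0 :: 's
 assumes markov: "\<And>n s y t z. 0 <= s 0 ==> (\<forall>i<n. s i <= s (Suc i)) ==> 0 <= t ==>
   \<P>(\<omega> in M. I \<omega> \<and> (\<forall>i\<le>n. X \<omega> (s i) = y i) \<and> X \<omega> (s n + t) = z) =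
   \<P>(\<omega> in M. I \<omega> \<and> (\<forall>i\<le>n. X \<omega> (s i) = y i)) * generated_semigroup L t (indicator {z}) (y n)"
  and X_meas: "\<And>t z. 0 <= t ==> z \<in> S ==> {\<omega>\<in>space M. X \<omega> t = z} \<in> sets M"
  and I_meas: "{\<omega>\<in>space M. I \<omega>} \<in> sets M"
  and start: "y\<^sub>0 \<in> S" "\<And>\<omega>. \<omega> \<in> space M ==> I \<omega> ==> X \<omega> 0 = y\<^sub>0"
  and conservative: "\<And>z. z \<in> S ==> L (\<lambda>_. 1) z = 0"
begin

definition history :: "(nat => real) => nat => (nat => 's) => 'a set" where
 "history s n y = {\<omega>\<in>space M. I \<omega> \<and> (\<forall>i\<le>n. X \<omega> (s i) = y i)}"

lemma history_meas:
 assumes s: "\<And>i. 0 <= s i" and y: "\<And>i. i <= n ==> y i \<in> S"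
 shows "history s n y \<in> sets M"
proof -
 have "history s n y = {\<omega>\<in>space M. I \<omega>} \<inter> (\<Inter>i\<in>{..n}. {\<omega>\<in>space M. X \<omega> (s i) = y i})"
  by (auto simp: history_def)
 also have "\<dots> \<in> sets M" using s y by (intro sets.Int I_meas sets.finite_INT X_meas) auto
 finally show ?thesis .
qed

lemma in_S_meas: "0 <= t ==> {\<omega>\<in>space M. I \<omega> \<and> X \<omega> t \<notin> S} \<in> sets M"
proof -
 assume t: "0 <= t"
 have "{\<omega>\<in>space M. I \<omega> \<and> X \<omega> t \<notin> S} = {\<omega>\<in>space M. I \<omega>} - (\<Union>z\<in>S. {\<omega>\<in>space M. X \<omega> t = z})" by auto
 also have "\<dots> \<in> sets M" using t finite_S by (intro sets.Diff I_meas sets.finite_UN X_meas) auto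
 finally show ?thesis .
qed

text \<open>The transition probabilities into \<open>S\<close> sum to the semigroup applied to the
  constant 1, which is 1 because \<open>L\<close> annihilates constants.\<close>

lemma stays_in_S:
 assumes t: "0 <= t"
 shows "prob {\<omega>\<in>space M. I \<omega> \<and> X \<omega> t \<notin> S} = 0"
proof -
 have I0: "{\<omega>\<in>space M. I \<omega> \<and> X \<omega> 0 = y\<^sub>0} = {\<omega>\<in>space M. I \<omega>}" using start(2) by auto
 have p: "prob {\<omega>\<in>space M. I \<omega> \<and> X \<omega> t = z} = prob {\<omega>\<in>space M. I \<omega>} * generated_semigroup L t (indicator {z}) y\<^sub>0" for z
 proof -
  have "{\<omega>\<in>space M. I \<omega> \<and> X \<omega> 0 = y\<^sub>0 \<and> X \<omega> t = z} = {\<omega>\<in>space M. I \<omega> \<and> X \<omega> t = z}" using start(2) by auto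
  then show ?thesis using markov[of "\<lambda>_. 0" 0 t "\<lambda>_. y\<^sub>0" z] t I0 by simp
 qed
 have zm: "{\<omega>\<in>space M. I \<omega> \<and> X \<omega> t = z} \<in> sets M" if "z \<in> S" for z
 proof -
  have "{\<omega>\<in>space M. I \<omega> \<and> X \<omega> t = z} = {\<omega>\<in>space M. I \<omega>} \<inter> {\<omega>\<in>space M. X \<omega> t = z}" by auto
  then show ?thesis using I_meas X_meas[OF t that] by simp
 qed
 have "prob (\<Union>z\<in>S. {\<omega>\<in>space M. I \<omega> \<and> X \<omega> t = z}) = (\<Sum>z\<in>S. prob {\<omega>\<in>space M. I \<omega> \<and> X \<omega> t = z})"
  using zm by (intro finite_measure_finite_Union finite_S) (auto simp: disjoint_family_on_def)
 also have "\<dots> = prob {\<omega>\<in>space M. I \<omega>} * (\<Sum>z\<in>S. 1 * generated_semigroup L t (indicator {z}) y\<^sub>0)"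
  by (simp add: p sum_distrib_left)
 also have "\<dots> = prob {\<omega>\<in>space M. I \<omega>}"
 proof -
  have "generated_semigroup L t (\<lambda>_. 1) y\<^sub>0 = 1"
   by (rule semigroup_one[OF start(1)]) (rule conservative)
  then show ?thesis unfolding semigroup_expand[OF start(1)] by simp
 qed
 finally have eq: "prob (\<Union>z\<in>S. {\<omega>\<in>space M. I \<omega> \<and> X \<omega> t = z}) = prob {\<omega>\<in>space M. I \<omega>}" .
 have "{\<omega>\<in>space M. I \<omega> \<and> X \<omega> t \<notin> S} = {\<omega>\<in>space M. I \<omega>} - (\<Union>z\<in>S. {\<omega>\<in>space M. I \<omega> \<and> X \<omega> t = z})" by auto
 then have "prob {\<omega>\<in>space M. I \<omega> \<and> X \<omega> t \<notin> S} = prob {\<omega>\<in>space M. I \<omega>} - prob (\<Union>z\<in>S. {\<omega>\<in>space M. I \<omega> \<and> X \<omega> t = z})"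
  using zm finite_S I_meas by (simp only:) (intro finite_measure_Diff sets.finite_UN, auto)
 with eq show ?thesis by simp
qed

text \<open>Along the grid the expectation of the exponential of the compensated sum grows per step
  by at most the factor \<open>1 + K * h\<^sup>2\<close>, where \<open>K\<close> is the exponential
  in the bound; Markov's inequality at level \<open>exp \<rho>\<close> follows. The factor
  \<open>prob\<close> of \<open>I\<close> is kept so that the bounds for different initial data can
  be added.\<close>

lemma exponential_inequality:
 fixes w :: "nat => 's => 's => real" and \<theta> :: "nat => 's => real"
 assumes s0: "0 <= s\<^sub>0" and h: "0 <= h" "h <= 1"
  and w0: "\<And>i y. w i y y = 0" and wb: "\<And>i y z. y \<in> S ==> z \<in> S ==> w i y z <= Wb"
  and \<theta>b: "\<And>i y. y \<in> S ==> \<bar>\<theta> i y\<bar> <= Tb"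
  and drift: "\<And>i y. y \<in> S ==> L (\<lambda>z. exp (w i y z)) y <= \<theta> i y"
 defines "s \<equiv> (\<lambda>i. s\<^sub>0 + real i * h)"
 shows "\<exists>Z\<in>sets M. {\<omega>\<in>space M. I \<omega> \<and> \<rho> <= (\<Sum>i<n. w i (X \<omega> (s i)) (X \<omega> (s (Suc i))) - h * \<theta> i (X \<omega> (s i)))} \<subseteq> Z \<and>
  prob Z <= prob {\<omega>\<in>space M. I \<omega>} * exp (exp (Tb + Wb + rate_bound) * h\<^sup>2 * real n - \<rho>)"
proof -
 have s: "0 <= s i" for i using s0 h by (simp add: s_def)
 have s_step: "s (Suc i) = s i + h" for i by (simp add: s_def algebra_simps)
 have s_mono: "s i <= s (Suc i)" for i using h by (simp add: s_step)
 define K where "K = exp (Tb + Wb + rate_bound)"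
 define V where "V n y = (\<Sum>i<n. w i (y i) (y (Suc i)) - h * \<theta> i (y i))" for n and y :: "nat => 's"
 define p where "p n y = prob (history s n y)" for n y
 \<comment> \<open>The expectation of \<open>exp V\<close> on \<open>I\<close> with all grid values
   in \<open>S\<close>, written as a finite sum over histories.\<close>
 define W where "W n = (\<Sum>y\<in>{..n} \<rightarrow>\<^sub>E S. p n y * exp (V n y))" for n
 have fin: "finite ({..n} \<rightarrow>\<^sub>E S)" for n :: nat by (intro finite_PiE finite_S) auto
 have p0: "0 <= p n y" for n y by (simp add: p_def)
 \<comment> \<open>The drift hypothesis cancels the first order term against the compensator,
   through \<open>1 + u <= exp u\<close>; only the Taylor remainder is left.\<close>
 have step: "generated_semigroup L h (\<lambda>z. exp (w i y z)) y * exp (- h * \<theta> i y) <= 1 + K * h\<^sup>2" if y: "y \<in> S" for i y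
 proof -
  have "generated_semigroup L h (\<lambda>z. exp (w i y z)) y
    <= exp (w i y y) + h * L (\<lambda>z. exp (w i y z)) y + h\<^sup>2 * (exp Wb * exp rate_bound)"
   using wb[OF y] h by (intro semigroup_taylor[OF y]) auto
  also have "\<dots> <= 1 + h * \<theta> i y + h\<^sup>2 * (exp Wb * exp rate_bound)"
   using mult_left_mono[OF drift[OF y] h(1)] w0 by simp
  also have "\<dots> <= exp (h * \<theta> i y) + h\<^sup>2 * (exp Wb * exp rate_bound)"
   using exp_ge_add_one_self[of "h * \<theta> i y"] by simp
  finally have "generated_semigroup L h (\<lambda>z. exp (w i y z)) y * exp (- h * \<theta> i y)
    <= (exp (h * \<theta> i y) + h\<^sup>2 * (exp Wb * exp rate_bound)) * exp (- h * \<theta> i y)"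
   by (intro mult_right_mono) auto
  also have "\<dots> = 1 + h\<^sup>2 * (exp Wb * exp rate_bound * exp (- h * \<theta> i y))"
   by (simp add: distrib_right exp_add[symmetric] mult.assoc)
  also have "exp (- h * \<theta> i y) <= exp Tb"
  proof -
   have "- h * \<theta> i y <= h * \<bar>\<theta> i y\<bar>" using h mult_left_mono[of "- \<theta> i y" "\<bar>\<theta> i y\<bar>" h] by simp
   also have "\<dots> <= 1 * Tb" using h \<theta>b[OF y] by (intro mult_mono) auto
   finally show ?thesis by simp
  qed
  then have "1 + h\<^sup>2 * (exp Wb * exp rate_bound * exp (- h * \<theta> i y)) <= 1 + h\<^sup>2 * (exp Wb * exp rate_bound * exp Tb)"
   by (intro add_left_mono mult_left_mono) auto
  also have "\<dots> = 1 + K * h\<^sup>2" by (simp add: K_def exp_add mult_ac)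
  finally show ?thesis .
 qed
 have W_Suc: "W (Suc n) <= (1 + K * h\<^sup>2) * W n" for n
 proof -
  have "W (Suc n) = (\<Sum>f\<in>{..n} \<rightarrow>\<^sub>E S. \<Sum>z\<in>S. p (Suc n) (f(Suc n := z)) * exp (V (Suc n) (f(Suc n := z))))"
   unfolding W_def by (rule sum_PiE_Suc[OF finite_S])
  also have "\<dots> = (\<Sum>f\<in>{..n} \<rightarrow>\<^sub>E S. p n f * exp (V n f) * (generated_semigroup L h (\<lambda>z. exp (w n (f n) z)) (f n) * exp (- h * \<theta> n (f n))))"
  proof (intro sum.cong refl)
   fix f assume f: "f \<in> {..n} \<rightarrow>\<^sub>E S"
   then have fn: "f n \<in> S" by auto
   have "p (Suc n) (f(Suc n := z)) = p n f * generated_semigroup L h (indicator {z}) (f n)" for z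
   proof -
    have "history s (Suc n) (f(Suc n := z)) = {\<omega>\<in>space M. I \<omega> \<and> (\<forall>i\<le>n. X \<omega> (s i) = f i) \<and> X \<omega> (s n + h) = z}"
     by (auto simp: history_def le_Suc_eq s_step)
    then show ?thesis using markov[of s n h f z] s s_mono h by (simp add: p_def history_def)
   qed
   moreover have "V (Suc n) (f(Suc n := z)) = V n f + (w n (f n) z - h * \<theta> n (f n))" for z
   proof -
    have "V n (f(Suc n := z)) = V n f" unfolding V_def by (intro sum.cong) auto
    then show ?thesis by (simp add: V_def)
   qed
   ultimately have "(\<Sum>z\<in>S. p (Suc n) (f(Suc n := z)) * exp (V (Suc n) (f(Suc n := z))))
     = (\<Sum>z\<in>S. p n f * exp (V n f) * exp (- h * \<theta> n (f n)) * (exp (w n (f n) z) * generated_semigroup L h (indicator {z}) (f n)))"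
    by (intro sum.cong refl) (simp add: exp_add exp_diff exp_minus divide_inverse mult_ac)
   also have "\<dots> = p n f * exp (V n f) * exp (- h * \<theta> n (f n)) * generated_semigroup L h (\<lambda>z. exp (w n (f n) z)) (f n)"
    unfolding sum_distrib_left[symmetric] semigroup_expand[OF fn] ..
   finally show "(\<Sum>z\<in>S. p (Suc n) (f(Suc n := z)) * exp (V (Suc n) (f(Suc n := z)))) =
     p n f * exp (V n f) * (generated_semigroup L h (\<lambda>z. exp (w n (f n) z)) (f n) * exp (- h * \<theta> n (f n)))"
    by (simp add: mult_ac)
  qed
  also have "\<dots> <= (\<Sum>f\<in>{..n} \<rightarrow>\<^sub>E S. p n f * exp (V n f) * (1 + K * h\<^sup>2))"
  proof (intro sum_mono mult_left_mono)
   fix f assume "f \<in> {..n} \<rightarrow>\<^sub>E S"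
   then have "f n \<in> S" by auto
   then show "generated_semigroup L h (\<lambda>z. exp (w n (f n) z)) (f n) * exp (- h * \<theta> n (f n)) <= 1 + K * h\<^sup>2" by (rule step)
  qed (use p0 in auto)
  also have "\<dots> = (1 + K * h\<^sup>2) * W n" by (simp add: W_def sum_distrib_left mult.commute)
  finally show ?thesis .
 qed
 have disj: "disjoint_family_on (history s n) ({..n} \<rightarrow>\<^sub>E S)" for n
  unfolding disjoint_family_on_def
 proof (intro ballI impI)
  fix f g assume fg: "f \<in> {..n} \<rightarrow>\<^sub>E S" "g \<in> {..n} \<rightarrow>\<^sub>E S" "f \<noteq> g"
  have "f = g" if "\<omega> \<in> history s n f" "\<omega> \<in> history s n g" for \<omega>
   using fg(1,2) that by (intro PiE_ext[OF fg(1,2)]) (auto simp: history_def)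
  with fg(3) show "history s n f \<inter> history s n g = {}" by blast
 qed
 have hist: "history s n f \<in> sets M" if "f \<in> {..n} \<rightarrow>\<^sub>E S" for n f
  using that s by (intro history_meas) auto
 have W0: "W 0 <= prob {\<omega>\<in>space M. I \<omega>}"
 proof -
  have "W 0 = (\<Sum>f\<in>{..0} \<rightarrow>\<^sub>E S. prob (history s 0 f))" by (simp add: W_def V_def p_def)
  also have "\<dots> = prob (\<Union>f\<in>{..0} \<rightarrow>\<^sub>E S. history s 0 f)"
   using hist[of _ 0] by (intro finite_measure_finite_Union[symmetric] fin disj) auto
  also have "\<dots> <= prob {\<omega>\<in>space M. I \<omega>}"
   by (intro finite_measure_mono I_meas) (auto simp: history_def)
  finally show ?thesis .
 qed
 have W_le: "W n <= prob {\<omega>\<in>space M. I \<omega>} * exp (K * h\<^sup>2 * real n)" for n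
 proof (induction n)
  case (Suc n)
  have "W (Suc n) <= exp (K * h\<^sup>2) * W n"
   using W_Suc[of n] exp_ge_add_one_self[of "K * h\<^sup>2"] p0
   by (elim order_trans) (intro mult_right_mono, auto simp: W_def intro!: sum_nonneg)
  also have "\<dots> <= exp (K * h\<^sup>2) * (prob {\<omega>\<in>space M. I \<omega>} * exp (K * h\<^sup>2 * real n))"
   by (intro mult_left_mono Suc.IH) auto
  also have "\<dots> = prob {\<omega>\<in>space M. I \<omega>} * exp (K * h\<^sup>2 * real (Suc n))"
   by (simp add: exp_add[symmetric] algebra_simps)
  finally show ?case .
 qed (use W0 in simp)
 let ?F = "{f \<in> {..n} \<rightarrow>\<^sub>E S. \<rho> <= V n f}"
 let ?Z1 = "\<Union>f\<in>?F. history s n f"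
 \<comment> \<open>A history that leaves \<open>S\<close> at some grid time is not counted in
   \<open>?Z1\<close>; such outcomes form this null set.\<close>
 let ?Z2 = "\<Union>i\<in>{..n}. {\<omega>\<in>space M. I \<omega> \<and> X \<omega> (s i) \<notin> S}"
 have Z1: "?Z1 \<in> sets M" using hist fin[of n] by (intro sets.finite_UN) auto
 have Z2: "?Z2 \<in> sets M" using in_S_meas s by (intro sets.finite_UN) auto
 have "prob ?Z1 = (\<Sum>f\<in>?F. p n f)"
  unfolding p_def using hist[of _ n] fin[of n]
  by (intro finite_measure_finite_Union disjoint_family_on_mono[OF _ disj]) auto
 also have "\<dots> <= (\<Sum>f\<in>?F. p n f * (exp (V n f) * exp (- \<rho>)))"
 proof (intro sum_mono)
  fix f assume "f \<in> ?F"
  then have "1 <= exp (V n f) * exp (- \<rho>)" by (simp add: exp_add[symmetric])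
  then show "p n f <= p n f * (exp (V n f) * exp (- \<rho>))" using p0[of n f] mult_left_mono[of 1 _ "p n f"] by fastforce
 qed
 also have "\<dots> <= (\<Sum>f\<in>{..n} \<rightarrow>\<^sub>E S. p n f * (exp (V n f) * exp (- \<rho>)))"
  using fin[of n] p0 by (intro sum_mono2) auto
 also have "\<dots> = W n * exp (- \<rho>)" by (simp add: W_def sum_distrib_right mult.assoc)
 also have "\<dots> <= prob {\<omega>\<in>space M. I \<omega>} * exp (K * h\<^sup>2 * real n) * exp (- \<rho>)"
  by (intro mult_right_mono W_le) auto
 also have "\<dots> = prob {\<omega>\<in>space M. I \<omega>} * exp (K * h\<^sup>2 * real n - \<rho>)" by (simp add: exp_diff exp_minus field_simps)
 finally have pZ1: "prob ?Z1 <= prob {\<omega>\<in>space M. I \<omega>} * exp (K * h\<^sup>2 * real n - \<rho>)" .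
 have "prob ?Z2 <= (\<Sum>i\<in>{..n}. prob {\<omega>\<in>space M. I \<omega> \<and> X \<omega> (s i) \<notin> S})"
  using in_S_meas s by (intro finite_measure_subadditive_finite) auto
 also have "\<dots> = 0" by (intro sum.neutral ballI stays_in_S s)
 finally have pZ2: "prob ?Z2 <= 0" .
 have "{\<omega>\<in>space M. I \<omega> \<and> \<rho> <= (\<Sum>i<n. w i (X \<omega> (s i)) (X \<omega> (s (Suc i))) - h * \<theta> i (X \<omega> (s i)))} \<subseteq> ?Z1 \<union> ?Z2"
 proof safe
  fix \<omega> assume \<omega>: "\<omega> \<in> space M" "I \<omega>" and le: "\<rho> <= (\<Sum>i<n. w i (X \<omega> (s i)) (X \<omega> (s (Suc i))) - h * \<theta> i (X \<omega> (s i)))"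
   and no: "\<omega> \<notin> ?Z2"
  define f where "f = restrict (\<lambda>i. X \<omega> (s i)) {..n}"
  have f: "f \<in> {..n} \<rightarrow>\<^sub>E S" using no \<omega> by (auto simp: f_def)
  have "V n f = (\<Sum>i<n. w i (X \<omega> (s i)) (X \<omega> (s (Suc i))) - h * \<theta> i (X \<omega> (s i)))"
   unfolding V_def by (intro sum.cong) (auto simp: f_def)
  moreover have "\<omega> \<in> history s n f" using \<omega> by (auto simp: history_def f_def)
  ultimately show "\<omega> \<in> ?Z1" using f le by auto
 qed
 moreover have "prob (?Z1 \<union> ?Z2) <= prob {\<omega>\<in>space M. I \<omega>} * exp (K * h\<^sup>2 * real n - \<rho>)"
  using measure_Un_le[OF Z1 Z2] pZ1 pZ2 by linarith
 ultimately show ?thesis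
  using Z1 Z2 unfolding K_def by (intro bexI[of _ "?Z1 \<union> ?Z2"] conjI) auto
qed

end


section \<open>Time grids and bounds for the jump rates\<close>

text \<open>The summand 1 in the index picks the grid point strictly to the right of the time, at
  distance at most one mesh, so right continuity is enough.\<close>

lemma rcll_grid_limit:
 assumes g: "rcll g" and s: "0 <= s\<^sub>0" and d: "0 < \<delta>" and x: "0 <= x" "x < 1"
 shows "N > 0 ==> nat \<lfloor>x * real N\<rfloor> + 1 <= N"
  and "(\<lambda>N. g (s\<^sub>0 + real (nat \<lfloor>x * real N\<rfloor> + 1) * (\<delta> / real N))) \<longlonglongrightarrow> g (s\<^sub>0 + x * \<delta>)"
proof -
 define t where "t = s\<^sub>0 + x * \<delta>"
 define j where "j N = nat \<lfloor>x * real N\<rfloor> + 1" for N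
 define v where "v N = s\<^sub>0 + real (j N) * (\<delta> / real N)" for N
 have jr: "real (j N) = of_int \<lfloor>x * real N\<rfloor> + 1" for N
  using x by (simp add: j_def)
 show "nat \<lfloor>x * real N\<rfloor> + 1 <= N" if "N > 0"
 proof -
  have "x * real N < real N" using x that by simp
  then have "\<lfloor>x * real N\<rfloor> < int N" by linarith
  then have "real (j N) <= real N" unfolding jr by linarith
  then show ?thesis by (simp add: j_def)
 qed
 have v1: "t < v N" if "N > 0" for N
 proof -
  have "x * real N < real (j N)" unfolding jr by linarith
  then have "x * real N * (\<delta> / real N) < real (j N) * (\<delta> / real N)" using that d by (intro mult_strict_right_mono) auto
  then show ?thesis using that by (simp add: v_def t_def)
 qed
 have v2: "v N <= t + \<delta> / real N" if "N > 0" for N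
 proof -
  have "real (j N) <= x * real N + 1" unfolding jr by linarith
  then have "real (j N) * (\<delta> / real N) <= (x * real N + 1) * (\<delta> / real N)" using that d by (intro mult_right_mono) auto
  also have "\<dots> = x * \<delta> + \<delta> / real N" using that by (simp add: field_simps)
  finally show ?thesis by (simp add: v_def t_def)
 qed
 have "v \<longlonglongrightarrow> t"
 proof (rule tendsto_sandwich[where f="\<lambda>_. t" and h="\<lambda>N. t + \<delta> / real N"])
  show "eventually (\<lambda>N. t <= v N) sequentially"
   using eventually_gt_at_top[of 0] by eventually_elim (use v1 in \<open>auto intro: less_imp_le\<close>)
  show "eventually (\<lambda>N. v N <= t + \<delta> / real N) sequentially"
   using eventually_gt_at_top[of 0] by eventually_elim (use v2 in auto)
  have "(\<lambda>N. t + \<delta> / real N) \<longlonglongrightarrow> t + 0" by (intro tendsto_intros lim_const_over_n)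
  then show "(\<lambda>N. t + \<delta> / real N) \<longlonglongrightarrow> t" by simp
 qed simp
 moreover have "eventually (\<lambda>N. v N \<in> {t<..} \<and> v N \<noteq> t) sequentially"
  using eventually_gt_at_top[of 0]
 proof eventually_elim
  case (elim N)
  then show ?case using v1[of N] by simp
 qed
 ultimately have "filterlim v (at_right t) sequentially" by (simp add: filterlim_at)
 moreover have "0 <= t" using s d x by (simp add: t_def)
 ultimately have "(\<lambda>N. g (v N)) \<longlonglongrightarrow> g t" using rcll_right[OF g] by (auto intro: filterlim_compose)
 then show "(\<lambda>N. g (s\<^sub>0 + real (nat \<lfloor>x * real N\<rfloor> + 1) * (\<delta> / real N))) \<longlonglongrightarrow> g (s\<^sub>0 + x * \<delta>)"
  by (simp only: v_def j_def t_def)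
qed

lemma rcll_grid_approximation:
 assumes g: "rcll g" and s: "0 <= s\<^sub>0" and d: "0 < \<delta>" and t: "s\<^sub>0 <= t" "t <= s\<^sub>0 + \<delta>"
 obtains j where "\<And>N :: nat. N > 0 ==> j N <= N" "(\<lambda>N. g (s\<^sub>0 + real (j N) * (\<delta> / real N))) \<longlonglongrightarrow> g t"
\<comment> \<open>At the right end no later grid point exists, but the last grid point is
  exact.\<close>
proof (cases "t = s\<^sub>0 + \<delta>")
 case True
 have "eventually (\<lambda>N. g (s\<^sub>0 + real N * (\<delta> / real N)) = g t) sequentially"
  using eventually_gt_at_top[of 0] by eventually_elim (simp add: True)
 then show ?thesis by (intro that[of "\<lambda>N. N"] tendsto_eventually) auto
next
 case False
 define x where "x = (t - s\<^sub>0) / \<delta>"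
 have x: "0 <= x" "x < 1" using t d False by (auto simp: x_def field_simps)
 have "t = s\<^sub>0 + x * \<delta>" using d by (simp add: x_def)
 with rcll_grid_limit[OF g s d x] show ?thesis by (intro that[of "\<lambda>N. nat \<lfloor>x * real N\<rfloor> + 1"]) auto
qed

lemma telescoping_positive_part:
 fixes x :: "nat => real"
 assumes "j <= N"
 shows "x j - x 0 <= (\<Sum>k<N. max 0 (x (Suc k) - x k))"
proof -
 have "x j - x 0 = (\<Sum>k<j. x (Suc k) - x k)" by (simp add: sum_lessThan_telescope)
 also have "\<dots> <= (\<Sum>k<j. max 0 (x (Suc k) - x k))" by (intro sum_mono) auto
 also have "\<dots> <= (\<Sum>k<N. max 0 (x (Suc k) - x k))" using assms by (intro sum_mono2) auto
 finally show ?thesis .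
qed

lemma telescoping_abs:
 fixes x :: "nat => real"
 assumes "i <= N" "j <= N"
 shows "\<bar>x i - x j\<bar> <= (\<Sum>k<N. \<bar>x (Suc k) - x k\<bar>)"
proof -
 have *: "\<bar>x j - x i\<bar> <= (\<Sum>k<N. \<bar>x (Suc k) - x k\<bar>)" if "i <= j" "j <= N" for i j
 proof -
  have "x j - x i = (\<Sum>k=i..<j. x (Suc k) - x k)" using that(1) by (simp add: sum_Suc_diff')
  also have "\<bar>\<dots>\<bar> <= (\<Sum>k=i..<j. \<bar>x (Suc k) - x k\<bar>)" by (rule sum_abs)
  also have "\<dots> <= (\<Sum>k<N. \<bar>x (Suc k) - x k\<bar>)" using that by (intro sum_mono2) auto
  finally show ?thesis .
 qed
 show ?thesis using *[of i j] *[of j i] assms by (cases "i <= j") (auto simp: abs_minus_commute)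
qed

lemma exp_le_quadratic:
 fixes u :: real
 assumes "u <= 1"
 shows "exp u <= 1 + u + u\<^sup>2"
proof (cases "u >= 0")
 case True
 then show ?thesis using exp_bound[of u] assms by simp
next
 case False
 have "0 < 1 - u" using False by simp
 have "1 - u <= exp (- u)" using exp_ge_add_one_self[of "- u"] by simp
 then have "exp u * (1 - u) <= 1" using mult_left_mono[of "1 - u" "exp (- u)" "exp u"] by (simp add: exp_minus)
 \<comment> \<open>The product equals \<open>1 - u ^ 3\<close>, which is at least 1 for negative
   \<open>u\<close>.\<close>
 also have "1 <= (1 + u + u\<^sup>2) * (1 - u)"
 proof -
  have "(1 + u + u\<^sup>2) * (1 - u) = 1 + - u * u\<^sup>2" by (simp add: algebra_simps power2_eq_square)
  moreover have "0 <= - u * u\<^sup>2" using False by (intro mult_nonneg_nonneg) auto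
  ultimately show ?thesis by linarith
 qed
 finally show ?thesis using \<open>0 < 1 - u\<close> by (simp add: mult_le_cancel_right)
qed

lemma exp_minus_one_le_double:
 fixes u :: real
 assumes "0 <= u" "u <= v" "v <= 1"
 shows "exp u - 1 <= 2 * v"
proof -
 have "u\<^sup>2 <= 1 * u" unfolding power2_eq_square using assms by (intro mult_right_mono) auto
 then show ?thesis using exp_le_quadratic[of u] assms by linarith
qed

locale sbd_rates =
 fixes eps \<alpha> \<beta> :: real and a b :: "real => real" and \<alpha>m \<beta>m Ka Kb :: real
 assumes eps: "0 < eps" "eps <= 1"
  and alpha: "0 <= \<alpha>" "\<alpha> <= \<alpha>m" and beta: "0 <= \<beta>" "\<beta> <= \<beta>m"
  and a_bounds: "\<And>x. 0 <= x ==> 0 <= a x" "\<And>x. 0 <= x ==> a x <= Ka * (1 + x)"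
  and b_bounds: "\<And>x. 0 <= x ==> 0 <= b x" "\<And>x. 0 <= x ==> b x <= Kb * (1 + x)"
begin

lemma Ka_nonneg: "0 <= Ka" and Kb_nonneg: "0 <= Kb"
 using a_bounds[of 0] b_bounds[of 0] by auto

lemma class_states: "y \<in> sbd_class eps m ==> y \<in> sbd_states eps"
 by (simp add: sbd_class_def)

lemma class_moment:
 assumes y: "y \<in> sbd_class eps m"
 shows "0 <= (LINT x|y. x)" "(LINT x|y. x) <= m" "0 <= m"
proof -
 obtain k :: nat where "(LINT x|y. x) = eps\<^sup>2 * real k" using sbd_states_moment[OF eps(1) class_states[OF y]] by blast
 then show 1: "0 <= (LINT x|y. x)" by simp
 show 2: "(LINT x|y. x) <= m" using sbd_class_transitions(1)[OF eps(1) y] by simp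
 show "0 <= m" using 1 2 by linarith
qed

lemma atoms_pos: "y \<in> sbd_class eps m ==> x \<in> atoms y ==> 0 < x"
 using sbd_states_atoms(2)[OF eps(1) class_states, of y m x] eps(1) by linarith

lemma nucleation_rate_bounds:
 assumes y: "y \<in> sbd_class eps m" and m: "m <= B"
 shows "0 <= \<alpha> * (m - (LINT x|y. x)) * (m - (LINT x|y. x) - eps\<^sup>2) / eps"
  and "\<alpha> * (m - (LINT x|y. x)) * (m - (LINT x|y. x) - eps\<^sup>2) / eps <= \<alpha>m * B\<^sup>2 / eps"
proof -
 let ?c = "m - (LINT x|y. x)"
 have c: "0 <= ?c" "?c <= B" "0 <= ?c * (?c - eps\<^sup>2)"
  using sbd_class_transitions(1,2)[OF eps(1) y] class_moment[OF y] m by auto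
 then show "0 <= \<alpha> * ?c * (?c - eps\<^sup>2) / eps"
  using alpha eps(1) by (simp add: mult.assoc)
 have "?c * (?c - eps\<^sup>2) <= ?c * ?c" using c by (intro mult_left_mono) auto
 also have "\<dots> <= B\<^sup>2" unfolding power2_eq_square using c by (intro mult_mono) auto
 finally have "\<alpha> * (?c * (?c - eps\<^sup>2)) <= \<alpha>m * B\<^sup>2" using alpha c by (intro mult_mono) auto
 then show "\<alpha> * ?c * (?c - eps\<^sup>2) / eps <= \<alpha>m * B\<^sup>2 / eps"
  using eps(1) by (intro divide_right_mono) (auto simp: mult.assoc)
qed

lemma growth_rate_bounds:
 assumes y: "y \<in> sbd_class eps m" and m: "m <= B" and x: "x \<in> atoms y"
 shows "0 <= a x * (m - (LINT x|y. x)) * measure y {x} / eps\<^sup>2"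
  and "a x * (m - (LINT x|y. x)) * measure y {x} / eps\<^sup>2 <= Ka * B * ((1 + x) * measure y {x}) / eps\<^sup>2"
proof -
 let ?c = "m - (LINT x|y. x)"
 have c: "0 <= ?c" "?c <= B" using sbd_class_transitions(1)[OF eps(1) y] class_moment[OF y] m by auto
 have x0: "0 <= x" using atoms_pos[OF y x] by simp
 show "0 <= a x * ?c * measure y {x} / eps\<^sup>2" using a_bounds(1)[OF x0] c by simp
 have "a x * ?c * measure y {x} <= Ka * (1 + x) * B * measure y {x}"
  using a_bounds[OF x0] c by (intro mult_right_mono mult_mono) auto
 then show "a x * ?c * measure y {x} / eps\<^sup>2 <= Ka * B * ((1 + x) * measure y {x}) / eps\<^sup>2"
  by (intro divide_right_mono) (auto simp: mult_ac)
qed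

lemma shrink_rate_bounds:
 assumes y: "y \<in> sbd_class eps m" and x: "x \<in> atoms y"
 shows "0 <= b x * measure y {x} / eps\<^sup>2"
  and "b x * measure y {x} / eps\<^sup>2 <= Kb * ((1 + x) * measure y {x}) / eps\<^sup>2"
proof -
 have x0: "0 <= x" using atoms_pos[OF y x] by simp
 show "0 <= b x * measure y {x} / eps\<^sup>2" using b_bounds(1)[OF x0] by simp
 have "b x * measure y {x} <= Kb * (1 + x) * measure y {x}"
  using b_bounds[OF x0] by (intro mult_right_mono) auto
 then show "b x * measure y {x} / eps\<^sup>2 <= Kb * ((1 + x) * measure y {x}) / eps\<^sup>2"
  by (intro divide_right_mono) (auto simp: mult_ac)
qed

text \<open>For exponents in the unit interval \<open>exp u - 1\<close> is at most twice the bound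
  on \<open>u\<close>. The jump sizes, of order eps for nucleation and \<open>eps\<^sup>2\<close>
  for growth, then cancel exactly the denominators of the rates. The numbers \<open>k1\<close> to
  \<open>k4\<close> are jump sizes in macroscopic units.\<close>

lemma generator_exp_le:
 assumes y: "y \<in> sbd_class eps m" and m: "m <= B" and lam: "0 <= lam"
  and wy: "w y = 0" and w0: "\<And>z. 0 <= w z"
  and w1: "w (nucleate eps y) <= lam * eps * k1" "lam * eps * k1 <= 1" "0 <= k1"
  and w2: "measure y {2 * eps} \<noteq> 0 ==> w (denucleate eps y) <= lam * eps * k2" "lam * eps * k2 <= 1" "0 <= k2"
  and w3: "\<And>x. x \<in> atoms y ==> w (grow eps y x) <= lam * eps\<^sup>2 * k3 x" "\<And>x. x \<in> atoms y ==> lam * eps\<^sup>2 * k3 x <= 1" "\<And>x. x \<in> atoms y ==> 0 <= k3 x"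
  and w4: "\<And>x. x \<in> atoms y ==> x >= 3 * eps ==> w (shrink eps y x) <= lam * eps\<^sup>2 * k4 x" "\<And>x. x \<in> atoms y ==> lam * eps\<^sup>2 * k4 x <= 1" "\<And>x. x \<in> atoms y ==> 0 <= k4 x"
 shows "sbd_generator eps \<alpha> \<beta> a b m (\<lambda>z. exp (w z)) y <=
  2 * lam * (\<alpha>m * B\<^sup>2 * k1 + \<beta>m * measure y {2 * eps} * k2 +
   Ka * B * (\<Sum>x\<in>atoms y. (1 + x) * measure y {x} * k3 x) + Kb * (\<Sum>x\<in>atoms y. (1 + x) * measure y {x} * k4 x))"
proof -
 note e = eps(1)
 have s: "y \<in> sbd_states eps" by (rule class_states[OF y])
 have B: "0 <= B" using class_moment[OF y] m by linarith
 have fin: "finite (atoms y)" by (rule sbd_states_atoms(1)[OF e s])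
 have x0: "0 <= x" if "x \<in> atoms y" for x using atoms_pos[OF y that] by simp
 have 1: "(exp (w (nucleate eps y)) - exp (w y)) * (\<alpha> * (m - (LINT x|y. x)) * (m - (LINT x|y. x) - eps\<^sup>2) / eps) <= 2 * lam * (\<alpha>m * B\<^sup>2 * k1)"
 proof -
  have "(exp (w (nucleate eps y)) - exp (w y)) * (\<alpha> * (m - (LINT x|y. x)) * (m - (LINT x|y. x) - eps\<^sup>2) / eps)
    <= (2 * (lam * eps * k1)) * (\<alpha>m * B\<^sup>2 / eps)"
   using exp_minus_one_le_double[OF w0 w1(1,2)] wy nucleation_rate_bounds[OF y m] lam e w1(3)
   by (intro mult_mono) auto
  also have "\<dots> = 2 * lam * (\<alpha>m * B\<^sup>2 * k1)" using e by simp
  finally show ?thesis .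
 qed
 have 2: "(exp (w (denucleate eps y)) - exp (w y)) * (\<beta> * measure y {2 * eps} / eps) <= 2 * lam * (\<beta>m * measure y {2 * eps} * k2)"
 proof (cases "measure y {2 * eps} = 0")
  case False
  have "(exp (w (denucleate eps y)) - exp (w y)) * (\<beta> * measure y {2 * eps} / eps)
    <= (2 * (lam * eps * k2)) * (\<beta>m * measure y {2 * eps} / eps)"
   using exp_minus_one_le_double[OF w0 w2(1)[OF False] w2(2)] wy lam e w2(3) beta
   by (intro mult_mono divide_right_mono) auto
  also have "\<dots> = 2 * lam * (\<beta>m * measure y {2 * eps} * k2)" using e by simp
  finally show ?thesis .
 qed simp
 have 3: "(\<Sum>x\<in>atoms y. (exp (w (grow eps y x)) - exp (w y)) * (a x * (m - (LINT x|y. x)) * measure y {x} / eps\<^sup>2))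
   <= 2 * lam * (Ka * B * (\<Sum>x\<in>atoms y. (1 + x) * measure y {x} * k3 x))"
  unfolding sum_distrib_left
 proof (intro sum_mono)
  fix x assume x: "x \<in> atoms y"
  have "(exp (w (grow eps y x)) - exp (w y)) * (a x * (m - (LINT x|y. x)) * measure y {x} / eps\<^sup>2)
    <= (2 * (lam * eps\<^sup>2 * k3 x)) * (Ka * B * ((1 + x) * measure y {x}) / eps\<^sup>2)"
   using exp_minus_one_le_double[OF w0 w3(1,2)[OF x]] wy growth_rate_bounds[OF y m x] lam w3(3)[OF x]
   by (intro mult_mono) auto
  also have "\<dots> = 2 * lam * (Ka * B * ((1 + x) * measure y {x} * k3 x))" using e by simp
  finally show "(exp (w (grow eps y x)) - exp (w y)) * (a x * (m - (LINT x|y. x)) * measure y {x} / eps\<^sup>2)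
    <= 2 * lam * (Ka * B * ((1 + x) * measure y {x} * k3 x))" .
 qed
 have "(\<Sum>x\<in>atoms y \<inter> {3 * eps..}. (exp (w (shrink eps y x)) - exp (w y)) * (b x * measure y {x} / eps\<^sup>2))
   <= (\<Sum>x\<in>atoms y \<inter> {3 * eps..}. 2 * lam * (Kb * ((1 + x) * measure y {x} * k4 x)))"
 proof (intro sum_mono)
  fix x assume "x \<in> atoms y \<inter> {3 * eps..}"
  then have x: "x \<in> atoms y" and x3: "x >= 3 * eps" by auto
  have "(exp (w (shrink eps y x)) - exp (w y)) * (b x * measure y {x} / eps\<^sup>2)
    <= (2 * (lam * eps\<^sup>2 * k4 x)) * (Kb * ((1 + x) * measure y {x}) / eps\<^sup>2)"
   using exp_minus_one_le_double[OF w0 w4(1)[OF x x3] w4(2)[OF x]] wy shrink_rate_bounds[OF y x] lam w4(3)[OF x]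
   by (intro mult_mono) auto
  also have "\<dots> = 2 * lam * (Kb * ((1 + x) * measure y {x} * k4 x))" using e by simp
  finally show "(exp (w (shrink eps y x)) - exp (w y)) * (b x * measure y {x} / eps\<^sup>2)
    <= 2 * lam * (Kb * ((1 + x) * measure y {x} * k4 x))" .
 qed
 also have "\<dots> <= (\<Sum>x\<in>atoms y. 2 * lam * (Kb * ((1 + x) * measure y {x} * k4 x)))"
  using fin lam Kb_nonneg x0 w4(3) by (intro sum_mono2) auto
 also have "\<dots> = 2 * lam * (Kb * (\<Sum>x\<in>atoms y. (1 + x) * measure y {x} * k4 x))" by (simp add: sum_distrib_left)
 finally have 4: "(\<Sum>x\<in>atoms y \<inter> {3 * eps..}. (exp (w (shrink eps y x)) - exp (w y)) * (b x * measure y {x} / eps\<^sup>2))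
   <= 2 * lam * (Kb * (\<Sum>x\<in>atoms y. (1 + x) * measure y {x} * k4 x))" .
 show ?thesis
  unfolding sbd_generator_eq[OF e s] using 1 2 3 4 by (simp only: distrib_left)
qed

lemma generator_one: "y \<in> sbd_class eps m ==> sbd_generator eps \<alpha> \<beta> a b m (\<lambda>_. c) y = 0"
 by (simp add: sbd_generator_eq[OF eps(1) class_states])

end

section \<open>The rescaled process: from grids to paths\<close>

locale sbd_rescaled = sbd_rates eps \<alpha> \<beta> a b \<alpha>m \<beta>m Ka Kb
 for eps \<alpha> \<beta> :: real and a b :: "real => real" and \<alpha>m \<beta>m Ka Kb :: real +
 fixes M :: "'a measure" and \<mu>in :: "'a => real measure" and uin :: "'a => real" and \<mu> :: "'a => real => real measure"
 assumes process: "sbd_process M eps \<alpha> \<beta> a b \<mu>in uin \<mu>"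
begin

sublocale prob_space M using process by (simp add: sbd_process_def)

definition total_mass :: "'a => real" where "total_mass \<omega> = uin \<omega> + (LINT x|\<mu>in \<omega>. x)"

lemma in_states: "\<omega> \<in> space M ==> 0 <= t ==> \<mu> \<omega> t \<in> sbd_states eps"
 and in_start: "\<omega> \<in> space M ==> \<mu> \<omega> 0 = \<mu>in \<omega>"
 and uin_nat: "\<omega> \<in> space M ==> \<exists>k :: nat. uin \<omega> = eps\<^sup>2 * real k"
 and in_cadlag: "\<omega> \<in> space M ==> \<mu> \<omega> \<in> cadlag weak_topology"
 and path_measurable: "\<mu> \<in> M \<rightarrow>\<^sub>M borel_of (skorohod_topology weak_topology)"
 and uin_measurable: "uin \<in> borel_measurable M"
proof -
 show m: "\<mu> \<in> M \<rightarrow>\<^sub>M borel_of (skorohod_topology weak_topology)" using process by (simp add: sbd_process_def)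
 show "\<omega> \<in> space M ==> \<mu> \<omega> \<in> cadlag weak_topology" using measurable_space[OF m] by simp
qed (use process in \<open>auto simp: sbd_process_def\<close>)

lemma eval_measurable:
 "continuous_map weak_topology euclideanreal g ==> 0 <= t ==> (\<lambda>\<omega>. g (\<mu> \<omega> t)) \<in> borel_measurable M"
 using measurable_compose[OF path_measurable borel_measurable_evaluation] .

text \<open>Countably many ramp integrals, each a measurable function of the path, identify the
  state.\<close>

lemma eval_eq_measurable:
 assumes t: "0 <= t" and z: "z \<in> sbd_states eps"
 shows "{\<omega>\<in>space M. \<mu> \<omega> t = z} \<in> sets M"
proof -
 have zm: "z \<in> moment_measures" by (rule sbd_states_moment_measures[OF eps(1) z])
 have [measurable]: "(\<lambda>\<omega>. LINT x|\<mu> \<omega> t. ramp i x) \<in> borel_measurable M" for i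
  using eval_measurable[OF continuous_map_weak_integral(1)[OF ramp_bounded_continuous] t] .
 have "\<mu> \<omega> t = z \<longleftrightarrow> (\<forall>i. (LINT x|\<mu> \<omega> t. ramp i x) = (LINT x|z. ramp i x))" if "\<omega> \<in> space M" for \<omega>
  using moment_measures_eqI[OF sbd_states_moment_measures[OF eps(1) in_states[OF that t]] zm] by auto
 then have "{\<omega>\<in>space M. \<mu> \<omega> t = z} = {\<omega>\<in>space M. \<forall>i. (LINT x|\<mu> \<omega> t. ramp i x) = (LINT x|z. ramp i x)}" by auto
 also have "\<dots> \<in> sets M" by measurable
 finally show ?thesis .
qed

lemma chain:
 assumes \<nu>: "\<nu>\<^sub>0 \<in> sbd_states eps" and u: "u\<^sub>0 = eps\<^sup>2 * real k" and m: "m = u\<^sub>0 + (LINT x|\<nu>\<^sub>0. x)"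
 shows "finite_markov_chain M (sbd_class eps m) (sbd_generator eps \<alpha> \<beta> a b m)
  (\<lambda>y z. sbd_generator eps \<alpha> \<beta> a b m (indicator {z}) y) \<mu> (\<lambda>\<omega>. \<mu>in \<omega> = \<nu>\<^sub>0 \<and> uin \<omega> = u\<^sub>0) \<nu>\<^sub>0"
proof (intro finite_markov_chain.intro finite_generator.intro finite_markov_chain_axioms.intro prob_space_axioms)
 show "finite (sbd_class eps m)" by (rule finite_sbd_class[OF eps(1)])
 show "sbd_generator eps \<alpha> \<beta> a b m \<psi> y = (\<Sum>z\<in>sbd_class eps m. \<psi> z * sbd_generator eps \<alpha> \<beta> a b m (indicator {z}) y)"
  if "y \<in> sbd_class eps m" for \<psi> y by (rule sbd_generator_matrix[OF eps(1) that])
 show "\<P>(\<omega> in M. (\<mu>in \<omega> = \<nu>\<^sub>0 \<and> uin \<omega> = u\<^sub>0) \<and> (\<forall>i\<le>n. \<mu> \<omega> (s i) = y i) \<and> \<mu> \<omega> (s n + t) = z) =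
   \<P>(\<omega> in M. (\<mu>in \<omega> = \<nu>\<^sub>0 \<and> uin \<omega> = u\<^sub>0) \<and> (\<forall>i\<le>n. \<mu> \<omega> (s i) = y i)) *
   generated_semigroup (sbd_generator eps \<alpha> \<beta> a b m) t (indicator {z}) (y n)"
  if "0 <= s 0" "\<forall>i<n. s i <= s (Suc i)" "0 <= t" for n s y t z
  using process that unfolding sbd_process_def m conj_assoc by blast
 show "{\<omega>\<in>space M. \<mu> \<omega> t = z} \<in> sets M" if "0 <= t" "z \<in> sbd_class eps m" for t z
  using eval_eq_measurable[OF that(1) class_states[OF that(2)]] .
 have "{\<omega>\<in>space M. \<mu>in \<omega> = \<nu>\<^sub>0 \<and> uin \<omega> = u\<^sub>0} = {\<omega>\<in>space M. \<mu> \<omega> 0 = \<nu>\<^sub>0} \<inter> {\<omega>\<in>space M. uin \<omega> = u\<^sub>0}"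
  using in_start by auto
 also have "\<dots> \<in> sets M" using eval_eq_measurable[OF _ \<nu>, of 0] uin_measurable by (intro sets.Int) auto
 finally show "{\<omega>\<in>space M. \<mu>in \<omega> = \<nu>\<^sub>0 \<and> uin \<omega> = u\<^sub>0} \<in> sets M" .
 show "\<nu>\<^sub>0 \<in> sbd_class eps m" using \<nu> u m by (auto simp: sbd_class_def)
 show "\<mu> \<omega> 0 = \<nu>\<^sub>0" if "\<omega> \<in> space M" "\<mu>in \<omega> = \<nu>\<^sub>0 \<and> uin \<omega> = u\<^sub>0" for \<omega> using in_start[OF that(1)] that(2) by simp
 show "sbd_generator eps \<alpha> \<beta> a b m (\<lambda>_. 1) z = 0" if "z \<in> sbd_class eps m" for z by (rule generator_one[OF that])
qed

text \<open>The possible starting points of total mass at most \<open>B\<close>. There are finitely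
  many, so estimates for fixed data can simply be summed.\<close>

definition initial_data :: "real => (real measure \<times> real) set" where
 "initial_data B = {(\<nu>, u). \<nu> \<in> sbd_states eps \<and> (\<exists>k :: nat. u = eps\<^sup>2 * real k) \<and> u + (LINT x|\<nu>. x) <= B}"

lemma finite_initial_data: "finite (initial_data B)"
proof (rule finite_subset)
 let ?K = "nat \<lceil>B / eps\<^sup>2\<rceil>"
 show "initial_data B \<subseteq> {\<nu> \<in> sbd_states eps. (LINT x|\<nu>. x) <= B} \<times> (\<lambda>k. eps\<^sup>2 * real k) ` {..?K}"
 proof safe
  fix \<nu> u assume "(\<nu>, u) \<in> initial_data B"
  then obtain k :: nat where \<nu>: "\<nu> \<in> sbd_states eps" and u: "u = eps\<^sup>2 * real k" and le: "u + (LINT x|\<nu>. x) <= B"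
   by (auto simp: initial_data_def)
  obtain l :: nat where l: "(LINT x|\<nu>. x) = eps\<^sup>2 * real l" using sbd_states_moment[OF eps(1) \<nu>] by blast
  have n: "0 <= eps\<^sup>2 * real l" "0 <= eps\<^sup>2 * real k" by simp_all
  show "\<nu> \<in> sbd_states eps" by (rule \<nu>)
  show "(LINT x|\<nu>. x) <= B" using le u n by linarith
  have "eps\<^sup>2 * real k <= B" using le u l n by linarith
  then have "real k <= B / eps\<^sup>2" using eps(1) by (simp add: field_simps)
  then have "k <= ?K" by linarith
  with u show "u \<in> (\<lambda>k. eps\<^sup>2 * real k) ` {..?K}" by auto
 qed
qed (use finite_sbd_states_bounded[OF eps(1)] in auto)

lemma initial_data_cases:
 assumes "\<omega> \<in> space M" "total_mass \<omega> <= B"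
 shows "(\<mu>in \<omega>, uin \<omega>) \<in> initial_data B"
 using assms uin_nat[OF assms(1)] in_states[OF assms(1), of 0] in_start[OF assms(1)]
 by (auto simp: initial_data_def total_mass_def)

text \<open>The inequality for fixed initial data, summed over all data below the mass bound. The
  constant \<open>C\<close> depends on eps and on the horizon but not on \<open>N\<close>, so it
  disappears as the mesh is refined.\<close>

lemma exponential_inequality:
 assumes s0: "0 <= s\<^sub>0" and d: "0 <= \<delta>" and B: "0 <= B"
  and w0: "\<And>t m y. w t m y y = 0"
  and wb: "\<And>t m y z. s\<^sub>0 <= t ==> t <= s\<^sub>0 + \<delta> ==> m <= B ==> y \<in> sbd_class eps m ==> z \<in> sbd_class eps m ==> w t m y z <= Wb"
  and \<theta>b: "\<And>t m y. s\<^sub>0 <= t ==> t <= s\<^sub>0 + \<delta> ==> m <= B ==> y \<in> sbd_class eps m ==> \<bar>\<theta> t m y\<bar> <= Tb"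
  and drift: "\<And>t m y. s\<^sub>0 <= t ==> t <= s\<^sub>0 + \<delta> ==> m <= B ==> y \<in> sbd_class eps m ==>
   sbd_generator eps \<alpha> \<beta> a b m (\<lambda>z. exp (w t m y z)) y <= \<theta> t m y"
 shows "\<exists>C. \<forall>N. 0 < N \<and> \<delta> / real N <= 1 \<longrightarrow> (\<exists>Z\<in>sets M. {\<omega>\<in>space M. total_mass \<omega> <= B \<and>
  \<rho> <= (\<Sum>i<N. w (s\<^sub>0 + real i * (\<delta> / real N)) (total_mass \<omega>) (\<mu> \<omega> (s\<^sub>0 + real i * (\<delta> / real N))) (\<mu> \<omega> (s\<^sub>0 + real (Suc i) * (\<delta> / real N)))
   - \<delta> / real N * \<theta> (s\<^sub>0 + real i * (\<delta> / real N)) (total_mass \<omega>) (\<mu> \<omega> (s\<^sub>0 + real i * (\<delta> / real N))))} \<subseteq> Z \<and>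
  prob Z <= exp (C / real N - \<rho>))"
proof -
 define rb where "rb d = finite_generator.rate_bound (sbd_class eps (snd d + (LINT x|fst d. x)))
  (\<lambda>y z. sbd_generator eps \<alpha> \<beta> a b (snd d + (LINT x|fst d. x)) (indicator {z}) y)" for d :: "real measure \<times> real"
 \<comment> \<open>The maxima with 0 cover the indices beyond \<open>N\<close>, where the functions
   \<open>w'\<close> and \<open>\<theta>'\<close> below are set to 0.\<close>
 define Wm where "Wm = max 0 Wb"
 define Tm where "Tm = max 0 Tb"
 define C where "C = \<delta>\<^sup>2 * (\<Sum>d\<in>initial_data B. exp (Tm + Wm + rb d))"
 show ?thesis
 proof (intro exI[of _ C] allI impI)
  fix N :: nat assume N: "0 < N \<and> \<delta> / real N <= 1"
  define h where "h = \<delta> / real N"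
  have h: "0 <= h" "h <= 1" using N d by (auto simp: h_def)
  have ti: "s\<^sub>0 <= s\<^sub>0 + real i * h" "s\<^sub>0 + real i * h <= s\<^sub>0 + \<delta>" if "i < N" for i
  proof -
   show "s\<^sub>0 <= s\<^sub>0 + real i * h" using h by simp
   have "real i * h <= real N * h" using that h by (intro mult_right_mono) auto
   then show "s\<^sub>0 + real i * h <= s\<^sub>0 + \<delta>" using N by (simp add: h_def)
  qed
  define w' where "w' m i y z = (if i < N then w (s\<^sub>0 + real i * h) m y z else 0)" for m i y z
  define \<theta>' where "\<theta>' m i y = (if i < N then \<theta> (s\<^sub>0 + real i * h) m y else 0)" for m i y
  define I where "I d \<omega> \<longleftrightarrow> \<mu>in \<omega> = fst d \<and> uin \<omega> = snd d" for d \<omega>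
  define E where "E d = {\<omega>\<in>space M. I d \<omega> \<and> \<rho> <= (\<Sum>i<N. w' (snd d + (LINT x|fst d. x)) i (\<mu> \<omega> (s\<^sub>0 + real i * h)) (\<mu> \<omega> (s\<^sub>0 + real (Suc i) * h))
    - h * \<theta>' (snd d + (LINT x|fst d. x)) i (\<mu> \<omega> (s\<^sub>0 + real i * h)))}" for d
  have ex: "\<exists>Z\<in>sets M. E d \<subseteq> Z \<and> prob Z <= prob {\<omega>\<in>space M. I d \<omega>} * exp (exp (Tm + Wm + rb d) * h\<^sup>2 * real N - \<rho>)"
   and I_meas: "{\<omega>\<in>space M. I d \<omega>} \<in> sets M" if d: "d \<in> initial_data B" for d
  proof -
   obtain \<nu>\<^sub>0 u\<^sub>0 k where d': "d = (\<nu>\<^sub>0, u\<^sub>0)" "\<nu>\<^sub>0 \<in> sbd_states eps" "u\<^sub>0 = eps\<^sup>2 * real k" "u\<^sub>0 + (LINT x|\<nu>\<^sub>0. x) <= B"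
    using d by (auto simp: initial_data_def)
   define m where "m = u\<^sub>0 + (LINT x|\<nu>\<^sub>0. x)"
   have m: "m <= B" using d' by (simp add: m_def)
   interpret C: finite_markov_chain M "sbd_class eps m" "sbd_generator eps \<alpha> \<beta> a b m"
    "\<lambda>y z. sbd_generator eps \<alpha> \<beta> a b m (indicator {z}) y" \<mu> "\<lambda>\<omega>. \<mu>in \<omega> = \<nu>\<^sub>0 \<and> uin \<omega> = u\<^sub>0" \<nu>\<^sub>0
    by (rule chain[OF d'(2,3) m_def])
   show "{\<omega>\<in>space M. I d \<omega>} \<in> sets M" using C.I_meas by (simp add: I_def d')
   have "\<exists>Z\<in>sets M. {\<omega>\<in>space M. (\<mu>in \<omega> = \<nu>\<^sub>0 \<and> uin \<omega> = u\<^sub>0) \<and> \<rho> <= (\<Sum>i<N. w' m i (\<mu> \<omega> (s\<^sub>0 + real i * h)) (\<mu> \<omega> (s\<^sub>0 + real (Suc i) * h))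
     - h * \<theta>' m i (\<mu> \<omega> (s\<^sub>0 + real i * h)))} \<subseteq> Z \<and>
    prob Z <= prob {\<omega>\<in>space M. \<mu>in \<omega> = \<nu>\<^sub>0 \<and> uin \<omega> = u\<^sub>0} * exp (exp (Tm + Wm + C.rate_bound) * h\<^sup>2 * real N - \<rho>)"
   proof (rule C.exponential_inequality[OF s0 h])
    show "w' m i y y = 0" for i y by (simp add: w'_def w0)
    show "w' m i y z <= Wm" if "y \<in> sbd_class eps m" "z \<in> sbd_class eps m" for i y z
     using wb[OF ti m that] by (auto simp: w'_def Wm_def intro: max.coboundedI2)
    show "\<bar>\<theta>' m i y\<bar> <= Tm" if "y \<in> sbd_class eps m" for i y
     using \<theta>b[OF ti m that] by (auto simp: \<theta>'_def Tm_def intro: max.coboundedI2)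
    show "sbd_generator eps \<alpha> \<beta> a b m (\<lambda>z. exp (w' m i y z)) y <= \<theta>' m i y" if "y \<in> sbd_class eps m" for i y
     using drift[OF ti m that] generator_one[OF that] by (auto simp: w'_def \<theta>'_def)
   qed
   then show "\<exists>Z\<in>sets M. E d \<subseteq> Z \<and> prob Z <= prob {\<omega>\<in>space M. I d \<omega>} * exp (exp (Tm + Wm + rb d) * h\<^sup>2 * real N - \<rho>)"
    by (simp add: E_def I_def d' m_def rb_def)
  qed
  then have "\<forall>d\<in>initial_data B. \<exists>Z. Z \<in> sets M \<and> E d \<subseteq> Z \<and>
    prob Z <= prob {\<omega>\<in>space M. I d \<omega>} * exp (exp (Tm + Wm + rb d) * h\<^sup>2 * real N - \<rho>)" by blast
  from bchoice[OF this] obtain Z where "\<forall>d\<in>initial_data B. Z d \<in> sets M \<and> E d \<subseteq> Z d \<and>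
    prob (Z d) <= prob {\<omega>\<in>space M. I d \<omega>} * exp (exp (Tm + Wm + rb d) * h\<^sup>2 * real N - \<rho>)" ..
  then have Z: "\<And>d. d \<in> initial_data B ==> Z d \<in> sets M" "\<And>d. d \<in> initial_data B ==> E d \<subseteq> Z d"
   "\<And>d. d \<in> initial_data B ==> prob (Z d) <= prob {\<omega>\<in>space M. I d \<omega>} * exp (exp (Tm + Wm + rb d) * h\<^sup>2 * real N - \<rho>)"
   by blast+
  have "prob (\<Union>d\<in>initial_data B. Z d) <= (\<Sum>d\<in>initial_data B. prob (Z d))"
   using Z(1) by (intro finite_measure_subadditive_finite finite_initial_data) auto
  also have "\<dots> <= (\<Sum>d\<in>initial_data B. prob {\<omega>\<in>space M. I d \<omega>} * exp (C / real N - \<rho>))"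
  proof (intro sum_mono)
   fix d assume d: "d \<in> initial_data B"
   have "exp (Tm + Wm + rb d) <= (\<Sum>d\<in>initial_data B. exp (Tm + Wm + rb d))"
    using d finite_initial_data by (intro member_le_sum) auto
   then have "exp (Tm + Wm + rb d) * h\<^sup>2 * real N <= (\<Sum>d\<in>initial_data B. exp (Tm + Wm + rb d)) * h\<^sup>2 * real N"
    by (intro mult_right_mono) auto
   also have "\<dots> = C / real N" using N by (simp add: h_def C_def power2_eq_square)
   finally show "prob (Z d) <= prob {\<omega>\<in>space M. I d \<omega>} * exp (C / real N - \<rho>)"
    using Z(3)[OF d] by (elim order_trans) (intro mult_left_mono, auto)
  qed
  \<comment> \<open>Events with different initial data are disjoint, so their probabilities add up
    to at most 1.\<close>
  also have "\<dots> = prob (\<Union>d\<in>initial_data B. {\<omega>\<in>space M. I d \<omega>}) * exp (C / real N - \<rho>)"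
   unfolding sum_distrib_right[symmetric] using I_meas finite_initial_data
   by (subst finite_measure_finite_Union) (auto simp: disjoint_family_on_def I_def prod_eq_iff)
  also have "\<dots> <= 1 * exp (C / real N - \<rho>)" by (intro mult_right_mono) auto
  finally have p: "prob (\<Union>d\<in>initial_data B. Z d) <= exp (C / real N - \<rho>)" by simp
  have "{\<omega>\<in>space M. total_mass \<omega> <= B \<and>
   \<rho> <= (\<Sum>i<N. w (s\<^sub>0 + real i * h) (total_mass \<omega>) (\<mu> \<omega> (s\<^sub>0 + real i * h)) (\<mu> \<omega> (s\<^sub>0 + real (Suc i) * h))
   - h * \<theta> (s\<^sub>0 + real i * h) (total_mass \<omega>) (\<mu> \<omega> (s\<^sub>0 + real i * h)))} \<subseteq> (\<Union>d\<in>initial_data B. Z d)"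
  proof safe
   fix \<omega> assume \<omega>: "\<omega> \<in> space M" "total_mass \<omega> <= B" and
    le: "\<rho> <= (\<Sum>i<N. w (s\<^sub>0 + real i * h) (total_mass \<omega>) (\<mu> \<omega> (s\<^sub>0 + real i * h)) (\<mu> \<omega> (s\<^sub>0 + real (Suc i) * h))
     - h * \<theta> (s\<^sub>0 + real i * h) (total_mass \<omega>) (\<mu> \<omega> (s\<^sub>0 + real i * h)))"
   have "\<omega> \<in> E (\<mu>in \<omega>, uin \<omega>)"
    using \<omega>(1) le by (simp add: E_def I_def w'_def \<theta>'_def total_mass_def)
   with Z(2)[OF initial_data_cases[OF \<omega>]] initial_data_cases[OF \<omega>] show "\<omega> \<in> (\<Union>d\<in>initial_data B. Z d)" by blast
  qed
  moreover have "(\<Union>d\<in>initial_data B. Z d) \<in> sets M" using Z(1) finite_initial_data by (intro sets.finite_UN) auto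
  ultimately show "\<exists>Z\<in>sets M. {\<omega>\<in>space M. total_mass \<omega> <= B \<and>
   \<rho> <= (\<Sum>i<N. w (s\<^sub>0 + real i * (\<delta> / real N)) (total_mass \<omega>) (\<mu> \<omega> (s\<^sub>0 + real i * (\<delta> / real N))) (\<mu> \<omega> (s\<^sub>0 + real (Suc i) * (\<delta> / real N)))
   - \<delta> / real N * \<theta> (s\<^sub>0 + real i * (\<delta> / real N)) (total_mass \<omega>) (\<mu> \<omega> (s\<^sub>0 + real i * (\<delta> / real N))))} \<subseteq> Z \<and>
   prob Z <= exp (C / real N - \<rho>)"
   using p unfolding h_def by blast
 qed
qed

text \<open>The mesh tends to 0. Each bad outcome violates the grid inequality for all large
  \<open>N\<close>, so it lies in the lower limit of the exceptional sets, whose probability is at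
  most the limit \<open>exp (- \<rho>)\<close> of the grid bounds.\<close>

lemma path_inequality:
 assumes s0: "0 <= s\<^sub>0" and d: "0 <= \<delta>" and B: "0 <= B"
  and w0: "\<And>t m y. w t m y y = 0"
  and wb: "\<And>t m y z. s\<^sub>0 <= t ==> t <= s\<^sub>0 + \<delta> ==> m <= B ==> y \<in> sbd_class eps m ==> z \<in> sbd_class eps m ==> w t m y z <= Wb"
  and \<theta>b: "\<And>t m y. s\<^sub>0 <= t ==> t <= s\<^sub>0 + \<delta> ==> m <= B ==> y \<in> sbd_class eps m ==> \<bar>\<theta> t m y\<bar> <= Tb"
  and drift: "\<And>t m y. s\<^sub>0 <= t ==> t <= s\<^sub>0 + \<delta> ==> m <= B ==> y \<in> sbd_class eps m ==>
   sbd_generator eps \<alpha> \<beta> a b m (\<lambda>z. exp (w t m y z)) y <= \<theta> t m y"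
 defines "S \<equiv> \<lambda>N \<omega>. \<Sum>i<N. w (s\<^sub>0 + real i * (\<delta> / real N)) (total_mass \<omega>) (\<mu> \<omega> (s\<^sub>0 + real i * (\<delta> / real N))) (\<mu> \<omega> (s\<^sub>0 + real (Suc i) * (\<delta> / real N)))
   - \<delta> / real N * \<theta> (s\<^sub>0 + real i * (\<delta> / real N)) (total_mass \<omega>) (\<mu> \<omega> (s\<^sub>0 + real i * (\<delta> / real N)))"
 assumes bad: "\<And>\<omega>. \<omega> \<in> Bad ==> \<omega> \<in> space M" "\<And>\<omega>. \<omega> \<in> Bad ==> total_mass \<omega> <= B"
   "\<And>\<omega>. \<omega> \<in> Bad ==> eventually (\<lambda>N. \<rho> <= S N \<omega>) sequentially"
 shows "\<exists>Z\<in>sets M. Bad \<subseteq> Z \<and> prob Z <= exp (- \<rho>)"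
proof -
 have "\<exists>C. \<forall>N. 0 < N \<and> \<delta> / real N <= 1 \<longrightarrow> (\<exists>Z\<in>sets M. {\<omega>\<in>space M. total_mass \<omega> <= B \<and> \<rho> <= S N \<omega>} \<subseteq> Z \<and> prob Z <= exp (C / real N - \<rho>))"
  unfolding S_def by (rule exponential_inequality) (fact s0 d B w0 wb \<theta>b drift)+
 then obtain C where C: "\<forall>N. 0 < N \<and> \<delta> / real N <= 1 \<longrightarrow> (\<exists>Z\<in>sets M. {\<omega>\<in>space M. total_mass \<omega> <= B \<and> \<rho> <= S N \<omega>} \<subseteq> Z \<and> prob Z <= exp (C / real N - \<rho>))" ..
 \<comment> \<open>The shift by \<open>N0\<close> makes every grid nonempty and every mesh at most
   1, as the grid inequality demands.\<close>
 obtain N0 :: nat where N0: "max 1 \<delta> <= real N0" using real_arch_simple by blast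
 have "\<exists>Z\<in>sets M. {\<omega>\<in>space M. total_mass \<omega> <= B \<and> \<rho> <= S (N + N0) \<omega>} \<subseteq> Z \<and> prob Z <= exp (C / real (N + N0) - \<rho>)" for N
  using N0 by (intro C[rule_format]) (auto simp: divide_le_eq)
 then have "\<forall>N. \<exists>Z. Z \<in> sets M \<and> {\<omega>\<in>space M. total_mass \<omega> <= B \<and> \<rho> <= S (N + N0) \<omega>} \<subseteq> Z \<and>
   prob Z <= exp (C / real (N + N0) - \<rho>)" by blast
 from choice[OF this] obtain Z where Z': "\<forall>N. Z N \<in> sets M \<and> {\<omega>\<in>space M. total_mass \<omega> <= B \<and> \<rho> <= S (N + N0) \<omega>} \<subseteq> Z N \<and>
   prob (Z N) <= exp (C / real (N + N0) - \<rho>)" ..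
 note Z = conjunct1[OF Z'[rule_format]] conjunct1[OF conjunct2[OF Z'[rule_format]]] conjunct2[OF conjunct2[OF Z'[rule_format]]]
 \<comment> \<open>The sets increase with \<open>p\<close>, and each lies in all \<open>Z N\<close>
   with \<open>N >= p\<close>; hence each has probability at most the limiting bound.\<close>
 define V where "V p = (\<Inter>N\<in>{p..}. Z N)" for p
 have V: "V p \<in> sets M" for p unfolding V_def using Z(1) by (intro sets.countable_INT') auto
 have lim: "(\<lambda>N. exp (C / real (N + N0) - \<rho>)) \<longlonglongrightarrow> exp (0 - \<rho>)"
  by (intro tendsto_intros LIMSEQ_ignore_initial_segment[OF lim_const_over_n])
 have "prob (V p) <= exp (0 - \<rho>)" for p
 proof (rule LIMSEQ_le_const[OF lim])
  have "prob (V p) <= exp (C / real (N + N0) - \<rho>)" if "N >= p" for N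
   using finite_measure_mono[OF _ Z(1)[of N], of "V p"] Z(3)[of N] that by (force simp: V_def)
  then show "\<exists>K. \<forall>N\<ge>K. prob (V p) <= exp (C / real (N + N0) - \<rho>)" by blast
 qed
 moreover have "incseq V" unfolding incseq_def V_def by auto
 ultimately have "prob (\<Union>p. V p) <= exp (- \<rho>)"
  using V by (intro LIMSEQ_le_const2[OF finite_Lim_measure_incseq]) auto
 moreover have "Bad \<subseteq> (\<Union>p. V p)"
 proof
  fix \<omega> assume \<omega>: "\<omega> \<in> Bad"
  obtain K where K: "\<And>N. N >= K ==> \<rho> <= S N \<omega>"
   using bad(3)[OF \<omega>] unfolding eventually_sequentially by blast
  have "\<omega> \<in> V K" unfolding V_def using Z(2) bad(1,2)[OF \<omega>] K by fastforce
  then show "\<omega> \<in> (\<Union>p. V p)" by blast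
 qed
 moreover have "(\<Union>p. V p) \<in> sets M" using V by auto
 ultimately show ?thesis by blast
qed

text \<open>At each rational time the state stays almost surely in the class of the initial data,
  where the free mass is nonnegative. An excess at some real time would persist on a small interval
  to the right, which contains a rational.\<close>

lemma moment_le_total_mass:
 "\<exists>Z\<in>sets M. {\<omega>\<in>space M. total_mass \<omega> <= B \<and> (\<exists>t\<ge>0. (LINT x|\<mu> \<omega> t. x) > total_mass \<omega>)} \<subseteq> Z \<and> prob Z = 0"
proof -
 define V where "V d q = {\<omega>\<in>space M. (\<mu>in \<omega> = fst d \<and> uin \<omega> = snd d) \<and> \<mu> \<omega> \<bar>of_rat q\<bar> \<notin> sbd_class eps (snd d + (LINT x|fst d. x))}"
  for d :: "real measure \<times> real" and q :: rat
 have V: "V d q \<in> null_sets M" if d: "d \<in> initial_data B" for d q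
 proof -
  obtain \<nu>\<^sub>0 u\<^sub>0 k where d': "d = (\<nu>\<^sub>0, u\<^sub>0)" "\<nu>\<^sub>0 \<in> sbd_states eps" "u\<^sub>0 = eps\<^sup>2 * real k"
   using d by (auto simp: initial_data_def)
  interpret C: finite_markov_chain M "sbd_class eps (u\<^sub>0 + (LINT x|\<nu>\<^sub>0. x))" "sbd_generator eps \<alpha> \<beta> a b (u\<^sub>0 + (LINT x|\<nu>\<^sub>0. x))"
   "\<lambda>y z. sbd_generator eps \<alpha> \<beta> a b (u\<^sub>0 + (LINT x|\<nu>\<^sub>0. x)) (indicator {z}) y" \<mu> "\<lambda>\<omega>. \<mu>in \<omega> = \<nu>\<^sub>0 \<and> uin \<omega> = u\<^sub>0" \<nu>\<^sub>0
   by (rule chain[OF d'(2,3) refl])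
  show ?thesis
   using C.in_S_meas[of "\<bar>of_rat q\<bar>"] C.stays_in_S[of "\<bar>of_rat q\<bar>"] by (intro null_setsI) (auto simp: V_def d' emeasure_eq_measure)
 qed
 have Z: "(\<Union>q. \<Union>d\<in>initial_data B. V d q) \<in> null_sets M"
  using V by (intro null_sets_UN' null_sets_UN countable_finite finite_initial_data) auto
 have "{\<omega>\<in>space M. total_mass \<omega> <= B \<and> (\<exists>t\<ge>0. (LINT x|\<mu> \<omega> t. x) > total_mass \<omega>)} \<subseteq> (\<Union>q. \<Union>d\<in>initial_data B. V d q)"
 proof (rule ccontr)
  assume "\<not> ?thesis"
  then obtain \<omega> t where \<omega>: "\<omega> \<in> space M" "total_mass \<omega> <= B" "t >= 0" "(LINT x|\<mu> \<omega> t. x) > total_mass \<omega>"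
   and no: "\<omega> \<notin> (\<Union>q. \<Union>d\<in>initial_data B. V d q)" by blast
  have le: "(LINT x|\<mu> \<omega> \<bar>of_rat q\<bar>. x) <= total_mass \<omega>" for q
  proof -
   have "\<omega> \<notin> V (\<mu>in \<omega>, uin \<omega>) q" using no initial_data_cases[OF \<omega>(1,2)] by blast
   then have "\<mu> \<omega> \<bar>of_rat q\<bar> \<in> sbd_class eps (total_mass \<omega>)" using \<omega>(1) by (auto simp: V_def total_mass_def)
   then show ?thesis by (rule class_moment(2))
  qed
  have "((\<lambda>t. LINT x|\<mu> \<omega> t. x) \<longlongrightarrow> (LINT x|\<mu> \<omega> t. x)) (at_right t)"
   by (rule rcll_right[OF rcll_cadlag[OF in_cadlag[OF \<omega>(1)] continuous_map_weak_moment] \<omega>(3)])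
  from order_tendstoD(1)[OF this \<omega>(4)] obtain b where b: "t < b" "\<And>s. t < s ==> s < b ==> total_mass \<omega> < (LINT x|\<mu> \<omega> s. x)"
   unfolding eventually_at_right_field by auto
  obtain q where q: "t < real_of_rat q" "real_of_rat q < b" using of_rat_dense[OF b(1)] by auto
  have "\<bar>real_of_rat q\<bar> = of_rat q" using q \<omega>(3) by linarith
  with le[of q] b(2)[OF q] show False by simp
 qed
 with Z show ?thesis by (intro bexI[of _ "\<Union>q. \<Union>d\<in>initial_data B. V d q"]) (auto simp: measure_eq_0_null_sets)
qed

end


section \<open>Riemann sums, and bounds on cluster number, tails and oscillation\<close>

text \<open>The step function takes on each cell the value at the right end, so it converges at
  every time before \<open>T\<close> by right continuity alone; boundedness gives convergence of the
  integrals.\<close>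

lemma rcll_riemann_sum:
 assumes k: "rcll k" and T: "0 < T"
 shows "(\<lambda>N. T / real N * (\<Sum>i<N. k (real (Suc i) * (T / real N)))) \<longlonglongrightarrow> (LINT s|lborel. indicator {0..T} s * k s)"
proof -
 define f where "f N s = (\<Sum>i<N. indicator {real i * (T / real N)..<real (Suc i) * (T / real N)} s * k (real (Suc i) * (T / real N)))" for N :: nat and s
 obtain C where C: "C >= 0" "\<And>t. 0 <= t ==> t <= T ==> \<bar>k t\<bar> <= C" using rcll_bounded[OF k] by blast
 have f_eq: "f N s = k (real (nat \<lfloor>s / T * real N\<rfloor> + 1) * (T / real N))" if N: "N > 0" and s: "0 <= s" "s < T" for N s
 proof -
  let ?j = "nat \<lfloor>s / T * real N\<rfloor>"
  have cell: "s \<in> {real i * (T / real N)..<real (Suc i) * (T / real N)} \<longleftrightarrow> i = ?j" for i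
  proof -
   have "s \<in> {real i * (T / real N)..<real (Suc i) * (T / real N)} \<longleftrightarrow> real i <= s / T * real N \<and> s / T * real N < real (Suc i)"
    using T N by (simp add: field_simps)
   also have "\<dots> \<longleftrightarrow> \<lfloor>s / T * real N\<rfloor> = int i" by (auto simp: floor_eq_iff)
   also have "\<dots> \<longleftrightarrow> i = ?j" using s T by auto
   finally show ?thesis .
  qed
  have "?j + 1 <= N" using rcll_grid_limit(1)[OF k order_refl T, of "s / T" N] s T N by simp
  have "f N s = (\<Sum>i<N. if i = ?j then k (real (Suc i) * (T / real N)) else 0)"
   unfolding f_def indicator_def by (intro sum.cong refl) (simp only: cell, auto)
  also have "\<dots> = k (real (Suc ?j) * (T / real N))" using \<open>?j + 1 <= N\<close> by simp
  finally show ?thesis by simp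
 qed
 have f_out: "f N s = 0" if "\<not> (0 <= s \<and> s < T)" for N s
  unfolding f_def
 proof (intro sum.neutral ballI)
  fix i assume i: "i \<in> {..<N}"
  have "real (Suc i) * (T / real N) <= real N * (T / real N)" using i T by (intro mult_right_mono) auto
  also have "\<dots> = T" using i by auto
  finally have "real (Suc i) * (T / real N) <= T" .
  moreover have "0 <= real i * (T / real N)" using T by simp
  ultimately have "s \<notin> {real i * (T / real N)..<real (Suc i) * (T / real N)}" using that by auto
  then show "indicator {real i * (T / real N)..<real (Suc i) * (T / real N)} s * k (real (Suc i) * (T / real N)) = 0" by simp
 qed
 have "(\<lambda>N. LINT s|lborel. f N s) \<longlonglongrightarrow> (LINT s|lborel. indicator {0..<T} s * k s)"
 proof (rule integral_dominated_convergence[where w="\<lambda>s. indicator {0..T} s * C"])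
  show "integrable lborel (\<lambda>s. indicator {0..T} s * C)" using T by simp
  have "(\<lambda>s. indicator {0..<T} s * (indicator {0..T} s * k s)) \<in> borel_measurable borel"
   by (intro borel_measurable_times rcll_borel_measurable[OF k]) auto
  moreover have "(\<lambda>s. indicator {0..<T} s * (indicator {0..T} s * k s)) = (\<lambda>s. indicator {0..<T} s * k s)"
   by (auto simp: indicator_def fun_eq_iff)
  ultimately show "(\<lambda>s. indicator {0..<T} s * k s) \<in> borel_measurable lborel" by simp
  show "f N \<in> borel_measurable lborel" for N unfolding f_def by (intro borel_measurable_sum borel_measurable_times) auto
  show "AE s in lborel. (\<lambda>N. f N s) \<longlonglongrightarrow> indicator {0..<T} s * k s"
  proof (intro AE_I2)
   fix s show "(\<lambda>N. f N s) \<longlonglongrightarrow> indicator {0..<T} s * k s"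
   proof (cases "0 <= s \<and> s < T")
    case True
    have "eventually (\<lambda>N. k (real (nat \<lfloor>s / T * real N\<rfloor> + 1) * (T / real N)) = f N s) sequentially"
     using eventually_gt_at_top[of 0] by eventually_elim (use f_eq True in auto)
    moreover have "(\<lambda>N. k (real (nat \<lfloor>s / T * real N\<rfloor> + 1) * (T / real N))) \<longlonglongrightarrow> k s"
     using rcll_grid_limit(2)[OF k order_refl T, of "s / T"] True T by simp
    ultimately show ?thesis using True by (auto intro: Lim_transform_eventually)
   next
    case False
    then show ?thesis using f_out[OF False] by auto
   qed
  qed
  show "AE s in lborel. norm (f N s) <= indicator {0..T} s * C" for N
  proof (intro AE_I2)
   fix s show "norm (f N s) <= indicator {0..T} s * C"
   proof (cases "0 <= s \<and> s < T \<and> N > 0")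
    case True
    have "nat \<lfloor>s / T * real N\<rfloor> + 1 <= N" using rcll_grid_limit(1)[OF k order_refl T, of "s / T" N] True T by simp
    then have "real (nat \<lfloor>s / T * real N\<rfloor> + 1) * (T / real N) <= real N * (T / real N)" using T by (intro mult_right_mono) auto
    then have "real (nat \<lfloor>s / T * real N\<rfloor> + 1) * (T / real N) <= T" using True by simp
    then show ?thesis using True T C(2) f_eq[of N s] by simp
   next
    case False
    then have "f N s = 0" using f_out[of s N] by (cases "N = 0") (auto simp: f_def)
    then show ?thesis using C by simp
   qed
  qed
 qed
 moreover have "(LINT s|lborel. indicator {0..<T} s * k s) = (LINT s|lborel. indicator {0..T} s * k s)"
 proof (rule integral_cong_AE)
  have "AE s in lborel. s \<noteq> T" by (rule AE_lborel_singleton)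
  then show "AE s in lborel. indicator {0..<T} s * k s = indicator {0..T} s * k s"
   by eventually_elim (auto simp: indicator_def)
  have "(\<lambda>s. indicator {0..<T} s * (indicator {0..T} s * k s)) \<in> borel_measurable borel"
   by (intro borel_measurable_times rcll_borel_measurable[OF k]) auto
  moreover have "(\<lambda>s. indicator {0..<T} s * (indicator {0..T} s * k s)) = (\<lambda>s. indicator {0..<T} s * k s)"
   by (auto simp: indicator_def fun_eq_iff)
  ultimately show "(\<lambda>s. indicator {0..<T} s * k s) \<in> borel_measurable lborel" by simp
  show "(\<lambda>s. indicator {0..T} s * k s) \<in> borel_measurable lborel" using rcll_borel_measurable[OF k] by simp
 qed
 moreover have "(LINT s|lborel. f N s) = T / real N * (\<Sum>i<N. k (real (Suc i) * (T / real N)))" for N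
 proof -
  have "(LINT s|lborel. f N s) = (\<Sum>i<N. \<integral>s. indicator {real i * (T / real N)..<real (Suc i) * (T / real N)} s * k (real (Suc i) * (T / real N)) \<partial>lborel)"
   unfolding f_def
  proof (intro Bochner_Integration.integral_sum integrable_mult_left integrable_real_indicator)
   fix i :: nat
   have le: "real i * (T / real N) <= real (Suc i) * (T / real N)" using T by (intro mult_right_mono) auto
   show "emeasure lborel {real i * (T / real N)..<real (Suc i) * (T / real N)} < \<infinity>"
    unfolding emeasure_lborel_Ico[OF le] by simp
  qed simp
  also have "\<dots> = (\<Sum>i<N. T / real N * k (real (Suc i) * (T / real N)))"
  proof (intro sum.cong refl)
   fix i assume "i \<in> {..<N}"
   have "real i * (T / real N) <= real (Suc i) * (T / real N)" using T by (intro mult_right_mono) auto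
   then have "measure lborel {real i * (T / real N)..<real (Suc i) * (T / real N)} = T / real N"
    by (simp add: algebra_simps add_divide_distrib)
   then show "(LINT s|lborel. indicator {real i * (T / real N)..<real (Suc i) * (T / real N)} s * k (real (Suc i) * (T / real N)))
     = T / real N * k (real (Suc i) * (T / real N))" by simp
  qed
  finally show ?thesis by (simp add: sum_distrib_left)
 qed
 ultimately show ?thesis by simp
qed

text \<open>Summation by parts: increments with the weight \<open>T - t\<close> become a Riemann sum
  of the path itself, because the weight falls by one mesh in each step.\<close>

lemma abel_summation_linear_weight:
 fixes x :: "nat => real"
 shows "(\<Sum>i<n. (T - real i * h) * (x (Suc i) - x i)) = (T - real n * h) * x n - T * x 0 + h * (\<Sum>i<n. x (Suc i))"
 by (induction n) (auto simp: algebra_simps)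

lemma rcll_mult_continuous:
 assumes g: "rcll g" and w: "continuous_on UNIV w"
 shows "rcll (\<lambda>s. w s * g s)"
 unfolding rcll_def
proof (intro conjI allI impI)
 have w': "(w \<longlongrightarrow> w t) (at t within S)" for t S
  using w by (metis continuous_on_def continuous_on_subset subset_UNIV tendsto_within_subset UNIV_I)
 show "((\<lambda>s. w s * g s) \<longlongrightarrow> w t * g t) (at_right t)" if "t >= 0" for t
  using rcll_right[OF g that] w' by (intro tendsto_mult)
 show "\<exists>l. ((\<lambda>s. w s * g s) \<longlongrightarrow> l) (at_left t)" if pos: "t > 0" for t
 proof -
  obtain l where "(g \<longlongrightarrow> l) (at_left t)" using g pos unfolding rcll_def by blast
  then have "((\<lambda>s. w s * g s) \<longlongrightarrow> w t * l) (at_left t)" using w' by (intro tendsto_mult)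
  then show ?thesis by blast
 qed
qed

lemma continuous_measurable_nonneg:
 fixes f :: "real => real"
 shows "continuous_on {0..} f ==> f \<in> borel_measurable borel_nonneg"
 by (rule borel_measurable_continuous_on_restrict)

lemma bounded_continuous_measurable: "f \<in> bounded_continuous ==> f \<in> borel_measurable borel_nonneg"
 by (auto simp: bounded_continuous_def intro: continuous_measurable_nonneg)

lemma ln_ratio_le:
 fixes p d :: real
 assumes "0 < p" "0 < p + d"
 shows "ln (p + d) - ln p <= d / p"
proof -
 have "1 + d / p = (p + d) / p" using assms by (simp add: field_simps)
 then have "ln (p + d) - ln p = ln (1 + d / p)" using assms by (simp add: ln_div)
 also have "\<dots> <= d / p" using assms by (intro ln_add_one_self_le_self2) (simp add: field_simps)
 finally show ?thesis .
qed

text \<open>Up to \<open>R\<close> the weight is \<open>x\<^sup>2 / R\<close>, whose increment is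
  \<open>eps * (2 * x + eps) / R\<close>; as eps is below \<open>x\<close>, this is at most
  \<open>3 * eps * x / R\<close>. An increment bounded by the ratio of weight to size is what
  Gronwall's argument needs.\<close>

lemma tail_weight_increment:
 assumes R: "0 < R" and e: "0 < eps" and x: "2 * eps <= x"
 shows "tail_weight R (x + eps) - tail_weight R x <= 3 * eps * min 1 (x / R)"
  and "tail_weight R (x - eps) <= tail_weight R x"
proof -
 show "tail_weight R (x + eps) - tail_weight R x <= 3 * eps * min 1 (x / R)"
 proof (cases "x <= R")
  case True
  have "tail_weight R (x + eps) <= (x + eps) * ((x + eps) / R)"
   unfolding tail_weight_def using e x by (intro mult_left_mono) auto
  moreover have "tail_weight R x = x * (x / R)" using True R by (simp add: tail_weight_def)
  moreover have "(x + eps) * ((x + eps) / R) - x * (x / R) = eps * (2 * x + eps) / R" using R by (simp add: field_simps)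
  moreover have "eps * (2 * x + eps) / R <= eps * (3 * x) / R" using e x R by (intro divide_right_mono mult_left_mono) auto
  ultimately show ?thesis using True R by (simp add: mult_ac)
 next
  case False
  then have "tail_weight R x = x" using R by (simp add: tail_weight_def)
  moreover have "tail_weight R (x + eps) <= x + eps" using R e x by (intro tail_weight_le) auto
  moreover have "min 1 (x / R) = 1" using False R by simp
  ultimately show ?thesis using e by simp
 qed
 show "tail_weight R (x - eps) <= tail_weight R x"
  unfolding tail_weight_def using R e x by (intro mult_mono min.mono divide_right_mono) auto
qed

context sbd_rates
begin

text \<open>There are finitely many states below the mass bound. The resulting bound may depend on
  eps; it serves only for the a priori bounds that drop out with the mesh.\<close>

lemma class_bounded:
 fixes g :: "real measure => real"
 shows "\<exists>G\<ge>0. \<forall>m y. m <= B \<longrightarrow> y \<in> sbd_class eps m \<longrightarrow> \<bar>g y\<bar> <= G"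
proof -
 let ?F = "{\<nu> \<in> sbd_states eps. (LINT x|\<nu>. x) <= B}"
 have fin: "finite ?F" by (rule finite_sbd_states_bounded[OF eps(1)])
 have "\<bar>g y\<bar> <= (\<Sum>z\<in>?F. \<bar>g z\<bar>)" if "m <= B" "y \<in> sbd_class eps m" for m y
  using class_moment(2)[OF that(2)] class_states[OF that(2)] that(1) fin by (intro member_le_sum) auto
 then show ?thesis by (intro exI[of _ "\<Sum>z\<in>?F. \<bar>g z\<bar>"]) (auto intro: sum_nonneg)
qed

lemma class_moment_measures: "y \<in> sbd_class eps m ==> y \<in> moment_measures"
 using sbd_states_moment_measures[OF eps(1) class_states] .

lemma class_sums:
 assumes y: "y \<in> sbd_class eps m"
 shows "f \<in> borel_measurable borel_nonneg ==> (\<Sum>x\<in>atoms y. f x * measure y {x}) = (LINT x|y. f x)"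
  and "(\<Sum>x\<in>atoms y. measure y {x}) = measure y {0..}"
  and "(\<Sum>x\<in>atoms y. x * measure y {x}) = (LINT x|y. x)"
  and "measure y {2 * eps} <= measure y {0..}"
proof -
 note at = sbd_states_atoms(4)[OF eps(1) class_states[OF y]]
 interpret finite_measure y by (rule finite_moment_measure[OF class_moment_measures[OF y]])
 show "f \<in> borel_measurable borel_nonneg ==> (\<Sum>x\<in>atoms y. f x * measure y {x}) = (LINT x|y. f x)" using at by simp
 show "(\<Sum>x\<in>atoms y. measure y {x}) = measure y {0..}"
  using at[of "\<lambda>_. 1"] by (simp add: space_moment_measure[OF class_moment_measures[OF y]])
 show "(\<Sum>x\<in>atoms y. x * measure y {x}) = (LINT x|y. x)"
  using at[of "\<lambda>x. x"] by (simp add: continuous_measurable_nonneg)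
 show "measure y {2 * eps} <= measure y {0..}"
  using eps(1) by (intro finite_measure_mono) (auto simp: sets_moment_measure[OF class_moment_measures[OF y]] borel_nonneg_sets_iff)
qed

lemmas transitions = sbd_transitions[OF eps(1) class_states]

end

context sbd_rescaled
begin

text \<open>The rise of \<open>f\<close> along a path is at most the sum of its positive increments
  on a fine grid. Penalising these increments with factor \<open>1 / eps\<close> costs
  \<open>2 * \<kappa> * T / eps\<close>, and the excess 1 in the threshold leaves the exponent
  \<open>1 / eps\<close>.\<close>

lemma positive_variation:
 assumes B: "0 <= B" and T: "0 < T" and f: "continuous_map weak_topology euclideanreal f"
  and drift: "\<And>m y. m <= B ==> y \<in> sbd_class eps m ==>
   sbd_generator eps \<alpha> \<beta> a b m (\<lambda>z. exp (1 / eps * max 0 (f z - f y))) y <= 2 * \<kappa> / eps"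
 shows "\<exists>Z\<in>sets M. {\<omega>\<in>space M. total_mass \<omega> <= B \<and> (\<exists>t\<in>{0..T}. f (\<mu> \<omega> t) > f (\<mu> \<omega> 0) + 2 * \<kappa> * T + 1)} \<subseteq> Z \<and>
  prob Z <= exp (- (1 / eps))"
proof -
 obtain G where G: "0 <= G" and G': "\<forall>m y. m <= B \<longrightarrow> y \<in> sbd_class eps m \<longrightarrow> \<bar>f y\<bar> <= G"
  using class_bounded[where B=B and g="f"] by (elim exE conjE)
 note G = G G'[rule_format]
 show ?thesis
 proof (rule path_inequality[where s\<^sub>0=0 and \<delta>=T and B=B and w="\<lambda>t m y z. 1 / eps * max 0 (f z - f y)" and \<theta>="\<lambda>t m y. 2 * \<kappa> / eps"
    and Wb="1 / eps * (2 * G)" and Tb="\<bar>2 * \<kappa> / eps\<bar>"])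
  show "1 / eps * max 0 (f z - f y) <= 1 / eps * (2 * G)" if "m <= B" "y \<in> sbd_class eps m" "z \<in> sbd_class eps m" for m y z
   using G(1) G(2)[OF that(1,2)] G(2)[OF that(1,3)] eps(1) by (intro mult_left_mono) auto
  fix \<omega> assume "\<omega> \<in> {\<omega>\<in>space M. total_mass \<omega> <= B \<and> (\<exists>t\<in>{0..T}. f (\<mu> \<omega> t) > f (\<mu> \<omega> 0) + 2 * \<kappa> * T + 1)}"
  then obtain t where \<omega>: "\<omega> \<in> space M" "total_mass \<omega> <= B" and t: "0 <= t" "t <= 0 + T" "f (\<mu> \<omega> t) > f (\<mu> \<omega> 0) + 2 * \<kappa> * T + 1" by auto
  obtain j where j: "\<And>N :: nat. N > 0 ==> j N <= N" "(\<lambda>N. f (\<mu> \<omega> (0 + real (j N) * (T / real N)))) \<longlonglongrightarrow> f (\<mu> \<omega> t)"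
   using rcll_grid_approximation[OF rcll_cadlag[OF in_cadlag[OF \<omega>(1)] f] order_refl T t(1,2)] by blast
  show "eventually (\<lambda>N. 1 / eps <= (\<Sum>i<N. 1 / eps * max 0 (f (\<mu> \<omega> (0 + real (Suc i) * (T / real N))) - f (\<mu> \<omega> (0 + real i * (T / real N))))
    - T / real N * (2 * \<kappa> / eps))) sequentially"
   using order_tendstoD(1)[OF j(2) t(3)] eventually_gt_at_top[of 0]
  proof eventually_elim
   case (elim N)
   define x where "x i = f (\<mu> \<omega> (0 + real i * (T / real N)))" for i
   have "2 * \<kappa> * T + 1 <= x (j N) - x 0" using elim by (simp add: x_def)
   also have "\<dots> <= (\<Sum>i<N. max 0 (x (Suc i) - x i))" using j(1) elim(2) by (intro telescoping_positive_part) auto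
   finally have le: "2 * \<kappa> * T + 1 <= (\<Sum>i<N. max 0 (x (Suc i) - x i))" .
   have "1 / eps = 1 / eps * (2 * \<kappa> * T + 1) - T * (2 * \<kappa> / eps)" using eps(1) by (simp add: field_simps)
   also have "\<dots> <= 1 / eps * (\<Sum>i<N. max 0 (x (Suc i) - x i)) - T * (2 * \<kappa> / eps)"
    using le eps(1) by (intro diff_right_mono mult_left_mono) auto
   also have "\<dots> = (\<Sum>i<N. 1 / eps * max 0 (x (Suc i) - x i) - T / real N * (2 * \<kappa> / eps))"
    using elim(2) by (simp add: sum_subtractf sum_distrib_left)
   finally show ?case by (simp only: x_def)
  qed
 qed (use B T drift in auto)
qed

text \<open>Nucleation is the only transition that raises the number of clusters, and its rate is
  bounded by the square of the free mass; growth and shrinkage are invisible to the constant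
  function.\<close>

lemma cluster_number_bound:
 assumes B: "0 <= B" and T: "0 < T"
 shows "\<exists>Z\<in>sets M. {\<omega>\<in>space M. total_mass \<omega> <= B \<and>
   (\<exists>t\<in>{0..T}. measure (\<mu> \<omega> t) {0..} > measure (\<mu> \<omega> 0) {0..} + 2 * (\<alpha>m * B\<^sup>2) * T + 1)} \<subseteq> Z \<and>
  prob Z <= exp (- (1 / eps))"
proof -
 let ?f = "\<lambda>\<nu>. \<integral>x. ramp (-1, 1) x \<partial>\<nu>"
 have rm: "ramp i \<in> borel_measurable borel_nonneg" for i
  by (rule bounded_continuous_measurable[OF ramp_bounded_continuous])
 note one = ramp_one
 have "\<exists>Z\<in>sets M. {\<omega>\<in>space M. total_mass \<omega> <= B \<and> (\<exists>t\<in>{0..T}. ?f (\<mu> \<omega> t) > ?f (\<mu> \<omega> 0) + 2 * (\<alpha>m * B\<^sup>2) * T + 1)} \<subseteq> Z \<and>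
  prob Z <= exp (- (1 / eps))"
 proof (rule positive_variation[OF B T continuous_map_weak_integral(1)[OF ramp_bounded_continuous]])
  fix m y assume m: "m <= B" and y: "y \<in> sbd_class eps m"
  note tr = transitions(5-8)[OF y rm]
  have at: "x >= 2 * eps" if "x \<in> atoms y" for x using sbd_states_atoms(2)[OF eps(1) class_states[OF y] that] .
  have "sbd_generator eps \<alpha> \<beta> a b m (\<lambda>z. exp (1 / eps * max 0 (?f z - ?f y))) y <=
   2 * (1 / eps) * (\<alpha>m * B\<^sup>2 * 1 + \<beta>m * measure y {2 * eps} * 0 +
   Ka * B * (\<Sum>x\<in>atoms y. (1 + x) * measure y {x} * 0) + Kb * (\<Sum>x\<in>atoms y. (1 + x) * measure y {x} * 0))"
  proof (rule generator_exp_le[OF y m])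
   show "1 / eps * max 0 (?f (nucleate eps y) - ?f y) <= 1 / eps * eps * 1"
    using eps(1) by (simp add: tr one del: One_nat_def)
   show "1 / eps * max 0 (?f (denucleate eps y) - ?f y) <= 1 / eps * eps * 0" if "measure y {2 * eps} \<noteq> 0"
    using eps(1) that by (simp add: tr one del: One_nat_def)
   show "1 / eps * max 0 (?f (grow eps y x) - ?f y) <= 1 / eps * eps\<^sup>2 * 0" if "x \<in> atoms y" for x
    using eps(1) that at[OF that] by (simp add: tr one del: One_nat_def)
   show "1 / eps * max 0 (?f (shrink eps y x) - ?f y) <= 1 / eps * eps\<^sup>2 * 0" if "x \<in> atoms y" "x >= 3 * eps" for x
    using eps(1) that at[OF that(1)] by (simp add: tr one del: One_nat_def)
  qed (use eps in auto)
  then show "sbd_generator eps \<alpha> \<beta> a b m (\<lambda>z. exp (1 / eps * max 0 (?f z - ?f y))) y <= 2 * (\<alpha>m * B\<^sup>2) / eps"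
   by simp
 qed
 moreover have eq: "measure (\<mu> \<omega> t) {0..} = ?f (\<mu> \<omega> t)" if "\<omega> \<in> space M" "0 <= t" for \<omega> t
  using measure_Ici_eq_ramp[OF sbd_states_moment_measures[OF eps(1) in_states[OF that]]] .
 have "{\<omega>\<in>space M. total_mass \<omega> <= B \<and> (\<exists>t\<in>{0..T}. measure (\<mu> \<omega> t) {0..} > measure (\<mu> \<omega> 0) {0..} + 2 * (\<alpha>m * B\<^sup>2) * T + 1)} =
  {\<omega>\<in>space M. total_mass \<omega> <= B \<and> (\<exists>t\<in>{0..T}. ?f (\<mu> \<omega> t) > ?f (\<mu> \<omega> 0) + 2 * (\<alpha>m * B\<^sup>2) * T + 1)}"
  by (intro Collect_cong conj_cong refl bex_cong) (simp add: eq del: One_nat_def)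
 ultimately show ?thesis by simp
qed

text \<open>A stochastic Gronwall argument: the drift of the tail integral is proportional to the
  integral itself, so its logarithm is controlled. The offset \<open>1 / R\<close> keeps the
  logarithm away from its pole and absorbs the part of the drift that is bounded by the first moment
  over \<open>R\<close>. In \<open>\<kappa>\<close> the first summand bounds nucleation and the
  second growth; the reverse transitions only lower the integral.\<close>

lemma tail_bound:
 assumes B: "0 <= B" and T: "0 < T" and R: "1 <= R" and small: "2 * eps <= 1" "3 * R * eps <= 1"
 defines "\<kappa> \<equiv> 4 * \<alpha>m * B\<^sup>2 + 3 * Ka * B * (B + 1)"
 shows "\<exists>Z\<in>sets M. {\<omega>\<in>space M. total_mass \<omega> <= B \<and>
   (\<exists>t\<in>{0..T}. (LINT x|\<mu> \<omega> t. tail_weight R x) > ((LINT x|\<mu> \<omega> 0. tail_weight R x) + 1 / R) * exp (2 * \<kappa> * T + 1))} \<subseteq> Z \<and>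
  prob Z <= exp (- (1 / eps))"
proof -
 have R0: "0 < R" using R by simp
 let ?I = "\<lambda>\<nu>. \<integral>x. tail_weight R x \<partial>\<nu>"
 \<comment> \<open>The maximum makes the logarithm a continuous function on the whole line, as
   needed for weak continuity; on moment measures it changes nothing.\<close>
 let ?f = "\<lambda>\<nu>. ln (max (1 / R) (?I \<nu> + 1 / R))"
 have tm: "tail_weight R \<in> borel_measurable borel_nonneg"
  unfolding tail_weight_def[abs_def] using R0 by (intro continuous_measurable_nonneg continuous_intros) auto
 have I0: "0 <= ?I \<nu>" if "\<nu> \<in> moment_measures" for \<nu>
  using tail_weight_nonneg[OF R0] by (intro integral_nonneg_AE AE_I2) (auto simp: space_moment_measure[OF that])
 have f_eq: "?f \<nu> = ln (?I \<nu> + 1 / R)" if "\<nu> \<in> moment_measures" for \<nu> using I0[OF that] by (simp add: max_def)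
 have cf: "continuous_map weak_topology euclideanreal ?f"
 proof -
  have "continuous_on UNIV (\<lambda>r. ln (max (1 / R) (r + 1 / R)))"
  proof (intro continuous_intros ballI)
   fix r :: real
   have "0 < 1 / R" using R0 by simp
   then have "0 < max (1 / R) (r + 1 / R)" by (rule less_max_iff_disj[THEN iffD2, OF disjI1])
   then show "max (1 / R) (r + 1 / R) \<noteq> 0" by linarith
  qed
  then have "continuous_map euclideanreal euclideanreal (\<lambda>r. ln (max (1 / R) (r + 1 / R)))" by simp
  from continuous_map_compose[OF continuous_map_weak_tail_weight[OF R0] this] show ?thesis by (simp add: o_def)
 qed
 have "\<exists>Z\<in>sets M. {\<omega>\<in>space M. total_mass \<omega> <= B \<and> (\<exists>t\<in>{0..T}. ?f (\<mu> \<omega> t) > ?f (\<mu> \<omega> 0) + 2 * \<kappa> * T + 1)} \<subseteq> Z \<and>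
  prob Z <= exp (- (1 / eps))"
 proof (rule positive_variation[OF B T cf])
  fix m y assume m: "m <= B" and y: "y \<in> sbd_class eps m"
  note ym = class_moment_measures[OF y]
  note tr = transitions(5-8)[OF y tm]
  note tm' = sbd_states_moment_measures[OF eps(1) transitions(1)[OF y]] sbd_states_moment_measures[OF eps(1) transitions(2)[OF y]]
   sbd_states_moment_measures[OF eps(1) transitions(3)[OF y]] sbd_states_moment_measures[OF eps(1) transitions(4)[OF y]]
  have at: "x >= 2 * eps" if "x \<in> atoms y" for x using sbd_states_atoms(2)[OF eps(1) class_states[OF y] that] .
  define q where "q = ?I y + 1 / R"
  have q: "1 / R <= q" "0 < q" using I0[OF ym] R0 by (auto simp: q_def add_nonneg_pos)
  have q1: "1 / q <= R" using q R0 by (simp add: field_simps)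
  have up: "max 0 (?f z - ?f y) <= d / q" if z: "z \<in> moment_measures" and d: "?I z - ?I y <= d" "0 <= d" for z d
  proof -
   have zq: "?I z + 1 / R = q + (?I z - ?I y)" by (simp add: q_def)
   have "0 < ?I z + 1 / R" using I0[OF z] R0 by (simp add: add_nonneg_pos)
   then have "ln (q + (?I z - ?I y)) - ln q <= (?I z - ?I y) / q"
    unfolding zq using q by (intro ln_ratio_le)
   moreover have "?f z = ln (q + (?I z - ?I y))" unfolding f_eq[OF z] by (simp only: zq)
   moreover have "?f y = ln q" unfolding f_eq[OF ym] by (simp only: q_def)
   ultimately have "?f z - ?f y <= (?I z - ?I y) / q" by simp
   also have "\<dots> <= d / q" using d q by (intro divide_right_mono) auto
   finally show ?thesis using d q by simp
  qed
  \<comment> \<open>The increment bound for the tail weight divided by the current value: the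
    relative increment, in macroscopic units.\<close>
  define k3 where "k3 x = 3 * min 1 (x / R) / q" for x
  have k3: "0 <= k3 x" "eps * k3 x <= 1" if "x \<in> atoms y" for x
  proof -
   have x0: "0 <= x" using at[OF that] eps(1) by linarith
   then show "0 <= k3 x" using q R0 by (simp add: k3_def)
   have "k3 x <= 3 * R"
    using mult_mono[of "3 * min 1 (x / R)" 3 "1 / q" R] q1 q x0 R0 by (simp add: k3_def)
   then have "eps * k3 x <= eps * (3 * R)" using eps(1) by (intro mult_left_mono) auto
   then show "eps * k3 x <= 1" using small by (simp add: mult_ac)
  qed
  have gen: "sbd_generator eps \<alpha> \<beta> a b m (\<lambda>z. exp (1 / eps * max 0 (?f z - ?f y))) y <=
   2 * (1 / eps) * (\<alpha>m * B\<^sup>2 * (4 * eps\<^sup>2) + \<beta>m * measure y {2 * eps} * 0 +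
   Ka * B * (\<Sum>x\<in>atoms y. (1 + x) * measure y {x} * k3 x) + Kb * (\<Sum>x\<in>atoms y. (1 + x) * measure y {x} * 0))"
  proof (rule generator_exp_le[OF y m])
   have "tail_weight R (2 * eps) <= 4 * eps\<^sup>2 / R"
   proof -
    have "tail_weight R (2 * eps) <= 2 * eps * (2 * eps / R)"
     unfolding tail_weight_def using eps(1) by (intro mult_left_mono) auto
    then show ?thesis by (simp add: power2_eq_square)
   qed
   then have "eps * tail_weight R (2 * eps) <= eps * (4 * eps\<^sup>2 / R)" using eps(1) by (intro mult_left_mono) auto
   then have "max 0 (?f (nucleate eps y) - ?f y) <= eps * (4 * eps\<^sup>2 / R) / q"
    using tr(1) eps(1) R0 by (intro up tm') auto
   also have "\<dots> <= eps * (4 * eps\<^sup>2 / R) * R"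
    using mult_left_mono[OF q1, of "eps * (4 * eps\<^sup>2 / R)"] eps(1) R0 by simp
   finally have "max 0 (?f (nucleate eps y) - ?f y) <= eps * (4 * eps\<^sup>2)" using R0 by simp
   from mult_left_mono[OF this, of "1 / eps"] show "1 / eps * max 0 (?f (nucleate eps y) - ?f y) <= 1 / eps * eps * (4 * eps\<^sup>2)"
    using eps(1) by (simp add: mult.assoc)
   have "(2 * eps) * (2 * eps) <= 1 * 1" using small eps(1) by (intro mult_mono) auto
   then show "1 / eps * eps * (4 * eps\<^sup>2) <= 1" using eps(1) by (simp add: power2_eq_square)
   show "1 / eps * max 0 (?f (denucleate eps y) - ?f y) <= 1 / eps * eps * 0" if d: "measure y {2 * eps} \<noteq> 0"
   proof -
    have "max 0 (?f (denucleate eps y) - ?f y) <= 0 / q"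
     using tr(2)[OF d] eps(1) tail_weight_nonneg[OF R0, of "2 * eps"] by (intro up tm' d) auto
    then show ?thesis by simp
   qed
   show "1 / eps * max 0 (?f (grow eps y x) - ?f y) <= 1 / eps * eps\<^sup>2 * k3 x" if x: "x \<in> atoms y" for x
   proof -
    have "eps * (tail_weight R (x + eps) - tail_weight R x) <= eps * (3 * eps * min 1 (x / R))"
     using tail_weight_increment(1)[OF R0 eps(1) at[OF x]] eps(1) by (intro mult_left_mono) auto
    then have "max 0 (?f (grow eps y x) - ?f y) <= eps * (3 * eps * min 1 (x / R)) / q"
     using tr(3)[OF x] eps(1) R0 at[OF x] by (intro up tm' x) auto
    also have "\<dots> = eps\<^sup>2 * k3 x" by (simp add: k3_def power2_eq_square)
    finally show ?thesis using eps(1) mult_left_mono[of _ "eps\<^sup>2 * k3 x" "1 / eps"] by (simp add: mult.assoc)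
   qed
   show "1 / eps * eps\<^sup>2 * k3 x <= 1" if x: "x \<in> atoms y" for x
    using k3(2)[OF x] eps(1) by (simp add: power2_eq_square)
   show "1 / eps * max 0 (?f (shrink eps y x) - ?f y) <= 1 / eps * eps\<^sup>2 * 0" if x: "x \<in> atoms y" "x >= 3 * eps" for x
   proof -
    have "max 0 (?f (shrink eps y x) - ?f y) <= 0 / q"
     using tr(4)[OF x] tail_weight_increment(2)[OF R0 eps(1) at[OF x(1)]] eps(1)
     by (intro up tm' x) (auto simp: mult_le_0_iff)
    then show ?thesis by simp
   qed
  qed (use eps k3 in auto)
  have "(\<Sum>x\<in>atoms y. (1 + x) * measure y {x} * k3 x) <= (\<Sum>x\<in>atoms y. (3 / q) * ((1 / R) * (x * measure y {x}) + tail_weight R x * measure y {x}))"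
  proof (intro sum_mono)
   fix x assume x: "x \<in> atoms y"
   have "(1 + x) * min 1 (x / R) <= (1 / R) * x + tail_weight R x"
    using R0 by (simp add: distrib_right tail_weight_def min.coboundedI2)
   then have "(3 / q * measure y {x}) * ((1 + x) * min 1 (x / R)) <= (3 / q * measure y {x}) * ((1 / R) * x + tail_weight R x)"
    using q by (intro mult_left_mono) auto
   then show "(1 + x) * measure y {x} * k3 x <= (3 / q) * ((1 / R) * (x * measure y {x}) + tail_weight R x * measure y {x})"
    by (simp add: k3_def algebra_simps add_divide_distrib)
  qed
  also have "\<dots> = (3 / q) * ((1 / R) * (LINT x|y. x) + ?I y)"
   unfolding sum_distrib_left[symmetric] sum.distrib class_sums(3)[OF y] class_sums(1)[OF y tm] ..
  \<comment> \<open>The first moment over \<open>R\<close> is at most \<open>B / R\<close>, hence at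
    most \<open>B * q\<close>; the factor \<open>q\<close> then cancels.\<close>
  also have "\<dots> <= (3 / q) * ((B + 1) * q)"
  proof (intro mult_left_mono)
   have "(1 / R) * (LINT x|y. x) <= (1 / R) * B" using class_moment[OF y] m R0 by (intro mult_left_mono) auto
   moreover have "0 <= B * ?I y" "0 <= 1 / R" using B I0[OF ym] R0 by auto
   moreover have "(B + 1) * q = B * ?I y + ?I y + (1 / R) * B + 1 / R" by (simp add: q_def algebra_simps add_divide_distrib)
   ultimately show "(1 / R) * (LINT x|y. x) + ?I y <= (B + 1) * q" by linarith
  qed (use q in auto)
  also have "\<dots> = 3 * (B + 1)" using q by simp
  finally have sum3: "(\<Sum>x\<in>atoms y. (1 + x) * measure y {x} * k3 x) <= 3 * (B + 1)" .
  have "4 * eps\<^sup>2 <= 4 * 1" using eps by (intro mult_left_mono power_le_one) auto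
  then have "\<alpha>m * B\<^sup>2 * (4 * eps\<^sup>2) <= \<alpha>m * B\<^sup>2 * 4" using alpha by (intro mult_left_mono) auto
  moreover have "Ka * B * (\<Sum>x\<in>atoms y. (1 + x) * measure y {x} * k3 x) <= Ka * B * (3 * (B + 1))"
   using sum3 Ka_nonneg B by (intro mult_left_mono) auto
  ultimately have "\<alpha>m * B\<^sup>2 * (4 * eps\<^sup>2) + Ka * B * (\<Sum>x\<in>atoms y. (1 + x) * measure y {x} * k3 x) <= \<kappa>"
   by (simp add: \<kappa>_def algebra_simps)
  then have "2 * (1 / eps) * (\<alpha>m * B\<^sup>2 * (4 * eps\<^sup>2) + Ka * B * (\<Sum>x\<in>atoms y. (1 + x) * measure y {x} * k3 x)) <= 2 * (1 / eps) * \<kappa>"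
   using eps(1) by (intro mult_left_mono) auto
  with gen show "sbd_generator eps \<alpha> \<beta> a b m (\<lambda>z. exp (1 / eps * max 0 (?f z - ?f y))) y <= 2 * \<kappa> / eps"
   by simp
 qed
 moreover have "{\<omega>\<in>space M. total_mass \<omega> <= B \<and> (\<exists>t\<in>{0..T}. ?I (\<mu> \<omega> t) > (?I (\<mu> \<omega> 0) + 1 / R) * exp (2 * \<kappa> * T + 1))} \<subseteq>
  {\<omega>\<in>space M. total_mass \<omega> <= B \<and> (\<exists>t\<in>{0..T}. ?f (\<mu> \<omega> t) > ?f (\<mu> \<omega> 0) + 2 * \<kappa> * T + 1)}"
 proof safe
  fix \<omega> t assume \<omega>: "\<omega> \<in> space M" and t: "t \<in> {0..T}" and gt: "?I (\<mu> \<omega> t) > (?I (\<mu> \<omega> 0) + 1 / R) * exp (2 * \<kappa> * T + 1)"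
  have mm: "\<mu> \<omega> s \<in> moment_measures" if "0 <= s" for s using sbd_states_moment_measures[OF eps(1) in_states[OF \<omega> that]] .
  have p: "0 < ?I (\<mu> \<omega> s) + 1 / R" if "0 <= s" for s using I0[OF mm[OF that]] R0 by (simp add: add_nonneg_pos)
  have "(?I (\<mu> \<omega> 0) + 1 / R) * exp (2 * \<kappa> * T + 1) < ?I (\<mu> \<omega> t) + 1 / R"
   using gt R0 by (simp add: add_strict_increasing2 less_trans[OF _ less_add_same_cancel1[THEN iffD2]])
  then have "ln ((?I (\<mu> \<omega> 0) + 1 / R) * exp (2 * \<kappa> * T + 1)) < ln (?I (\<mu> \<omega> t) + 1 / R)"
   using p[of 0] p[of t] t by (subst ln_less_cancel_iff) auto
  then have "ln (?I (\<mu> \<omega> 0) + 1 / R) + (2 * \<kappa> * T + 1) < ln (?I (\<mu> \<omega> t) + 1 / R)"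
   using p[of 0] by (simp add: ln_mult)
  then show "\<exists>t\<in>{0..T}. ?f (\<mu> \<omega> t) > ?f (\<mu> \<omega> 0) + 2 * \<kappa> * T + 1"
   using t f_eq[OF mm[of 0]] f_eq[OF mm[of t]] by (intro bexI[OF _ t]) auto
 qed
 ultimately show ?thesis by blast
qed

text \<open>On one cell of length \<open>\<delta>\<close> the total variation of a ramp integral is
  penalised with factor \<open>1 / eps\<close>. The compensator costs
  \<open>2 * \<kappa> * \<delta> / eps\<close>, and the extra summand 1 leaves the exponent
  \<open>\<delta> / eps\<close>. The slope of the ramp bounds the effect of growth and
  shrinkage.\<close>

lemma modulus_bound:
 assumes B: "0 <= B" and A: "0 <= A" and s0: "0 <= s\<^sub>0" and d: "0 < \<delta>" and small: "eps * real (snd i) <= 1"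
 defines "\<kappa> \<equiv> \<alpha>m * B\<^sup>2 + \<beta>m * A + (Ka * B + Kb) * (real (snd i) * (A + B))"
 shows "\<exists>Z\<in>sets M. {\<omega>\<in>space M. total_mass \<omega> <= B \<and> (\<forall>t\<in>{s\<^sub>0..s\<^sub>0 + \<delta>}. measure (\<mu> \<omega> t) {0..} <= A) \<and>
   (\<exists>s\<in>{s\<^sub>0..s\<^sub>0 + \<delta>}. \<exists>t\<in>{s\<^sub>0..s\<^sub>0 + \<delta>}. \<bar>(LINT x|\<mu> \<omega> s. ramp i x) - (LINT x|\<mu> \<omega> t. ramp i x)\<bar> > (2 * \<kappa> + 1) * \<delta>)} \<subseteq> Z \<and>
  prob Z <= exp (- (\<delta> / eps))"
proof -
 let ?f = "\<lambda>\<nu>. \<integral>x. ramp i x \<partial>\<nu>"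
 \<comment> \<open>The penalty is switched off above \<open>A\<close> clusters, where the rates are
   not controlled; on the event considered this never happens.\<close>
 let ?w = "\<lambda>t m y z. if measure y {0..} <= A then 1 / eps * \<bar>?f z - ?f y\<bar> else 0"
 have rm: "ramp i \<in> borel_measurable borel_nonneg"
  by (rule bounded_continuous_measurable[OF ramp_bounded_continuous])
 have cf: "continuous_map weak_topology euclideanreal ?f"
  by (rule continuous_map_weak_integral(1)[OF ramp_bounded_continuous])
 have \<kappa>0: "0 <= \<kappa>" unfolding \<kappa>_def using alpha beta B A Ka_nonneg Kb_nonneg by auto
 obtain G where G: "0 <= G" and G': "\<forall>m y. m <= B \<longrightarrow> y \<in> sbd_class eps m \<longrightarrow> \<bar>?f y\<bar> <= G"
  using class_bounded[where B=B and g="?f"] by (elim exE conjE)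
 note G = G G'[rule_format]
 show ?thesis
 proof (rule path_inequality[where s\<^sub>0=s\<^sub>0 and \<delta>=\<delta> and B=B and w="?w" and \<theta>="\<lambda>t m y. 2 * \<kappa> / eps"
    and Wb="1 / eps * (2 * G)" and Tb="2 * \<kappa> / eps"])
  show "?w t m y z <= 1 / eps * (2 * G)" if "m <= B" "y \<in> sbd_class eps m" "z \<in> sbd_class eps m" for t m y z
  proof -
   have "1 / eps * \<bar>?f z - ?f y\<bar> <= 1 / eps * (2 * G)"
    using G(2)[OF that(1,2)] G(2)[OF that(1,3)] eps(1) by (intro mult_left_mono) auto
   moreover have "0 <= 1 / eps * (2 * G)" using G(1) eps(1) by simp
   ultimately show ?thesis by simp
  qed
  fix m y assume m: "m <= B" and y: "y \<in> sbd_class eps m"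
  show "sbd_generator eps \<alpha> \<beta> a b m (\<lambda>z. exp (?w t m y z)) y <= 2 * \<kappa> / eps" for t
  proof (cases "measure y {0..} <= A")
   case False
   then have "sbd_generator eps \<alpha> \<beta> a b m (\<lambda>z. exp (?w t m y z)) y = 0" using generator_one[OF y] by simp
   then show ?thesis using \<kappa>0 eps(1) by simp
  next
   case True
   note tr = transitions(5-8)[OF y rm]
   let ?k = "\<lambda>x::real. real (snd i)"
   have lam: "1 / eps * eps\<^sup>2 * real (snd i) = eps * real (snd i)" using eps(1) by (simp add: power2_eq_square)
   have gen: "sbd_generator eps \<alpha> \<beta> a b m (\<lambda>z. exp (1 / eps * \<bar>?f z - ?f y\<bar>)) y <=
    2 * (1 / eps) * (\<alpha>m * B\<^sup>2 * 1 + \<beta>m * measure y {2 * eps} * 1 +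
    Ka * B * (\<Sum>x\<in>atoms y. (1 + x) * measure y {x} * real (snd i)) + Kb * (\<Sum>x\<in>atoms y. (1 + x) * measure y {x} * real (snd i)))"
   proof (rule generator_exp_le[OF y m])
    show "1 / eps * \<bar>?f (nucleate eps y) - ?f y\<bar> <= 1 / eps * eps * 1"
     using eps(1) ramp_bounds[of i "2 * eps"] by (simp add: tr abs_mult)
    show "1 / eps * \<bar>?f (denucleate eps y) - ?f y\<bar> <= 1 / eps * eps * 1" if "measure y {2 * eps} \<noteq> 0"
     using eps(1) ramp_bounds[of i "2 * eps"] that by (simp add: tr abs_mult)
    have step: "1 / eps * \<bar>eps * (ramp i u - ramp i v)\<bar> <= 1 / eps * eps\<^sup>2 * real (snd i)" if "\<bar>u - v\<bar> = eps" for u v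
     unfolding lam abs_mult using ramp_lipschitz[of i u v] eps(1) that by (simp add: mult.commute)
    show "1 / eps * \<bar>?f (grow eps y x) - ?f y\<bar> <= 1 / eps * eps\<^sup>2 * real (snd i)" if "x \<in> atoms y" for x
     using step[of "x + eps" x] eps(1) that by (simp add: tr)
    show "1 / eps * \<bar>?f (shrink eps y x) - ?f y\<bar> <= 1 / eps * eps\<^sup>2 * real (snd i)" if "x \<in> atoms y" "x >= 3 * eps" for x
     using step[of "x - eps" x] eps(1) that by (simp add: tr)
    show "1 / eps * eps\<^sup>2 * real (snd i) <= 1" using small lam by simp
    show "1 / eps * eps\<^sup>2 * real (snd i) <= 1" using small lam by simp
   qed (use eps in auto)
   have S: "(\<Sum>x\<in>atoms y. (1 + x) * measure y {x} * real (snd i)) = (measure y {0..} + (LINT x|y. x)) * real (snd i)"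
    unfolding sum_distrib_right[symmetric] distrib_right mult_1 sum.distrib class_sums(2,3)[OF y] ..
   have S': "(measure y {0..} + (LINT x|y. x)) * real (snd i) <= real (snd i) * (A + B)"
    using True class_moment[OF y] m by (subst mult.commute) (intro mult_left_mono, auto)
   have "\<beta>m * measure y {2 * eps} <= \<beta>m * A" using class_sums(4)[OF y] True beta by (intro mult_left_mono) auto
   moreover have "Ka * B * ((measure y {0..} + (LINT x|y. x)) * real (snd i)) <= Ka * B * (real (snd i) * (A + B))"
    using S' Ka_nonneg B by (intro mult_left_mono) auto
   moreover have "Kb * ((measure y {0..} + (LINT x|y. x)) * real (snd i)) <= Kb * (real (snd i) * (A + B))"
    using S' Kb_nonneg by (intro mult_left_mono) auto
   ultimately have "\<alpha>m * B\<^sup>2 * 1 + \<beta>m * measure y {2 * eps} * 1 +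
    Ka * B * ((measure y {0..} + (LINT x|y. x)) * real (snd i)) + Kb * ((measure y {0..} + (LINT x|y. x)) * real (snd i)) <= \<kappa>"
    by (simp add: \<kappa>_def distrib_right)
   then have "2 * (1 / eps) * (\<alpha>m * B\<^sup>2 * 1 + \<beta>m * measure y {2 * eps} * 1 +
    Ka * B * ((measure y {0..} + (LINT x|y. x)) * real (snd i)) + Kb * ((measure y {0..} + (LINT x|y. x)) * real (snd i))) <= 2 * (1 / eps) * \<kappa>"
    using eps(1) by (intro mult_left_mono) auto
   with gen True show ?thesis by (simp add: S)
  qed
 next
  fix \<omega> assume "\<omega> \<in> {\<omega>\<in>space M. total_mass \<omega> <= B \<and> (\<forall>t\<in>{s\<^sub>0..s\<^sub>0 + \<delta>}. measure (\<mu> \<omega> t) {0..} <= A) \<and>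
   (\<exists>s\<in>{s\<^sub>0..s\<^sub>0 + \<delta>}. \<exists>t\<in>{s\<^sub>0..s\<^sub>0 + \<delta>}. \<bar>?f (\<mu> \<omega> s) - ?f (\<mu> \<omega> t)\<bar> > (2 * \<kappa> + 1) * \<delta>)}"
  then obtain s t where \<omega>: "\<omega> \<in> space M" and le: "\<And>t. s\<^sub>0 <= t ==> t <= s\<^sub>0 + \<delta> ==> measure (\<mu> \<omega> t) {0..} <= A"
   and s: "s\<^sub>0 <= s" "s <= s\<^sub>0 + \<delta>" and t: "s\<^sub>0 <= t" "t <= s\<^sub>0 + \<delta>" and gt: "\<bar>?f (\<mu> \<omega> s) - ?f (\<mu> \<omega> t)\<bar> > (2 * \<kappa> + 1) * \<delta>" by auto
  note app = rcll_grid_approximation[OF rcll_cadlag[OF in_cadlag[OF \<omega>] cf] s0 d]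
  obtain j where j: "\<And>N :: nat. N > 0 ==> j N <= N" "(\<lambda>N. ?f (\<mu> \<omega> (s\<^sub>0 + real (j N) * (\<delta> / real N)))) \<longlonglongrightarrow> ?f (\<mu> \<omega> s)"
   using app[OF s] by blast
  obtain l where l: "\<And>N :: nat. N > 0 ==> l N <= N" "(\<lambda>N. ?f (\<mu> \<omega> (s\<^sub>0 + real (l N) * (\<delta> / real N)))) \<longlonglongrightarrow> ?f (\<mu> \<omega> t)"
   using app[OF t] by blast
  have "(\<lambda>N. \<bar>?f (\<mu> \<omega> (s\<^sub>0 + real (j N) * (\<delta> / real N))) - ?f (\<mu> \<omega> (s\<^sub>0 + real (l N) * (\<delta> / real N)))\<bar>) \<longlonglongrightarrow> \<bar>?f (\<mu> \<omega> s) - ?f (\<mu> \<omega> t)\<bar>"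
   by (intro tendsto_rabs tendsto_diff j l)
  from order_tendstoD(1)[OF this gt] eventually_gt_at_top[of 0]
  show "eventually (\<lambda>N. \<delta> / eps <= (\<Sum>i<N. ?w (s\<^sub>0 + real i * (\<delta> / real N)) (total_mass \<omega>) (\<mu> \<omega> (s\<^sub>0 + real i * (\<delta> / real N))) (\<mu> \<omega> (s\<^sub>0 + real (Suc i) * (\<delta> / real N)))
    - \<delta> / real N * (2 * \<kappa> / eps))) sequentially"
  proof eventually_elim
   case (elim N)
   define x where "x i = ?f (\<mu> \<omega> (s\<^sub>0 + real i * (\<delta> / real N)))" for i
   have "(2 * \<kappa> + 1) * \<delta> <= \<bar>x (j N) - x (l N)\<bar>" using elim by (simp add: x_def)
   also have "\<dots> <= (\<Sum>i<N. \<bar>x (Suc i) - x i\<bar>)" using j(1) l(1) elim(2) by (intro telescoping_abs) auto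
   finally have le1: "(2 * \<kappa> + 1) * \<delta> <= (\<Sum>i<N. \<bar>x (Suc i) - x i\<bar>)" .
   have "\<delta> / eps = 1 / eps * ((2 * \<kappa> + 1) * \<delta>) - \<delta> * (2 * \<kappa> / eps)" using eps(1) by (simp add: field_simps)
   also have "\<dots> <= 1 / eps * (\<Sum>i<N. \<bar>x (Suc i) - x i\<bar>) - \<delta> * (2 * \<kappa> / eps)"
    using le1 eps(1) by (intro diff_right_mono mult_left_mono) auto
   also have "\<dots> = (\<Sum>i<N. 1 / eps * \<bar>x (Suc i) - x i\<bar> - \<delta> / real N * (2 * \<kappa> / eps))"
    using elim(2) by (simp add: sum_subtractf sum_distrib_left)
   also have "\<dots> = (\<Sum>i<N. ?w (s\<^sub>0 + real i * (\<delta> / real N)) (total_mass \<omega>) (\<mu> \<omega> (s\<^sub>0 + real i * (\<delta> / real N))) (\<mu> \<omega> (s\<^sub>0 + real (Suc i) * (\<delta> / real N)))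
    - \<delta> / real N * (2 * \<kappa> / eps))"
   proof (intro sum.cong refl)
    fix i assume i: "i \<in> {..<N}"
    have "real i * (\<delta> / real N) <= real N * (\<delta> / real N)" using i d by (intro mult_right_mono) auto
    then have "measure (\<mu> \<omega> (s\<^sub>0 + real i * (\<delta> / real N))) {0..} <= A" using elim(2) d by (intro le) auto
    then show "1 / eps * \<bar>x (Suc i) - x i\<bar> - \<delta> / real N * (2 * \<kappa> / eps) =
      ?w (s\<^sub>0 + real i * (\<delta> / real N)) (total_mass \<omega>) (\<mu> \<omega> (s\<^sub>0 + real i * (\<delta> / real N))) (\<mu> \<omega> (s\<^sub>0 + real (Suc i) * (\<delta> / real N)))
      - \<delta> / real N * (2 * \<kappa> / eps)" by (simp add: x_def)
   qed
   finally show ?case .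
  qed
 qed (use B s0 d \<kappa>0 eps(1) in auto)
qed

end


section \<open>Deviation of the process from its drift\<close>

text \<open>The flux term of the equation, with aggregation and fragmentation separated. The
  parameter \<open>m\<close> is the random total mass for the process and the deterministic one for
  the limit.\<close>

definition drift_functional :: "(real => real) => (real => real) => real => real measure => real" where
 "drift_functional \<psi>a \<psi>b m \<nu> = (m - (LINT x|\<nu>. x)) * (LINT x|\<nu>. \<psi>a x) - (LINT x|\<nu>. \<psi>b x)"

lemma continuous_map_drift_functional:
 "\<psi>a \<in> bounded_continuous ==> \<psi>b \<in> bounded_continuous ==>
  continuous_map weak_topology euclideanreal (drift_functional \<psi>a \<psi>b m)"
 unfolding drift_functional_def
 by (intro continuous_map_diff continuous_map_real_mult continuous_map_weak_integral(1) continuous_map_weak_moment continuous_map_const[THEN iffD2]) auto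

text \<open>The equation integrated over times up to \<open>T\<close>; exchanging the order of the
  two time integrals produces the weight \<open>T - s\<close>.\<close>

definition drift_deviation ::
 "(real => real) => (real => real) => (real => real) => real => real => (real => real measure) => real" where
 "drift_deviation \<phi> \<psi>a \<psi>b m T x = path_integral T (\<lambda>_. 1) (\<lambda>\<nu>. LINT z|\<nu>. \<phi> z) x - T * (LINT z|x 0. \<phi> z) -
  path_integral T (\<lambda>s. T - s) (drift_functional \<psi>a \<psi>b m) x"

context sbd_rescaled
begin

text \<open>The sign \<sigma> yields both one-sided bounds. The errors \<open>ea\<close> and
  \<open>eb\<close> of the difference quotients and the squares in \<open>quad\<close> are bounded
  by multiples of \<open>x\<close>, so that summing over clusters leaves only the first moment and
  never the number of clusters.\<close>

context
 fixes B T \<sigma> \<eta> Q :: real and \<phi> \<psi>a \<psi>b :: "real => real"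
 assumes B: "0 <= B" and T: "0 < T" and \<sigma>: "\<bar>\<sigma>\<bar> = 1"
  and \<phi>: "\<phi> \<in> bounded_continuous" "\<psi>a \<in> bounded_continuous" "\<psi>b \<in> bounded_continuous"
  and \<phi>2: "\<phi> (2 * eps) = 0" and pos: "0 <= \<eta>" "0 <= Q"
  and lip: "\<And>x. 2 * eps <= x ==> T * \<bar>\<phi> (x + eps) - \<phi> x\<bar> <= 1" "\<And>x. 2 * eps <= x ==> T * \<bar>\<phi> (x - eps) - \<phi> x\<bar> <= 1"
  and quad: "\<And>x. 2 * eps <= x ==> (1 + x) * (\<phi> (x + eps) - \<phi> x)\<^sup>2 <= Q * eps\<^sup>2 * x"
   "\<And>x. 2 * eps <= x ==> (1 + x) * (\<phi> (x - eps) - \<phi> x)\<^sup>2 <= Q * eps\<^sup>2 * x"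
  and ea: "\<And>x. 2 * eps <= x ==> \<bar>(\<phi> (x + eps) - \<phi> x) / eps * a x - \<psi>a x\<bar> <= \<eta> * x"
  and eb: "\<And>x. 2 * eps <= x ==> \<bar>(if 3 * eps <= x then (\<phi> (x - eps) - \<phi> x) / eps * b x else 0) + \<psi>b x\<bar> <= \<eta> * x"
begin

text \<open>From \<open>exp u <= 1 + u + u\<^sup>2\<close>: the linear part is the drift, up to
  \<open>\<eta> / eps\<close>. In the quadratic part the squared increments cancel the rate
  \<open>1 / eps\<^sup>2\<close>, so it stays bounded and is negligible against
  \<open>1 / eps\<close>.\<close>

lemma drift_generator_le:
 assumes m: "m <= B" and y: "y \<in> sbd_class eps m" and v: "0 <= v" "v <= T"
 shows "sbd_generator eps \<alpha> \<beta> a b m (\<lambda>z. exp (\<sigma> / eps * (v * ((LINT x|z. \<phi> x) - (LINT x|y. \<phi> x))))) y <=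
  \<sigma> / eps * (v * drift_functional \<psi>a \<psi>b m y) + (T * \<eta> * B * (B + 1) / eps + T\<^sup>2 * (Ka * B + Kb) * Q * B)"
proof -
 note e = eps(1)
 have s: "y \<in> sbd_states eps" by (rule class_states[OF y])
 let ?c = "m - (LINT x|y. x)"
 have c: "0 <= ?c" "?c <= B" using sbd_class_transitions(1)[OF e y] class_moment[OF y] m by auto
 note meas = bounded_continuous_measurable[OF \<phi>(1)]
 note tr = transitions(5-8)[OF y meas]
 have at: "x >= 2 * eps" if "x \<in> atoms y" for x using sbd_states_atoms(2)[OF e s that] .
 have fin: "finite (atoms y)" by (rule sbd_states_atoms(1)[OF e s])
 have \<sigma>2: "\<sigma>\<^sup>2 = 1" using \<sigma> by (metis power2_abs one_power2)
 have u1: "\<sigma> * v * d <= 1" if "T * \<bar>d\<bar> <= 1" for d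
 proof -
  have "\<sigma> * v * d <= \<bar>\<sigma> * v * d\<bar>" by simp
  also have "\<dots> = v * \<bar>d\<bar>" using \<sigma> v by (simp add: abs_mult)
  also have "\<dots> <= T * \<bar>d\<bar>" using v by (intro mult_right_mono) auto
  finally show ?thesis using that by linarith
 qed
 have v2: "(\<sigma> * v * d)\<^sup>2 <= T\<^sup>2 * d\<^sup>2" for d
 proof -
  have "v\<^sup>2 <= T\<^sup>2" using v by (intro power_mono) auto
  then show ?thesis by (simp add: power_mult_distrib \<sigma>2 mult_right_mono)
 qed
 define p where "p x = \<phi> (x + eps) - \<phi> x" for x
 define n where "n x = \<phi> (x - eps) - \<phi> x" for x
 define pa where "pa x = p x / eps * a x" for x
 define pb where "pb x = (if 3 * eps <= x then n x / eps * b x else 0)" for x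
 have up: "(exp (\<sigma> / eps * (v * (eps * p x))) - 1) * (a x * ?c * measure y {x} / eps\<^sup>2) <=
   \<sigma> / eps * v * (pa x * ?c * measure y {x}) + T\<^sup>2 * Ka * B * Q * (x * measure y {x})" if x: "x \<in> atoms y" for x
 proof -
  let ?u = "\<sigma> * v * p x" and ?r = "a x * ?c * measure y {x} / eps\<^sup>2"
  have eq: "\<sigma> / eps * (v * (eps * p x)) = ?u" using e by simp
  have "exp ?u - 1 <= ?u + ?u\<^sup>2" using exp_le_quadratic[OF u1[OF lip(1)[OF at[OF x]]]] by (simp add: p_def)
  then have "(exp ?u - 1) * ?r <= (?u + ?u\<^sup>2) * ?r" using growth_rate_bounds(1)[OF y m x] by (intro mult_right_mono)
  also have "\<dots> = \<sigma> / eps * v * (pa x * ?c * measure y {x}) + ?u\<^sup>2 * ?r"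
   using e by (simp add: pa_def power2_eq_square field_simps)
  also have "?u\<^sup>2 * ?r <= (T\<^sup>2 * (p x)\<^sup>2) * (Ka * B * ((1 + x) * measure y {x}) / eps\<^sup>2)"
   using v2 growth_rate_bounds[OF y m x] by (intro mult_mono) auto
  also have "\<dots> = T\<^sup>2 * Ka * B * measure y {x} / eps\<^sup>2 * ((1 + x) * (p x)\<^sup>2)" by (simp add: field_simps)
  also have "\<dots> <= T\<^sup>2 * Ka * B * measure y {x} / eps\<^sup>2 * (Q * eps\<^sup>2 * x)"
   using quad(1)[OF at[OF x]] Ka_nonneg B by (intro mult_left_mono) (auto simp: p_def)
  also have "\<dots> = T\<^sup>2 * Ka * B * Q * (x * measure y {x})" using e by simp
  finally show ?thesis unfolding eq by simp
 qed
 have down: "(exp (\<sigma> / eps * (v * (eps * n x))) - 1) * (b x * measure y {x} / eps\<^sup>2) <=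
   \<sigma> / eps * v * (pb x * measure y {x}) + T\<^sup>2 * Kb * Q * (x * measure y {x})" if x: "x \<in> atoms y" and x3: "3 * eps <= x" for x
 proof -
  let ?u = "\<sigma> * v * n x" and ?r = "b x * measure y {x} / eps\<^sup>2"
  have eq: "\<sigma> / eps * (v * (eps * n x)) = ?u" using e by simp
  have "exp ?u - 1 <= ?u + ?u\<^sup>2" using exp_le_quadratic[OF u1[OF lip(2)[OF at[OF x]]]] by (simp add: n_def)
  then have "(exp ?u - 1) * ?r <= (?u + ?u\<^sup>2) * ?r" using shrink_rate_bounds(1)[OF y x] by (intro mult_right_mono)
  also have "\<dots> = \<sigma> / eps * v * (pb x * measure y {x}) + ?u\<^sup>2 * ?r"
   using e x3 by (simp add: pb_def power2_eq_square field_simps)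
  also have "?u\<^sup>2 * ?r <= (T\<^sup>2 * (n x)\<^sup>2) * (Kb * ((1 + x) * measure y {x}) / eps\<^sup>2)"
   using v2 shrink_rate_bounds[OF y x] by (intro mult_mono) auto
  also have "\<dots> = T\<^sup>2 * Kb * measure y {x} / eps\<^sup>2 * ((1 + x) * (n x)\<^sup>2)" by (simp add: field_simps)
  also have "\<dots> <= T\<^sup>2 * Kb * measure y {x} / eps\<^sup>2 * (Q * eps\<^sup>2 * x)"
   using quad(2)[OF at[OF x]] Kb_nonneg by (intro mult_left_mono) (auto simp: n_def)
  also have "\<dots> = T\<^sup>2 * Kb * Q * (x * measure y {x})" using e by simp
  finally show ?thesis unfolding eq by simp
 qed
 have A0: "0 <= T\<^sup>2 * Kb * Q * (x * measure y {x})" if "x \<in> atoms y" for x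
  using at[OF that] e Kb_nonneg pos by (intro mult_nonneg_nonneg) auto
 have gr: "(LINT z|grow eps y x. \<phi> z) - (LINT z|y. \<phi> z) = eps * p x" if "x \<in> atoms y" for x
  using tr(3)[OF that] by (simp add: p_def)
 have sh: "(LINT z|shrink eps y x. \<phi> z) - (LINT z|y. \<phi> z) = eps * n x" if "x \<in> atoms y" "x >= 3 * eps" for x
  using tr(4)[OF that] by (simp add: n_def)
 have term3: "(\<Sum>x\<in>atoms y. (exp (\<sigma> / eps * (v * ((LINT z|grow eps y x. \<phi> z) - (LINT z|y. \<phi> z)))) - exp (\<sigma> / eps * (v * ((LINT z|y. \<phi> z) - (LINT z|y. \<phi> z))))) * (a x * ?c * measure y {x} / eps\<^sup>2))
   <= (\<Sum>x\<in>atoms y. \<sigma> / eps * v * (pa x * ?c * measure y {x}) + T\<^sup>2 * Ka * B * Q * (x * measure y {x}))"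
  using up by (intro sum_mono) (simp add: gr)
 have "(\<Sum>x\<in>atoms y \<inter> {3 * eps..}. (exp (\<sigma> / eps * (v * ((LINT z|shrink eps y x. \<phi> z) - (LINT z|y. \<phi> z)))) - exp (\<sigma> / eps * (v * ((LINT z|y. \<phi> z) - (LINT z|y. \<phi> z))))) * (b x * measure y {x} / eps\<^sup>2))
   <= (\<Sum>x\<in>atoms y \<inter> {3 * eps..}. \<sigma> / eps * v * (pb x * measure y {x}) + T\<^sup>2 * Kb * Q * (x * measure y {x}))"
  using down by (intro sum_mono) (simp add: sh)
 \<comment> \<open>Below \<open>3 * eps\<close> the coefficient \<open>pb\<close> is 0 and the
   remaining term is nonnegative, so the sum may run over all atoms.\<close>
 also have "\<dots> <= (\<Sum>x\<in>atoms y. \<sigma> / eps * v * (pb x * measure y {x}) + T\<^sup>2 * Kb * Q * (x * measure y {x}))"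
  using A0 fin by (intro sum_mono2) (auto simp: pb_def)
 finally have term4: "(\<Sum>x\<in>atoms y \<inter> {3 * eps..}. (exp (\<sigma> / eps * (v * ((LINT z|shrink eps y x. \<phi> z) - (LINT z|y. \<phi> z)))) - exp (\<sigma> / eps * (v * ((LINT z|y. \<phi> z) - (LINT z|y. \<phi> z))))) * (b x * measure y {x} / eps\<^sup>2))
   <= (\<Sum>x\<in>atoms y. \<sigma> / eps * v * (pb x * measure y {x}) + T\<^sup>2 * Kb * Q * (x * measure y {x}))" .
 have term1: "(exp (\<sigma> / eps * (v * ((LINT z|nucleate eps y. \<phi> z) - (LINT z|y. \<phi> z)))) - exp (\<sigma> / eps * (v * ((LINT z|y. \<phi> z) - (LINT z|y. \<phi> z))))) * r = 0" for r
  using tr(1) \<phi>2 by simp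
 have term2: "(exp (\<sigma> / eps * (v * ((LINT z|denucleate eps y. \<phi> z) - (LINT z|y. \<phi> z)))) - exp (\<sigma> / eps * (v * ((LINT z|y. \<phi> z) - (LINT z|y. \<phi> z))))) * (\<beta> * measure y {2 * eps} / eps) = 0"
  using tr(2) \<phi>2 by (cases "measure y {2 * eps} = 0") auto
 have le1: "sbd_generator eps \<alpha> \<beta> a b m (\<lambda>z. exp (\<sigma> / eps * (v * ((LINT x|z. \<phi> x) - (LINT x|y. \<phi> x))))) y <=
   (\<Sum>x\<in>atoms y. \<sigma> / eps * v * (pa x * ?c * measure y {x}) + T\<^sup>2 * Ka * B * Q * (x * measure y {x})) +
   (\<Sum>x\<in>atoms y. \<sigma> / eps * v * (pb x * measure y {x}) + T\<^sup>2 * Kb * Q * (x * measure y {x}))"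
  unfolding sbd_generator_eq[OF e s] term1 term2 using term3 term4 by linarith
 have eq: "(\<Sum>x\<in>atoms y. \<sigma> / eps * v * (pa x * c * measure y {x}) + T\<^sup>2 * Ka * B * Q * (x * measure y {x})) +
   (\<Sum>x\<in>atoms y. \<sigma> / eps * v * (pb x * measure y {x}) + T\<^sup>2 * Kb * Q * (x * measure y {x})) =
   \<sigma> / eps * v * (\<Sum>x\<in>atoms y. (pa x * c + pb x) * measure y {x}) +
   T\<^sup>2 * (Ka * B + Kb) * Q * (\<Sum>x\<in>atoms y. x * measure y {x})" for c
  unfolding sum_distrib_left sum.distrib[symmetric] by (intro sum.cong) (simp_all add: algebra_simps add_divide_distrib)
 have bound1: "T\<^sup>2 * (Ka * B + Kb) * Q * (LINT x|y. x) <= T\<^sup>2 * (Ka * B + Kb) * Q * B"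
  using class_moment[OF y] m Ka_nonneg Kb_nonneg B pos by (intro mult_left_mono) auto
 have bound2: "\<sigma> / eps * v * (\<Sum>x\<in>atoms y. (pa x * ?c + pb x) * measure y {x}) <=
   \<sigma> / eps * (v * drift_functional \<psi>a \<psi>b m y) + T * \<eta> * B * (B + 1) / eps"
 proof -
  let ?S = "\<Sum>x\<in>atoms y. (pa x * ?c + pb x) * measure y {x}" and ?G = "drift_functional \<psi>a \<psi>b m y"
  have "?G = ?c * (\<Sum>x\<in>atoms y. \<psi>a x * measure y {x}) - (\<Sum>x\<in>atoms y. \<psi>b x * measure y {x})"
   unfolding drift_functional_def using class_sums(1)[OF y bounded_continuous_measurable[OF \<phi>(2)]]
    class_sums(1)[OF y bounded_continuous_measurable[OF \<phi>(3)]] by simp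
  then have SG: "?S - ?G = (\<Sum>x\<in>atoms y. ((pa x - \<psi>a x) * ?c + (pb x + \<psi>b x)) * measure y {x})"
   by (simp add: sum_subtractf[symmetric] sum.distrib[symmetric] sum_distrib_left algebra_simps)
  have "\<bar>?S - ?G\<bar> <= (\<Sum>x\<in>atoms y. \<bar>((pa x - \<psi>a x) * ?c + (pb x + \<psi>b x)) * measure y {x}\<bar>)" unfolding SG by (rule sum_abs)
  also have "\<dots> <= (\<Sum>x\<in>atoms y. \<eta> * (B + 1) * (x * measure y {x}))"
  proof (intro sum_mono)
   fix x assume x: "x \<in> atoms y"
   have x0: "0 <= x" using at[OF x] e by linarith
   have "\<bar>(pa x - \<psi>a x) * ?c + (pb x + \<psi>b x)\<bar> <= \<bar>pa x - \<psi>a x\<bar> * ?c + \<bar>pb x + \<psi>b x\<bar>"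
    using abs_triangle_ineq[of "(pa x - \<psi>a x) * ?c" "pb x + \<psi>b x"] c by (simp add: abs_mult)
   also have "\<dots> <= (\<eta> * x) * B + \<eta> * x"
    using ea[OF at[OF x]] eb[OF at[OF x]] c pos x0 unfolding pa_def pb_def p_def n_def by (intro add_mono mult_mono) auto
   finally have "\<bar>(pa x - \<psi>a x) * ?c + (pb x + \<psi>b x)\<bar> * measure y {x} <= ((\<eta> * x) * B + \<eta> * x) * measure y {x}"
    by (intro mult_right_mono) auto
   then show "\<bar>((pa x - \<psi>a x) * ?c + (pb x + \<psi>b x)) * measure y {x}\<bar> <= \<eta> * (B + 1) * (x * measure y {x})"
    unfolding abs_mult[of _ "measure y {x}"] by (simp add: distrib_left distrib_right mult_ac)
  qed
  also have "\<dots> = \<eta> * (B + 1) * (LINT x|y. x)" unfolding sum_distrib_left[symmetric] class_sums(3)[OF y] ..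
  also have "\<dots> <= \<eta> * (B + 1) * B" using class_moment[OF y] m pos B by (intro mult_left_mono) auto
  finally have d: "\<bar>?S - ?G\<bar> <= \<eta> * (B + 1) * B" .
  have "\<sigma> / eps * v * (?S - ?G) <= \<bar>\<sigma> / eps * v * (?S - ?G)\<bar>" by (rule abs_ge_self)
  also have "\<dots> = 1 / eps * v * \<bar>?S - ?G\<bar>" using \<sigma> e v by (simp add: abs_mult)
  also have "\<dots> <= 1 / eps * T * (\<eta> * (B + 1) * B)" using d e v by (intro mult_mono) auto
  also have "\<dots> = T * \<eta> * B * (B + 1) / eps" by (simp add: mult_ac)
  finally have "\<sigma> / eps * v * (?S - ?G) <= T * \<eta> * B * (B + 1) / eps" .
  moreover have "\<sigma> / eps * v * ?S = \<sigma> / eps * (v * ?G) + \<sigma> / eps * v * (?S - ?G)" by (simp add: right_diff_distrib)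
  ultimately show ?thesis by linarith
 qed
 show ?thesis using le1 bound1 bound2 unfolding eq class_sums(3)[OF y] by linarith
qed

text \<open>The grid sums, with the weight falling linearly to 0 at \<open>T\<close>, converge to
  the deviation for every cadlag path. The path inequality thus bounds a time integral of the path
  although it is formulated with increments.\<close>

lemma drift_path_bound:
 "\<exists>Z\<in>sets M. {\<omega>\<in>space M. total_mass \<omega> <= B \<and> e < \<sigma> * drift_deviation \<phi> \<psi>a \<psi>b (total_mass \<omega>) T (\<mu> \<omega>)} \<subseteq> Z \<and>
  prob Z <= exp (- (e / eps - T * (T * \<eta> * B * (B + 1) / eps + T\<^sup>2 * (Ka * B + Kb) * Q * B)))"
proof -
 define f where "f \<nu> = (LINT x|\<nu>. \<phi> x)" for \<nu>
 have dd: "drift_deviation \<phi> \<psi>a \<psi>b m T x = path_integral T (\<lambda>_. 1) f x - T * f (x 0) - path_integral T (\<lambda>s. T - s) (drift_functional \<psi>a \<psi>b m) x" for m x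
  by (simp add: drift_deviation_def f_def[abs_def])
 let ?G = "drift_functional \<psi>a \<psi>b"
 let ?K = "T * \<eta> * B * (B + 1) / eps + T\<^sup>2 * (Ka * B + Kb) * Q * B"
 have K0: "0 <= ?K" using T pos B Ka_nonneg Kb_nonneg eps(1) by simp
 have cf: "continuous_map weak_topology euclideanreal f" unfolding f_def[abs_def] by (rule continuous_map_weak_integral(1)[OF \<phi>(1)])
 have cG: "continuous_map weak_topology euclideanreal (?G m)" for m by (rule continuous_map_drift_functional[OF \<phi>(2,3)])
 obtain Gf where Gf: "0 <= Gf" and Gf': "\<forall>m y. m <= B \<longrightarrow> y \<in> sbd_class eps m \<longrightarrow> \<bar>f y\<bar> <= Gf"
  using class_bounded[where B=B and g=f] by (elim exE conjE)
 obtain Ga where Ga: "0 <= Ga" and Ga': "\<forall>m y. m <= B \<longrightarrow> y \<in> sbd_class eps m \<longrightarrow> \<bar>LINT x|y. \<psi>a x\<bar> <= Ga"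
  using class_bounded[where B=B and g="\<lambda>y. \<integral>x. \<psi>a x \<partial>y"] by (elim exE conjE)
 obtain Gb where Gb: "0 <= Gb" and Gb': "\<forall>m y. m <= B \<longrightarrow> y \<in> sbd_class eps m \<longrightarrow> \<bar>LINT x|y. \<psi>b x\<bar> <= Gb"
  using class_bounded[where B=B and g="\<lambda>y. \<integral>x. \<psi>b x \<partial>y"] by (elim exE conjE)
 have Gbd: "\<bar>?G m y\<bar> <= B * Ga + Gb" if m: "m <= B" and y: "y \<in> sbd_class eps m" for m y
 proof -
  have c: "\<bar>m - (LINT x|y. x)\<bar> <= B" using class_moment[OF y] m by auto
  have "\<bar>(m - (LINT x|y. x)) * (LINT x|y. \<psi>a x)\<bar> <= B * Ga"
   unfolding abs_mult using c Ga'[rule_format, OF m y] B by (intro mult_mono) auto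
  then show ?thesis using Gb'[rule_format, OF m y] unfolding drift_functional_def by linarith
 qed
 show ?thesis
  unfolding dd
 proof (rule path_inequality[where s\<^sub>0=0 and \<delta>=T and B=B and w="\<lambda>t m y z. \<sigma> / eps * ((T - t) * (f z - f y))"
    and \<theta>="\<lambda>t m y. \<sigma> / eps * ((T - t) * ?G m y) + ?K" and Wb="1 / eps * (T * (2 * Gf))" and Tb="1 / eps * (T * (B * Ga + Gb)) + ?K"])
  fix t m y assume t: "0 <= t" "t <= 0 + T" and m: "m <= B" and y: "y \<in> sbd_class eps m"
  have bd: "\<bar>\<sigma> / eps * ((T - t) * d)\<bar> <= 1 / eps * (T * D)" if "\<bar>d\<bar> <= D" for d D
  proof -
   have "\<bar>\<sigma> / eps * ((T - t) * d)\<bar> = 1 / eps * ((T - t) * \<bar>d\<bar>)" using \<sigma> eps(1) t by (simp add: abs_mult)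
   also have "\<dots> <= 1 / eps * (T * D)" using that t eps(1) T by (intro mult_left_mono mult_mono) auto
   finally show ?thesis .
  qed
  show "\<sigma> / eps * ((T - t) * (f z - f y)) <= 1 / eps * (T * (2 * Gf))" if z: "z \<in> sbd_class eps m" for z
   using bd[of "f z - f y" "2 * Gf"] Gf'[rule_format, OF m y] Gf'[rule_format, OF m z] by linarith
  show "\<bar>\<sigma> / eps * ((T - t) * ?G m y) + ?K\<bar> <= 1 / eps * (T * (B * Ga + Gb)) + ?K"
   using bd[OF Gbd[OF m y]] K0 by linarith
  show "sbd_generator eps \<alpha> \<beta> a b m (\<lambda>z. exp (\<sigma> / eps * ((T - t) * (f z - f y)))) y <= \<sigma> / eps * ((T - t) * ?G m y) + ?K"
   unfolding f_def using t by (intro drift_generator_le[OF m y]) auto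
 next
  fix \<omega> assume "\<omega> \<in> {\<omega>\<in>space M. total_mass \<omega> <= B \<and>
   e < \<sigma> * (path_integral T (\<lambda>_. 1) f (\<mu> \<omega>) - T * f (\<mu> \<omega> 0) - path_integral T (\<lambda>s. T - s) (?G (total_mass \<omega>)) (\<mu> \<omega>))}"
  then have \<omega>: "\<omega> \<in> space M" and gt: "e < \<sigma> * (path_integral T (\<lambda>_. 1) f (\<mu> \<omega>) - T * f (\<mu> \<omega> 0) - path_integral T (\<lambda>s. T - s) (?G (total_mass \<omega>)) (\<mu> \<omega>))" by auto
  let ?m = "total_mass \<omega>"
  define k where "k s = f (\<mu> \<omega> s)" for s
  define g where "g s = (T - s) * ?G ?m (\<mu> \<omega> s)" for s
  have rk: "rcll k" unfolding k_def by (rule rcll_cadlag[OF in_cadlag[OF \<omega>] cf])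
  have rg: "rcll g" unfolding g_def by (intro rcll_mult_continuous rcll_cadlag[OF in_cadlag[OF \<omega>] cG] continuous_intros)
  \<comment> \<open>The discrete deviation: weighted increments minus the Riemann sum of the
    weighted drift.\<close>
  define S where "S N = (\<Sum>i<N. (T - real i * (T / real N)) * (k (real (Suc i) * (T / real N)) - k (real i * (T / real N))))
   - T / real N * (\<Sum>i<N. g (real i * (T / real N)))" for N :: nat
  have S_eq: "S N = (T / real N * (\<Sum>i<N. k (real (Suc i) * (T / real N))) - T * k 0)
    - (T / real N * (\<Sum>i<N. g (real (Suc i) * (T / real N))) + T / real N * g 0)" if N: "N > 0" for N
  proof -
   have "(\<Sum>i<N. (T - real i * (T / real N)) * (k (real (Suc i) * (T / real N)) - k (real i * (T / real N)))) =
     T / real N * (\<Sum>i<N. k (real (Suc i) * (T / real N))) - T * k 0"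
    using abel_summation_linear_weight[of T "T / real N" "\<lambda>i. k (real i * (T / real N))" N] N by simp
   \<comment> \<open>Left and right Riemann sums differ by boundary terms, of which the one at
     \<open>T\<close> is 0 because the weight vanishes there.\<close>
   moreover have "(\<Sum>i<N. g (real (Suc i) * (T / real N))) - (\<Sum>i<N. g (real i * (T / real N))) = g (real N * (T / real N)) - g (real 0 * (T / real N))"
    unfolding sum_subtractf[symmetric] by (rule sum_lessThan_telescope)
   then have "(\<Sum>i<N. g (real i * (T / real N))) = (\<Sum>i<N. g (real (Suc i) * (T / real N))) + g 0"
    using N by (simp add: g_def)
   ultimately show ?thesis unfolding S_def by (simp add: distrib_left)
  qed
  have "(\<lambda>N. (T / real N * (\<Sum>i<N. k (real (Suc i) * (T / real N))) - T * k 0)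
    - (T / real N * (\<Sum>i<N. g (real (Suc i) * (T / real N))) + T / real N * g 0)) \<longlonglongrightarrow>
   ((LINT s|lborel. indicator {0..T} s * k s) - T * k 0) - ((LINT s|lborel. indicator {0..T} s * g s) + 0 * g 0)"
   by (intro tendsto_intros rcll_riemann_sum[OF rk T] rcll_riemann_sum[OF rg T] lim_const_over_n)
  also have "((LINT s|lborel. indicator {0..T} s * k s) - T * k 0) - ((LINT s|lborel. indicator {0..T} s * g s) + 0 * g 0) =
   path_integral T (\<lambda>_. 1) f (\<mu> \<omega>) - T * f (\<mu> \<omega> 0) - path_integral T (\<lambda>s. T - s) (?G ?m) (\<mu> \<omega>)"
   by (simp add: path_integral_def k_def g_def)
  finally have lim: "(\<lambda>N. (T / real N * (\<Sum>i<N. k (real (Suc i) * (T / real N))) - T * k 0)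
    - (T / real N * (\<Sum>i<N. g (real (Suc i) * (T / real N))) + T / real N * g 0)) \<longlonglongrightarrow>
   path_integral T (\<lambda>_. 1) f (\<mu> \<omega>) - T * f (\<mu> \<omega> 0) - path_integral T (\<lambda>s. T - s) (?G ?m) (\<mu> \<omega>)" .
  have "S \<longlonglongrightarrow> path_integral T (\<lambda>_. 1) f (\<mu> \<omega>) - T * f (\<mu> \<omega> 0) - path_integral T (\<lambda>s. T - s) (?G ?m) (\<mu> \<omega>)"
   by (rule Lim_transform_eventually[OF lim]) (use eventually_gt_at_top[of 0] in \<open>eventually_elim, simp only: S_eq\<close>)
  from order_tendstoD(1)[OF tendsto_mult[OF tendsto_const[of \<sigma>] this] gt] eventually_gt_at_top[of 0]
  show "eventually (\<lambda>N. e / eps - T * ?K <= (\<Sum>i<N. \<sigma> / eps * ((T - (0 + real i * (T / real N))) * (f (\<mu> \<omega> (0 + real (Suc i) * (T / real N))) - f (\<mu> \<omega> (0 + real i * (T / real N)))))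
    - T / real N * (\<sigma> / eps * ((T - (0 + real i * (T / real N))) * ?G ?m (\<mu> \<omega> (0 + real i * (T / real N)))) + ?K))) sequentially"
  proof eventually_elim
   case (elim N)
   have "(\<Sum>i<N. \<sigma> / eps * ((T - (0 + real i * (T / real N))) * (f (\<mu> \<omega> (0 + real (Suc i) * (T / real N))) - f (\<mu> \<omega> (0 + real i * (T / real N)))))
    - T / real N * (\<sigma> / eps * ((T - (0 + real i * (T / real N))) * ?G ?m (\<mu> \<omega> (0 + real i * (T / real N)))) + ?K))
    = (\<Sum>i<N. \<sigma> / eps * ((T - real i * (T / real N)) * (k (real (Suc i) * (T / real N)) - k (real i * (T / real N)))) - (\<sigma> / eps * (T / real N * g (real i * (T / real N))) + T / real N * ?K))"
    by (intro sum.cong refl) (simp only: k_def g_def add_0_left distrib_left mult.left_commute)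
   also have "\<dots> = \<sigma> / eps * S N - real N * (T / real N * ?K)"
    unfolding S_def sum_subtractf sum.distrib sum_constant card_lessThan sum_distrib_left right_diff_distrib by simp
   also have "real N * (T / real N * ?K) = T * ?K" using elim(2) by simp
   finally have eq: "(\<Sum>i<N. \<sigma> / eps * ((T - (0 + real i * (T / real N))) * (f (\<mu> \<omega> (0 + real (Suc i) * (T / real N))) - f (\<mu> \<omega> (0 + real i * (T / real N)))))
    - T / real N * (\<sigma> / eps * ((T - (0 + real i * (T / real N))) * ?G ?m (\<mu> \<omega> (0 + real i * (T / real N)))) + ?K)) = \<sigma> / eps * S N - T * ?K" .
   have "e / eps <= \<sigma> * S N / eps" using elim(1) eps(1) by (intro divide_right_mono) auto
   then show ?case unfolding eq by simp
  qed
 qed (use B T in auto)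
qed

end

end


section \<open>Events of vanishing outer probability\<close>

text \<open>Convergence to 0 of the outer probability: the events themselves may fail to be
  measurable, as they involve all times at once.\<close>

definition vanishing :: "(nat => 'a measure) => (nat => 'a set) => bool" where
 "vanishing M E \<longleftrightarrow> (\<exists>Z. (\<forall>n. Z n \<in> sets (M n) \<and> E n \<subseteq> Z n) \<and> (\<lambda>n. measure (M n) (Z n)) \<longlonglongrightarrow> 0)"

lemma vanishingI:
 assumes sub: "\<And>n. E n \<subseteq> space (M n)" and p: "p \<longlonglongrightarrow> 0"
  and ev: "eventually (\<lambda>n. \<exists>Z\<in>sets (M n). E n \<subseteq> Z \<and> measure (M n) Z <= p n) sequentially"
 shows "vanishing M E"
proof -
 let ?P = "\<lambda>n Z. Z \<in> sets (M n) \<and> E n \<subseteq> Z"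
 \<comment> \<open>For the finitely many indices at which the estimate may fail, the whole space
   serves as the covering set.\<close>
 have "\<exists>Z. ?P n Z \<and> ((\<exists>Z\<in>sets (M n). E n \<subseteq> Z \<and> measure (M n) Z <= p n) \<longrightarrow> measure (M n) Z <= p n)" for n
  using sub[of n] by (cases "\<exists>Z\<in>sets (M n). E n \<subseteq> Z \<and> measure (M n) Z <= p n") auto
 then obtain Z where Z: "\<And>n. ?P n (Z n)"
  "\<And>n. (\<exists>Z\<in>sets (M n). E n \<subseteq> Z \<and> measure (M n) Z <= p n) ==> measure (M n) (Z n) <= p n" by metis
 have "(\<lambda>n. measure (M n) (Z n)) \<longlonglongrightarrow> 0"
  by (rule Lim_null_comparison[OF _ p]) (use ev in \<open>eventually_elim, simp add: Z(2)\<close>)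
 with Z(1) show ?thesis unfolding vanishing_def by (intro exI[of _ Z]) auto
qed

lemma vanishing_mono:
 assumes F: "vanishing M F" and sub: "\<And>n. E n \<subseteq> space (M n)" and ev: "eventually (\<lambda>n. E n \<subseteq> F n) sequentially"
 shows "vanishing M E"
proof -
 obtain Z where Z: "\<And>n. Z n \<in> sets (M n)" "\<And>n. F n \<subseteq> Z n" "(\<lambda>n. measure (M n) (Z n)) \<longlonglongrightarrow> 0"
  using F unfolding vanishing_def by auto
 show ?thesis by (rule vanishingI[OF sub Z(3)]) (use ev in \<open>eventually_elim, use Z in blast\<close>)
qed

lemma vanishing_Un:
 assumes E: "vanishing M E" and F: "vanishing M F"
 shows "vanishing M (\<lambda>n. E n \<union> F n)"
proof -
 obtain Z where Z: "\<And>n. Z n \<in> sets (M n)" "\<And>n. E n \<subseteq> Z n" "(\<lambda>n. measure (M n) (Z n)) \<longlonglongrightarrow> 0"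
  using E unfolding vanishing_def by auto
 obtain W where W: "\<And>n. W n \<in> sets (M n)" "\<And>n. F n \<subseteq> W n" "(\<lambda>n. measure (M n) (W n)) \<longlonglongrightarrow> 0"
  using F unfolding vanishing_def by auto
 have "(\<lambda>n. measure (M n) (Z n \<union> W n)) \<longlonglongrightarrow> 0"
 proof (rule Lim_null_comparison[OF always_eventually])
  show "\<forall>n. norm (measure (M n) (Z n \<union> W n)) <= measure (M n) (Z n) + measure (M n) (W n)"
   using measure_Un_le[OF Z(1) W(1)] by simp
  show "(\<lambda>n. measure (M n) (Z n) + measure (M n) (W n)) \<longlonglongrightarrow> 0" using tendsto_add[OF Z(3) W(3)] by simp
 qed
 moreover have "Z n \<union> W n \<in> sets (M n) \<and> E n \<union> F n \<subseteq> Z n \<union> W n" for n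
  using Z(1,2)[of n] W(1,2)[of n] by blast
 ultimately show ?thesis unfolding vanishing_def by (intro exI[of _ "\<lambda>n. Z n \<union> W n"]) simp
qed

lemma vanishing_UN:
 assumes "finite I" "\<And>i. i \<in> I ==> vanishing M (E i)"
 shows "vanishing M (\<lambda>n. \<Union>i\<in>I. E i n)"
 using assms
proof (induction I rule: finite_induct)
 case empty
 show ?case unfolding vanishing_def by (intro exI[of _ "\<lambda>_. {}"]) auto
next
 case (insert i I)
 then show ?case using vanishing_Un[of M "E i" "\<lambda>n. \<Union>i\<in>I. E i n"] by auto
qed

lemma vanishing_Markov:
 fixes F :: "nat => 'a => real"
 assumes M: "\<And>n. prob_space (M n)" and F: "\<And>n. F n \<in> borel_measurable (M n)"
  and bd: "\<And>n \<omega>. 0 <= F n \<omega>" "\<And>n \<omega>. F n \<omega> <= 1"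
  and lim: "(\<lambda>n. LINT \<omega>|M n. F n \<omega>) \<longlonglongrightarrow> 0"
 shows "vanishing M (\<lambda>n. {\<omega>\<in>space (M n). 1 <= F n \<omega>})"
proof (rule vanishingI[where p="\<lambda>n. \<integral>\<omega>. F n \<omega> \<partial>M n"])
 show "(\<lambda>n. LINT \<omega>|M n. F n \<omega>) \<longlonglongrightarrow> 0" by (rule lim)
 show "\<forall>\<^sub>F n in sequentially. \<exists>Z\<in>sets (M n). {\<omega>\<in>space (M n). 1 <= F n \<omega>} \<subseteq> Z \<and> measure (M n) Z <= (LINT \<omega>|M n. F n \<omega>)"
 proof (intro always_eventually allI bexI conjI)
  fix n
  interpret prob_space "M n" by (rule M)
  have i: "integrable (M n) (F n)" using F bd by (intro integrable_const_bound[of _ 1]) auto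
  show "{\<omega>\<in>space (M n). 1 <= F n \<omega>} \<in> sets (M n)" using F by measurable
  show "measure (M n) {\<omega>\<in>space (M n). 1 <= F n \<omega>} <= (LINT \<omega>|M n. F n \<omega>)"
   using integral_Markov_inequality_measure[OF i, of "{}" 1] bd by auto
 qed simp
qed auto

lemma weakly_compact_bounds:
 assumes K: "compactin weak_topology K"
 shows "\<exists>A\<ge>0. \<forall>\<nu>\<in>K. measure \<nu> {0..} <= A"
proof -
 have sub: "K \<subseteq> moment_measures" using compactin_subset_topspace[OF K] by simp
 have "bounded ((\<lambda>\<nu>. LINT x|\<nu>. ramp (-1,1) x) ` K)"
  using image_compactin[OF K continuous_map_weak_integral(1)[OF ramp_bounded_continuous[of "(-1,1)"]]]
  by (simp add: compact_imp_bounded)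
 then obtain C where C: "\<forall>\<nu>\<in>K. \<bar>LINT x|\<nu>. ramp (-1,1) x\<bar> <= C" by (auto simp: bounded_iff)
 have "measure \<nu> {0..} <= max C 0" if "\<nu> \<in> K" for \<nu>
 proof -
  have "measure \<nu> {0..} = (LINT x|\<nu>. ramp (-1,1) x)" using sub that by (intro measure_Ici_eq_ramp) auto
  then show ?thesis using C that abs_ge_self[of "measure \<nu> {0..}"] by fastforce
 qed
 then show ?thesis by (intro exI[of _ "max C 0"]) auto
qed

text \<open>Dini's argument: the tail functionals decrease to zero pointwise and are continuous.\<close>

lemma weakly_compact_tails:
 assumes K: "compactin weak_topology K" and ne: "K \<noteq> {}"
 shows "\<exists>\<kappa>. \<kappa> \<longlonglongrightarrow> 0 \<and> (\<forall>\<nu>\<in>K. \<forall>R. (LINT x|\<nu>. tail_weight (real (Suc R)) x) <= \<kappa> R)"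
proof -
 let ?g = "\<lambda>R \<nu>. \<integral>x. tail_weight (real (Suc R)) x \<partial>\<nu>"
 have sub: "K \<subseteq> moment_measures" using compactin_subset_topspace[OF K] by simp
 define \<kappa> where "\<kappa> R = (SUP \<nu>\<in>K. ?g R \<nu>)" for R
 have cont: "continuous_map weak_topology euclideanreal (?g R)" for R by (rule continuous_map_weak_tail_weight) simp
 have bdd: "bdd_above (?g R ` K)" for R
  using image_compactin[OF K cont] by (simp add: compact_imp_bounded bounded_imp_bdd_above)
 have up: "?g R \<nu> <= \<kappa> R" if "\<nu> \<in> K" for \<nu> R unfolding \<kappa>_def by (rule cSUP_upper[OF that bdd])
 have nn: "0 <= \<kappa> R" for R
 proof -
  obtain \<nu> where \<nu>: "\<nu> \<in> K" using ne by auto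
  then have "\<nu> \<in> moment_measures" using sub by auto
  then have "0 <= ?g R \<nu>"
   by (intro Bochner_Integration.integral_nonneg) (auto simp: space_moment_measure intro!: tail_weight_nonneg)
  with up[OF \<nu>] show ?thesis using order_trans by blast
 qed
 have "\<kappa> \<longlonglongrightarrow> 0"
 proof (rule LIMSEQ_I)
  fix e :: real assume e: "e > 0"
  define U where "U R = {\<nu> \<in> moment_measures. ?g R \<nu> < e / 2}" for R
  have "openin weak_topology (U R)" for R
   using cont[of R] unfolding continuous_map U_def by (auto dest!: conjunct2 spec[of _ "{..<e/2}"])
  moreover have "K \<subseteq> \<Union>(range U)"
  proof
   fix \<nu> assume "\<nu> \<in> K"
   then have \<nu>: "\<nu> \<in> moment_measures" using sub by auto
   have "eventually (\<lambda>R. ?g R \<nu> < e / 2) sequentially"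
    using e by (intro order_tendstoD(2)[OF tail_weight_integral_tendsto_0[OF \<nu>]]) simp
   then obtain R where "?g R \<nu> < e / 2" by (auto simp: eventually_sequentially)
   then show "\<nu> \<in> \<Union>(range U)" using \<nu> by (auto simp: U_def)
  qed
  ultimately obtain F where F: "finite F" "F \<subseteq> range U" "K \<subseteq> \<Union>F" using compactinD[OF K, of "range U"] by auto
  from finite_subset_image[OF F(1,2)] obtain I where I: "finite I" "F = U ` I" by auto
  have "norm (\<kappa> R - 0) < e" if R: "R >= Max (insert 0 I)" for R
  proof -
   have "?g R \<nu> <= e / 2" if \<nu>: "\<nu> \<in> K" for \<nu>
   proof -
    obtain i where i: "i \<in> I" "\<nu> \<in> U i" using F(3) I(2) \<nu> by auto
    have "i <= R" using i(1) I(1) R by auto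
    have "?g R \<nu> <= ?g i \<nu>" using sub \<nu> \<open>i <= R\<close> by (intro tail_weight_integral_antimono) auto
    then show ?thesis using i(2) by (auto simp: U_def)
   qed
   then have "\<kappa> R <= e / 2" unfolding \<kappa>_def by (intro cSUP_least[OF ne])
   then show ?thesis using nn[of R] e by simp
  qed
  then show "\<exists>no. \<forall>n\<ge>no. norm (\<kappa> n - 0) < e" by blast
 qed
 then show ?thesis using up by blast
qed

text \<open>From \<open>s\<close> to \<open>t\<close> one passes through the shared ends of
  neighbouring cells. The cells visited have total length at most the distance plus
  \<open>2 * \<delta>\<close>, one cell being lost at each end.\<close>

lemma grid_modulus:
 fixes g :: "real => real"
 assumes \<delta>: "0 < \<delta>" and c: "0 <= c" and T: "T <= real N * \<delta>"
  and cell: "\<And>l s t. l < N ==> s \<in> {real l * \<delta>..real l * \<delta> + \<delta>} ==> t \<in> {real l * \<delta>..real l * \<delta> + \<delta>} ==> \<bar>g s - g t\<bar> <= c * \<delta>"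
  and st: "s \<in> {0..<T}" "t \<in> {0..<T}"
 shows "\<bar>g s - g t\<bar> <= c * (\<bar>s - t\<bar> + 2 * \<delta>)"
proof -
 let ?c = "\<lambda>l. {real l * \<delta>..real l * \<delta> + \<delta>}"
 have chain: "\<bar>g s - g t\<bar> <= c * \<delta> * (real j - real i + 1)"
  if "i <= j" "j < N" "s \<in> ?c i" "t \<in> ?c j" for i j s t
  using that
 proof (induction j arbitrary: t rule: dec_induct)
  case base
  then show ?case using cell[of i s t] by simp
 next
  case (step j)
  have e: "real (Suc j) * \<delta> \<in> ?c j" "real (Suc j) * \<delta> \<in> ?c (Suc j)" using \<delta> by (auto simp: algebra_simps)
  have "\<bar>g s - g (real (Suc j) * \<delta>)\<bar> <= c * \<delta> * (real j - real i + 1)" using step.IH step.prems e(1) by simp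
  moreover have "\<bar>g (real (Suc j) * \<delta>) - g t\<bar> <= c * \<delta>" using cell[OF step.prems(1) e(2)] step.prems by blast
  moreover have "c * \<delta> * (real (Suc j) - real i + 1) = c * \<delta> * (real j - real i + 1) + c * \<delta>" by (simp add: algebra_simps)
  ultimately show ?case by linarith
 qed
 have main: "\<bar>g s - g t\<bar> <= c * (\<bar>s - t\<bar> + 2 * \<delta>)" if st: "0 <= s" "s <= t" "t < T" for s t
 proof -
  define i where "i = nat \<lfloor>s / \<delta>\<rfloor>"
  define j where "j = nat \<lfloor>t / \<delta>\<rfloor>"
  have t0: "0 <= t" using st by simp
  have fl: "real (nat \<lfloor>u / \<delta>\<rfloor>) * \<delta> <= u \<and> u <= real (nat \<lfloor>u / \<delta>\<rfloor>) * \<delta> + \<delta>" if "0 <= u" for u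
  proof -
   have "real (nat \<lfloor>u / \<delta>\<rfloor>) = of_int \<lfloor>u / \<delta>\<rfloor>" using that \<delta> by simp
   then have "real (nat \<lfloor>u / \<delta>\<rfloor>) <= u / \<delta>" "u / \<delta> <= real (nat \<lfloor>u / \<delta>\<rfloor>) + 1" by linarith+
   then show ?thesis using \<delta> by (simp add: field_simps)
  qed
  have i: "s \<in> ?c i" and j: "t \<in> ?c j" using fl[OF st(1)] fl[OF t0] by (auto simp: i_def j_def)
  have ij: "i <= j" unfolding i_def j_def using st \<delta> by (intro nat_mono floor_mono divide_right_mono) auto
  have "real j * \<delta> < real N * \<delta>" using j st(3) T by auto
  then have jN: "j < N" using \<delta> by simp
  have "\<bar>g s - g t\<bar> <= c * \<delta> * (real j - real i + 1)" by (rule chain[OF ij jN i j])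
  also have "\<dots> = c * (real j * \<delta> - real i * \<delta> + \<delta>)" by (simp add: algebra_simps)
  also have "\<dots> <= c * (\<bar>s - t\<bar> + 2 * \<delta>)" using i j st c by (intro mult_left_mono) auto
  finally show ?thesis .
 qed
 show ?thesis
 proof (cases "s <= t")
  case True
  then show ?thesis using main[of s t] st by auto
 next
  case False
  then show ?thesis using main[of t s] st by (auto simp: abs_minus_commute)
 qed
qed

section \<open>The sequence of processes and existence of a limit in law\<close>

locale sbd_sequence =
 fixes eps \<alpha> \<beta> :: "nat => real" and a b :: "nat => real => real"
  and \<alpha>\<^sub>0 \<beta>\<^sub>0 Ka Kb :: real and a\<^sub>0 b\<^sub>0 :: "real => real"
  and M :: "nat => 'a measure"
  and \<mu>in :: "nat => 'a => real measure" and uin :: "nat => 'a => real"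
  and \<mu> :: "nat => 'a => real => real measure"
  and \<mu>\<^sub>0 :: "real measure" and u\<^sub>0 :: real and \<K> :: "real measure set"
 assumes eps: "\<And>n. eps n > 0" "eps \<longlonglongrightarrow> 0"
  and rates_nonneg: "\<And>n. \<alpha> n >= 0" "\<And>n. \<beta> n >= 0"
   "\<And>n x. x >= 0 ==> a n x >= 0" "\<And>n x. x >= 0 ==> b n x >= 0"
  and process: "\<And>n. sbd_process (M n) (eps n) (\<alpha> n) (\<beta> n) (a n) (b n) (\<mu>in n) (uin n) (\<mu> n)"
  and limit_rates_nonneg: "\<And>x. x >= 0 ==> a\<^sub>0 x >= 0" "\<And>x. x >= 0 ==> b\<^sub>0 x >= 0"
  and limit_rates_continuous: "continuous_on {0..} a\<^sub>0" "continuous_on {0..} b\<^sub>0"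
  and nucleation_tendsto: "\<alpha> \<longlonglongrightarrow> \<alpha>\<^sub>0" "\<beta> \<longlonglongrightarrow> \<beta>\<^sub>0"
  and rates_tendsto: "\<And>C. compact C ==> C \<subseteq> {0..} ==> uniform_limit C a a\<^sub>0 sequentially"
   "\<And>C. compact C ==> C \<subseteq> {0..} ==> uniform_limit C b b\<^sub>0 sequentially"
  and linear_growth: "Ka > 0" "Kb > 0"
   "\<And>n x. x >= 0 ==> a n x <= Ka * (1 + x)" "\<And>n x. x >= 0 ==> b n x <= Kb * (1 + x)"
  and initial_measure: "\<mu>\<^sub>0 \<in> moment_measures"
   "converges_weakly weak_topology (\<lambda>n. distr (M n) (borel_of weak_topology) (\<mu>in n))
    (return (borel_of weak_topology) \<mu>\<^sub>0)"
  and initial_compact: "compactin weak_topology \<K>" "\<And>n. \<P>(\<omega> in M n. \<mu>in n \<omega> \<in> \<K>) = 1"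
  and initial_monomers: "u\<^sub>0 >= 0"
   "weak_conv_m (\<lambda>n. distr (M n) borel (uin n)) (return borel u\<^sub>0)"
begin

definition "\<alpha>m = (SUP n. \<alpha> n)"
definition "\<beta>m = (SUP n. \<beta> n)"

lemma nucleation_bounds: "\<alpha> n <= \<alpha>m" "\<beta> n <= \<beta>m" "0 <= \<alpha>m" "0 <= \<beta>m"
proof -
 have "bdd_above (range \<alpha>)" "bdd_above (range \<beta>)"
  using nucleation_tendsto by (auto intro!: bounded_imp_bdd_above convergent_imp_bounded convergentI)
 then show *: "\<alpha> n <= \<alpha>m" "\<beta> n <= \<beta>m" for n unfolding \<alpha>m_def \<beta>m_def by (auto intro: cSUP_upper)
 show "0 <= \<alpha>m" "0 <= \<beta>m" using *[of 0] rates_nonneg(1,2)[of 0] by linarith+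
qed

lemma rescaled: "eps n <= 1 ==> sbd_rescaled (eps n) (\<alpha> n) (\<beta> n) (a n) (b n) \<alpha>m \<beta>m Ka Kb (M n) (\<mu>in n) (uin n) (\<mu> n)"
 by unfold_locales (use eps rates_nonneg nucleation_bounds linear_growth process in auto)

lemma eventually_small: "0 < c ==> eventually (\<lambda>n. eps n <= c) sequentially"
 using order_tendstoD(2)[OF eps(2), of c] by (auto elim: eventually_mono)

lemma prob: "prob_space (M n)" using process[of n] by (simp add: sbd_process_def)

lemma process_measurable:
 "\<mu> n \<in> M n \<rightarrow>\<^sub>M borel_of (skorohod_topology weak_topology)"
 "\<mu>in n \<in> M n \<rightarrow>\<^sub>M borel_of weak_topology" "uin n \<in> borel_measurable (M n)"
 using process[of n] by (simp_all add: sbd_process_def)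

lemma process_cadlag: "\<omega> \<in> space (M n) ==> \<mu> n \<omega> \<in> cadlag weak_topology"
 using measurable_space[OF process_measurable(1)] by simp

lemma process_start: "\<omega> \<in> space (M n) ==> \<mu> n \<omega> 0 = \<mu>in n \<omega>"
 using process[of n] by (simp add: sbd_process_def)

definition mass :: "nat => 'a => real" where "mass n \<omega> = uin n \<omega> + (LINT x|\<mu>in n \<omega>. x)"
definition mass_limit :: real where "mass_limit = u\<^sub>0 + (LINT x|\<mu>\<^sub>0. x)"
text \<open>The excess 1 only has to be positive: the total mass converges in probability, so larger
  masses are vanishing events.\<close>

definition mass_bound :: real where "mass_bound = mass_limit + 1"

lemma total_mass_eq: "eps n <= 1 ==> sbd_rescaled.total_mass (\<mu>in n) (uin n) = mass n"
 by (rule ext) (simp add: sbd_rescaled.total_mass_def[OF rescaled] mass_def)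

lemma mass_bound_nonneg: "0 <= mass_bound"
proof -
 have "0 <= (LINT x|\<mu>\<^sub>0. x)" by (intro Bochner_Integration.integral_nonneg) (simp add: space_moment_measure[OF initial_measure(1)])
 then show ?thesis using initial_monomers(1) by (simp add: mass_bound_def mass_limit_def)
qed

text \<open>Convergence in law to a point is convergence in probability: the bounded continuous test
  function \<open>f\<close> is 0 at the limit and equals 1 where the deviation reaches
  \<open>\<delta>\<close>.\<close>

lemma initial_functional_vanishing:
 assumes g: "continuous_map weak_topology euclideanreal g" and d: "0 < \<delta>"
 shows "vanishing M (\<lambda>n. {\<omega>\<in>space (M n). \<delta> <= \<bar>g (\<mu>in n \<omega>) - g \<mu>\<^sub>0\<bar>})"
proof -
 define f where "f \<nu> = min 1 (\<bar>g \<nu> - g \<mu>\<^sub>0\<bar> / \<delta>)" for \<nu>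
 have fc: "continuous_map weak_topology euclideanreal f" unfolding f_def divide_inverse
  by (intro continuous_map_real_min continuous_map_real_mult continuous_map_real_abs continuous_map_diff g continuous_map_const[THEN iffD2]) auto
 have fm: "f \<in> borel_measurable (borel_of weak_topology)" by (rule borel_measurable_continuous_map[OF fc])
 have fb: "0 <= f \<nu>" "f \<nu> <= 1" for \<nu> using d by (auto simp: f_def)
 have "bounded (f ` topspace weak_topology)" using fb by (auto intro!: boundedI[of _ 1])
 then have "(\<lambda>n. LINT x|distr (M n) (borel_of weak_topology) (\<mu>in n). f x) \<longlonglongrightarrow> (LINT x|return (borel_of weak_topology) \<mu>\<^sub>0. f x)"
  using initial_measure(2) fc unfolding converges_weakly_def by blast
 also have "(LINT x|return (borel_of weak_topology) \<mu>\<^sub>0. f x) = 0"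
  using integral_return[OF _ fm, of \<mu>\<^sub>0] initial_measure(1) by (simp add: f_def)
 finally have "(\<lambda>n. LINT \<omega>|M n. f (\<mu>in n \<omega>)) \<longlonglongrightarrow> 0"
  by (simp add: integral_distr[OF process_measurable(2) fm])
 from vanishing_Markov[OF prob measurable_compose[OF process_measurable(2) fm] fb this]
 show ?thesis using d by (simp add: f_def)
qed

lemma initial_monomers_vanishing:
 assumes d: "0 < \<delta>"
 shows "vanishing M (\<lambda>n. {\<omega>\<in>space (M n). \<delta> <= \<bar>uin n \<omega> - u\<^sub>0\<bar>})"
proof -
 define f where "f x = min 1 (\<bar>x - u\<^sub>0\<bar> / \<delta>)" for x
 have fb: "0 <= f x" "f x <= 1" for x using d by (auto simp: f_def)
 have fm [measurable]: "f \<in> borel_measurable borel" unfolding f_def by measurable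
 have "real_distribution (distr (M n) borel (uin n))" for n
  using prob_space.real_distribution_distr[OF prob process_measurable(3)] .
 moreover have "real_distribution (return borel u\<^sub>0)"
  by (simp add: real_distribution_def real_distribution_axioms_def prob_space_return)
 ultimately have "(\<lambda>n. LINT x|distr (M n) borel (uin n). f x) \<longlonglongrightarrow> (LINT x|return borel u\<^sub>0. f x)"
  using fb d by (intro weak_conv_imp_integral_bdd_continuous_conv[OF _ _ initial_monomers(2), where B=1])
   (auto simp: f_def intro!: continuous_intros)
 also have "(LINT x|return borel u\<^sub>0. f x) = 0" using integral_return[OF _ fm, of u\<^sub>0] by (simp add: f_def)
 finally have "(\<lambda>n. LINT \<omega>|M n. f (uin n \<omega>)) \<longlonglongrightarrow> 0"
  by (simp add: integral_distr[OF process_measurable(3) fm])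
 from vanishing_Markov[OF prob measurable_compose[OF process_measurable(3) fm] fb this]
 show ?thesis using d by (simp add: f_def)
qed

lemma mass_vanishing:
 assumes d: "0 < \<delta>"
 shows "vanishing M (\<lambda>n. {\<omega>\<in>space (M n). \<delta> < \<bar>mass n \<omega> - mass_limit\<bar>})"
proof (rule vanishing_mono[OF vanishing_Un[OF initial_functional_vanishing[OF continuous_map_weak_moment, of "\<delta>/2"] initial_monomers_vanishing[of "\<delta>/2"]] _ always_eventually])
 have "\<delta> / 2 <= \<bar>x - y\<bar> \<or> \<delta> / 2 <= \<bar>u - v\<bar>" if "\<delta> < \<bar>(u + x) - (v + y)\<bar>" for x y u v :: real
  using that by linarith
 then show "\<forall>n. {\<omega>\<in>space (M n). \<delta> < \<bar>mass n \<omega> - mass_limit\<bar>} \<subseteq>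
   {\<omega>\<in>space (M n). \<delta> / 2 <= \<bar>(LINT x|\<mu>in n \<omega>. x) - (LINT x|\<mu>\<^sub>0. x)\<bar>} \<union> {\<omega>\<in>space (M n). \<delta> / 2 <= \<bar>uin n \<omega> - u\<^sub>0\<bar>}"
  unfolding mass_def mass_limit_def by blast
qed (use d in auto)

lemma compact_vanishing: "vanishing M (\<lambda>n. {\<omega>\<in>space (M n). \<mu>in n \<omega> \<notin> \<K>})"
 unfolding vanishing_def
proof (intro exI conjI allI)
 fix n
 interpret prob_space "M n" by (rule prob)
 \<comment> \<open>A set outside the sigma-algebra has measure 0 by convention, so probability 1
   forces measurability.\<close>
 have s: "{\<omega>\<in>space (M n). \<mu>in n \<omega> \<in> \<K>} \<in> sets (M n)"
  using initial_compact(2)[of n] measure_notin_sets[of "{\<omega>\<in>space (M n). \<mu>in n \<omega> \<in> \<K>}" "M n"] by auto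
 show "space (M n) - {\<omega>\<in>space (M n). \<mu>in n \<omega> \<in> \<K>} \<in> sets (M n)" using s by auto
next
 have "measure (M n) (space (M n) - {\<omega>\<in>space (M n). \<mu>in n \<omega> \<in> \<K>}) = 0" for n
 proof -
  interpret prob_space "M n" by (rule prob)
  have s: "{\<omega>\<in>space (M n). \<mu>in n \<omega> \<in> \<K>} \<in> sets (M n)"
   using initial_compact(2)[of n] measure_notin_sets[of "{\<omega>\<in>space (M n). \<mu>in n \<omega> \<in> \<K>}" "M n"] by auto
  then show ?thesis using prob_compl[OF s] initial_compact(2)[of n] by simp
 qed
 then show "(\<lambda>n. measure (M n) (space (M n) - {\<omega>\<in>space (M n). \<mu>in n \<omega> \<in> \<K>})) \<longlonglongrightarrow> 0" by simp
qed auto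

lemma exp_vanishing:
 assumes c: "0 < c"
 shows "(\<lambda>n. exp (- (c / eps n - d))) \<longlonglongrightarrow> 0"
proof -
 have "filterlim (\<lambda>n. inverse (eps n)) at_top sequentially"
  using eps by (intro filterlim_inverse_at_top) auto
 then have "filterlim (\<lambda>n. - d + c * inverse (eps n)) at_top sequentially"
  by (intro filterlim_tendsto_add_at_top[OF tendsto_const] filterlim_tendsto_pos_mult_at_top[OF tendsto_const c])
 then have "((\<lambda>n. exp (- (- d + c * inverse (eps n)))) \<longlongrightarrow> 0) sequentially"
  by (intro filterlim_compose[OF exp_at_bot]) (simp only: filterlim_uminus_at_bot minus_minus)
 then show ?thesis by (simp add: field_simps)
qed

lemma vanishing_exponential:
 assumes c: "0 < c" and sub: "\<And>n. E n \<subseteq> space (M n)"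
  and ev: "eventually (\<lambda>n. \<exists>Z\<in>sets (M n). E n \<subseteq> Z \<and> measure (M n) Z <= exp (- (c / eps n - d))) sequentially"
 shows "vanishing M E"
 by (rule vanishingI[OF sub exp_vanishing[OF c] ev])

lemma moment_vanishing:
 "vanishing M (\<lambda>n. {\<omega>\<in>space (M n). mass n \<omega> <= mass_bound \<and> (\<exists>t\<ge>0. (LINT x|\<mu> n \<omega> t. x) > mass n \<omega>)})"
proof (rule vanishingI[OF _ tendsto_const])
 show "\<forall>\<^sub>F n in sequentially. \<exists>Z\<in>sets (M n). {\<omega>\<in>space (M n). mass n \<omega> <= mass_bound \<and> (\<exists>t\<ge>0. (LINT x|\<mu> n \<omega> t. x) > mass n \<omega>)} \<subseteq> Z \<and> measure (M n) Z <= 0"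
  using eventually_small[OF zero_less_one]
 proof eventually_elim
  case (elim n)
  show ?case using sbd_rescaled.moment_le_total_mass[OF rescaled[OF elim], of mass_bound] unfolding total_mass_eq[OF elim]
   by (elim bexE conjE, intro bexI conjI) auto
 qed
qed auto

text \<open>On these outcomes the random mass, the initial measure and the moments at all times obey
  bounds independent of the index.\<close>

definition good :: "nat => 'a set" where
 "good n = {\<omega>\<in>space (M n). mass n \<omega> <= mass_bound \<and> \<mu>in n \<omega> \<in> \<K> \<and> (\<forall>t\<ge>0. (LINT x|\<mu> n \<omega> t. x) <= mass n \<omega>)}"

lemma not_good_vanishing: "vanishing M (\<lambda>n. space (M n) - good n)"
 by (rule vanishing_mono[OF vanishing_Un[OF mass_vanishing[OF zero_less_one] vanishing_Un[OF compact_vanishing moment_vanishing]] _ always_eventually])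
  (auto simp: good_def mass_bound_def not_le)

text \<open>Membership in the set of regular paths of index \<open>k\<close> fails only on a finite
  union of vanishing events: one family for the cluster number, one for tails, and one for each ramp
  and time cell.\<close>

theorem limit_exists: "\<exists>(N :: (real => real measure) measure) Y. subsequential_limit_in_law (skorohod_topology weak_topology) M \<mu> N Y"
proof -
 let ?B = mass_bound
 note B = mass_bound_nonneg
 interpret M0: prob_space "M 0" by (rule prob)
 have ne: "\<K> \<noteq> {}" using initial_compact(2)[of 0] by auto
 obtain AK where AK: "0 <= AK" and AK': "\<forall>\<nu>\<in>\<K>. measure \<nu> {0..} <= AK"
  using weakly_compact_bounds[OF initial_compact(1)] by (elim exE conjE)
 obtain \<kappa>K where \<kappa>K: "\<kappa>K \<longlonglongrightarrow> 0" and \<kappa>K': "\<forall>\<nu>\<in>\<K>. \<forall>R. (LINT x|\<nu>. tail_weight (real (Suc R)) x) <= \<kappa>K R"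
  using weakly_compact_tails[OF initial_compact(1) ne] by (elim exE conjE)
 \<comment> \<open>The constants \<open>A\<close>, \<open>\<tau>\<close> and \<open>C\<close> are
   the thresholds of the three path bounds, with the initial values replaced by their bounds on
   \<K>. The horizon is \<open>T + 1\<close> because grid cells may extend beyond
   \<open>T\<close>.\<close>
 define A where "A T = AK + 2 * (\<alpha>m * ?B\<^sup>2) * (real T + 1) + 1" for T :: nat
 define \<kappa> where "\<kappa> = 4 * \<alpha>m * ?B\<^sup>2 + 3 * Ka * ?B * (?B + 1)"
 define \<tau> where "\<tau> T R = (\<kappa>K R + 1 / real (Suc R)) * exp (2 * \<kappa> * (real T + 1) + 1)" for T R :: nat
 define C where "C T i = 2 * (\<alpha>m * ?B\<^sup>2 + \<beta>m * A T + (Ka * ?B + Kb) * (real (snd i) * (A T + ?B))) + 1" for T and i :: "rat \<times> nat"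
 have A0: "0 <= A T" for T using AK nucleation_bounds by (simp add: A_def)
 have C0: "0 <= C T i" for T i
  unfolding C_def using A0[of T] nucleation_bounds B linear_growth(1,2) by simp
 have \<tau>0: "(\<lambda>R. \<tau> T R) \<longlonglongrightarrow> 0" for T
  unfolding \<tau>_def using tendsto_mult_right[OF tendsto_add[OF \<kappa>K LIMSEQ_inverse_real_of_nat], of "exp (2 * \<kappa> * (real T + 1) + 1)"]
  by (simp add: inverse_eq_divide)
 let ?G = "regular_paths A ?B \<tau> C"
 show ?thesis
 proof (rule subsequential_limit_in_law_exists[where G="?G", OF prob process_measurable(1) rational_evaluation_measurable])
  show "\<exists>C' k. \<forall>x\<in>?G k. \<bar>rational_evaluation j x\<bar> <= C'" for j by (rule regular_paths_bounded)
  show "?G (Suc k) \<subseteq> ?G k" for k by (rule regular_paths_decreasing[OF C0])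
  show "?G 0 \<subseteq> topspace (skorohod_topology weak_topology)" by (auto simp: regular_paths_def)
  show "\<exists>y\<in>(\<Inter>k. ?G k). limitin (skorohod_topology weak_topology) x y sequentially \<and> (\<forall>j. (\<lambda>k. rational_evaluation j (x k)) \<longlonglongrightarrow> rational_evaluation j y)"
   if "\<And>k. x k \<in> ?G k" "\<And>j. convergent (\<lambda>k. rational_evaluation j (x k))" for x
   using that by (intro regular_paths_compactness[OF C0 \<tau>0]) auto
  show "x = y" if "x \<in> (\<Inter>k. ?G k)" "y \<in> (\<Inter>k. ?G k)" "\<And>j. rational_evaluation j x = rational_evaluation j y" for x y
   using that by (intro cadlag_weak_eqI) (auto simp: regular_paths_def)
  fix k :: nat
  define \<delta> where "\<delta> = 1 / (2 * real (Suc k))"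
  have \<delta>: "0 < \<delta>" "2 * \<delta> = 1 / real (Suc k)" "\<delta> <= 1" by (auto simp: \<delta>_def field_simps)
  define N where "N T = nat \<lceil>(real T + 1) / \<delta>\<rceil>" for T :: nat
  define E3 where "E3 T n = {\<omega>\<in>space (M n). mass n \<omega> <= ?B \<and>
   (\<exists>t\<in>{0..real T + 1}. measure (\<mu> n \<omega> t) {0..} > measure (\<mu> n \<omega> 0) {0..} + 2 * (\<alpha>m * ?B\<^sup>2) * (real T + 1) + 1)}" for T n
  define E4 where "E4 T R n = {\<omega>\<in>space (M n). mass n \<omega> <= ?B \<and>
   (\<exists>t\<in>{0..real T + 1}. (LINT x|\<mu> n \<omega> t. tail_weight (real (Suc R)) x) >
    ((LINT x|\<mu> n \<omega> 0. tail_weight (real (Suc R)) x) + 1 / real (Suc R)) * exp (2 * \<kappa> * (real T + 1) + 1))}" for T R n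
  define E5 where "E5 T i l n = {\<omega>\<in>space (M n). mass n \<omega> <= ?B \<and> (\<forall>t\<in>{real l * \<delta>..real l * \<delta> + \<delta>}. measure (\<mu> n \<omega> t) {0..} <= A T) \<and>
   (\<exists>s\<in>{real l * \<delta>..real l * \<delta> + \<delta>}. \<exists>t\<in>{real l * \<delta>..real l * \<delta> + \<delta>}.
    \<bar>(LINT x|\<mu> n \<omega> s. ramp i x) - (LINT x|\<mu> n \<omega> t. ramp i x)\<bar> > C T i * \<delta>)}" for T and i :: "rat \<times> nat" and l n
  have v3: "vanishing M (E3 T)" for T
  proof (rule vanishing_exponential[where c=1 and d=0])
   show "\<forall>\<^sub>F n in sequentially. \<exists>Z\<in>sets (M n). E3 T n \<subseteq> Z \<and> measure (M n) Z <= exp (- (1 / eps n - 0))"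
    using eventually_small[OF zero_less_one]
   proof eventually_elim
    case (elim n)
    show ?case using sbd_rescaled.cluster_number_bound[OF rescaled[OF elim] B, of "real T + 1"]
     unfolding total_mass_eq[OF elim] E3_def by simp
   qed
  qed (auto simp: E3_def)
  have v4: "vanishing M (E4 T R)" for T R
  proof (rule vanishing_exponential[where c=1 and d=0])
   have "0 < 1 / (3 * real (Suc R))" by simp
   from eventually_small[OF this] eventually_small[of "1/2", simplified]
   show "\<forall>\<^sub>F n in sequentially. \<exists>Z\<in>sets (M n). E4 T R n \<subseteq> Z \<and> measure (M n) Z <= exp (- (1 / eps n - 0))"
   proof eventually_elim
    case (elim n)
    have e1: "eps n <= 1" using elim(2) by simp
    have e3: "3 * real (Suc R) * eps n <= 1" using elim(1) by (simp add: field_simps)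
    show ?case using sbd_rescaled.tail_bound[OF rescaled[OF e1] B, of "real T + 1" "real (Suc R)"] elim(2) e3
     unfolding total_mass_eq[OF e1] E4_def \<kappa>_def by simp
   qed
  qed (auto simp: E4_def)
  have v5: "vanishing M (E5 T i l)" for T i l
  proof (rule vanishing_exponential[where c=\<delta> and d=0])
   have "0 < 1 / (real (snd i) + 1)" by simp
   from eventually_small[OF this] eventually_small[OF zero_less_one]
   show "\<forall>\<^sub>F n in sequentially. \<exists>Z\<in>sets (M n). E5 T i l n \<subseteq> Z \<and> measure (M n) Z <= exp (- (\<delta> / eps n - 0))"
   proof eventually_elim
    case (elim n)
    have "eps n * (real (snd i) + 1) <= 1" using elim(1) by (simp add: field_simps)
    then have e3: "eps n * real (snd i) <= 1" using eps(1)[of n] by (simp add: distrib_left)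
    show ?case using sbd_rescaled.modulus_bound[OF rescaled[OF elim(2)] B A0 _ \<delta>(1) e3, of "real l * \<delta>" T] \<delta>(1)
     unfolding total_mass_eq[OF elim(2)] E5_def C_def by simp
   qed
  qed (use \<delta> in \<open>auto simp: E5_def\<close>)
  let ?I = "{i. to_nat (i :: rat \<times> nat) <= k}"
  have fI: "finite ?I"
   using finite_vimageI[OF finite_atMost[of k] inj_to_nat] by (simp add: vimage_def)
  let ?E = "\<lambda>n. (space (M n) - good n) \<union> ((\<Union>T\<in>{..k}. E3 T n) \<union> ((\<Union>p\<in>{..k} \<times> {..k}. E4 (fst p) (snd p) n) \<union>
   (\<Union>p\<in>(SIGMA T:{..k}. ?I \<times> {..<N T}). E5 (fst p) (fst (snd p)) (snd (snd p)) n)))"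
  have vE: "vanishing M ?E"
   by (intro vanishing_Un not_good_vanishing vanishing_UN v3 v4 v5 finite_SigmaI finite_cartesian_product fI) auto
  have "\<mu> n \<omega> \<in> ?G k" if \<omega>: "\<omega> \<in> space (M n)" "\<omega> \<notin> ?E n" for n \<omega>
  proof -
   have cad: "\<mu> n \<omega> \<in> cadlag weak_topology" by (rule process_cadlag[OF \<omega>(1)])
   have g: "mass n \<omega> <= ?B" "\<mu> n \<omega> 0 \<in> \<K>" "\<And>t. 0 <= t ==> (LINT x|\<mu> n \<omega> t. x) <= ?B"
    using \<omega> process_start[OF \<omega>(1)] by (auto simp: good_def intro: order_trans)
   have mA: "measure (\<mu> n \<omega> t) {0..} <= A T" if "T <= k" "t \<in> {0..real T + 1}" for T t
   proof -
    have "\<omega> \<notin> E3 T n" using \<omega>(2) that(1) by auto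
    then have "measure (\<mu> n \<omega> t) {0..} <= measure (\<mu> n \<omega> 0) {0..} + 2 * (\<alpha>m * ?B\<^sup>2) * (real T + 1) + 1"
     using \<omega>(1) g(1) that(2) unfolding E3_def by (auto simp: not_less)
    then show ?thesis using AK'[rule_format, OF g(2)] by (simp add: A_def)
   qed
   have mt: "(LINT x|\<mu> n \<omega> t. tail_weight (real (Suc R)) x) <= \<tau> T R" if "T <= k" "R <= k" "t \<in> {0..real T + 1}" for T R t
   proof -
    have "\<omega> \<notin> E4 T R n" using \<omega>(2) that(1,2) by force
    then have "(LINT x|\<mu> n \<omega> t. tail_weight (real (Suc R)) x) <=
     ((LINT x|\<mu> n \<omega> 0. tail_weight (real (Suc R)) x) + 1 / real (Suc R)) * exp (2 * \<kappa> * (real T + 1) + 1)"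
     using \<omega>(1) g(1) that(3) unfolding E4_def by (auto simp: not_less)
    also have "\<dots> <= \<tau> T R" unfolding \<tau>_def using \<kappa>K'[rule_format, OF g(2), of R] by (intro mult_right_mono) auto
    finally show ?thesis .
   qed
   have mc: "\<bar>(LINT z|\<mu> n \<omega> s. ramp i z) - (LINT z|\<mu> n \<omega> t. ramp i z)\<bar> <= C T i * (\<bar>s - t\<bar> + 1 / real (Suc k))"
    if T: "T <= k" and i: "to_nat i <= k" and st: "s \<in> {0..real T}" "t \<in> {0..real T}" for T i s t
    unfolding \<delta>(2)[symmetric]
   \<comment> \<open>The cells must stay inside \<open>[0, T + 1]\<close>, where the cluster number
     is bounded, and yet cover more than \<open>[0, T]\<close>. Dropping the last cell achieves the
     former; as \<open>\<delta>\<close> is at most \<open>1 / 2\<close>, the rest still reaches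
     \<open>T + 1 / 2\<close>.\<close>
   proof (rule grid_modulus[OF \<delta>(1) C0, where T="real T + 1 / 2" and N="N T - 1"])
    have ge: "(real T + 1) / \<delta> <= real (N T)" "real (N T) < (real T + 1) / \<delta> + 1"
     using \<delta>(1) unfolding N_def by (auto simp: of_nat_ceiling) linarith+
    have "real T + 1 <= real (N T) * \<delta>" using ge(1) \<delta>(1) by (simp add: field_simps)
    moreover have "1 <= N T" using ge(1) \<delta>(1) by (cases "N T") (auto simp: field_simps)
    moreover have "\<delta> <= 1 / 2" by (simp add: \<delta>_def field_simps)
    ultimately show "real T + 1 / 2 <= real (N T - 1) * \<delta>" by (simp add: of_nat_diff algebra_simps)
    fix l s t assume l: "l < N T - 1" and s: "s \<in> {real l * \<delta>..real l * \<delta> + \<delta>}" and t: "t \<in> {real l * \<delta>..real l * \<delta> + \<delta>}"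
    have nE: "\<omega> \<notin> E5 T i l n"
    proof
     assume "\<omega> \<in> E5 T i l n"
     then have "\<omega> \<in> (\<Union>p\<in>(SIGMA T:{..k}. ?I \<times> {..<N T}). E5 (fst p) (fst (snd p)) (snd (snd p)) n)"
      using T i l by (intro UN_I[of "(T, i, l)"]) auto
     with \<omega>(2) show False by blast
    qed
    have "real l + 1 + 1 <= real (N T)" using l by linarith
    then have "real l + 1 < (real T + 1) / \<delta>" using ge(2) by linarith
    then have "real l * \<delta> + \<delta> <= real T + 1" using \<delta>(1) by (simp add: field_simps)
    then have "\<forall>t\<in>{real l * \<delta>..real l * \<delta> + \<delta>}. measure (\<mu> n \<omega> t) {0..} <= A T"
     using mA[OF T] \<delta>(1) order_trans[of 0 "real l * \<delta>"] by auto
    then show "\<bar>(LINT z|\<mu> n \<omega> s. ramp i z) - (LINT z|\<mu> n \<omega> t. ramp i z)\<bar> <= C T i * \<delta>"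
     using nE s t \<omega>(1) g(1) unfolding E5_def by (auto simp: not_less)
   qed (use st in auto)
   show ?thesis unfolding regular_paths_def
    using cad mA g(3) mt mc by auto
  qed
  then have "vanishing M (\<lambda>n. {\<omega>\<in>space (M n). \<mu> n \<omega> \<notin> ?G k})"
   by (intro vanishing_mono[OF vE] always_eventually) blast+
  then show "\<exists>Z. (\<forall>n. Z n \<in> sets (M n) \<and> {\<omega>\<in>space (M n). \<mu> n \<omega> \<notin> ?G k} \<subseteq> Z n) \<and> (\<lambda>n. measure (M n) (Z n)) \<longlonglongrightarrow> 0"
   unfolding vanishing_def .
 qed
qed

end


section \<open>Test functions and difference quotients\<close>

text \<open>Only the derivative has compact support: to the right of \<open>q\<close> the function
  may be a nonzero constant. This admits all primitives of cut-off polynomials, which in general are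
  not compactly supported.\<close>

definition test_pair :: "real => real => (real => real) => (real => real) => bool" where
 "test_pair p q \<phi> D \<longleftrightarrow> 0 < p \<and> p <= q \<and> continuous_on UNIV D \<and> (\<forall>x. (\<phi> has_real_derivative D x) (at x)) \<and>
  (\<forall>x. x \<notin> {p..q} \<longrightarrow> D x = 0) \<and> (\<forall>x\<le>p. \<phi> x = 0)"

lemma test_pairD:
 assumes "test_pair p q \<phi> D"
 shows "0 < p" "p <= q" "continuous_on UNIV D" "(\<phi> has_real_derivative D x) (at x)"
  "x \<notin> {p..q} ==> D x = 0" "x <= p ==> \<phi> x = 0"
 using assms by (auto simp: test_pair_def)

lemma test_pair_mono: "test_pair p q \<phi> D ==> 0 < p' ==> p' <= p ==> q <= q' ==> test_pair p' q' \<phi> D"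
 unfolding test_pair_def by auto

lemma test_pair_linear:
 assumes 1: "test_pair p q \<phi> D" and 2: "test_pair p q \<phi>' D'"
 shows "test_pair p q (\<lambda>x. \<phi> x + c * \<phi>' x) (\<lambda>x. D x + c * D' x)"
proof -
 have "((\<lambda>x. \<phi> x + c * \<phi>' x) has_real_derivative D x + c * D' x) (at x)" for x
  by (intro DERIV_add test_pairD(4)[OF 1] DERIV_cmult test_pairD(4)[OF 2])
 then show ?thesis using test_pairD(1-3,5,6)[OF 1] test_pairD(3,5,6)[OF 2] unfolding test_pair_def
  by (auto intro!: continuous_intros)
qed

lemma test_pair_exists:
 assumes "0 < p" "p <= q" and D: "continuous_on UNIV D" and 0: "\<And>x. x \<notin> {p..q} ==> D x = 0"
 shows "\<exists>\<phi>. test_pair p q \<phi> D"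
proof -
 have "\<exists>F. \<forall>x :: real. - \<infinity> < ereal x \<longrightarrow> ereal x < \<infinity> \<longrightarrow> (F has_vector_derivative D x) (at x)"
  using D by (intro einterval_antiderivative) (auto simp: continuous_on_eq_continuous_at)
 then obtain F where F: "\<And>x. (F has_real_derivative D x) (at x)"
  by (auto simp: has_real_derivative_iff_has_vector_derivative)
 have c: "F x = F p" if "x <= p" for x
 proof (cases "x = p")
  case False
  have "\<exists>z>x. z < p \<and> F p - F x = (p - x) * D z"
  proof (rule MVT2)
   show "x < p" using that False by simp
  qed (rule F)
  then obtain z where "x < z" "z < p" "F p - F x = (p - x) * D z" by (elim exE conjE)
  then show ?thesis using 0[of z] by simp
 qed simp
 have "test_pair p q (\<lambda>x. F x - F p) D"
  unfolding test_pair_def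
 proof (intro conjI allI impI assms)
  show "((\<lambda>x. F x - F p) has_real_derivative D x) (at x)" for x
   using DERIV_diff[OF F DERIV_const[of "F p"]] by simp
  show "F x - F p = 0" if "x <= p" for x using c[OF that] by (simp only: diff_self)
 qed
 then show ?thesis by (rule exI[where x="\<lambda>x. F x - F p"])
qed

lemma test_pair_mean_value:
 assumes tp: "test_pair p q \<phi> D"
 obtains \<xi> where "\<bar>\<xi> - x\<bar> <= \<bar>h\<bar>" "\<phi> (x + h) - \<phi> x = h * D \<xi>"
proof (cases h "0 :: real" rule: linorder_cases)
 case less
 then obtain z where "x + h < z" "z < x" "\<phi> x - \<phi> (x + h) = (x - (x + h)) * D z"
  using MVT2[of "x + h" x \<phi> D] test_pairD(4)[OF tp] by auto
 then show ?thesis using less by (intro that[of z]) (auto simp: algebra_simps)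
next
 case equal
 then show ?thesis by (intro that[of x]) auto
next
 case greater
 then obtain z where "x < z" "z < x + h" "\<phi> (x + h) - \<phi> x = (x + h - x) * D z"
  using MVT2[of x "x + h" \<phi> D] test_pairD(4)[OF tp] by auto
 then show ?thesis using greater by (intro that[of z]) auto
qed

lemma test_pair_lipschitz:
 assumes tp: "test_pair p q \<phi> D" and L: "\<And>x. \<bar>D x\<bar> <= L"
 shows "\<bar>\<phi> (x + h) - \<phi> x\<bar> <= L * \<bar>h\<bar>"
proof -
 obtain \<xi> where "\<phi> (x + h) - \<phi> x = h * D \<xi>" by (rule test_pair_mean_value[OF tp])
 then show ?thesis using mult_right_mono[OF L[of \<xi>], of "\<bar>h\<bar>"] by (simp add: abs_mult mult.commute)
qed

lemma test_pair_bound: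
 assumes tp: "test_pair p q \<phi> D" and L: "\<And>x. \<bar>D x\<bar> <= L"
 shows "\<bar>\<phi> x\<bar> <= L * q"
proof -
 have L0: "0 <= L" using L[of 0] by linarith
 note pq = test_pairD(1,2)[OF tp]
 have *: "\<bar>\<phi> x\<bar> <= L * q" if "x <= q" for x
 proof (cases "x <= p")
  case True
  then show ?thesis using test_pairD(6)[OF tp] L0 pq by simp
 next
  case False
  have "\<bar>\<phi> x\<bar> <= L * \<bar>x - p\<bar>" using test_pair_lipschitz[OF tp L, of p "x - p"] test_pairD(6)[OF tp, of p] by simp
  also have "\<dots> <= L * q" using False that L0 pq by (intro mult_left_mono) auto
  finally show ?thesis .
 qed
 show ?thesis
 proof (cases "x <= q")
  case True
  then show ?thesis by (rule *)
 next
  case False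
  then obtain z where "q < z" "z < x" "\<phi> x - \<phi> q = (x - q) * D z" using MVT2[of q x \<phi> D] test_pairD(4)[OF tp] by auto
  then have "\<phi> x = \<phi> q" using test_pairD(5)[OF tp, of z] by simp
  then show ?thesis using *[of q] by simp
 qed
qed

lemma test_pair_derivative_bounded:
 assumes tp: "test_pair p q \<phi> D"
 shows "\<exists>L\<ge>0. \<forall>x. \<bar>D x\<bar> <= L"
proof -
 have "compact (D ` {p..q})" using continuous_on_subset[OF test_pairD(3)[OF tp]] by (intro compact_continuous_image) auto
 then obtain L where L: "\<forall>x\<in>{p..q}. \<bar>D x\<bar> <= L" using compact_imp_bounded[of "D ` {p..q}"] by (auto simp: bounded_iff simp del: atLeastAtMost_iff)
 have "\<bar>D x\<bar> <= max L 0" for x using L test_pairD(5)[OF tp, of x] by (cases "x \<in> {p..q}") fastforce+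
 then show ?thesis by (intro exI[of _ "max L 0"]) auto
qed

lemma test_pair_continuous: "test_pair p q \<phi> D ==> continuous_on S \<phi>"
 by (rule DERIV_continuous_on[where D=D]) (auto simp: test_pair_def intro: has_field_derivative_at_within)

lemma test_pair_bounded_continuous:
 assumes tp: "test_pair p q \<phi> D"
 shows "\<phi> \<in> bounded_continuous"
proof -
 obtain L where L: "\<forall>x. \<bar>D x\<bar> <= L" using test_pair_derivative_bounded[OF tp] by (elim exE conjE)
 show ?thesis by (rule bounded_continuousI[OF test_pair_continuous[OF tp] test_pair_bound[OF tp L[rule_format]]])
qed

lemma test_pair_flux_bound:
 assumes tp: "test_pair p q \<phi> D" and L: "\<And>x. \<bar>D x\<bar> <= L"
  and r: "\<And>x. 0 <= x ==> 0 <= r x" "\<And>x. 0 <= x ==> r x <= K * (1 + x)" and K: "0 <= K" and x: "0 <= x"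
 shows "\<bar>D x * r x\<bar> <= L * (K * (1 + q))"
proof (cases "x \<in> {p..q}")
 case True
 have "r x <= K * (1 + q)" using r(2)[OF x] mult_left_mono[OF _ K, of "1 + x" "1 + q"] True by auto
 then show ?thesis unfolding abs_mult using L[of x] r(1)[OF x] by (intro mult_mono) auto
next
 case False
 have "0 <= L" using L[of 0] by linarith
 then show ?thesis using test_pairD(1,2)[OF tp] test_pairD(5)[OF tp False] K by simp
qed

lemma test_pair_flux_bounded_continuous:
 assumes tp: "test_pair p q \<phi> D" and rc: "continuous_on {0..} r"
  and r: "\<And>x. 0 <= x ==> 0 <= r x" "\<And>x. 0 <= x ==> r x <= K * (1 + x)" and K: "0 <= K"
 shows "(\<lambda>x. D x * r x) \<in> bounded_continuous"
proof -
 obtain L where L: "\<forall>x. \<bar>D x\<bar> <= L" using test_pair_derivative_bounded[OF tp] by (elim exE conjE)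
 show ?thesis using test_pair_flux_bound[OF tp L[rule_format] r K] continuous_on_subset[OF test_pairD(3)[OF tp]] rc
  by (intro bounded_continuousI continuous_intros) auto
qed

text \<open>Left of \<open>p / 2\<close> and right of \<open>q + 1\<close> both terms vanish, since
  the intermediate point misses the support of \<open>D\<close>. In between the error is at most
  \<open>\<eta> * p / 2\<close>, and \<open>x >= p / 2\<close> turns this into an error proportional
  to \<open>x\<close>.\<close>

lemma difference_quotient_estimate:
 assumes tp: "test_pair p q \<phi> D" and h: "h \<noteq> 0" "\<bar>h\<bar> <= p / 2" "\<bar>h\<bar> <= 1"
  and r: "\<And>x. 0 <= x ==> 0 <= r x" "\<And>x. 0 <= x ==> r x <= K * (1 + x)" and K: "0 <= K" and L: "\<And>x. \<bar>D x\<bar> <= L"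
  and unif: "\<And>y z. y \<in> {0..q + 2} ==> z \<in> {0..q + 2} ==> \<bar>y - z\<bar> <= \<bar>h\<bar> ==> \<bar>D y - D z\<bar> <= u"
  and rr: "\<And>x. x \<in> {0..q + 1} ==> \<bar>r x - r0 x\<bar> <= v"
  and small: "u * (K * (2 + q)) + L * v <= \<eta> * (p / 2)" and x: "0 <= x" and \<eta>: "0 <= \<eta>"
 shows "\<bar>(\<phi> (x + h) - \<phi> x) / h * r x - D x * r0 x\<bar> <= \<eta> * x"
proof -
 note pq = test_pairD(1,2)[OF tp]
 obtain \<xi> where \<xi>: "\<bar>\<xi> - x\<bar> <= \<bar>h\<bar>" "\<phi> (x + h) - \<phi> x = h * D \<xi>" by (rule test_pair_mean_value[OF tp])
 have eq: "(\<phi> (x + h) - \<phi> x) / h = D \<xi>" using \<xi>(2) h(1) by simp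
 have rng: "\<xi> <= x + p / 2" "x - p / 2 <= \<xi>" "\<xi> <= x + 1" "x - 1 <= \<xi>" using \<xi>(1) h(2,3) by linarith+
 consider "x < p / 2" | "x > q + 1" | "p / 2 <= x" "x <= q + 1" by linarith
 then show ?thesis
 proof cases
  case 1
  then have "x \<notin> {p..q}" "\<xi> \<notin> {p..q}" using rng pq by auto
  then show ?thesis unfolding eq using test_pairD(5)[OF tp] \<eta> x by simp
 next
  case 2
  then have "x \<notin> {p..q}" "\<xi> \<notin> {p..q}" using rng pq by auto
  then show ?thesis unfolding eq using test_pairD(5)[OF tp] \<eta> x by simp
 next
  case 3
  have "D \<xi> * r x - D x * r0 x = (D \<xi> - D x) * r x + D x * (r x - r0 x)" by (simp add: algebra_simps)
  then have "\<bar>D \<xi> * r x - D x * r0 x\<bar> <= \<bar>D \<xi> - D x\<bar> * r x + \<bar>D x\<bar> * \<bar>r x - r0 x\<bar>"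
   using abs_triangle_ineq[of "(D \<xi> - D x) * r x" "D x * (r x - r0 x)"] r(1)[OF x] by (simp add: abs_mult)
  also have "\<dots> <= u * (K * (2 + q)) + L * v"
  proof (intro add_mono mult_mono)
   show *: "\<bar>D \<xi> - D x\<bar> <= u" using 3 rng pq \<xi>(1) by (intro unif) auto
   then show "0 <= u" by linarith
   show "r x <= K * (2 + q)" using r(2)[OF x] mult_left_mono[OF _ K, of "1 + x" "2 + q"] 3 by auto
   show "\<bar>r x - r0 x\<bar> <= v" using rr[of x] x 3 by auto
   show "0 <= L" using L[of 0] by linarith
  qed (use L r(1) x in auto)
  also have "\<dots> <= \<eta> * x" using small mult_left_mono[OF 3(1) \<eta>] by linarith
  finally show ?thesis unfolding eq .
 qed
qed

text \<open>Below \<open>p / 2\<close> the increment is 0; above, \<open>1 + x\<close> is at most a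
  multiple of \<open>x\<close>, so the sum over clusters is again controlled by the first
  moment.\<close>

lemma weighted_increment_square:
 assumes tp: "test_pair p q \<phi> D" and h: "\<bar>h\<bar> <= p / 2" and L: "\<And>x. \<bar>D x\<bar> <= L" and x: "0 <= x"
 shows "(1 + x) * (\<phi> (x + h) - \<phi> x)\<^sup>2 <= (L\<^sup>2 * (1 + 2 / p)) * h\<^sup>2 * x"
proof (cases "x < p / 2")
 case True
 then have "\<phi> (x + h) = 0" "\<phi> x = 0" using h test_pairD(1)[OF tp] by (auto intro!: test_pairD(6)[OF tp])
 then show ?thesis using x test_pairD(1)[OF tp] by simp
next
 case False
 note p = test_pairD(1)[OF tp]
 have "1 <= 2 / p * x" using False p by (simp add: field_simps)
 then have 1: "1 + x <= (1 + 2 / p) * x" by (simp add: distrib_right)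
 have "\<bar>\<phi> (x + h) - \<phi> x\<bar>\<^sup>2 <= (L * \<bar>h\<bar>)\<^sup>2" by (intro power_mono test_pair_lipschitz[OF tp L]) auto
 then have 2: "(\<phi> (x + h) - \<phi> x)\<^sup>2 <= L\<^sup>2 * h\<^sup>2" by (simp add: power_mult_distrib)
 have "(1 + x) * (\<phi> (x + h) - \<phi> x)\<^sup>2 <= ((1 + 2 / p) * x) * (L\<^sup>2 * h\<^sup>2)" using 1 2 x by (intro mult_mono) auto
 then show ?thesis by (simp add: mult_ac)
qed

lemma path_integral_bound:
 assumes h: "rcll (\<lambda>s. g (x s))" and w: "continuous_on UNIV w" and T: "0 <= T"
  and C: "\<And>s. 0 <= s ==> s <= T ==> \<bar>w s * g (x s)\<bar> <= C"
 shows "\<bar>path_integral T w g x\<bar> <= T * C"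
proof -
 have "\<bar>path_integral T w g x\<bar> <= (LINT s|lborel. indicator {0..T} s * C)"
  unfolding path_integral_def
 proof (rule abs_integral_le[OF rcll_integrable[OF h w]])
  show "integrable lborel (\<lambda>s. indicator {0..T} s * C)" by (intro integrable_mult_left integrable_real_indicator) (auto simp: emeasure_lborel_Icc_eq)
 qed (use C in \<open>auto simp: indicator_def\<close>)
 also have "\<dots> = T * C" using T by simp
 finally show ?thesis .
qed

lemma path_integral_linear:
 assumes "rcll (\<lambda>s. g (x s))" "rcll (\<lambda>s. g' (x s))" and w: "continuous_on UNIV w"
  and eq: "\<And>s. 0 <= s ==> f (x s) = g (x s) + c * g' (x s)"
 shows "path_integral T w f x = path_integral T w g x + c * path_integral T w g' x"
proof -
 have "path_integral T w f x = (LINT s|lborel. indicator {0..T} s * (w s * g (x s)) + c * (indicator {0..T} s * (w s * g' (x s))))"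
  unfolding path_integral_def by (intro Bochner_Integration.integral_cong) (auto simp: indicator_def eq algebra_simps)
 then show ?thesis unfolding path_integral_def using rcll_integrable[OF assms(1) w, of T] rcll_integrable[OF assms(2) w, of T] by simp
qed

section \<open>The integrated equation holds in the limit\<close>

context sbd_sequence
begin

lemma limit_rates_growth: "0 <= x ==> a\<^sub>0 x <= Ka * (1 + x)" "0 <= x ==> b\<^sub>0 x <= Kb * (1 + x)"
proof -
 assume x: "0 <= x"
 then have "(\<lambda>n. a n x) \<longlonglongrightarrow> a\<^sub>0 x" "(\<lambda>n. b n x) \<longlonglongrightarrow> b\<^sub>0 x"
  using tendsto_uniform_limitI[OF rates_tendsto(1)[of "{x}"]] tendsto_uniform_limitI[OF rates_tendsto(2)[of "{x}"]] by auto
 then show "a\<^sub>0 x <= Ka * (1 + x)" "b\<^sub>0 x <= Kb * (1 + x)" using linear_growth(3,4)[OF x] by (auto intro: LIMSEQ_le_const2)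
qed

definition LS_drift :: "(real => real) => real measure => real" where
 "LS_drift D = drift_functional (\<lambda>x. D x * a\<^sub>0 x) (\<lambda>x. D x * b\<^sub>0 x) mass_limit"

text \<open>The equation integrated once more in time, which makes it a Skorohod continuous functional of
 the path.\<close>

definition LS_defect :: "(real => real) => (real => real) => real => (real => real measure) => real" where
 "LS_defect \<phi> D T x = path_integral T (\<lambda>_. 1) (\<lambda>\<nu>. LINT z|\<nu>. \<phi> z) x - T * (LINT z|\<mu>\<^sub>0. \<phi> z) -
  path_integral T (\<lambda>s. T - s) (LS_drift D) x"

lemma flux_bounded_continuous:
 assumes "test_pair p q \<phi> D"
 shows "(\<lambda>x. D x * a\<^sub>0 x) \<in> bounded_continuous" "(\<lambda>x. D x * b\<^sub>0 x) \<in> bounded_continuous"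
 using test_pair_flux_bounded_continuous[OF assms limit_rates_continuous(1) limit_rates_nonneg(1) limit_rates_growth(1)]
  test_pair_flux_bounded_continuous[OF assms limit_rates_continuous(2) limit_rates_nonneg(2) limit_rates_growth(2)]
  linear_growth(1,2) by auto

lemma continuous_map_LS_drift: "test_pair p q \<phi> D ==> continuous_map weak_topology euclideanreal (LS_drift D)"
 unfolding LS_drift_def by (intro continuous_map_drift_functional flux_bounded_continuous)

lemma continuous_map_LS_defect:
 assumes tp: "test_pair p q \<phi> D"
 shows "continuous_map (skorohod_topology weak_topology) euclideanreal (LS_defect \<phi> D T)"
 unfolding LS_defect_def
 by (intro continuous_map_diff continuous_map_path_integral continuous_map_LS_drift[OF tp]
   continuous_map_weak_integral(1)[OF test_pair_bounded_continuous[OF tp]] continuous_map_const[THEN iffD2] continuous_intros) auto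

text \<open>The path bound has an exponent of order \<open>1 / eps\<close> as soon as the relative
  error \<open>\<eta>\<close> of the difference quotients is small against \<open>\<delta>\<close>;
  uniform continuity of \<open>D\<close> and uniform convergence of the rates provide this for small
  eps.\<close>

lemma drift_deviation_vanishing:
 assumes tp: "test_pair p q \<phi> D" and T: "0 < T" and \<delta>: "0 < \<delta>" and \<sigma>: "\<bar>\<sigma>\<bar> = 1"
 shows "vanishing M (\<lambda>n. {\<omega>\<in>space (M n). mass n \<omega> <= mass_bound \<and>
  \<delta> < \<sigma> * drift_deviation \<phi> (\<lambda>x. D x * a\<^sub>0 x) (\<lambda>x. D x * b\<^sub>0 x) (mass n \<omega>) T (\<mu> n \<omega>)})"
proof -
 let ?B = mass_bound
 note B = mass_bound_nonneg
 note pq = test_pairD(1,2)[OF tp]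
 obtain L where L0: "0 <= L" and L': "\<forall>x. \<bar>D x\<bar> <= L" using test_pair_derivative_bounded[OF tp] by (elim exE conjE)
 note L = L'[rule_format]
 define Q where "Q = L\<^sup>2 * (1 + 2 / p)"
 \<comment> \<open>With this choice the drift error takes less than \<open>\<delta> / 2\<close>, so
   the coefficient of \<open>1 / eps\<close> in the exponent stays positive. The summand 1 makes the
   denominator positive even if the mass bound is 0.\<close>
 define \<eta> where "\<eta> = \<delta> / (2 * (T * T * ?B * (?B + 1) + 1))"
 have den: "0 < T * T * ?B * (?B + 1) + 1" using B T by (intro add_nonneg_pos mult_nonneg_nonneg) auto
 have \<eta>: "0 < \<eta>" using \<delta> den by (simp add: \<eta>_def)
 have "\<eta> * (2 * (T * T * ?B * (?B + 1) + 1)) = \<delta>"    unfolding \<eta>_def by (rule nonzero_eq_divide_eq[THEN iffD1, OF _ refl]) (use den in simp)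
 then have "2 * \<eta> * (T * T * ?B * (?B + 1) + 1) = \<delta>" by (simp only: mult_ac)
 then have c: "0 < \<delta> - T * (T * \<eta> * ?B * (?B + 1))" using \<eta> \<delta> by (simp add: algebra_simps)
 define \<omega>1 where "\<omega>1 = \<eta> * p / (4 * ((Ka + Kb) * (2 + q)))"
 define \<omega>2 where "\<omega>2 = \<eta> * p / (4 * (L + 1))"
 have K: "0 < Ka" "0 < Kb" "0 < (Ka + Kb) * (2 + q)" using linear_growth(1,2) pq by simp_all
 have \<omega>: "0 < \<omega>1" "0 < \<omega>2" using \<eta> pq K L0 by (simp_all add: \<omega>1_def \<omega>2_def)
 have s2: "L * \<omega>2 <= \<eta> * (p / 4)"
 proof -
  have "L * \<omega>2 <= (L + 1) * \<omega>2" using \<omega> by simp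
  also have "\<dots> = \<eta> * (p / 4)" using L0 nonzero_mult_divide_mult_cancel_left[of "L + 1" "\<eta> * p" 4] by (simp add: \<omega>2_def mult_ac)
  finally show ?thesis .
 qed
 have s1: "\<omega>1 * (K * (2 + q)) <= \<eta> * (p / 4)" if "K <= Ka + Kb" for K
 proof -
  have "\<omega>1 * (K * (2 + q)) <= \<omega>1 * ((Ka + Kb) * (2 + q))" using \<omega> pq that by (intro mult_left_mono mult_right_mono) auto
  also have "\<dots> = \<eta> * (p / 4)"
  proof -
   have "y / (4 * k) * k = y / 4" if "0 < k" for y k :: real using that by simp
   from this[OF K(3), of "\<eta> * p"] show ?thesis by (simp only: \<omega>1_def times_divide_eq_right)
  qed
  finally show ?thesis .
 qed
 have "uniformly_continuous_on {0..q + 2} D"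
  using continuous_on_subset[OF test_pairD(3)[OF tp]] by (intro compact_uniformly_continuous) auto
 then obtain d where d: "0 < d" and d': "\<forall>y\<in>{0..q + 2}. \<forall>z\<in>{0..q + 2}. dist z y < d \<longrightarrow> dist (D z) (D y) < \<omega>1"
  using \<omega>(1) unfolding uniformly_continuous_on_def by blast
 \<comment> \<open>The bounds ensure in turn: steps of length at most 1 within the modulus of
   \<open>D\<close>, a support beyond \<open>3 * eps\<close>, and exponents of at most 1.\<close>
 define e0 where "e0 = min (min 1 (d / 2)) (min (p / 4) (1 / (T * L + 1)))"
 have TL: "0 < T * L + 1" using T L0 by (simp add: add_nonneg_pos)
 have e0: "0 < e0" "e0 <= 1" "e0 <= d / 2" "e0 <= p / 4" "e0 <= 1 / (T * L + 1)"
  using d pq TL by (auto simp: e0_def)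
 have ua: "eventually (\<lambda>n. \<forall>x\<in>{0..q + 1}. \<bar>a n x - a\<^sub>0 x\<bar> < \<omega>2) sequentially"
  using uniform_limitD[OF rates_tendsto(1)[of "{0..q + 1}"] \<omega>(2)] by (auto simp: dist_real_def)
 have ub: "eventually (\<lambda>n. \<forall>x\<in>{0..q + 1}. \<bar>b n x - b\<^sub>0 x\<bar> < \<omega>2) sequentially"
  using uniform_limitD[OF rates_tendsto(2)[of "{0..q + 1}"] \<omega>(2)] by (auto simp: dist_real_def)
 show ?thesis
 proof (rule vanishing_exponential[OF c, where d="T * (T\<^sup>2 * (Ka * ?B + Kb) * Q * ?B)"])
  show "\<forall>\<^sub>F n in sequentially. \<exists>Z\<in>sets (M n). {\<omega>\<in>space (M n). mass n \<omega> <= ?B \<and>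
    \<delta> < \<sigma> * drift_deviation \<phi> (\<lambda>x. D x * a\<^sub>0 x) (\<lambda>x. D x * b\<^sub>0 x) (mass n \<omega>) T (\<mu> n \<omega>)} \<subseteq> Z \<and>
    measure (M n) Z <= exp (- ((\<delta> - T * (T * \<eta> * ?B * (?B + 1))) / eps n - T * (T\<^sup>2 * (Ka * ?B + Kb) * Q * ?B)))"
   using eventually_small[OF e0(1)] ua ub
  proof eventually_elim
   case (elim n)
   let ?e = "eps n"
   have e: "0 < ?e" "?e <= 1" "?e < d" "?e <= p / 4" "?e <= 1 / (T * L + 1)" using eps(1)[of n] elim(1) e0 by linarith+
   have unif: "\<bar>D y - D z\<bar> <= \<omega>1" if "y \<in> {0..q + 2}" "z \<in> {0..q + 2}" "\<bar>y - z\<bar> <= ?e" for y z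
   proof -
    have "dist y z < d" using that(3) e(3) by (simp add: dist_real_def)
    then show ?thesis using d' that(1,2) by (auto simp: dist_real_def intro: less_imp_le)
   qed
   have small: "\<omega>1 * (Ka * (2 + q)) + L * \<omega>2 <= \<eta> * (p / 2)" "\<omega>1 * (Kb * (2 + q)) + L * \<omega>2 <= \<eta> * (p / 2)"
    using s1[of Ka] s1[of Kb] s2 K by auto
   have lip: "T * \<bar>\<phi> (x + h) - \<phi> x\<bar> <= 1" if "\<bar>h\<bar> = ?e" for x h
   proof -
    have "T * \<bar>\<phi> (x + h) - \<phi> x\<bar> <= T * (L * ?e)"
     using test_pair_lipschitz[OF tp L, of x h] that T by (intro mult_left_mono) auto
    also have "\<dots> <= (T * L + 1) * ?e" using e(1) by (simp add: algebra_simps)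
    also have "\<dots> <= 1" using e(5) TL by (simp add: field_simps)
    finally show ?thesis .
   qed
   have ra: "\<bar>(\<phi> (x + ?e) - \<phi> x) / ?e * a n x - D x * a\<^sub>0 x\<bar> <= \<eta> * x" if "2 * ?e <= x" for x
    using that e pq \<eta> K elim(2) small(1) rates_nonneg(3) linear_growth(3) L unif
    by (intro difference_quotient_estimate[OF tp, where K=Ka and L=L and u="\<omega>1" and v="\<omega>2"]) (auto intro: less_imp_le)
   have rb: "\<bar>(\<phi> (x + - ?e) - \<phi> x) / (- ?e) * b n x - D x * b\<^sub>0 x\<bar> <= \<eta> * x" if "2 * ?e <= x" for x
    using that e pq \<eta> K elim(3) small(2) rates_nonneg(4) linear_growth(4) L unif
    by (intro difference_quotient_estimate[OF tp, where K=Kb and L=L and u="\<omega>1" and v="\<omega>2"]) (auto intro: less_imp_le)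
   have quad: "(1 + x) * (\<phi> (x + h) - \<phi> x)\<^sup>2 <= Q * ?e\<^sup>2 * x" if "2 * ?e <= x" "\<bar>h\<bar> = ?e" for x h
    using weighted_increment_square[OF tp _ L, of h x] that e pq power2_abs[of h] by (simp add: Q_def)
   have "\<exists>Z\<in>sets (M n). {\<omega>\<in>space (M n). mass n \<omega> <= ?B \<and>
    \<delta> < \<sigma> * drift_deviation \<phi> (\<lambda>x. D x * a\<^sub>0 x) (\<lambda>x. D x * b\<^sub>0 x) (mass n \<omega>) T (\<mu> n \<omega>)} \<subseteq> Z \<and>
    measure (M n) Z <= exp (- (\<delta> / ?e - T * (T * \<eta> * ?B * (?B + 1) / ?e + T\<^sup>2 * (Ka * ?B + Kb) * Q * ?B)))"
    unfolding total_mass_eq[OF e(2), symmetric]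
   proof (rule sbd_rescaled.drift_path_bound[OF rescaled[OF e(2)] B T \<sigma> test_pair_bounded_continuous[OF tp] flux_bounded_continuous[OF tp]])
    show "\<phi> (2 * ?e) = 0" using e pq by (intro test_pairD(6)[OF tp]) auto
    show "0 <= \<eta>" using \<eta> by simp
    show "0 <= Q" using pq by (simp add: Q_def)
    fix x assume x: "2 * ?e <= x"
    show "T * \<bar>\<phi> (x + ?e) - \<phi> x\<bar> <= 1" using lip[of ?e x] e by simp
    show "T * \<bar>\<phi> (x - ?e) - \<phi> x\<bar> <= 1" using lip[of "- ?e" x] e by simp
    show "(1 + x) * (\<phi> (x + ?e) - \<phi> x)\<^sup>2 <= Q * ?e\<^sup>2 * x" using quad[OF x, of ?e] e by simp
    show "(1 + x) * (\<phi> (x - ?e) - \<phi> x)\<^sup>2 <= Q * ?e\<^sup>2 * x" using quad[OF x, of "- ?e"] e by simp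
    show "\<bar>(\<phi> (x + ?e) - \<phi> x) / ?e * a n x - D x * a\<^sub>0 x\<bar> <= \<eta> * x" by (rule ra[OF x])
    show "\<bar>(if 3 * ?e <= x then (\<phi> (x - ?e) - \<phi> x) / ?e * b n x else 0) + D x * b\<^sub>0 x\<bar> <= \<eta> * x"
    proof (cases "3 * ?e <= x")
     case True
     have "(\<phi> (x - ?e) - \<phi> x) / ?e * b n x + D x * b\<^sub>0 x = - ((\<phi> (x + - ?e) - \<phi> x) / (- ?e) * b n x - D x * b\<^sub>0 x)" by simp
     then show ?thesis using rb[OF x] True by (simp only: if_True abs_minus_cancel)
    next
     case False
     \<comment> \<open>Clusters too small to shrink lie below \<open>3 * p / 4\<close>, outside the
       support.\<close>
     then have "D x = 0" using e pq by (intro test_pairD(5)[OF tp]) auto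
     then show ?thesis using False \<eta> x e(1) by simp
    qed
   qed
   also have "\<delta> / ?e - T * (T * \<eta> * ?B * (?B + 1) / ?e + T\<^sup>2 * (Ka * ?B + Kb) * Q * ?B) =
    (\<delta> - T * (T * \<eta> * ?B * (?B + 1))) / ?e - T * (T\<^sup>2 * (Ka * ?B + Kb) * Q * ?B)"
    by (simp add: distrib_left diff_divide_distrib)
   finally show ?case .
  qed
 qed auto
qed

text \<open>The defect differs from the drift deviation by replacing the initial measure and the
  random mass by their deterministic limits. Both replacements and the deviation itself cost at most
  \<open>\<delta> / 4\<close> outside vanishing events.\<close>

lemma defect_vanishing:
 assumes tp: "test_pair p q \<phi> D" and T: "0 < T" and \<delta>: "0 < \<delta>"
 shows "vanishing M (\<lambda>n. {\<omega>\<in>space (M n). \<delta> < \<bar>LS_defect \<phi> D T (\<mu> n \<omega>)\<bar>})"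
proof -
 let ?B = mass_bound
 note B = mass_bound_nonneg
 note pq = test_pairD(1,2)[OF tp]
 let ?f = "\<lambda>\<nu>. \<integral>z. \<phi> z \<partial>\<nu>" and ?g = "\<lambda>\<nu>. \<integral>z. D z * a\<^sub>0 z \<partial>\<nu>" and ?G = "drift_functional (\<lambda>x. D x * a\<^sub>0 x) (\<lambda>x. D x * b\<^sub>0 x)"
 obtain L where L0: "0 <= L" and L': "\<forall>x. \<bar>D x\<bar> <= L" using test_pair_derivative_bounded[OF tp] by (elim exE conjE)
 note L = L'[rule_format]
 \<comment> \<open>Since the support starts at \<open>p\<close>, a bounded flux is also bounded by a
   multiple of \<open>x\<close>, so its integral is controlled by the mass bound.\<close>
 define Ca where "Ca = L * (Ka * (1 + q)) / p"
 have Ca0: "0 <= Ca" using L0 linear_growth(1) pq by (simp add: Ca_def)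
 have Ca: "\<bar>D x * a\<^sub>0 x\<bar> <= Ca * x" if x: "0 <= x" for x
 proof (cases "x \<in> {p..q}")
  case True
  have "\<bar>D x * a\<^sub>0 x\<bar> <= Ca * p"
   using test_pair_flux_bound[OF tp L limit_rates_nonneg(1) limit_rates_growth(1) _ x] linear_growth(1) pq by (simp add: Ca_def)
  also have "\<dots> <= Ca * x" using True Ca0 by (intro mult_left_mono) auto
  finally show ?thesis .
 next
  case False
  then show ?thesis using test_pairD(5)[OF tp] Ca0 x by simp
 qed
 define d1 where "d1 = \<delta> / (4 * T)"
 define d2 where "d2 = \<delta> / (4 * (T * (T * (Ca * ?B)) + 1))"
 have den: "0 < T * (T * (Ca * ?B)) + 1" using T Ca0 B by (simp add: add_nonneg_pos)
 have d: "0 < d1" "0 < d2" using \<delta> T den by (auto simp: d1_def d2_def)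
 let ?X = "\<lambda>n \<omega>. drift_deviation \<phi> (\<lambda>x. D x * a\<^sub>0 x) (\<lambda>x. D x * b\<^sub>0 x) (mass n \<omega>) T (\<mu> n \<omega>)"
 have sub: "\<bar>LS_defect \<phi> D T (\<mu> n \<omega>)\<bar> <= \<delta>" if \<omega>: "\<omega> \<in> space (M n)" "\<omega> \<in> good n" and
  1: "\<not> d1 <= \<bar>?f (\<mu>in n \<omega>) - ?f \<mu>\<^sub>0\<bar>" and 2: "\<not> d2 < \<bar>mass n \<omega> - mass_limit\<bar>" and
  3: "\<not> \<delta> / 4 < 1 * ?X n \<omega>" "\<not> \<delta> / 4 < - 1 * ?X n \<omega>" for n \<omega>
 proof -
  note cad = process_cadlag[OF \<omega>(1)]
  have rg: "rcll (\<lambda>s. ?g (\<mu> n \<omega> s))" by (rule rcll_cadlag[OF cad continuous_map_weak_integral(1)[OF flux_bounded_continuous(1)[OF tp]]])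
  have rG: "rcll (\<lambda>s. ?G m (\<mu> n \<omega> s))" for m by (rule rcll_cadlag[OF cad continuous_map_drift_functional[OF flux_bounded_continuous[OF tp]]])
  let ?P = "path_integral T (\<lambda>s. T - s) ?g (\<mu> n \<omega>)"
  have eq: "path_integral T (\<lambda>s. T - s) (?G mass_limit) (\<mu> n \<omega>) = path_integral T (\<lambda>s. T - s) (?G (mass n \<omega>)) (\<mu> n \<omega>) + (mass_limit - mass n \<omega>) * ?P"
   by (intro path_integral_linear rg rG continuous_intros) (simp add: drift_functional_def algebra_simps)
  have "\<bar>?P\<bar> <= T * (T * (Ca * ?B))"
  proof (intro path_integral_bound rg continuous_intros)
   fix s assume s: "0 <= s" "s <= T"
   have \<nu>: "\<mu> n \<omega> s \<in> moment_measures" using cadlag_topspace[OF cad s(1)] by simp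
   have "\<bar>?g (\<mu> n \<omega> s)\<bar> <= (LINT x|\<mu> n \<omega> s. Ca * x)"
    using Ca integrable_id_moment_measure[OF \<nu>]
    by (intro abs_integral_le integrable_bounded_continuous(1)[OF \<nu> flux_bounded_continuous(1)[OF tp]]) (auto simp: space_moment_measure[OF \<nu>])
   also have "\<dots> = Ca * (LINT x|\<mu> n \<omega> s. x)" by simp
   also have "\<dots> <= Ca * ?B" using \<omega>(2) s Ca0 by (intro mult_left_mono) (auto simp: good_def intro: order_trans)
   finally show "\<bar>(T - s) * ?g (\<mu> n \<omega> s)\<bar> <= T * (Ca * ?B)" unfolding abs_mult using s T by (intro mult_mono) auto
  qed (use T in auto)
  then have "\<bar>(mass_limit - mass n \<omega>) * ?P\<bar> <= d2 * (T * (T * (Ca * ?B)))"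
   unfolding abs_mult using 2 by (intro mult_mono) auto
  also have "\<dots> <= d2 * (T * (T * (Ca * ?B)) + 1)" using d by (intro mult_left_mono) auto
  also have "\<dots> = \<delta> / 4" unfolding d2_def using den
   by (metis divide_divide_eq_left nonzero_divide_eq_eq less_irrefl)
  finally have b1: "\<bar>(mass_limit - mass n \<omega>) * ?P\<bar> <= \<delta> / 4" .
  have "\<bar>T * (?f (\<mu>in n \<omega>) - ?f \<mu>\<^sub>0)\<bar> <= T * d1" using 1 T unfolding abs_mult by (intro mult_mono) auto
  then have b2: "\<bar>T * (?f (\<mu>in n \<omega>) - ?f \<mu>\<^sub>0)\<bar> <= \<delta> / 4" using T by (simp add: d1_def)
  have "LS_defect \<phi> D T (\<mu> n \<omega>) = ?X n \<omega> + T * (?f (\<mu>in n \<omega>) - ?f \<mu>\<^sub>0) - (mass_limit - mass n \<omega>) * ?P"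
   unfolding LS_defect_def LS_drift_def eq drift_deviation_def process_start[OF \<omega>(1)] by (simp add: right_diff_distrib)
  moreover have "\<bar>X + t - r\<bar> <= \<delta>" if "\<bar>r\<bar> <= \<delta> / 4" "\<bar>t\<bar> <= \<delta> / 4" "\<not> \<delta> / 4 < 1 * X" "\<not> \<delta> / 4 < - 1 * X" for X t r
   using that \<delta> by linarith
  ultimately show ?thesis using b1 b2 3 by presburger
 qed
 let ?E = "\<lambda>n. (space (M n) - good n) \<union> ({\<omega>\<in>space (M n). d1 <= \<bar>?f (\<mu>in n \<omega>) - ?f \<mu>\<^sub>0\<bar>} \<union>
  ({\<omega>\<in>space (M n). d2 < \<bar>mass n \<omega> - mass_limit\<bar>} \<union>
  ({\<omega>\<in>space (M n). mass n \<omega> <= ?B \<and> \<delta> / 4 < 1 * ?X n \<omega>} \<union> {\<omega>\<in>space (M n). mass n \<omega> <= ?B \<and> \<delta> / 4 < - 1 * ?X n \<omega>})))"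
 have "vanishing M ?E"
  by (intro vanishing_Un not_good_vanishing mass_vanishing d initial_functional_vanishing drift_deviation_vanishing[OF tp T]
    continuous_map_weak_integral(1)[OF test_pair_bounded_continuous[OF tp]]) (use \<delta> in auto)
 then show ?thesis
 proof (rule vanishing_mono[OF _ _ always_eventually])
  show "\<forall>n. {\<omega>\<in>space (M n). \<delta> < \<bar>LS_defect \<phi> D T (\<mu> n \<omega>)\<bar>} \<subseteq> ?E n"
  proof (intro allI subsetI)
   fix n \<omega> assume "\<omega> \<in> {\<omega>\<in>space (M n). \<delta> < \<bar>LS_defect \<phi> D T (\<mu> n \<omega>)\<bar>}"
   then have \<omega>: "\<omega> \<in> space (M n)" "\<delta> < \<bar>LS_defect \<phi> D T (\<mu> n \<omega>)\<bar>" by auto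
   show "\<omega> \<in> ?E n"
   proof (rule ccontr)
    assume n: "\<omega> \<notin> ?E n"
    then have g: "\<omega> \<in> good n" using \<omega>(1) by auto
    then have "mass n \<omega> <= ?B" by (auto simp: good_def)
    then have "\<bar>LS_defect \<phi> D T (\<mu> n \<omega>)\<bar> <= \<delta>" using n \<omega>(1) by (intro sub[OF \<omega>(1) g]) blast+
    then show False using \<omega>(2) by simp
   qed
  qed
 qed auto
qed

text \<open>The truncation \<open>min 1\<close> of the absolute defect is a bounded continuous
  function of the path. Its expectations tend to 0 along the processes, so its expectation under the
  limit law is 0.\<close>

lemma defect_zero_AE:
 assumes lim: "subsequential_limit_in_law (skorohod_topology weak_topology) M \<mu> N Y"
  and tp: "test_pair p q \<phi> D" and T: "0 < T"
 shows "AE \<omega> in N. LS_defect \<phi> D T (Y \<omega>) = 0"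
proof -
 let ?S = "skorohod_topology weak_topology"
 define h where "h x = min 1 \<bar>LS_defect \<phi> D T x\<bar>" for x
 have hc: "continuous_map ?S euclideanreal h" unfolding h_def
  by (intro continuous_map_real_min continuous_map_real_abs continuous_map_LS_defect[OF tp] continuous_map_const[THEN iffD2]) auto
 have hm: "h \<in> borel_measurable (borel_of ?S)" by (rule borel_measurable_continuous_map[OF hc])
 have hb: "0 <= h x" "h x <= 1" for x by (auto simp: h_def)
 obtain r where pN: "prob_space N" and Y: "Y \<in> N \<rightarrow>\<^sub>M borel_of ?S" and r: "strict_mono r"
  and cw: "converges_weakly ?S (\<lambda>k. distr (M (r k)) (borel_of ?S) (\<mu> (r k))) (distr N (borel_of ?S) Y)"
  using lim unfolding subsequential_limit_in_law_def by (elim exE conjE)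
 interpret N: prob_space N by (rule pN)
 have "(\<lambda>n. LINT \<omega>|M n. h (\<mu> n \<omega>)) \<longlonglongrightarrow> 0"
 proof (rule LIMSEQ_I)
  fix e :: real assume e: "0 < e"
  obtain Z where Z: "\<forall>n. Z n \<in> sets (M n) \<and> {\<omega>\<in>space (M n). e / 2 < \<bar>LS_defect \<phi> D T (\<mu> n \<omega>)\<bar>} \<subseteq> Z n"
   and Z0: "(\<lambda>n. measure (M n) (Z n)) \<longlonglongrightarrow> 0"
   using defect_vanishing[OF tp T half_gt_zero[OF e]] unfolding vanishing_def by (elim exE conjE)
  have bd: "\<bar>LINT \<omega>|M n. h (\<mu> n \<omega>)\<bar> <= e / 2 + measure (M n) (Z n)" for n
  proof -
   interpret prob_space "M n" by (rule prob)
   have Zn: "Z n \<in> sets (M n)" using Z by simp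
   have "\<bar>LINT \<omega>|M n. h (\<mu> n \<omega>)\<bar> <= (LINT \<omega>|M n. e / 2 + indicator (Z n) \<omega>)"
   proof (rule abs_integral_le)
    show "integrable (M n) (\<lambda>\<omega>. h (\<mu> n \<omega>))"
     using measurable_compose[OF process_measurable(1) hm] hb by (intro integrable_const_bound[of _ 1]) auto
    show "integrable (M n) (\<lambda>\<omega>. e / 2 + indicator (Z n) \<omega>)" using Zn
     by (intro Bochner_Integration.integrable_add integrable_real_indicator) (auto simp: emeasure_eq_measure)
    fix \<omega> assume \<omega>: "\<omega> \<in> space (M n)"
    show "\<bar>h (\<mu> n \<omega>)\<bar> <= e / 2 + indicator (Z n) \<omega>"
    proof (cases "\<omega> \<in> Z n")
     case True
     then show ?thesis using hb[of "\<mu> n \<omega>"] e by simp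
    next
     case False
     then have "\<not> e / 2 < \<bar>LS_defect \<phi> D T (\<mu> n \<omega>)\<bar>" using Z \<omega> by blast
     then show ?thesis using False by (auto simp: h_def)
    qed
   qed
   also have "\<dots> = e / 2 + measure (M n) (Z n)" using Zn
    by (subst Bochner_Integration.integral_add) (auto simp: prob_space emeasure_eq_measure)
   finally show ?thesis .
  qed
  have "eventually (\<lambda>n. measure (M n) (Z n) < e / 2) sequentially" using e by (intro order_tendstoD(2)[OF Z0]) simp
  then obtain n0 where "\<forall>n\<ge>n0. measure (M n) (Z n) < e / 2" by (auto simp: eventually_sequentially)
  then show "\<exists>n0. \<forall>n\<ge>n0. norm ((LINT \<omega>|M n. h (\<mu> n \<omega>)) - 0) < e"
   using bd by (intro exI[of _ n0]) (fastforce intro: le_less_trans)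
 qed
 from LIMSEQ_subseq_LIMSEQ[OF this r] have lim0: "(\<lambda>k. LINT \<omega>|M (r k). h (\<mu> (r k) \<omega>)) \<longlonglongrightarrow> 0" by (simp add: o_def)
 have "bounded (h ` topspace ?S)" using hb by (auto intro!: boundedI[of _ 1])
 then have "(\<lambda>k. \<integral>x. h x \<partial>distr (M (r k)) (borel_of ?S) (\<mu> (r k))) \<longlonglongrightarrow> (\<integral>x. h x \<partial>distr N (borel_of ?S) Y)"
  using cw hc unfolding converges_weakly_def by blast
 then have "(\<lambda>k. LINT \<omega>|M (r k). h (\<mu> (r k) \<omega>)) \<longlonglongrightarrow> (LINT \<omega>|N. h (Y \<omega>))"
  by (simp add: integral_distr[OF process_measurable(1) hm] integral_distr[OF Y hm])
 then have "(LINT \<omega>|N. h (Y \<omega>)) = 0" using lim0 LIMSEQ_unique by blast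
 moreover have "integrable N (\<lambda>\<omega>. h (Y \<omega>))"
  using measurable_compose[OF Y hm] hb by (intro N.integrable_const_bound[of _ 1]) auto
 ultimately have "AE \<omega> in N. h (Y \<omega>) = 0" using hb by (subst integral_nonneg_eq_0_iff_AE[symmetric]) auto
 then show ?thesis by eventually_elim (auto simp: h_def min_def split: if_splits)
qed

end


section \<open>Density of a countable family of test functions and the equation itself\<close>

text \<open>Equal to 1 on \<open>[2 / (j + 1), j + 1]\<close> and 0 outside
  \<open>[1 / (j + 1), j + 2]\<close>; these plateaus exhaust the open half line.\<close>

definition cutoff :: "nat => real => real" where
 "cutoff j x = min 1 (max 0 (real (Suc j) * x - 1)) * min 1 (max 0 (real (Suc j) + 1 - x))"

definition cutoff_monomial :: "nat => nat => real => real" where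
 "cutoff_monomial j k x = cutoff j x * x ^ k"

definition primitive :: "nat => nat => real => real" where
 "primitive j k = (SOME \<phi>. test_pair (1 / real (Suc j)) (real (Suc j) + 1) \<phi> (cutoff_monomial j k))"

lemma cutoff_bounds: "0 <= cutoff j x" "cutoff j x <= 1"
 unfolding cutoff_def by (auto intro!: mult_le_one)

lemma cutoff_support: "x \<notin> {1 / real (Suc j)..real (Suc j) + 1} ==> cutoff j x = 0"
 unfolding cutoff_def by (auto simp: field_simps not_le max_def)

lemma cutoff_one: "2 / real (Suc j) <= x ==> x <= real (Suc j) ==> cutoff j x = 1"
 unfolding cutoff_def by (auto simp: field_simps min_def max_def)

lemma primitive: "test_pair (1 / real (Suc j)) (real (Suc j) + 1) (primitive j k) (cutoff_monomial j k)"
proof -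
 have "\<exists>\<phi>. test_pair (1 / real (Suc j)) (real (Suc j) + 1) \<phi> (cutoff_monomial j k)"
 proof (rule test_pair_exists)
 have "1 / real (Suc j) <= 1" by simp
 then show "1 / real (Suc j) <= real (Suc j) + 1" by linarith
 show "continuous_on UNIV (cutoff_monomial j k)"
  unfolding cutoff_monomial_def[abs_def] cutoff_def by (intro continuous_intros)
 show "cutoff_monomial j k x = 0" if "x \<notin> {1 / real (Suc j)..real (Suc j) + 1}" for x
  unfolding cutoff_monomial_def using cutoff_support[OF that] by simp
 qed simp
 then show ?thesis unfolding primitive_def by (rule someI_ex)
qed

lemma C1_compact_support_test_pair:
 assumes \<phi>: "\<phi> \<in> C1_compact_support"
 obtains p q where "test_pair p q \<phi> (deriv \<phi>)"
proof -
 obtain K where K: "compact K" "K \<subseteq> {0<..}" "\<And>x. x \<notin> K ==> \<phi> x = 0" and C1: "\<phi> C1_differentiable_on {0<..}"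
  using \<phi> unfolding C1_compact_support_def by auto
 \<comment> \<open>Inserting 1 makes the compact set nonempty, so that it has a least and a greatest
   element also when the test function is 0.\<close>
 have cK: "compact (insert 1 K)" using K(1) by (rule compact_insert)
 obtain p where p: "p \<in> insert 1 K" "\<forall>x\<in>insert 1 K. p <= x" using compact_attains_inf[OF cK] by auto
 obtain q where q: "q \<in> insert 1 K" "\<forall>x\<in>insert 1 K. x <= q" using compact_attains_sup[OF cK] by auto
 have p0: "0 < p" and pq: "p <= q" using p q K(2) by auto
 have zero: "\<phi> x = 0" if "x \<notin> {p..q}" for x using K(3) p(2) q(2) that by auto
 have out: "(\<phi> has_real_derivative 0) (at x)" if "x \<notin> {p..q}" for x
 proof (rule has_field_derivative_transform_within_open[of "\<lambda>_. 0"])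
  show "open (- {p..q})" by (intro open_Compl closed_atLeastAtMost)
 qed (use that zero in auto)
 have der: "(\<phi> has_real_derivative deriv \<phi> x) (at x)" for x
 proof (cases "0 < x")
  case True
  then have "\<phi> differentiable at x" using C1 by (simp add: C1_differentiable_on_eq)
  then show ?thesis by (simp add: DERIV_deriv_iff_real_differentiable)
 next
  case False
  then have "x \<notin> {p..q}" using p0 by auto
  then show ?thesis using out DERIV_imp_deriv by metis
 qed
 have dz: "deriv \<phi> x = 0" if "x \<notin> {p..q}" for x using out[OF that] by (rule DERIV_imp_deriv)
 have "continuous_on {0<..} (\<lambda>x. vector_derivative \<phi> (at x))" using C1 by (simp add: C1_differentiable_on_eq)
 moreover have "vector_derivative \<phi> (at x) = deriv \<phi> x" for x
  using der[of x] by (intro vector_derivative_at) (simp add: has_real_derivative_iff_has_vector_derivative)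
 ultimately have "continuous_on {0<..} (deriv \<phi>)" by simp
 moreover have "continuous_on {..<p} (deriv \<phi>)"
  using dz by (subst continuous_on_cong[OF refl, of _ _ "\<lambda>_. 0"]) auto
 ultimately have "continuous_on ({0<..} \<union> {..<p}) (deriv \<phi>)" by (intro continuous_on_open_Un) auto
 also have "{0<..} \<union> {..<p} = UNIV" using p0 by auto
 finally have cont: "continuous_on UNIV (deriv \<phi>)" .
 \<comment> \<open>A test pair must vanish at its left end too, while vanishing is known only
   strictly below \<open>p\<close>; hence the half.\<close>
 have "test_pair (p / 2) q \<phi> (deriv \<phi>)"
  unfolding test_pair_def
 proof (intro conjI allI impI cont der)
  show "0 < p / 2" "p / 2 <= q" using p0 pq by auto
  show "deriv \<phi> x = 0" if "x \<notin> {p / 2..q}" for x using that p0 by (intro dz) auto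
  show "\<phi> x = 0" if "x <= p / 2" for x using that p0 by (intro zero) auto
 qed
 then show thesis by (rule that)
qed

context sbd_sequence
begin

lemma defect_linear:
 assumes x: "x \<in> cadlag weak_topology" and tp: "test_pair p q \<phi> D" and tp': "test_pair p q \<phi>' D'"
 shows "LS_defect (\<lambda>z. \<phi> z + c * \<phi>' z) (\<lambda>z. D z + c * D' z) T x = LS_defect \<phi> D T x + c * LS_defect \<phi>' D' T x"
proof -
 note bc = test_pair_bounded_continuous[OF tp] test_pair_bounded_continuous[OF tp']
 note fl = flux_bounded_continuous[OF tp] flux_bounded_continuous[OF tp']
 have i: "(LINT z|\<nu>. \<phi> z + c * \<phi>' z) = (LINT z|\<nu>. \<phi> z) + c * (LINT z|\<nu>. \<phi>' z)" if "\<nu> \<in> moment_measures" for \<nu>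
  using integrable_bounded_continuous(1)[OF that] bc by simp
 have d: "LS_drift (\<lambda>z. D z + c * D' z) \<nu> = LS_drift D \<nu> + c * LS_drift D' \<nu>" if \<nu>: "\<nu> \<in> moment_measures" for \<nu>
 proof -
  have eq: "(D z + c * D' z) * r z = D z * r z + c * (D' z * r z)" for z and r :: "real => real" by (simp add: algebra_simps)
  have "(LINT z|\<nu>. (D z + c * D' z) * a\<^sub>0 z) = (LINT z|\<nu>. D z * a\<^sub>0 z) + c * (LINT z|\<nu>. D' z * a\<^sub>0 z)"
   "(LINT z|\<nu>. (D z + c * D' z) * b\<^sub>0 z) = (LINT z|\<nu>. D z * b\<^sub>0 z) + c * (LINT z|\<nu>. D' z * b\<^sub>0 z)"
   unfolding eq using integrable_bounded_continuous(1)[OF \<nu>] fl by simp_all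
  then show ?thesis unfolding LS_drift_def drift_functional_def by (simp add: algebra_simps)
 qed
 have rf: "rcll (\<lambda>s. LINT z|x s. \<phi> z)" "rcll (\<lambda>s. LINT z|x s. \<phi>' z)" using rcll_cadlag[OF x continuous_map_weak_integral(1)] bc by auto
 have rd: "rcll (\<lambda>s. LS_drift D (x s))" "rcll (\<lambda>s. LS_drift D' (x s))"
  using rcll_cadlag[OF x continuous_map_LS_drift] tp tp' by auto
 have xm: "x s \<in> moment_measures" if "0 <= s" for s using cadlag_topspace[OF x that] by simp
 have 1: "path_integral T (\<lambda>_. 1) (\<lambda>\<nu>. LINT z|\<nu>. \<phi> z + c * \<phi>' z) x =
   path_integral T (\<lambda>_. 1) (\<lambda>\<nu>. LINT z|\<nu>. \<phi> z) x + c * path_integral T (\<lambda>_. 1) (\<lambda>\<nu>. LINT z|\<nu>. \<phi>' z) x"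
  using i[OF xm] by (intro path_integral_linear rf continuous_intros)
 have 2: "path_integral T (\<lambda>s. T - s) (LS_drift (\<lambda>z. D z + c * D' z)) x =
   path_integral T (\<lambda>s. T - s) (LS_drift D) x + c * path_integral T (\<lambda>s. T - s) (LS_drift D') x"
  using d[OF xm] by (intro path_integral_linear rd continuous_intros)
 show ?thesis unfolding LS_defect_def i[OF initial_measure(1)] 1 2 by (simp add: algebra_simps)
qed

text \<open>For a fixed path and a fixed support interval the defect depends continuously on
  \<open>D\<close> in the supremum norm: the path has bounded mass and first moment up to
  \<open>T\<close>, and the test function itself is bounded by \<open>L * q\<close>.\<close>

lemma defect_bound:
 assumes x: "x \<in> cadlag weak_topology" and T: "0 <= T" and q: "0 <= q"
 shows "\<exists>C\<ge>0. \<forall>\<phi> D L. test_pair p q \<phi> D \<longrightarrow> (\<forall>z. \<bar>D z\<bar> <= L) \<longrightarrow> \<bar>LS_defect \<phi> D T x\<bar> <= C * L"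
proof -
 have one: "(\<lambda>z. 1) \<in> bounded_continuous" by (rule bounded_continuousI[of _ 1]) auto
 have rb: "\<exists>C\<ge>0. \<forall>t\<in>{0..T}. \<bar>h t\<bar> <= C" if h: "rcll h" for h
  by (rule rcll_bounded[OF h, of T]) auto
 obtain A where A1: "0 <= A" and A': "\<forall>t\<in>{0..T}. \<bar>LINT z|x t. (1 :: real)\<bar> <= A"
  using rb[OF rcll_cadlag[OF x continuous_map_weak_integral(1)[OF one]]] by (elim exE conjE)
 obtain E where E0: "0 <= E" and E': "\<forall>t\<in>{0..T}. \<bar>LINT z|x t. z\<bar> <= E"
  using rb[OF rcll_cadlag[OF x continuous_map_weak_moment]] by (elim exE conjE)
 have A: "0 <= A" "\<And>t. 0 <= t ==> t <= T ==> \<bar>LINT z|x t. (1 :: real)\<bar> <= A" using A1 A' by auto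
 have E: "0 <= E" "\<And>t. 0 <= t ==> t <= T ==> \<bar>LINT z|x t. z\<bar> <= E" using E0 E' by auto
 define A0 where "A0 = \<bar>LINT z|\<mu>\<^sub>0. (1 :: real)\<bar>"
 have bd: "\<bar>LINT z|\<nu>. f z\<bar> <= F * \<bar>LINT z|\<nu>. 1\<bar>" if \<nu>: "\<nu> \<in> moment_measures" and f: "f \<in> bounded_continuous" "\<And>z. 0 <= z ==> \<bar>f z\<bar> <= F" for f F \<nu>
 proof -
  have "\<bar>LINT z|\<nu>. f z\<bar> <= (LINT z|\<nu>. F * 1)"
   using f(2) by (intro abs_integral_le integrable_bounded_continuous(1)[OF \<nu> f(1)] integrable_mult_right integrable_bounded_continuous(1)[OF \<nu> one])
    (auto simp: space_moment_measure[OF \<nu>])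
  also have "\<dots> = F * (LINT z|\<nu>. 1)" by (rule integral_mult_right_zero)
  also have "\<dots> = F * \<bar>LINT z|\<nu>. 1\<bar>" by simp
  finally show ?thesis .
 qed
 define C where "C = T * (q * A) + T * (q * A0) + T * (T * ((\<bar>mass_limit\<bar> + E) * (Ka * (1 + q) * A) + Kb * (1 + q) * A))"
 have xm: "x s \<in> moment_measures" if "0 <= s" for s using cadlag_topspace[OF x that] by simp
 have "0 <= C" unfolding C_def using T q A E linear_growth(1,2) by (auto simp: A0_def intro!: add_nonneg_nonneg mult_nonneg_nonneg)
 moreover have "\<bar>LS_defect \<phi> D T x\<bar> <= C * L" if tp: "test_pair p q \<phi> D" and L: "\<forall>z. \<bar>D z\<bar> <= L" for \<phi> D L
 proof -
  note L = L[rule_format]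
  have L0: "0 <= L" using L[of 0] by linarith
  note bc = test_pair_bounded_continuous[OF tp] and fl = flux_bounded_continuous[OF tp]
  have f: "\<bar>LINT z|\<nu>. \<phi> z\<bar> <= L * q * \<bar>LINT z|\<nu>. 1\<bar>" if "\<nu> \<in> moment_measures" for \<nu>
   by (rule bd[OF that bc test_pair_bound[OF tp L]])
  have fa: "\<bar>LINT z|\<nu>. D z * a\<^sub>0 z\<bar> <= L * (Ka * (1 + q)) * \<bar>LINT z|\<nu>. 1\<bar>" if "\<nu> \<in> moment_measures" for \<nu>
   using linear_growth(1) by (intro bd[OF that fl(1)] test_pair_flux_bound[OF tp L limit_rates_nonneg(1) limit_rates_growth(1)]) auto
  have fb: "\<bar>LINT z|\<nu>. D z * b\<^sub>0 z\<bar> <= L * (Kb * (1 + q)) * \<bar>LINT z|\<nu>. 1\<bar>" if "\<nu> \<in> moment_measures" for \<nu>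
   using linear_growth(2) by (intro bd[OF that fl(2)] test_pair_flux_bound[OF tp L limit_rates_nonneg(2) limit_rates_growth(2)]) auto
  have 1: "\<bar>path_integral T (\<lambda>_. 1) (\<lambda>\<nu>. LINT z|\<nu>. \<phi> z) x\<bar> <= T * (L * q * A)"
  proof (intro path_integral_bound T continuous_on_const rcll_cadlag[OF x continuous_map_weak_integral(1)[OF bc]])
   fix s assume s: "0 <= s" "s <= T"
   have "L * q * \<bar>LINT z|x s. 1\<bar> <= L * q * A" using A(2)[OF s] L0 q by (intro mult_left_mono) auto
   then show "\<bar>1 * (LINT z|x s. \<phi> z)\<bar> <= L * q * A" using f[OF xm[OF s(1)]] by simp
  qed
  have 2: "\<bar>T * (LINT z|\<mu>\<^sub>0. \<phi> z)\<bar> <= T * (L * q * A0)"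
   unfolding abs_mult using f[OF initial_measure(1)] T by (intro mult_mono) (auto simp: A0_def)
  let ?g = "(\<bar>mass_limit\<bar> + E) * (L * (Ka * (1 + q)) * A) + L * (Kb * (1 + q)) * A"
  have 3: "\<bar>path_integral T (\<lambda>s. T - s) (LS_drift D) x\<bar> <= T * (T * ?g)"
  proof (intro path_integral_bound T continuous_intros rcll_cadlag[OF x continuous_map_LS_drift[OF tp]])
   fix s assume s: "0 <= s" "s <= T"
   have "L * (Ka * (1 + q)) * \<bar>LINT z|x s. 1\<bar> <= L * (Ka * (1 + q)) * A" "L * (Kb * (1 + q)) * \<bar>LINT z|x s. 1\<bar> <= L * (Kb * (1 + q)) * A"
    using A(2)[OF s] L0 q linear_growth(1,2) by (auto intro!: mult_left_mono)
   then have ab: "\<bar>LINT z|x s. D z * a\<^sub>0 z\<bar> <= L * (Ka * (1 + q)) * A" "\<bar>LINT z|x s. D z * b\<^sub>0 z\<bar> <= L * (Kb * (1 + q)) * A"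
    using fa[OF xm[OF s(1)]] fb[OF xm[OF s(1)]] by linarith+
   have "\<bar>mass_limit - (LINT z|x s. z)\<bar> <= \<bar>mass_limit\<bar> + E" using E(2)[OF s] by linarith
   then have "\<bar>(mass_limit - (LINT z|x s. z)) * (LINT z|x s. D z * a\<^sub>0 z)\<bar> <= (\<bar>mass_limit\<bar> + E) * (L * (Ka * (1 + q)) * A)"
    unfolding abs_mult using ab(1) E(1) by (intro mult_mono) auto
   then have "\<bar>LS_drift D (x s)\<bar> <= ?g" using ab(2) unfolding LS_drift_def drift_functional_def by linarith
   then show "\<bar>(T - s) * LS_drift D (x s)\<bar> <= T * ?g" unfolding abs_mult using s T by (intro mult_mono) auto
  qed
  have "C * L = T * (L * q * A) + T * (L * q * A0) + T * (T * ?g)" by (simp add: C_def algebra_simps)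
  then show ?thesis unfolding LS_defect_def using 1 2 3 by linarith
 qed
 ultimately show ?thesis by blast
qed

text \<open>A polynomial approximates \<open>D\<close> on the whole support of the cutoff, and the
  cutoff is 1 on the support of \<open>D\<close>. Removing the cut-off polynomial, one monomial at a
  time, leaves the defect unchanged and makes the derivative uniformly small.\<close>

lemma defect_zero_dense:
 assumes x: "x \<in> cadlag weak_topology" and T: "0 <= T"
  and zero: "\<And>j k. LS_defect (primitive j k) (cutoff_monomial j k) T x = 0" and tp: "test_pair p q \<phi> D"
 shows "LS_defect \<phi> D T x = 0"
proof -
 obtain j1 :: nat where j1: "2 / p <= real j1" using real_arch_simple by blast
 obtain j2 :: nat where j2: "q <= real j2" using real_arch_simple by blast
 \<comment> \<open>Large enough for the plateau of the cutoff to contain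
   \<open>[p, q]\<close>.\<close>
 define j where "j = max j1 j2"
 let ?p = "1 / real (Suc j)" and ?q = "real (Suc j) + 1"
 note pq = test_pairD(1,2)[OF tp]
 have "2 / p <= real (Suc j)" using j1 by (simp add: j_def)
 then have p2: "2 / real (Suc j) <= p" using pq by (simp add: field_simps)
 have q2: "q <= real (Suc j)" using j2 by (simp add: j_def)
 have "?p <= 2 / real (Suc j)" by (simp add: divide_right_mono)
 then have tpj: "test_pair ?p ?q \<phi> D" using p2 q2 by (intro test_pair_mono[OF tp]) auto
 obtain C where C: "0 <= C" and C': "\<forall>\<phi> D L. test_pair ?p ?q \<phi> D \<longrightarrow> (\<forall>z. \<bar>D z\<bar> <= L) \<longrightarrow> \<bar>LS_defect \<phi> D T x\<bar> <= C * L"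
  using defect_bound[OF x T, of ?q ?p] by auto
 have "\<bar>LS_defect \<phi> D T x\<bar> <= C * \<eta>" if \<eta>: "0 < \<eta>" for \<eta>
 proof -
  have "continuous_on {?p..?q} D" using test_pairD(3)[OF tp] by (rule continuous_on_subset) simp
  then obtain g where g: "real_polynomial_function g" "\<And>z. z \<in> {?p..?q} ==> \<bar>D z - g z\<bar> < \<eta>"
   using Stone_Weierstrass_real_polynomial_function[OF compact_Icc _ \<eta>] by metis
  obtain c N where gc: "g = (\<lambda>z. \<Sum>i\<le>N. c i * z ^ i)" using g(1) unfolding real_polynomial_function_iff_sum by auto
  define \<phi>' where "\<phi>' n z = \<phi> z + (\<Sum>i<n. - c i * primitive j i z)" for n z
  define D' where "D' n z = D z + (\<Sum>i<n. - c i * cutoff_monomial j i z)" for n z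
  have ind: "test_pair ?p ?q (\<phi>' n) (D' n) \<and> LS_defect (\<phi>' n) (D' n) T x = LS_defect \<phi> D T x" for n
  proof (induction n)
   case 0
   then show ?case using tpj by (simp add: \<phi>'_def[abs_def] D'_def[abs_def])
  next
   case (Suc n)
   have eq: "\<phi>' (Suc n) = (\<lambda>z. \<phi>' n z + (- c n) * primitive j n z)" "D' (Suc n) = (\<lambda>z. D' n z + (- c n) * cutoff_monomial j n z)"
    by (auto simp: \<phi>'_def D'_def fun_eq_iff)
   show ?case unfolding eq
    using test_pair_linear[OF conjunct1[OF Suc.IH] primitive[of j n], where c="- c n"]
     defect_linear[OF x conjunct1[OF Suc.IH] primitive[of j n], where c="- c n" and T=T] conjunct2[OF Suc.IH] zero[of j n] by simp
  qed
  \<comment> \<open>The remainder contains the cutoff as a factor, so the approximation is needed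
    only on the interval where the polynomial is close to \<open>D\<close>.\<close>
  have D'eq: "D' (Suc N) z = cutoff j z * (D z - g z)" for z
  proof -
   have "D z = cutoff j z * D z"
   proof (cases "z \<in> {p..q}")
    case True
    then show ?thesis using cutoff_one[of j z] p2 q2 by simp
   next
    case False
    then show ?thesis using test_pairD(5)[OF tp] by simp
   qed
   moreover have "(\<Sum>i<Suc N. - c i * cutoff_monomial j i z) = - cutoff j z * g z"
    unfolding gc lessThan_Suc_atMost by (simp add: cutoff_monomial_def sum_distrib_left sum_negf mult_ac)
   ultimately show ?thesis unfolding D'_def by (simp add: right_diff_distrib)
  qed
  have "\<bar>D' (Suc N) z\<bar> <= \<eta>" for z
  proof (cases "z \<in> {?p..?q}")
   case True
   have "\<bar>D' (Suc N) z\<bar> <= 1 * \<bar>D z - g z\<bar>"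
    unfolding D'eq abs_mult using cutoff_bounds[of j z] by (intro mult_right_mono) auto
   then show ?thesis using g(2)[OF True] by simp
  next
   case False
   then show ?thesis unfolding D'eq using cutoff_support[OF False] \<eta> by simp
  qed
  then have "\<bar>LS_defect (\<phi>' (Suc N)) (D' (Suc N)) T x\<bar> <= C * \<eta>" using C' ind by blast
  then show ?thesis using ind by simp
 qed
 from this[of "e / (C + 1)" for e] have "\<bar>LS_defect \<phi> D T x\<bar> <= e" if "0 < e" for e
 proof -
  have "\<bar>LS_defect \<phi> D T x\<bar> <= C * (e / (C + 1))" using that C by (intro \<open>\<And>\<eta>. 0 < \<eta> ==> \<bar>LS_defect \<phi> D T x\<bar> <= C * \<eta>\<close>) auto
  also have "\<dots> <= e" using that C by (simp add: field_simps)
  finally show ?thesis .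
 qed
 then have "\<bar>LS_defect \<phi> D T x\<bar> <= 0" by (rule field_le_epsilon[of _ 0, simplified])
 then show ?thesis by simp
qed

text \<open>Differentiating the twice integrated equation from the right recovers the equation itself.\<close>

lemma equation_from_defect:
 assumes x: "x \<in> cadlag weak_topology" and tp: "test_pair p q \<phi> D"
  and zero: "\<And>r :: rat. 0 < r ==> LS_defect \<phi> D (of_rat r) x = 0" and t: "0 <= t"
 shows "(LINT z|x t. \<phi> z) = (LINT z|\<mu>\<^sub>0. \<phi> z) + (LINT s|lborel. indicator {0..t} s * LS_drift D (x s))"
proof -
 define h where "h s = (LINT z|x s. \<phi> z)" for s
 define h0 where "h0 = (LINT z|\<mu>\<^sub>0. \<phi> z)"
 define g where "g s = LS_drift D (x s)" for s
 define H where "H t = (LINT s|lborel. indicator {0..t} s * g s)" for t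
 have rh: "rcll h" unfolding h_def by (rule rcll_cadlag[OF x continuous_map_weak_integral(1)[OF test_pair_bounded_continuous[OF tp]]])
 have rg: "rcll g" unfolding g_def by (rule rcll_cadlag[OF x continuous_map_LS_drift[OF tp]])
 have ig: "integrable lborel (\<lambda>s. indicator {0..T} s * (w s * g s))" if "continuous_on UNIV w" for T w
  by (rule rcll_integrable[OF rg that])
 have ig1: "integrable lborel (\<lambda>s. indicator {0..T} s * g s)" for T using ig[of "\<lambda>_. 1" T] by simp
 define I where "I T = (LINT s|lborel. indicator {0..T} s * (1 * h s))" for T
 define J where "J T = (LINT s|lborel. indicator {0..T} s * ((T - s) * g s))" for T
 have def: "LS_defect \<phi> D T x = I T - T * h0 - J T" for T
  unfolding LS_defect_def path_integral_def I_def J_def h_def h0_def g_def by simp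
 \<comment> \<open>First at positive rational times: \<open>T + 1 / (k + 1)\<close> is rational as
   well, so the defect vanishes at both ends of the difference quotient.\<close>
 have rat: "h T = h0 + H T" if T: "T = of_rat r" "0 < r" for T and r :: rat
 proof -
  have T0: "0 < T" using T by simp
  obtain C where C: "0 <= C" "\<And>s. 0 <= s ==> s <= T + 1 ==> \<bar>g s\<bar> <= C" using rcll_bounded[OF rg] by blast
  let ?d = "\<lambda>k. 1 / real (Suc k)"
  \<comment> \<open>The weight grows by \<open>d\<close> on \<open>[0, T]\<close>, which gives
    \<open>d * H T\<close>; on the new interval the weight is at most \<open>d\<close>, so that part
    is of second order.\<close>
  have Jd: "\<bar>J (T + d) - J T - d * H T\<bar> <= d * (d * C)" if d: "0 < d" "d <= 1" for d
  proof -
   have c: "continuous_on UNIV (\<lambda>s. T + d - s)" "continuous_on UNIV (\<lambda>s. T - s)" by (intro continuous_intros)+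
   have eq: "J (T + d) - J T - d * H T = (LINT s|lborel. indicator {0..T + d} s * ((T + d - s) * g s) - indicator {0..T} s * ((T - s) * g s) - d * (indicator {0..T} s * g s))"
    unfolding J_def H_def using ig[OF c(1)] ig[OF c(2)] ig1 by simp
   have "\<bar>J (T + d) - J T - d * H T\<bar> <= (LINT s|lborel. indicator {T..T + d} s * (d * C))" unfolding eq
   proof (rule abs_integral_le)
    show "integrable lborel (\<lambda>s. indicator {0..T + d} s * ((T + d - s) * g s) - indicator {0..T} s * ((T - s) * g s) - d * (indicator {0..T} s * g s))"
     by (intro Bochner_Integration.integrable_diff ig[OF c(1)] ig[OF c(2)] integrable_mult_right ig1)
    show "integrable lborel (\<lambda>s. indicator {T..T + d} s * (d * C))"
     by (intro integrable_mult_left integrable_real_indicator) (auto simp: emeasure_lborel_Icc_eq)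
    fix s :: real
    consider "s < 0" | "0 <= s" "s <= T" | "T < s" "s <= T + d" | "T + d < s" by linarith
    then show "\<bar>indicator {0..T + d} s * ((T + d - s) * g s) - indicator {0..T} s * ((T - s) * g s) - d * (indicator {0..T} s * g s)\<bar>
     <= indicator {T..T + d} s * (d * C)"
    proof cases
     case 3
     have "\<bar>(T + d - s) * g s\<bar> <= d * C" unfolding abs_mult using 3 d T0 C by (intro mult_mono) auto
     then show ?thesis using 3 T0 by simp
    next
     case 2
     then show ?thesis using d C by (simp add: algebra_simps)
    qed (use d T0 C in auto)
   qed
   also have "\<dots> = d * (d * C)" using d by simp
   finally show ?thesis .
  qed
  have lim1: "(\<lambda>k. real (Suc k) * (I (T + ?d k) - I T)) \<longlonglongrightarrow> h T"
   unfolding I_def using rcll_right_average[OF rh] T0 by simp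
  have "(\<lambda>k. real (Suc k) * (I (T + ?d k) - I T) - (h0 + H T)) \<longlonglongrightarrow> 0"
  proof (rule Lim_null_comparison[OF always_eventually])
   show "\<forall>k. norm (real (Suc k) * (I (T + ?d k) - I T) - (h0 + H T)) <= ?d k * C"
   proof
    fix k
    let ?e = "?d k"
    have e: "0 < ?e" "?e <= 1" "real (Suc k) * ?e = 1" by auto
    have T': "T + ?e = of_rat (r + 1 / of_nat (Suc k))" unfolding T(1) by (simp only: of_rat_add of_rat_divide of_rat_1 of_rat_of_nat_eq)
    have "LS_defect \<phi> D (T + ?e) x = 0" unfolding T' using T(2) by (intro zero add_pos_pos) auto
    moreover have "LS_defect \<phi> D T x = 0" unfolding T(1) by (rule zero[OF T(2)])
    ultimately have "I (T + ?e) - I T = ?e * h0 + (J (T + ?e) - J T)" unfolding def by (simp add: algebra_simps)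
    then have "real (Suc k) * (I (T + ?e) - I T) = real (Suc k) * ?e * h0 + real (Suc k) * (J (T + ?e) - J T)" by (simp only: distrib_left mult.assoc)
    then have "real (Suc k) * (I (T + ?e) - I T) - (h0 + H T) = real (Suc k) * (J (T + ?e) - J T) - real (Suc k) * ?e * H T" using e(3) by simp
    also have "\<dots> = real (Suc k) * (J (T + ?e) - J T - ?e * H T)" by (simp only: right_diff_distrib mult.assoc)
    finally have "\<bar>real (Suc k) * (I (T + ?e) - I T) - (h0 + H T)\<bar> = real (Suc k) * \<bar>J (T + ?e) - J T - ?e * H T\<bar>" by (simp add: abs_mult)
    also have "\<dots> <= real (Suc k) * (?e * (?e * C))" using Jd[OF e(1,2)] by (intro mult_left_mono) auto
    also have "\<dots> = ?e * C" using e(3) by (simp only: mult.assoc[symmetric])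
    finally show "norm (real (Suc k) * (I (T + ?e) - I T) - (h0 + H T)) <= ?e * C" by simp
   qed
   have "(\<lambda>k. ?d k * C) \<longlonglongrightarrow> 0 * C" by (intro tendsto_mult tendsto_const LIMSEQ_Suc[OF lim_1_over_n])
   then show "(\<lambda>k. ?d k * C) \<longlonglongrightarrow> 0" by simp
  qed
  then have "(\<lambda>k. real (Suc k) * (I (T + ?d k) - I T)) \<longlonglongrightarrow> h0 + H T" by (simp add: LIM_zero_iff)
  then show ?thesis using LIMSEQ_unique[OF lim1] by simp
 qed
 \<comment> \<open>Other times follow from right continuity of \<open>h\<close> and continuity of
   \<open>H\<close>, by comparison with a slightly later rational time.\<close>
 have "h t = h0 + H t"
 proof (rule ccontr)
  assume ne: "h t \<noteq> h0 + H t"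
  define e where "e = \<bar>h t - (h0 + H t)\<bar> / 2"
  have e: "0 < e" using ne by (simp add: e_def)
  obtain C where C: "0 <= C" "\<And>s. 0 <= s ==> s <= t + 1 ==> \<bar>g s\<bar> <= C" using rcll_bounded[OF rg] by blast
  obtain b where b: "t < b" "\<And>s. t < s ==> s < b ==> \<bar>h s - h t\<bar> < e"
   using tendstoD[OF rcll_right[OF rh t] e] unfolding eventually_at_right_field dist_real_def by auto
  \<comment> \<open>Before \<open>c\<close> the change of \<open>h\<close> and that of
    \<open>H\<close> are each below \<open>e\<close>, half of the supposed discrepancy.\<close>
  define c where "c = min (min b (t + 1)) (t + e / (C + 1))"
  have "t < c" using b(1) e C(1) by (auto simp: c_def)
  then obtain r where r: "t < of_rat r" "of_rat r < c" using of_rat_dense by blast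
  define s where "s = real_of_rat r"
  have s: "t < s" "s < b" "s <= t + 1" "s < t + e / (C + 1)" using r by (auto simp: s_def c_def)
  have eq: "H s - H t = (LINT v|lborel. indicator {0..s} v * g v - indicator {0..t} v * g v)"
   unfolding H_def using ig1 by simp
  have "\<bar>H s - H t\<bar> <= (LINT v|lborel. indicator {t..s} v * C)" unfolding eq
  proof (rule abs_integral_le)
   show "integrable lborel (\<lambda>v. indicator {0..s} v * g v - indicator {0..t} v * g v)" by (intro Bochner_Integration.integrable_diff ig1)
   show "integrable lborel (\<lambda>v. indicator {t..s} v * C)"
    by (intro integrable_mult_left integrable_real_indicator) (auto simp: emeasure_lborel_Icc_eq)
   fix v :: real
   show "\<bar>indicator {0..s} v * g v - indicator {0..t} v * g v\<bar> <= indicator {t..s} v * C"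
    using C s t by (auto simp: indicator_def)
  qed
  also have "\<dots> = (s - t) * C" using s by simp
  also have "\<dots> <= (s - t) * (C + 1)" using s by simp
  also have "\<dots> < e" using s(4) C(1) by (simp add: field_simps)
  finally have "\<bar>H s - H t\<bar> < e" .
  moreover have "0 < r" using r(1) t by (metis le_less_trans zero_less_of_rat_iff)
  then have "h s = h0 + H s" by (intro rat) (auto simp: s_def)
  then have "\<bar>h t - (h0 + H t)\<bar> <= \<bar>h s - h t\<bar> + \<bar>H s - H t\<bar>" by linarith
  moreover have "\<bar>h t - (h0 + H t)\<bar> = 2 * e" by (simp add: e_def)
  ultimately show False using b(2)[OF s(1,2)] by linarith
 qed
 then show ?thesis by (simp add: h_def h0_def H_def g_def)
qed

text \<open>One null set serves all test functions and all times: it is fixed by countably many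
  conditions, for rational times and primitives of cut-off monomials. Every further step is
  deterministic, path by path.\<close>

theorem limit_solves:
 assumes lim: "subsequential_limit_in_law (skorohod_topology weak_topology) M \<mu> N Y"
 shows "AE \<omega> in N. vague_LS_solution a\<^sub>0 b\<^sub>0 \<mu>\<^sub>0 mass_limit (Y \<omega>)"
proof -
 have Y: "Y \<omega> \<in> cadlag weak_topology" if "\<omega> \<in> space N" for \<omega>
  using lim that unfolding subsequential_limit_in_law_def by (auto dest: measurable_space)
 have "AE \<omega> in N. \<forall>r :: rat. \<forall>j k. 0 < r \<longrightarrow> LS_defect (primitive j k) (cutoff_monomial j k) (of_rat r) (Y \<omega>) = 0"
  unfolding AE_all_countable using defect_zero_AE[OF lim primitive] by (auto intro: AE_I2)
 then show ?thesis
 proof (rule AE_mp[OF _ AE_I2], intro impI)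
  fix \<omega> assume \<omega>: "\<omega> \<in> space N" and zero: "\<forall>r :: rat. \<forall>j k. 0 < r \<longrightarrow> LS_defect (primitive j k) (cutoff_monomial j k) (of_rat r) (Y \<omega>) = 0"
  let ?x = "Y \<omega>"
  note x = Y[OF \<omega>]
  show "vague_LS_solution a\<^sub>0 b\<^sub>0 \<mu>\<^sub>0 mass_limit ?x"
   unfolding vague_LS_solution_def Let_def
  proof (intro ballI allI impI)
   fix \<phi> t assume \<phi>: "\<phi> \<in> C1_compact_support" and t: "0 <= (t :: real)"
   obtain p q where tp: "test_pair p q \<phi> (deriv \<phi>)" by (rule C1_compact_support_test_pair[OF \<phi>])
   have z: "LS_defect \<phi> (deriv \<phi>) (of_rat r) ?x = 0" if "0 < r" for r :: rat
    using zero that by (intro defect_zero_dense[OF x _ _ tp]) auto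
   have eq: "(\<integral>z. deriv \<phi> z * (a\<^sub>0 z * (mass_limit - (\<integral>x. x \<partial>?x s)) - b\<^sub>0 z) \<partial>?x s) = LS_drift (deriv \<phi>) (?x s)" if s: "0 <= s" for s
   proof -
    have \<nu>: "?x s \<in> moment_measures" using cadlag_topspace[OF x s] by simp
    have "deriv \<phi> z * (a\<^sub>0 z * c - b\<^sub>0 z) = c * (deriv \<phi> z * a\<^sub>0 z) - deriv \<phi> z * b\<^sub>0 z" for z c by (simp add: algebra_simps)
    then show ?thesis unfolding LS_drift_def drift_functional_def
     using integrable_bounded_continuous(1)[OF \<nu>] flux_bounded_continuous[OF tp] by simp
   qed
   have ind: "indicator {0..t} s *\<^sub>R (\<integral>z. deriv \<phi> z * (a\<^sub>0 z * (mass_limit - (\<integral>x. x \<partial>?x s)) - b\<^sub>0 z) \<partial>?x s) =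
     indicator {0..t} s * (1 * LS_drift (deriv \<phi>) (?x s))" for s
    using eq[of s] by (auto simp: indicator_def)
   show "set_integrable lborel {0..t} (\<lambda>s. \<integral>z. deriv \<phi> z * (a\<^sub>0 z * (mass_limit - (\<integral>x. x \<partial>?x s)) - b\<^sub>0 z) \<partial>?x s) \<and>
    (\<integral>z. \<phi> z \<partial>?x t) = (LINT z|\<mu>\<^sub>0. \<phi> z) + (\<integral>s\<in>{0..t}. (\<integral>z. deriv \<phi> z * (a\<^sub>0 z * (mass_limit - (\<integral>x. x \<partial>?x s)) - b\<^sub>0 z) \<partial>?x s) \<partial>lborel)"
    unfolding set_integrable_def set_lebesgue_integral_def ind
    using rcll_integrable[OF rcll_cadlag[OF x continuous_map_LS_drift[OF tp]] continuous_on_const[where c=1]] equation_from_defect[OF x tp z t] by simp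
  qed
 qed
qed

end

theorem theorem2:
  fixes \<epsilon> \<alpha> \<beta> :: "nat \<Rightarrow> real" and a b :: "nat \<Rightarrow> real \<Rightarrow> real"
    and \<alpha>\<^sub>0 \<beta>\<^sub>0 Ka Kb :: real and a\<^sub>0 b\<^sub>0 :: "real \<Rightarrow> real"
    and M :: "nat \<Rightarrow> 'a measure"
    and \<mu>in :: "nat \<Rightarrow> 'a \<Rightarrow> real measure" and uin :: "nat \<Rightarrow> 'a \<Rightarrow> real"
    and \<mu> :: "nat \<Rightarrow> 'a \<Rightarrow> real \<Rightarrow> real measure"
    and \<mu>\<^sub>0 :: "real measure" and u\<^sub>0 :: real and \<K> :: "real measure set"
  assumes eps: "\<And>n. \<epsilon> n > 0" "\<epsilon> \<longlonglongrightarrow> 0"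
    and rates_nonneg: "\<And>n. \<alpha> n \<ge> 0" "\<And>n. \<beta> n \<ge> 0"
      "\<And>n x. x \<ge> 0 \<Longrightarrow> a n x \<ge> 0" "\<And>n x. x \<ge> 0 \<Longrightarrow> b n x \<ge> 0"
    and rates_measurable: "\<And>n. a n \<in> borel_measurable borel_nonneg"
      "\<And>n. b n \<in> borel_measurable borel_nonneg"
    and process: "\<And>n. sbd_process (M n) (\<epsilon> n) (\<alpha> n) (\<beta> n) (a n) (b n) (\<mu>in n) (uin n) (\<mu> n)"
    and limit_rates_nonneg: "\<alpha>\<^sub>0 \<ge> 0" "\<beta>\<^sub>0 \<ge> 0"
      "\<And>x. x \<ge> 0 \<Longrightarrow> a\<^sub>0 x \<ge> 0" "\<And>x. x \<ge> 0 \<Longrightarrow> b\<^sub>0 x \<ge> 0"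
    and limit_rates_continuous: "continuous_on {0..} a\<^sub>0" "continuous_on {0..} b\<^sub>0"
    and nucleation_tendsto: "\<alpha> \<longlonglongrightarrow> \<alpha>\<^sub>0" "\<beta> \<longlonglongrightarrow> \<beta>\<^sub>0"
    and rates_tendsto: "\<And>C. compact C \<Longrightarrow> C \<subseteq> {0..} \<Longrightarrow> uniform_limit C a a\<^sub>0 sequentially"
      "\<And>C. compact C \<Longrightarrow> C \<subseteq> {0..} \<Longrightarrow> uniform_limit C b b\<^sub>0 sequentially"
    and linear_growth: "Ka > 0" "Kb > 0"
      "\<And>n x. x \<ge> 0 \<Longrightarrow> a n x \<le> Ka * (1 + x)" "\<And>n x. x \<ge> 0 \<Longrightarrow> b n x \<le> Kb * (1 + x)"
    and initial_measure: "\<mu>\<^sub>0 \<in> moment_measures"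
      "converges_weakly weak_topology (\<lambda>n. distr (M n) (borel_of weak_topology) (\<mu>in n))
         (return (borel_of weak_topology) \<mu>\<^sub>0)"
    and initial_compact: "compactin weak_topology \<K>" "\<And>n. \<P>(\<omega> in M n. \<mu>in n \<omega> \<in> \<K>) = 1"
    and initial_monomers: "u\<^sub>0 \<ge> 0"
      "weak_conv_m (\<lambda>n. distr (M n) borel (uin n)) (return borel u\<^sub>0)"
  shows "(\<exists>(N :: (real \<Rightarrow> real measure) measure) Y.
            subsequential_limit_in_law (skorohod_topology weak_topology) M \<mu> N Y) \<and>
         (\<forall>(N :: 'b measure) Y.
            subsequential_limit_in_law (skorohod_topology weak_topology) M \<mu> N Y \<longrightarrow>
            (AE \<omega> in N. vague_LS_solution a\<^sub>0 b\<^sub>0 \<mu>\<^sub>0 (u\<^sub>0 + (\<integral>x. x \<partial>\<mu>\<^sub>0)) (Y \<omega>)))"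
proof -
  interpret sbd_sequence \<epsilon> \<alpha> \<beta> a b \<alpha>\<^sub>0 \<beta>\<^sub>0 Ka Kb a\<^sub>0 b\<^sub>0 M \<mu>in uin \<mu> \<mu>\<^sub>0 u\<^sub>0 \<K>
    by unfold_locales (fact assms)+
  show ?thesis using limit_exists limit_solves unfolding mass_limit_def by blast
qed

end
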